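(* The $\mathfrak h$-bialgebroid $\mathcal F_R(GL(n))$ is an $\mathfrak h$-Hopf algebroid with the antipode $S$ defined on the generators by $S(\det^{-1})=\det$, $S(\mu_r(f))=\mu_l(f)$, $S(\mu_l(f))=\mu_r(f)$ for all $f\in M_{\mathfrak h^*}$, and $$S(t_{ij})=\det{}^{-1}\,\frac{\mu_l(\mathrm{sign}(\hat\jmath;\{j\}))}{\mu_r(\mathrm{sign}(\hat\imath;\{i\}))}\,\xi^{\hat\jmath}_{\hat\imath}\qquad(1\le i,j\le n),$$ and extended as an algebra anti-homomorphism.
   Context: Setting. Fix $n\ge 1$ and $q\in\mathbb C^\times$ not a root of unity, with a fixed choice of $\log q$ and $q^z=\exp(z\log q)$. Identify $\mathfrak h^*\cong\mathbb C^n$ with unit vectors $e_i$, put $\omega(i)=e_i$, $\omega(I)=\sum_{i\in I}e_i$, $\underline1=(1,\dots,1)$, $\hat\imath=\{1,\dots,n\}\setminus\{i\}$. $M_{\mathfrak h^*}$ is the field of meromorphic functions on $\mathfrak h^*$ (in $\underline\lambda=(\lambda_1,\dots,\lambda_n)$), $(T_\alpha f)(\lambda)=f(\lambda+\alpha)$. Put $h_0(z)=\frac{q^{-1}-q}{q^{-2z}-1}$, $g(z)=\frac{(q^{-2z}-q^{-2})(q^{-2z}-q^2)}{(q^{-2z}-1)^2}$, $h(z)=q-h_0(z)=q\frac{q^{-2z}-q^{-2}}{q^{-2z}-1}$. $\mathfrak h$-Hopf algebroids. An $\mathfrak h$-algebra is a unital associative $\mathbb C$-algebra $\mathcal A=\bigoplus_{\alpha,\beta\in\mathfrak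 h^*}\mathcal A_{\alpha\beta}$ (bigraded) with algebra embeddings $\mu_l,\mu_r\colon M_{\mathfrak h^*}\to\mathcal A_{00}$ such that $\mu_l(f)a=a\mu_l(T_\alpha f)$, $\mu_r(f)a=a\mu_r(T_\beta f)$ for $a\in\mathcal A_{\alpha\beta}$. $\mathcal A\widetilde\otimes\mathcal B$ has $(\mathcal A\widetilde\otimes\mathcal B)_{\alpha\beta}=\bigoplus_\gamma\mathcal A_{\alpha\gamma}\otimes\mathcal B_{\gamma\beta}$ modulo $\mu_r(f)a\otimes b=a\otimes\mu_l(f)b$, with product $(a\otimes b)(c\otimes d)=ac\otimes bd$ and moment maps $\mu_l(f)\otimes1$, $1\otimes\mu_r(f)$. $D_{\mathfrak h^*}$ is the $\mathfrak h$-algebra of difference operators $\sum_i f_iT_{\beta_i}$ on $M_{\mathfrak h^*}$, with $fT_{-\beta}\in(D_{\mathfrak h^*})_{\beta\beta}$ and both moment maps the natural embedding; $\mathcal A\cong\mathcal A\widetilde\otimes D_{\mathfrak h^*}\cong D_{\mathfrak h^*}\widetilde\otimes\mathcal A$ via $x\cong x\otimes T_{-\beta}\cong T_{-\alpha}\otimes x$, $x\in\mathcal A_{\alpha\beta}$. An $\mathfrak h$-bialgebroid is an $\mathfrak h$-algebra with coassociative and counital $\mathfrak h$-algebra homomorphisms $\Delta\colon\mathcal A\to\mathcal A\widetilde\otimes\mathcal A$, $\varepsilon\colon\mathcal A\to D_{\mathfrak h^*}$. An $\mathfrak h$-Hopf algebroid is an $\mathfrak h$-bialgebroid with a $\mathbb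 C$-linear map $S\colon\mathcal A\to\mathcal A$ (antipode) such that $S(\mu_r(f)a)=S(a)\mu_l(f)$, $S(a\mu_l(f))=\mu_r(f)S(a)$ for all $a,f$, and, with $m$ the multiplication, $m(\mathrm{Id}\otimes S)\Delta(a)=\mu_l(\varepsilon(a)1)$ for all $a$ and $m(S\otimes\mathrm{Id})\Delta(a)=\mu_r(T_\alpha(\varepsilon(a)1))$ for $a\in\mathcal A_{\alpha\beta}$, where $\varepsilon(a)1$ is the difference operator $\varepsilon(a)$ applied to the constant function $1$. The $\mathfrak h$-bialgebroid $\mathcal F_R(M(n))$. It is generated by $t_{ij}$ ($1\le i,j\le n$) and two commuting copies of $M_{\mathfrak h^*}$, written $f(\underline\lambda)=\mu_l(f)$ and $f(\underline\mu)=\mu_r(f)$, with relations $f(\underline\lambda)t_{ij}=t_{ij}f(\underline\lambda+\omega(i))$, $f(\underline\mu)t_{ij}=t_{ij}f(\underline\mu+\omega(j))$ and, for all $a,b,c,d$, the RLL-relations $\sum_{x,y}R^{xy}_{ac}(\underline\lambda)t_{xb}t_{yd}=\sum_{x,y}R^{bd}_{xy}(\underline\mu)t_{cy}t_{ax}$. The nonzero $R$-entries are $R^{aa}_{aa}=q$; $R^{ab}_{ab}(\underline\lambda)=1$ if $a<b$ and $g(\lambda_a-\lambda_b)$ if $a>b$; $R^{ab}_{ba}(\underline\lambda)=h_0(\lambda_a-\lambda_b)$ if $a\ne b$. Moreover $t_{ij}$ has bidegree $(\omega(i),\omega(j))$, $\Delta(t_{ij})=\sum_kt_{ik}\otimes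 t_{kj}$, $\varepsilon(t_{ij})=\delta_{ij}T_{-\omega(i)}$, $\Delta(f(\underline\lambda))=f(\underline\lambda)\otimes1$, $\Delta(f(\underline\mu))=1\otimes f(\underline\mu)$, $\varepsilon(f(\underline\lambda))=\varepsilon(f(\underline\mu))=f$. Minors and signs. For subsets $I=\{i_1<\dots<i_r\}$, $J=\{j_1<\dots<j_r\}$ of $\{1,\dots,n\}$ the dynamical quantum minor determinant is $\xi^I_J=\sum_{\sigma\in S_r}\mu_l(S(\sigma,I))\,t_{i_{\sigma(1)}j_1}\cdots t_{i_{\sigma(r)}j_r}$, with $S(\sigma,I)(\underline\lambda)=\prod_{k<l,\,\sigma(k)>\sigma(l)}\big(-h(\lambda_{i_{\sigma(k)}}-\lambda_{i_{\sigma(l)}})\big)$ and $\xi^\emptyset_\emptyset=1$; $\det=\xi^{\{1,\dots,n\}}_{\{1,\dots,n\}}$. For disjoint $I_1,I_2$, $\mathrm{sign}(I_1;I_2)(\underline\lambda)=\prod_{k\in I_1,\,m\in I_2,\,k>m}\big(-h(\lambda_k-\lambda_m)\big)$. $\mathcal F_R(GL(n))$. The element $\det$ commutes with all $t_{ij}$. $\mathcal F_R(GL(n))$ is obtained from $\mathcal F_R(M(n))$ by adjoining $\det^{-1}$ with relations $\det\det^{-1}=1=\det^{-1}\det$, $t_{ij}\det^{-1}=\det^{-1}t_{ij}$, $f(\underline\lambda)\det^{-1}=\det^{-1}f(\underline\lambda-\underline1)$, $f(\underline\mu)\det^{-1}=\det^{-1}f(\underline\mu-\underline1)$; $\det^{-1}$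 has bidegree $(-\underline1,-\underline1)$, $\Delta(\det^{-1})=\det^{-1}\otimes\det^{-1}$, $\varepsilon(\det^{-1})=T_{\underline1}$. This is an $\mathfrak h$-bialgebroid. *)

theory Defs
  imports
    "HOL-Complex_Analysis.Complex_Analysis"
    "HOL-Library.Poly_Mapping"
    "HOL-Algebra.QuotRing"
    "HOL-Algebra.Module"
    "HOL-Algebra.Algebraic_Closure_Type"
    "HOL-Combinatorics.Permutations"
begin

text \<open>Holomorphy on an open set, as existence of complex-linear Frechet derivatives.\<close>

definition holomorphic_several :: "(complex^'n \<Rightarrow> complex) \<Rightarrow> (complex^'n) set \<Rightarrow> bool"
  where "holomorphic_several f U \<longleftrightarrow>
    (\<forall>z\<in>U. \<exists>c. (f has_derivative (\<lambda>v. \<Sum>i\<in>UNIV. c $ i * v $ i)) (at z))"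

definition generically :: "('a::topological_space \<Rightarrow> bool) \<Rightarrow> bool"
  where "generically P \<longleftrightarrow> (\<exists>U. open U \<and> closure U = UNIV \<and> (\<forall>z\<in>U. P z))"

text \<open>
  A function represents a meromorphic function on \<open>\<complex>\<^sup>n\<close> if it is locally a quotient of holomorphic
  functions; its values where the local denominator vanishes are arbitrary.  Accordingly, the
  field of meromorphic functions identifies representatives that agree on a dense open set.
\<close>

definition meromorphic_several :: "(complex^'n \<Rightarrow> complex) \<Rightarrow> bool"
  where "meromorphic_several f \<longleftrightarrow>
    (\<forall>z. \<exists>U p d. open U \<and> connected U \<and> z \<in> U \<and>
       holomorphic_several p U \<and> holomorphic_several d U \<and> (\<exists>w\<in>U. d w \<noteq> 0) \<and>
       (\<forall>w\<in>U. d w \<noteq> 0 \<longrightarrow> f w = p w / d w))"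

lemma holomorphic_several_subset:
  "holomorphic_several f U \<Longrightarrow> V \<subseteq> U \<Longrightarrow> holomorphic_several f V"
  unfolding holomorphic_several_def by blast

lemma holomorphic_several_const [simp]: "holomorphic_several (\<lambda>_. a) U"
  unfolding holomorphic_several_def
  by (auto intro!: exI[of _ 0])

lemma holomorphic_several_add:
  assumes "holomorphic_several f U" "holomorphic_several g U"
  shows "holomorphic_several (\<lambda>z. f z + g z) U"
  unfolding holomorphic_several_def
proof
  fix z assume "z \<in> U"
  with assms obtain c d
    where "(f has_derivative (\<lambda>v. \<Sum>i\<in>UNIV. c $ i * v $ i)) (at z)"
      and "(g has_derivative (\<lambda>v. \<Sum>i\<in>UNIV. d $ i * v $ i)) (at z)"
    unfolding holomorphic_several_def by blast
  from has_derivative_add[OF this]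
  have "((\<lambda>z. f z + g z) has_derivative (\<lambda>v. \<Sum>i\<in>UNIV. (c + d) $ i * v $ i)) (at z)"
    by (simp add: sum.distrib distrib_right)
  then show "\<exists>c. ((\<lambda>z. f z + g z) has_derivative (\<lambda>v. \<Sum>i\<in>UNIV. c $ i * v $ i)) (at z)" ..
qed

lemma holomorphic_several_mult:
  assumes "holomorphic_several f U" "holomorphic_several g U"
  shows "holomorphic_several (\<lambda>z. f z * g z) U"
  unfolding holomorphic_several_def
proof
  fix z assume "z \<in> U"
  with assms obtain c d
    where "(f has_derivative (\<lambda>v. \<Sum>i\<in>UNIV. c $ i * v $ i)) (at z)"
      and "(g has_derivative (\<lambda>v. \<Sum>i\<in>UNIV. d $ i * v $ i)) (at z)"
    unfolding holomorphic_several_def by blast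
  from has_derivative_mult[OF this]
  have "((\<lambda>z. f z * g z) has_derivative
      (\<lambda>v. \<Sum>i\<in>UNIV. (\<chi> i. f z * d $ i + c $ i * g z) $ i * v $ i)) (at z)"
    by (rule has_derivative_eq_rhs)
       (simp add: fun_eq_iff sum.distrib sum_distrib_left algebra_simps)
  then show "\<exists>c. ((\<lambda>z. f z * g z) has_derivative (\<lambda>v. \<Sum>i\<in>UNIV. c $ i * v $ i)) (at z)" ..
qed

lemma holomorphic_several_imp_continuous_on:
  assumes "holomorphic_several f U"
  shows "continuous_on U f"
proof (rule continuous_at_imp_continuous_on, rule ballI)
  fix z assume "z \<in> U"
  with assms show "isCont f z"
    unfolding holomorphic_several_def using has_derivative_continuous by blast
qed

lemma holomorphic_several_line:
  assumes "holomorphic_several f U" and "\<And>t. t \<in> S \<Longrightarrow> w + t *s u \<in> U"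
  shows "(\<lambda>t. f (w + t *s u)) holomorphic_on S"
proof (unfold holomorphic_on_def, rule ballI)
  fix t assume "t \<in> S"
  then have "w + t *s u \<in> U" by (rule assms(2))
  with assms(1) obtain c
    where c: "(f has_derivative (\<lambda>v. \<Sum>i\<in>UNIV. c $ i * v $ i)) (at (w + t *s u))"
    unfolding holomorphic_several_def by blast
  have lin: "bounded_linear (\<lambda>t::complex. t *s u)"
  proof (rule linear_conv_bounded_linear[THEN iffD1], rule linearI)
    show "(a + b) *s u = a *s u + b *s u" for a b by (simp add: vector_sadd_rdistrib)
    show "(r *\<^sub>R b) *s u = r *\<^sub>R (b *s u)" for r :: real and b by (simp add: vec_eq_iff)
  qed
  have "((\<lambda>t. w + t *s u) has_derivative (\<lambda>h. h *s u)) (at t)"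
    using bounded_linear_imp_has_derivative[OF lin] by (auto intro!: derivative_eq_intros)
  from has_derivative_compose[OF this c]
  have "((\<lambda>t. f (w + t *s u)) has_derivative (\<lambda>h. (\<Sum>i\<in>UNIV. c $ i * u $ i) * h)) (at t)"
    by (rule has_derivative_eq_rhs) (simp add: fun_eq_iff sum_distrib_left algebra_simps)
  then have "((\<lambda>t. f (w + t *s u)) has_field_derivative (\<Sum>i\<in>UNIV. c $ i * u $ i)) (at t)"
    by (simp add: has_field_derivative_def)
  then show "(\<lambda>t. f (w + t *s u)) field_differentiable (at t within S)"
    using field_differentiable_def field_differentiable_at_within by blast
qed

lemma holomorphic_several_ball_eq_0:
  fixes f :: "complex^'n \<Rightarrow> complex"
  assumes "holomorphic_several f (ball z r)" "open V" "V \<subseteq> ball z r" "w \<in> V"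
    and "\<And>v. v \<in> V \<Longrightarrow> f v = 0" and v: "v \<in> ball z r"
  shows "f v = 0"
proof -
  define u where "u = v - w"
  define l where "l = (\<lambda>t::complex. w + t *s u)"
  have lin: "linear (\<lambda>t::complex. t *s u)"
  proof (rule linearI)
    show "(a + b) *s u = a *s u + b *s u" for a b by (simp add: vector_sadd_rdistrib)
    show "(r *\<^sub>R b) *s u = r *\<^sub>R (b *s u)" for r :: real and b by (simp add: vec_eq_iff)
  qed
  have cont: "continuous_on UNIV l"
    unfolding l_def using lin
    by (intro continuous_intros linear_continuous_on) (simp add: linear_conv_bounded_linear)
  define S where "S = l -` ball z r"
  define S0 where "S0 = l -` V"
  have "open S" unfolding S_def using cont by (simp add: open_vimage)
  have "open S0" unfolding S0_def using cont \<open>open V\<close> by (simp add: open_vimage)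
  have "convex S"
  proof -
    have "S = (\<lambda>t::complex. t *s u) -` ball (z - w) r"
      unfolding S_def l_def by (simp add: set_eq_iff dist_norm diff_diff_eq)
    then show ?thesis
      using lin convex_ball convex_linear_vimage by metis
  qed
  have "(\<lambda>t. f (l t)) 1 = 0"
  proof (rule analytic_continuation_open[of S0 S "\<lambda>t. f (l t)" "\<lambda>_. 0" 1])
    show "S0 \<noteq> {}" using \<open>w \<in> V\<close> by (auto simp: S0_def l_def set_eq_iff intro!: exI[of _ 0])
    show "connected S" using \<open>convex S\<close> by (rule convex_connected)
    show "S0 \<subseteq> S" using \<open>V \<subseteq> ball z r\<close> by (auto simp: S0_def S_def)
    show "(\<lambda>t. f (l t)) holomorphic_on S"
      unfolding l_def
      by (rule holomorphic_several_line[OF assms(1)]) (auto simp: S_def l_def)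
    show "1 \<in> S" using v by (simp add: S_def l_def u_def)
  qed (use \<open>open S\<close> \<open>open S0\<close> assms(5) in \<open>auto simp: S0_def\<close>)
  then show ?thesis by (simp add: l_def u_def)
qed

lemma holomorphic_several_eq_0:
  fixes f :: "complex^'n \<Rightarrow> complex"
  assumes hol: "holomorphic_several f U" and "open U" "connected U"
    and V: "open V" "V \<subseteq> U" "V \<noteq> {}" "\<And>v. v \<in> V \<Longrightarrow> f v = 0" and "z \<in> U"
  shows "f z = 0"
proof -
  define W where "W = {z\<in>U. \<exists>N. open N \<and> z \<in> N \<and> (\<forall>v\<in>N. f v = 0)}"
  have W_open: "open W"
  proof (subst open_subopen, intro ballI)
    fix x assume "x \<in> W"
    then obtain N where "x \<in> U" "open N" "x \<in> N" "\<forall>v\<in>N. f v = 0" by (auto simp: W_def)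
    then show "\<exists>T. open T \<and> x \<in> T \<and> T \<subseteq> W"
      using \<open>open U\<close> by (intro exI[of _ "U \<inter> N"]) (auto simp: W_def)
  qed
  have "open (U - W)"
  proof (subst open_subopen, intro ballI)
    fix x assume x: "x \<in> U - W"
    obtain r where r: "r > 0" "ball x r \<subseteq> U"
      using x \<open>open U\<close> by (meson DiffE open_contains_ball)
    have "ball x r \<inter> W = {}"
    proof (rule ccontr)
      assume "ball x r \<inter> W \<noteq> {}"
      then obtain w N where "w \<in> ball x r" "open N" "w \<in> N" "\<forall>v\<in>N. f v = 0"
        by (auto simp: W_def)
      have hx: "holomorphic_several f (ball x r)"
        using holomorphic_several_subset[OF hol r(2)] .
      have "f v = 0" if v: "v \<in> ball x r" for v
      proof (rule holomorphic_several_ball_eq_0[OF hx, of "N \<inter> ball x r" w])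
        show "open (N \<inter> ball x r)" using \<open>open N\<close> by (simp add: open_Int)
      qed (use v \<open>w \<in> N\<close> \<open>w \<in> ball x r\<close> \<open>\<forall>v\<in>N. f v = 0\<close> in blast)+
      then have "x \<in> W" using x r by (auto simp: W_def intro!: exI[of _ "ball x r"])
      with x show False by blast
    qed
    then show "\<exists>T. open T \<and> x \<in> T \<and> T \<subseteq> U - W"
      using r by (intro exI[of _ "ball x r"]) auto
  qed
  moreover have "W \<inter> U \<noteq> {}"
  proof -
    obtain v where "v \<in> V" using V by blast
    with V have "v \<in> W" unfolding W_def by blast
    then show ?thesis using \<open>v \<in> V\<close> V by blast
  qed
  moreover have "W \<subseteq> U" by (auto simp: W_def)
  ultimately have "U - W = {}"
    using connectedD[OF \<open>connected U\<close> W_open, of "U - W"] by blast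
  with \<open>z \<in> U\<close> show ?thesis by (auto simp: W_def)
qed

lemma open_dense_Int:
  fixes A B :: "'a::topological_space set"
  assumes "open A" "closure A = UNIV" "open B" "closure B = UNIV"
  shows "closure (A \<inter> B) = UNIV"
proof -
  have "A \<inter> closure B \<subseteq> closure (A \<inter> B)" using assms(1) by (rule open_Int_closure_subset)
  then have "A \<subseteq> closure (A \<inter> B)" unfolding assms(4) by simp
  then have "closure A \<subseteq> closure (A \<inter> B)" by (simp add: closure_minimal)
  with assms show ?thesis by blast
qed

lemma generically_mono: "generically P \<Longrightarrow> (\<And>z. P z \<Longrightarrow> Q z) \<Longrightarrow> generically Q"
  unfolding generically_def by blast

lemma generically_True [simp]: "generically (\<lambda>_. True)"
  unfolding generically_def by (intro exI[of _ UNIV]) auto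

lemma generically_conj:
  assumes P: "generically P" and Q: "generically Q"
  shows "generically (\<lambda>z. P z \<and> Q z)"
proof -
  from P obtain A where A: "open A" "closure A = UNIV" "\<forall>z\<in>A. P z"
    unfolding generically_def by blast
  from Q obtain B where B: "open B" "closure B = UNIV" "\<forall>z\<in>B. Q z"
    unfolding generically_def by blast
  have "open (A \<inter> B)" "closure (A \<inter> B) = UNIV" "\<forall>z\<in>A \<inter> B. P z \<and> Q z"
    using A B by (auto simp: open_dense_Int)
  then show ?thesis unfolding generically_def by blast
qed

lemma generically_mono2:
  assumes "generically P" "generically Q" "\<And>z. P z \<Longrightarrow> Q z \<Longrightarrow> R z"
  shows "generically R"
  by (rule generically_mono[OF generically_conj[OF assms(1,2)]]) (use assms(3) in blast)

lemma generically_ex: 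
  assumes "generically (P :: 'a::topological_space \<Rightarrow> bool)" "open V" "V \<noteq> {}"
  shows "\<exists>z\<in>V. P z"
proof -
  obtain A where A: "open A" "closure A = UNIV" "\<forall>z\<in>A. P z"
    using assms unfolding generically_def by blast
  then have "V \<inter> A \<noteq> {}" using open_Int_closure_eq_empty[of V A] assms by auto
  then show ?thesis using A by auto
qed

lemma generically_local:
  assumes "\<And>z. \<exists>B U. open B \<and> z \<in> B \<and> open U \<and> B \<subseteq> closure U \<and> (\<forall>w\<in>U. P w)"
  shows "generically P"
proof -
  define U where "U = \<Union>{U. open U \<and> (\<forall>w\<in>U. P w)}"
  have "z \<in> closure U" for z
  proof -
    obtain B V where *: "z \<in> B" "open V" "B \<subseteq> closure V" "\<forall>w\<in>V. P w"
      using assms[of z] by blast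
    then have "V \<subseteq> U" by (auto simp: U_def)
    with * show ?thesis using closure_mono by blast
  qed
  then show ?thesis unfolding generically_def
    by (intro exI[of _ U]) (auto simp: U_def)
qed

lemma holomorphic_several_nonzero_dense:
  assumes "holomorphic_several d U" "open U" "connected U" "w \<in> U" "d w \<noteq> 0"
  shows "open {z\<in>U. d z \<noteq> 0}" "U \<subseteq> closure {z\<in>U. d z \<noteq> 0}"
proof -
  have "open (U \<inter> d -` (- {0}))"
    by (rule continuous_open_preimage) 
       (use assms holomorphic_several_imp_continuous_on in auto)
  moreover have "U \<inter> d -` (- {0}) = {z\<in>U. d z \<noteq> 0}" by auto
  ultimately show "open {z\<in>U. d z \<noteq> 0}" by simp
  show "U \<subseteq> closure {z\<in>U. d z \<noteq> 0}"
  proof (rule subsetI, rule ccontr)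
    fix x assume x: "x \<in> U" "x \<notin> closure {z\<in>U. d z \<noteq> 0}"
    have "d w = 0"
      by (rule holomorphic_several_eq_0[OF assms(1-3), of "U - closure {z\<in>U. d z \<noteq> 0}"])
         (use x assms closure_subset[of "{z\<in>U. d z \<noteq> 0}"] in auto)
    with assms show False by simp
  qed
qed

lemma meromorphic_severalE:
  assumes "meromorphic_several f"
  shows "\<exists>r p d. r > 0 \<and> (\<forall>s. 0 < s \<longrightarrow> s \<le> r \<longrightarrow>
      holomorphic_several p (ball z s) \<and> holomorphic_several d (ball z s) \<and>
      open {w\<in>ball z s. d w \<noteq> 0} \<and> ball z s \<subseteq> closure {w\<in>ball z s. d w \<noteq> 0} \<and>
      (\<forall>w\<in>ball z s. d w \<noteq> 0 \<longrightarrow> f w = p w / d w))"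
proof -
  obtain U p d w where U: "open U" "connected U" "z \<in> U"
      "holomorphic_several p U" "holomorphic_several d U" "w \<in> U" "d w \<noteq> 0"
      "\<forall>w\<in>U. d w \<noteq> 0 \<longrightarrow> f w = p w / d w"
  proof -
    from assms obtain U p d where "open U \<and> connected U \<and> z \<in> U \<and>
       holomorphic_several p U \<and> holomorphic_several d U \<and> (\<exists>w\<in>U. d w \<noteq> 0) \<and>
       (\<forall>w\<in>U. d w \<noteq> 0 \<longrightarrow> f w = p w / d w)"
      unfolding meromorphic_several_def by (elim allE[of _ z] exE)
    then show thesis by (elim conjE bexE) (rule that)
  qed
  obtain r where r: "r > 0" "ball z r \<subseteq> U" using U by (meson open_contains_ball)
  show ?thesis
  proof (rule exI[of _ r], rule exI[of _ p], rule exI[of _ d], rule conjI[OF \<open>r > 0\<close>], rule allI, rule impI, rule impI)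
    fix s :: real assume s: "0 < s" "s \<le> r"
    then have sub: "ball z s \<subseteq> U" using r subset_ball[of s r z] by auto
    have "\<exists>v\<in>ball z s. d v \<noteq> 0"
    proof -
      have "ball z s \<inter> closure {z\<in>U. d z \<noteq> 0} \<noteq> {}"
        using holomorphic_several_nonzero_dense(2)[OF U(5,1,2,6,7)] s U(3) centre_in_ball by blast
      then show ?thesis using open_Int_closure_eq_empty[of "ball z s" "{z\<in>U. d z \<noteq> 0}"] by auto
    qed
    then obtain v where v: "v \<in> ball z s" "d v \<noteq> 0" by blast
    have h: "holomorphic_several p (ball z s)" "holomorphic_several d (ball z s)"
      using U sub holomorphic_several_subset by blast+
    show "holomorphic_several p (ball z s) \<and> holomorphic_several d (ball z s) \<and>
      open {w\<in>ball z s. d w \<noteq> 0} \<and> ball z s \<subseteq> closure {w\<in>ball z s. d w \<noteq> 0} \<and>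
      (\<forall>w\<in>ball z s. d w \<noteq> 0 \<longrightarrow> f w = p w / d w)"
      using h holomorphic_several_nonzero_dense[OF h(2) _ _ v] U(8) sub by auto
  qed
qed

lemma meromorphic_severalI:
  assumes "\<And>z. \<exists>r p d. r > 0 \<and> holomorphic_several p (ball z r) \<and>
      holomorphic_several d (ball z r) \<and> (\<exists>w\<in>ball z r. d w \<noteq> 0) \<and>
      (\<forall>w\<in>ball z r. d w \<noteq> 0 \<longrightarrow> f w = p w / d w)"
  shows "meromorphic_several f"
  unfolding meromorphic_several_def
proof
  fix z
  obtain r p d where *: "r > 0" "holomorphic_several p (ball z r)"
      "holomorphic_several d (ball z r)" "\<exists>w\<in>ball z r. d w \<noteq> 0"
      "\<forall>w\<in>ball z r. d w \<noteq> 0 \<longrightarrow> f w = p w / d w" using assms by blast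
  then show "\<exists>U p d. open U \<and> connected U \<and> z \<in> U \<and>
       holomorphic_several p U \<and> holomorphic_several d U \<and> (\<exists>w\<in>U. d w \<noteq> 0) \<and>
       (\<forall>w\<in>U. d w \<noteq> 0 \<longrightarrow> f w = p w / d w)"
    by (intro exI[of _ "ball z r"] exI[of _ p] exI[of _ d]) auto
qed

lemma holomorphic_several_imp_meromorphic:
  "holomorphic_several f UNIV \<Longrightarrow> meromorphic_several f"
  unfolding meromorphic_several_def
  by (intro allI exI[of _ UNIV] exI[of _ f] exI[of _ "\<lambda>_. 1"]) auto

lemma meromorphic_several_const [simp]: "meromorphic_several (\<lambda>_. a)"
  by (rule holomorphic_several_imp_meromorphic) simp

lemma meromorphic_several_binary:
  fixes f g :: "complex^'n \<Rightarrow> complex"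
    and N :: "(complex^'n \<Rightarrow> complex) \<Rightarrow> (complex^'n \<Rightarrow> complex) \<Rightarrow>
      (complex^'n \<Rightarrow> complex) \<Rightarrow> (complex^'n \<Rightarrow> complex) \<Rightarrow> complex^'n \<Rightarrow> complex"
  assumes "meromorphic_several f" "meromorphic_several g"
    and "\<And>V p d p' d'. holomorphic_several p V \<Longrightarrow> holomorphic_several d V \<Longrightarrow>
       holomorphic_several p' V \<Longrightarrow> holomorphic_several d' V \<Longrightarrow> holomorphic_several (N p d p' d') V"
    and "\<And>p d p' d' w. d w \<noteq> 0 \<Longrightarrow> d' w \<noteq> 0 \<Longrightarrow> 
      F (p w / d w) (p' w / d' w) = N p d p' d' w / (d w * d' w)"
  shows "meromorphic_several (\<lambda>z. F (f z) (g z))"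
proof (rule meromorphic_severalI)
  fix z
  obtain r p d where f0: "r > 0 \<and> (\<forall>s. 0 < s \<longrightarrow> s \<le> r \<longrightarrow>
      holomorphic_several p (ball z s) \<and> holomorphic_several d (ball z s) \<and>
      open {w\<in>ball z s. d w \<noteq> 0} \<and> ball z s \<subseteq> closure {w\<in>ball z s. d w \<noteq> 0} \<and>
      (\<forall>w\<in>ball z s. d w \<noteq> 0 \<longrightarrow> f w = p w / d w))"
  proof -
    from meromorphic_severalE[OF assms(1), of "z"] show thesis by (elim exE) (rule that)
  qed
  note f = f0[THEN conjunct1] f0[THEN conjunct2, rule_format]
  obtain r' p' d' where g0: "r' > 0 \<and> (\<forall>s. 0 < s \<longrightarrow> s \<le> r' \<longrightarrow>
      holomorphic_several p' (ball z s) \<and> holomorphic_several d' (ball z s) \<and>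
      open {w\<in>ball z s. d' w \<noteq> 0} \<and> ball z s \<subseteq> closure {w\<in>ball z s. d' w \<noteq> 0} \<and>
      (\<forall>w\<in>ball z s. d' w \<noteq> 0 \<longrightarrow> g w = p' w / d' w))"
  proof -
    from meromorphic_severalE[OF assms(2), of "z"] show thesis by (elim exE) (rule that)
  qed
  note g = g0[THEN conjunct1] g0[THEN conjunct2, rule_format]
  define s where "s = min r r'"
  have s: "0 < s" "s \<le> r" "s \<le> r'" using f g by (auto simp: s_def)
  note f = f(2)[OF s(1,2)] and g = g(2)[OF s(1,3)]
  have "\<exists>w\<in>ball z s. d w * d' w \<noteq> 0"
  proof -
    have "z \<in> closure {w\<in>ball z s. d w \<noteq> 0}" using f s centre_in_ball by blast
    then have ne: "{w\<in>ball z s. d w \<noteq> 0} \<noteq> {}" by (metis closure_empty empty_iff)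
    have "{w\<in>ball z s. d w \<noteq> 0} \<inter> closure {w\<in>ball z s. d' w \<noteq> 0} \<noteq> {}"
      using ne g by blast
    then have "{w\<in>ball z s. d w \<noteq> 0} \<inter> {w\<in>ball z s. d' w \<noteq> 0} \<noteq> {}"
      using f open_Int_closure_eq_empty by blast
    then show ?thesis by auto
  qed
  then show "\<exists>r P D. r > 0 \<and> holomorphic_several P (ball z r) \<and>
      holomorphic_several D (ball z r) \<and> (\<exists>w\<in>ball z r. D w \<noteq> 0) \<and>
      (\<forall>w\<in>ball z r. D w \<noteq> 0 \<longrightarrow> F (f w) (g w) = P w / D w)"
    using f g s assms(3,4)
    by (intro exI[of _ s] exI[of _ "N p d p' d'"] exI[of _ "\<lambda>w. d w * d' w"])
       (auto intro: holomorphic_several_mult)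
qed

lemma meromorphic_several_add:
  assumes "meromorphic_several f" "meromorphic_several g"
  shows "meromorphic_several (\<lambda>z. f z + g z)"
proof (rule meromorphic_several_binary[OF assms,
    where F = "(+)" and N = "\<lambda>p d p' d' w. p w * d' w + p' w * d w"])
  show "holomorphic_several (\<lambda>w. p w * d' w + p' w * d w) V"
    if "holomorphic_several p V" "holomorphic_several d V"
      "holomorphic_several p' V" "holomorphic_several d' V" for V p d p' d'
    by (rule holomorphic_several_add; rule holomorphic_several_mult; fact that)
qed (rule add_frac_eq)

lemma meromorphic_several_mult:
  assumes "meromorphic_several f" "meromorphic_several g"
  shows "meromorphic_several (\<lambda>z. f z * g z)"
proof (rule meromorphic_several_binary[OF assms,
    where F = "(*)" and N = "\<lambda>p d p' d' w. p w * p' w"])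
  show "holomorphic_several (\<lambda>w. p w * p' w) V"
    if "holomorphic_several p V" "holomorphic_several d V"
      "holomorphic_several p' V" "holomorphic_several d' V" for V p d p' d'
    by (rule holomorphic_several_mult; fact that)
qed (rule times_divide_times_eq)

lemma meromorphic_several_uminus:
  "meromorphic_several f \<Longrightarrow> meromorphic_several (\<lambda>z. - f z)"
  using meromorphic_several_mult[of "\<lambda>_. - 1" f] by simp

lemma meromorphic_several_diff:
  "meromorphic_several f \<Longrightarrow> meromorphic_several g \<Longrightarrow> meromorphic_several (\<lambda>z. f z - g z)"
  using meromorphic_several_add[of f "\<lambda>z. - g z"] meromorphic_several_uminus[of g] by simp

lemma meromorphic_several_inverse:
  assumes "meromorphic_several f"
  shows "meromorphic_several (\<lambda>z. inverse (f z))"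
proof (rule meromorphic_severalI)
  fix z
  obtain r p d where f0: "r > 0 \<and> (\<forall>s. 0 < s \<longrightarrow> s \<le> r \<longrightarrow>
      holomorphic_several p (ball z s) \<and> holomorphic_several d (ball z s) \<and>
      open {w\<in>ball z s. d w \<noteq> 0} \<and> ball z s \<subseteq> closure {w\<in>ball z s. d w \<noteq> 0} \<and>
      (\<forall>w\<in>ball z s. d w \<noteq> 0 \<longrightarrow> f w = p w / d w))"
  proof -
    from meromorphic_severalE[OF assms, of "z"] show thesis by (elim exE) (rule that)
  qed
  note f = f0[THEN conjunct1] f0[THEN conjunct2, rule_format]
  have z: "z \<in> ball z r" using f by simp
  show "\<exists>r P D. r > 0 \<and> holomorphic_several P (ball z r) \<and>
      holomorphic_several D (ball z r) \<and> (\<exists>w\<in>ball z r. D w \<noteq> 0) \<and>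
      (\<forall>w\<in>ball z r. D w \<noteq> 0 \<longrightarrow> inverse (f w) = P w / D w)"
  proof (cases "\<exists>w\<in>ball z r. d w * p w \<noteq> 0")
    case True
    then show ?thesis using f f(2)[of r]
      by (intro exI[of _ r] exI[of _ "\<lambda>w. d w * d w"] exI[of _ "\<lambda>w. d w * p w"])
         (auto intro!: holomorphic_several_mult)
  next
    case False
    moreover have "{w\<in>ball z r. d w \<noteq> 0} \<noteq> {}"
    proof -
      have "z \<in> closure {w\<in>ball z r. d w \<noteq> 0}" using f(2)[OF f(1) order_refl] z by blast
      then show ?thesis by (metis closure_empty empty_iff)
    qed
    ultimately show ?thesis using f f(2)[of r]
      by (intro exI[of _ r] exI[of _ "\<lambda>w. 0"] exI[of _ "d"]) auto
  qed
qed

lemma meromorphic_several_dichotomy: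
  assumes "meromorphic_several f"
  shows "generically (\<lambda>z. f z = 0) \<or> generically (\<lambda>z. f z \<noteq> 0)"
proof -
  define A where "A P = {z. \<exists>B U. open B \<and> z \<in> B \<and> open U \<and> B \<subseteq> closure U \<and> (\<forall>w\<in>U. P (f w))}"
    for P :: "complex \<Rightarrow> bool"
  have op: "open (A P)" for P
    by (subst open_subopen, unfold A_def) blast
  have un: "z \<in> A (\<lambda>x. x = 0) \<or> z \<in> A (\<lambda>x. x \<noteq> 0)" for z
  proof -
    obtain r p d where f0: "r > 0 \<and> (\<forall>s. 0 < s \<longrightarrow> s \<le> r \<longrightarrow>
      holomorphic_several p (ball z s) \<and> holomorphic_several d (ball z s) \<and>
      open {w\<in>ball z s. d w \<noteq> 0} \<and> ball z s \<subseteq> closure {w\<in>ball z s. d w \<noteq> 0} \<and>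
      (\<forall>w\<in>ball z s. d w \<noteq> 0 \<longrightarrow> f w = p w / d w))"
    proof -
      from meromorphic_severalE[OF assms, of "z"] show thesis by (elim exE) (rule that)
    qed
    note f = f0[THEN conjunct1] f0[THEN conjunct2, rule_format]
    note f2 = f(2)[OF f(1) order_refl]
    show ?thesis
    proof (cases "\<exists>w\<in>ball z r. p w * d w \<noteq> 0")
      case True
      then obtain w where w: "w \<in> ball z r" "p w * d w \<noteq> 0" by blast
      have "z \<in> A (\<lambda>x. x \<noteq> 0)" unfolding A_def
        using f2 f(1) holomorphic_several_nonzero_dense[of "\<lambda>w. p w * d w" "ball z r" w] w
        by (intro CollectI exI[of _ "ball z r"] exI[of _ "{w\<in>ball z r. p w * d w \<noteq> 0}"])
           (auto simp: holomorphic_several_mult)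
      then show ?thesis ..
    next
      case False
      have "z \<in> A (\<lambda>x. x = 0)" unfolding A_def
        using f2 f(1) False
        by (intro CollectI exI[of _ "ball z r"] exI[of _ "{w\<in>ball z r. d w \<noteq> 0}"]) auto
      then show ?thesis ..
    qed
  qed
  have disj: "A (\<lambda>x. x = 0) \<inter> A (\<lambda>x. x \<noteq> 0) = {}"
  proof (rule ccontr)
    assume "A (\<lambda>x. x = 0) \<inter> A (\<lambda>x. x \<noteq> 0) \<noteq> {}"
    then obtain z B U B' U' where *: "open B" "z \<in> B" "open U" "B \<subseteq> closure U" "\<forall>w\<in>U. f w = 0"
      "open B'" "z \<in> B'" "open U'" "B' \<subseteq> closure U'" "\<forall>w\<in>U'. f w \<noteq> 0"
      unfolding A_def by blast
    then have "B \<inter> B' \<inter> closure U \<noteq> {}" by blast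
    then have "B \<inter> B' \<inter> U \<noteq> {}" using * open_Int_closure_eq_empty[of "B \<inter> B'" U] by auto
    then have "B \<inter> B' \<inter> U \<inter> closure U' \<noteq> {}" using * by blast
    then have "B \<inter> B' \<inter> U \<inter> U' \<noteq> {}"
      using * open_Int_closure_eq_empty[of "B \<inter> B' \<inter> U" U'] by auto
    then show False using * by blast
  qed
  have "A (\<lambda>x. x = 0) = UNIV \<or> A (\<lambda>x. x \<noteq> 0) = UNIV"
  proof -
    have "A (\<lambda>x. x = 0) \<inter> A (\<lambda>x. x \<noteq> 0) \<inter> UNIV = {}" using disj by simp
    moreover have cov: "UNIV \<subseteq> A (\<lambda>x. x = 0) \<union> A (\<lambda>x. x \<noteq> 0)" using un by auto
    ultimately have "A (\<lambda>x. x = 0) \<inter> UNIV = {} \<or> A (\<lambda>x. x \<noteq> 0) \<inter> UNIV = {}"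
      by (rule connectedD[OF connected_UNIV op op])
    then show ?thesis using cov by auto
  qed
  then show ?thesis
  proof
    assume "A (\<lambda>x. x = 0) = UNIV"
    then have "generically (\<lambda>z. f z = 0)" unfolding A_def by (intro generically_local) (simp add: set_eq_iff)
    then show ?thesis ..
  next
    assume "A (\<lambda>x. x \<noteq> 0) = UNIV"
    then have "generically (\<lambda>z. f z \<noteq> 0)" unfolding A_def by (intro generically_local) (simp add: set_eq_iff)
    then show ?thesis ..
  qed
qed

lemma has_derivative_shift:
  fixes f :: "'a::real_normed_vector \<Rightarrow> 'b::real_normed_vector"
  assumes "(f has_derivative D) (at (z + a))"
  shows "((\<lambda>z. f (z + a)) has_derivative D) (at z)"
proof -
  have "((\<lambda>z. z + a) has_derivative (\<lambda>x. x)) (at z)"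
    by (auto intro!: derivative_eq_intros)
  from has_derivative_compose[OF this assms] show ?thesis .
qed

lemma holomorphic_several_shift:
  assumes "holomorphic_several f V" "\<And>z. z \<in> U \<Longrightarrow> z + a \<in> V"
  shows "holomorphic_several (\<lambda>z. f (z + a)) U"
  unfolding holomorphic_several_def
proof
  fix z assume "z \<in> U"
  then have "z + a \<in> V" by (rule assms(2))
  with assms(1) obtain c where "(f has_derivative (\<lambda>v. \<Sum>i\<in>UNIV. c $ i * v $ i)) (at (z + a))"
    unfolding holomorphic_several_def by blast
  then have "((\<lambda>z. f (z + a)) has_derivative (\<lambda>v. \<Sum>i\<in>UNIV. c $ i * v $ i)) (at z)"
    by (rule has_derivative_shift)
  then show "\<exists>c. ((\<lambda>z. f (z + a)) has_derivative (\<lambda>v. \<Sum>i\<in>UNIV. c $ i * v $ i)) (at z)" ..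
qed

lemma meromorphic_several_shift:
  assumes "meromorphic_several f"
  shows "meromorphic_several (\<lambda>z. f (z + a))"
proof (rule meromorphic_severalI)
  fix z
  obtain r p d where f0: "r > 0 \<and> (\<forall>s. 0 < s \<longrightarrow> s \<le> r \<longrightarrow>
      holomorphic_several p (ball (z+a) s) \<and> holomorphic_several d (ball (z+a) s) \<and>
      open {w\<in>ball (z+a) s. d w \<noteq> 0} \<and> ball (z+a) s \<subseteq> closure {w\<in>ball (z+a) s. d w \<noteq> 0} \<and>
      (\<forall>w\<in>ball (z+a) s. d w \<noteq> 0 \<longrightarrow> f w = p w / d w))"
  proof -
    from meromorphic_severalE[OF assms, of "z + a"] show thesis by (elim exE) (rule that)
  qed
  note f = f0[THEN conjunct1] f0[THEN conjunct2, rule_format]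
  note f2 = f(2)[OF f(1) order_refl]
  have "z + a \<in> closure {w\<in>ball (z+a) r. d w \<noteq> 0}" using f2 f(1) centre_in_ball by blast
  then have "{w\<in>ball (z+a) r. d w \<noteq> 0} \<noteq> {}" by (metis closure_empty empty_iff)
  then obtain w where w: "w \<in> ball (z+a) r" "d w \<noteq> 0" by blast
  have b: "v + a \<in> ball (z + a) r" if "v \<in> ball z r" for v using that by (simp add: dist_norm)
  have h: "holomorphic_several (\<lambda>z. p (z + a)) (ball z r)" 
     "holomorphic_several (\<lambda>z. d (z + a)) (ball z r)"
    by (rule holomorphic_several_shift[OF _ b], use f2 in blast, assumption)+
  show "\<exists>r P D. r > 0 \<and> holomorphic_several P (ball z r) \<and>
      holomorphic_several D (ball z r) \<and> (\<exists>w\<in>ball z r. D w \<noteq> 0) \<and>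
      (\<forall>w\<in>ball z r. D w \<noteq> 0 \<longrightarrow> f (w + a) = P w / D w)"
  proof (intro exI conjI)
    show "r > 0" by (fact f(1))
    show "holomorphic_several (\<lambda>z. p (z + a)) (ball z r)"
      and "holomorphic_several (\<lambda>z. d (z + a)) (ball z r)" by (fact h)+
    have "w - a \<in> ball z r" using w(1) by (simp add: dist_norm algebra_simps)
    then show "\<exists>w\<in>ball z r. d (w + a) \<noteq> 0" using w(2) by (intro bexI[of _ "w - a"]) simp_all
    show "\<forall>w\<in>ball z r. d (w + a) \<noteq> 0 \<longrightarrow> f (w + a) = p (w + a) / d (w + a)"
      using f2 b by blast
  qed
qed

lemma generically_shift:
  fixes P :: "'a::real_normed_vector \<Rightarrow> bool"
  assumes "generically P"
  shows "generically (\<lambda>z. P (z + a))"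
proof -
  obtain U where U: "open U" "closure U = UNIV" "\<forall>z\<in>U. P z"
    using assms unfolding generically_def by blast
  have "closure ((+) (-a) ` U) = UNIV"
    using U closure_translation[of "-a" U] by (simp add: surj_plus)
  moreover have "open ((+) (-a) ` U)" using U(1) by (rule open_translation)
  moreover have "\<forall>z\<in>(+) (-a) ` U. P (z + a)" using U(3) by auto
  ultimately show ?thesis unfolding generically_def by (intro exI conjI)
qed

definition mero_rel :: "(complex^'n \<Rightarrow> complex) \<Rightarrow> (complex^'n \<Rightarrow> complex) \<Rightarrow> bool"
  where "mero_rel f g \<longleftrightarrow>
    meromorphic_several f \<and> meromorphic_several g \<and> generically (\<lambda>z. f z = g z)"

quotient_type 'n mero = "complex^('n::finite) \<Rightarrow> complex" / partial: mero_rel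
proof (rule part_equivpI)
  show "\<exists>f. mero_rel f f" by (rule exI[of _ "\<lambda>_. 0"]) (simp add: mero_rel_def)
  show "symp mero_rel"
    by (rule sympI, unfold mero_rel_def, elim conjE, intro conjI)
       (assumption+, erule generically_mono, simp)
  show "transp mero_rel"
    by (rule transpI, unfold mero_rel_def, elim conjE, intro conjI)
       (assumption+, erule (1) generically_mono2, simp)
qed

instantiation mero :: (finite) field
begin

lift_definition zero_mero :: "'a mero" is "\<lambda>_. 0" by (simp add: mero_rel_def)
lift_definition one_mero :: "'a mero" is "\<lambda>_. 1" by (simp add: mero_rel_def)
lift_definition plus_mero :: "'a mero \<Rightarrow> 'a mero \<Rightarrow> 'a mero" is "\<lambda>f g z. f z + g z"
  unfolding mero_rel_def
  by (elim conjE, intro conjI)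
     (erule (1) meromorphic_several_add, erule (1) meromorphic_several_add,
      erule (1) generically_mono2, simp)
lift_definition minus_mero :: "'a mero \<Rightarrow> 'a mero \<Rightarrow> 'a mero" is "\<lambda>f g z. f z - g z"
  unfolding mero_rel_def
  by (elim conjE, intro conjI)
     (erule (1) meromorphic_several_diff, erule (1) meromorphic_several_diff,
      erule (1) generically_mono2, simp)
lift_definition times_mero :: "'a mero \<Rightarrow> 'a mero \<Rightarrow> 'a mero" is "\<lambda>f g z. f z * g z"
  unfolding mero_rel_def
  by (elim conjE, intro conjI)
     (erule (1) meromorphic_several_mult, erule (1) meromorphic_several_mult,
      erule (1) generically_mono2, simp)
lift_definition uminus_mero :: "'a mero \<Rightarrow> 'a mero" is "\<lambda>f z. - f z"
  unfolding mero_rel_def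
  by (elim conjE, intro conjI)
     (erule meromorphic_several_uminus, erule meromorphic_several_uminus,
      erule generically_mono, simp)
lift_definition inverse_mero :: "'a mero \<Rightarrow> 'a mero" is "\<lambda>f z. inverse (f z)"
  unfolding mero_rel_def
  by (elim conjE, intro conjI)
     (erule meromorphic_several_inverse, erule meromorphic_several_inverse,
      erule generically_mono, simp)

definition divide_mero :: "'a mero \<Rightarrow> 'a mero \<Rightarrow> 'a mero"
  where "divide_mero f g = f * inverse g"

instance
proof
  fix a b c :: "'a mero"
  show "a + b + c = a + (b + c)" by transfer
    (auto simp: mero_rel_def add_ac intro!: meromorphic_several_add)
  show "a + b = b + a" by transfer
    (auto simp: mero_rel_def add_ac intro!: meromorphic_several_add)
  show "0 + a = a" by transfer (auto simp: mero_rel_def)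
  show "- a + a = 0" by transfer (auto simp: mero_rel_def)
  show "a - b = a + - b" by transfer
    (auto simp: mero_rel_def intro!: meromorphic_several_diff)
  show "a * b * c = a * (b * c)" by transfer
    (auto simp: mero_rel_def mult_ac intro!: meromorphic_several_mult)
  show "a * b = b * a" by transfer
    (auto simp: mero_rel_def mult_ac intro!: meromorphic_several_mult)
  show "1 * a = a" by transfer (auto simp: mero_rel_def)
  show "(a + b) * c = a * c + b * c" by transfer
    (auto simp: mero_rel_def algebra_simps intro!: meromorphic_several_mult meromorphic_several_add)
  show "(0::'a mero) \<noteq> 1"
  proof (transfer, rule notI)
    assume "mero_rel (\<lambda>_::complex^'a. 0) (\<lambda>_. 1)"
    then show False
      unfolding mero_rel_def using generically_ex[of "\<lambda>_::complex^'a. (0::complex) = 1" UNIV] by auto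
  qed
  show "a \<noteq> 0 \<Longrightarrow> inverse a * a = 1"
  proof transfer
    fix f :: "complex^'a \<Rightarrow> complex"
    assume f: "mero_rel f f" "\<not> mero_rel f (\<lambda>_. 0)"
    then have "generically (\<lambda>z. f z \<noteq> 0)"
      using meromorphic_several_dichotomy[of f] by (auto simp: mero_rel_def)
    then have "generically (\<lambda>z. inverse (f z) * f z = 1)" by (rule generically_mono) simp
    then show "mero_rel (\<lambda>z. inverse (f z) * f z) (\<lambda>_. 1)"
      using f by (auto simp: mero_rel_def intro: meromorphic_several_mult meromorphic_several_inverse)
  qed
  show "inverse (0::'a mero) = 0" by transfer (simp add: mero_rel_def)
  show "a div b = a * inverse b" by (fact divide_mero_def)
qed

end

lift_definition mero_const :: "complex \<Rightarrow> 'n::finite mero" is "\<lambda>c _. c"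
  by (simp add: mero_rel_def)

text \<open>The shift operator \<open>T\<^sub>\<alpha>\<close>.\<close>

lift_definition mero_shift :: "complex^'n \<Rightarrow> 'n::finite mero \<Rightarrow> 'n mero" is "\<lambda>\<alpha> f z. f (z + \<alpha>)"
  unfolding mero_rel_def
  by (elim conjE, intro conjI)
     (erule meromorphic_several_shift, erule meromorphic_several_shift, erule generically_shift)

text \<open>
  The dual \<open>h\<^sup>*\<close> is the type \<^typ>\<open>complex^'n\<close>, where \<^typ>\<open>'n\<close> is an arbitrary finite linear
  order playing the role of \<open>{1, \<dots>, n}\<close>.  Algebras are records in the style of
  \<^theory>\<open>HOL-Algebra.Module\<close>: a \<open>\<complex>\<close>-algebra carries its scalar multiplication, and an
  h-algebra in addition its homogeneous components and the two moment maps.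
\<close>

abbreviation unit_weight :: "'n::finite \<Rightarrow> complex^'n"
  where "unit_weight i \<equiv> axis i 1"

record ('n::finite, 'a) h_alg = "(complex, 'a) module" +
  grade :: "complex^'n \<Rightarrow> complex^'n \<Rightarrow> 'a set"
  mu_l :: "'n mero \<Rightarrow> 'a"
  mu_r :: "'n mero \<Rightarrow> 'a"

definition complex_algebra :: "(complex, 'a, 'm) module_scheme \<Rightarrow> bool"
  where "complex_algebra A \<longleftrightarrow>
    ring A \<and> Module.module (ring_of_type_algebra :: complex ring) A \<and>
    (\<forall>c. \<forall>x\<in>carrier A. \<forall>y\<in>carrier A.
       (c \<odot>\<^bsub>A\<^esub> x) \<otimes>\<^bsub>A\<^esub> y = c \<odot>\<^bsub>A\<^esub> (x \<otimes>\<^bsub>A\<^esub> y) \<and>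
       x \<otimes>\<^bsub>A\<^esub> (c \<odot>\<^bsub>A\<^esub> y) = c \<odot>\<^bsub>A\<^esub> (x \<otimes>\<^bsub>A\<^esub> y))"

definition bigraded :: "('n::finite, 'a, 'm) h_alg_scheme \<Rightarrow> bool"
  where "bigraded A \<longleftrightarrow>
    (\<forall>\<alpha> \<beta>. submodule (grade A \<alpha> \<beta>) (ring_of_type_algebra :: complex ring) A) \<and>
    (\<forall>x\<in>carrier A. \<exists>!c. (\<forall>\<alpha> \<beta>. c (\<alpha>, \<beta>) \<in> grade A \<alpha> \<beta>) \<and> finite {p. c p \<noteq> \<zero>\<^bsub>A\<^esub>} \<and>
       x = (\<Oplus>\<^bsub>A\<^esub>p\<in>{p. c p \<noteq> \<zero>\<^bsub>A\<^esub>}. c p)) \<and>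
    \<one>\<^bsub>A\<^esub> \<in> grade A 0 0 \<and>
    (\<forall>\<alpha> \<beta> \<gamma> \<delta>. \<forall>x\<in>grade A \<alpha> \<beta>. \<forall>y\<in>grade A \<gamma> \<delta>. x \<otimes>\<^bsub>A\<^esub> y \<in> grade A (\<alpha> + \<gamma>) (\<beta> + \<delta>))"

definition moment_map ::
    "('n::finite, 'a, 'm) h_alg_scheme \<Rightarrow> ('n mero \<Rightarrow> 'a) \<Rightarrow> bool"
  where "moment_map A \<mu> \<longleftrightarrow>
    \<mu> \<in> ring_hom ring_of_type_algebra A \<and> inj \<mu> \<and>
    (\<forall>c f. \<mu> (mero_const c * f) = c \<odot>\<^bsub>A\<^esub> \<mu> f) \<and> range \<mu> \<subseteq> grade A 0 0"

definition h_algebra :: "('n::finite, 'a, 'm) h_alg_scheme \<Rightarrow> bool"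
  where "h_algebra A \<longleftrightarrow>
    complex_algebra A \<and> bigraded A \<and> moment_map A (mu_l A) \<and> moment_map A (mu_r A) \<and>
    (\<forall>\<alpha> \<beta> f. \<forall>a\<in>grade A \<alpha> \<beta>.
       mu_l A f \<otimes>\<^bsub>A\<^esub> a = a \<otimes>\<^bsub>A\<^esub> mu_l A (mero_shift \<alpha> f) \<and>
       mu_r A f \<otimes>\<^bsub>A\<^esub> a = a \<otimes>\<^bsub>A\<^esub> mu_r A (mero_shift \<beta> f))"

definition h_algebra_hom ::
    "('n::finite, 'a, 'm) h_alg_scheme \<Rightarrow> ('n, 'b, 'k) h_alg_scheme \<Rightarrow> ('a \<Rightarrow> 'b) \<Rightarrow> bool"
  where "h_algebra_hom A B \<phi> \<longleftrightarrow>
    \<phi> \<in> ring_hom A B \<and> (\<forall>c. \<forall>x\<in>carrier A. \<phi> (c \<odot>\<^bsub>A\<^esub> x) = c \<odot>\<^bsub>B\<^esub> \<phi> x) \<and>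
    (\<forall>\<alpha> \<beta>. \<phi> ` grade A \<alpha> \<beta> \<subseteq> grade B \<alpha> \<beta>) \<and>
    (\<forall>f. \<phi> (mu_l A f) = mu_l B f \<and> \<phi> (mu_r A f) = mu_r B f)"

text \<open>Difference operators act on meromorphic functions, so the product is composition.\<close>

definition diff_ops :: "('n::finite, 'n mero \<Rightarrow> 'n mero) h_alg"
  where "diff_ops = \<lparr>
    carrier = {F. \<exists>B c. finite B \<and> F = (\<lambda>g. \<Sum>\<beta>\<in>B. c \<beta> * mero_shift \<beta> g)},
    mult = (\<circ>), one = id, zero = (\<lambda>g. 0), add = (\<lambda>F G g. F g + G g),
    smult = (\<lambda>c F g. mero_const c * F g),
    grade = (\<lambda>\<alpha> \<beta>. if \<alpha> = \<beta> then {F. \<exists>f. F = (\<lambda>g. f * mero_shift (- \<beta>) g)} else {\<lambda>g. 0}),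
    mu_l = (\<lambda>f g. f * g), mu_r = (\<lambda>f g. f * g)\<rparr>"

text \<open>
  \<open>monoid_algebra G\<close> is \<open>\<complex>[G]\<close>.  It serves both for free algebras (words in the generators) and
  for the algebra covering a matrix tensor product (pairs of homogeneous elements).
\<close>

abbreviation scale_pm :: "complex \<Rightarrow> ('a \<Rightarrow>\<^sub>0 complex) \<Rightarrow> ('a \<Rightarrow>\<^sub>0 complex)"
  where "scale_pm c \<equiv> Poly_Mapping.map ((*) c)"

definition monoid_algebra :: "('a, 'm) monoid_scheme \<Rightarrow> (complex, 'a \<Rightarrow>\<^sub>0 complex) module"
  where "monoid_algebra G = \<lparr>
    carrier = {x. Poly_Mapping.keys x \<subseteq> carrier G},
    mult = (\<lambda>x y. \<Sum>p\<in>Poly_Mapping.keys x. \<Sum>r\<in>Poly_Mapping.keys y.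
       Poly_Mapping.single (p \<otimes>\<^bsub>G\<^esub> r) (Poly_Mapping.lookup x p * Poly_Mapping.lookup y r)),
    one = Poly_Mapping.single \<one>\<^bsub>G\<^esub> 1, zero = 0, add = (+), smult = scale_pm\<rparr>"

definition quot_algebra ::
    "(complex, 'a, 'm) module_scheme \<Rightarrow> 'a set \<Rightarrow> (complex, 'a set) module"
  where "quot_algebra R I = ring.extend (R Quot I)
    (module.fields (\<lambda>c Y. \<Union>x\<in>Y. I +>\<^bsub>R\<^esub> (c \<odot>\<^bsub>R\<^esub> x)))"

definition linear_ext ::
    "(complex, 'b, 'm) module_scheme \<Rightarrow> ('a \<Rightarrow> 'b) \<Rightarrow> ('a \<Rightarrow>\<^sub>0 complex) \<Rightarrow> 'b"
  where "linear_ext V \<phi> x =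
    (\<Oplus>\<^bsub>V\<^esub>p\<in>Poly_Mapping.keys x. Poly_Mapping.lookup x p \<odot>\<^bsub>V\<^esub> \<phi> p)"

definition algebra_ext ::
    "(complex, 'b, 'm) module_scheme \<Rightarrow> ('g \<Rightarrow> 'b) \<Rightarrow> ('g list \<Rightarrow>\<^sub>0 complex) \<Rightarrow> 'b"
  where "algebra_ext V \<delta> = linear_ext V (\<lambda>w. foldr (\<lambda>g y. \<delta> g \<otimes>\<^bsub>V\<^esub> y) w \<one>\<^bsub>V\<^esub>)"

text \<open>
  The map induced on a quotient: the common value of \<open>\<phi>\<close> on a coset.  Nothing is known about the
  result unless \<open>\<phi>\<close> is constant on the coset.
\<close>

definition descend :: "('a \<Rightarrow> 'b) \<Rightarrow> 'a set \<Rightarrow> 'b"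
  where "descend \<phi> Y = the_elem (\<phi> ` Y)"

definition composable ::
    "('n::finite, 'a, 'm) h_alg_scheme \<Rightarrow> ('n, 'b, 'k) h_alg_scheme \<Rightarrow> ('a \<times> 'b) set"
  where "composable A B = (\<Union>\<alpha> \<gamma> \<beta>. grade A \<alpha> \<gamma> \<times> grade B \<gamma> \<beta>)"

definition tensor_cover ::
    "('n::finite, 'a, 'm) h_alg_scheme \<Rightarrow> ('n, 'b, 'k) h_alg_scheme \<Rightarrow>
     (complex, ('a \<times> 'b) \<Rightarrow>\<^sub>0 complex) module"
  where "tensor_cover A B = monoid_algebra \<lparr>carrier = composable A B,
    mult = (\<lambda>(a, b) (c, d). (a \<otimes>\<^bsub>A\<^esub> c, b \<otimes>\<^bsub>B\<^esub> d)), one = (\<one>\<^bsub>A\<^esub>, \<one>\<^bsub>B\<^esub>)\<rparr>"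

abbreviation pair :: "'a \<Rightarrow> 'b \<Rightarrow> ('a \<times> 'b) \<Rightarrow>\<^sub>0 complex"
  where "pair a b \<equiv> Poly_Mapping.single (a, b) 1"

inductive tensor_relation ::
    "('n::finite, 'a, 'm) h_alg_scheme \<Rightarrow> ('n, 'b, 'k) h_alg_scheme \<Rightarrow>
     (('a \<times> 'b) \<Rightarrow>\<^sub>0 complex) \<Rightarrow> (('a \<times> 'b) \<Rightarrow>\<^sub>0 complex) \<Rightarrow> bool"
  for A B
  where
    add_left: "a \<in> grade A \<alpha> \<gamma> \<Longrightarrow> a' \<in> grade A \<alpha> \<gamma> \<Longrightarrow> b \<in> grade B \<gamma> \<beta> \<Longrightarrow>
      tensor_relation A B (pair (a \<oplus>\<^bsub>A\<^esub> a') b) (pair a b + pair a' b)"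
  | add_right: "a \<in> grade A \<alpha> \<gamma> \<Longrightarrow> b \<in> grade B \<gamma> \<beta> \<Longrightarrow> b' \<in> grade B \<gamma> \<beta> \<Longrightarrow>
      tensor_relation A B (pair a (b \<oplus>\<^bsub>B\<^esub> b')) (pair a b + pair a b')"
  | smult_left: "a \<in> grade A \<alpha> \<gamma> \<Longrightarrow> b \<in> grade B \<gamma> \<beta> \<Longrightarrow>
      tensor_relation A B (pair (c \<odot>\<^bsub>A\<^esub> a) b) (scale_pm c (pair a b))"
  | smult_right: "a \<in> grade A \<alpha> \<gamma> \<Longrightarrow> b \<in> grade B \<gamma> \<beta> \<Longrightarrow>
      tensor_relation A B (pair a (c \<odot>\<^bsub>B\<^esub> b)) (scale_pm c (pair a b))"
  | balanced: "a \<in> grade A \<alpha> \<gamma> \<Longrightarrow> b \<in> grade B \<gamma> \<beta> \<Longrightarrow>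
      tensor_relation A B (pair (mu_r A f \<otimes>\<^bsub>A\<^esub> a) b) (pair a (mu_l B f \<otimes>\<^bsub>B\<^esub> b))"

text \<open>The linear span of the relations is automatically a two-sided ideal of the cover.\<close>

definition tensor_null ::
    "('n::finite, 'a, 'm) h_alg_scheme \<Rightarrow> ('n, 'b, 'k) h_alg_scheme \<Rightarrow>
     (('a \<times> 'b) \<Rightarrow>\<^sub>0 complex) set"
  where "tensor_null A B = module.span scale_pm {u - v | u v. tensor_relation A B u v}"

definition tensor_class ::
    "('n::finite, 'a, 'm) h_alg_scheme \<Rightarrow> ('n, 'b, 'k) h_alg_scheme \<Rightarrow>
     (('a \<times> 'b) \<Rightarrow>\<^sub>0 complex) \<Rightarrow> (('a \<times> 'b) \<Rightarrow>\<^sub>0 complex) set"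
  where "tensor_class A B x = tensor_null A B +>\<^bsub>tensor_cover A B\<^esub> x"

definition tens ::
    "('n::finite, 'a, 'm) h_alg_scheme \<Rightarrow> ('n, 'b, 'k) h_alg_scheme \<Rightarrow> 'a \<Rightarrow> 'b \<Rightarrow>
     (('a \<times> 'b) \<Rightarrow>\<^sub>0 complex) set"
  where "tens A B a b = tensor_class A B (pair a b)"

definition h_tensor ::
    "('n::finite, 'a, 'm) h_alg_scheme \<Rightarrow> ('n, 'b, 'k) h_alg_scheme \<Rightarrow>
     ('n, (('a \<times> 'b) \<Rightarrow>\<^sub>0 complex) set) h_alg"
  where "h_tensor A B = module.extend (quot_algebra (tensor_cover A B) (tensor_null A B))
    (h_alg.fields
      (\<lambda>\<alpha> \<beta>. tensor_class A B ` {x. Poly_Mapping.keys x \<subseteq> (\<Union>\<gamma>. grade A \<alpha> \<gamma> \<times> grade B \<gamma> \<beta>)})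
      (\<lambda>f. tens A B (mu_l A f) \<one>\<^bsub>B\<^esub>)
      (\<lambda>f. tens A B \<one>\<^bsub>A\<^esub> (mu_r B f)))"

definition tensor_map ::
    "('n::finite, 'c, 'm) h_alg_scheme \<Rightarrow> ('n, 'd, 'k) h_alg_scheme \<Rightarrow> ('a \<Rightarrow> 'c) \<Rightarrow> ('b \<Rightarrow> 'd) \<Rightarrow>
     (('a \<times> 'b) \<Rightarrow>\<^sub>0 complex) set \<Rightarrow> (('c \<times> 'd) \<Rightarrow>\<^sub>0 complex) set"
  where "tensor_map C D \<phi> \<psi> =
    descend (linear_ext (h_tensor C D) (\<lambda>(a, b). tens C D (\<phi> a) (\<psi> b)))"

text \<open>
  The identification of \<open>(A \<otimes> B) \<otimes> C\<close> with \<open>A \<otimes> (B \<otimes> C)\<close>.  A homogeneous coset \<open>Y\<close> also contains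
  representatives with cancelling terms in other degrees, whose second legs cannot be
  tensored with \<open>c\<close>; only representatives all of whose second legs are composable with \<open>c\<close> are used.
\<close>

definition tensor_assoc ::
    "('n::finite, 'a, 'm) h_alg_scheme \<Rightarrow> ('n, 'b, 'k) h_alg_scheme \<Rightarrow> ('n, 'c, 'l) h_alg_scheme \<Rightarrow>
     (((('a \<times> 'b) \<Rightarrow>\<^sub>0 complex) set \<times> 'c) \<Rightarrow>\<^sub>0 complex) set \<Rightarrow>
     (('a \<times> (('b \<times> 'c) \<Rightarrow>\<^sub>0 complex) set) \<Rightarrow>\<^sub>0 complex) set"
  where "tensor_assoc A B C =
    descend (linear_ext (h_tensor A (h_tensor B C)) (\<lambda>(Y, c).
      descend (linear_ext (h_tensor A (h_tensor B C))
          (\<lambda>(a, b). tens A (h_tensor B C) a (tens B C b c)))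
        {x \<in> Y. \<forall>(a, b)\<in>Poly_Mapping.keys x. (b, c) \<in> composable B C}))"

record ('n::finite, 'a) h_bialg = "('n, 'a) h_alg" +
  comult :: "'a \<Rightarrow> (('a \<times> 'a) \<Rightarrow>\<^sub>0 complex) set"
  counit :: "'a \<Rightarrow> ('n mero \<Rightarrow> 'n mero)"

definition coassociative :: "('n::finite, 'a, 'm) h_bialg_scheme \<Rightarrow> bool"
  where "coassociative A \<longleftrightarrow> (\<forall>a\<in>carrier A.
    tensor_assoc A A A (tensor_map (h_tensor A A) A (comult A) id (comult A a)) =
    tensor_map A (h_tensor A A) id (comult A) (comult A a))"

text \<open>
  The identifications of \<open>A\<close> with \<open>A \<otimes> D\<close> and \<open>D \<otimes> A\<close> send \<open>a\<close> of bidegree \<open>(\<alpha>, \<beta>)\<close> to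
  \<open>a \<otimes> T\<^sub>-\<^sub>\<beta>\<close> and \<open>T\<^sub>-\<^sub>\<alpha> \<otimes> a\<close>.
\<close>

definition counital :: "('n::finite, 'a, 'm) h_bialg_scheme \<Rightarrow> bool"
  where "counital A \<longleftrightarrow> (\<forall>\<alpha> \<beta>. \<forall>a\<in>grade A \<alpha> \<beta>.
    tensor_map A diff_ops id (counit A) (comult A a) = tens A diff_ops a (mero_shift (- \<beta>)) \<and>
    tensor_map diff_ops A (counit A) id (comult A a) = tens diff_ops A (mero_shift (- \<alpha>)) a)"

definition h_bialgebroid :: "('n::finite, 'a, 'm) h_bialg_scheme \<Rightarrow> bool"
  where "h_bialgebroid A \<longleftrightarrow>
    h_algebra A \<and> h_algebra_hom A (h_tensor A A) (comult A) \<and>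
    h_algebra_hom A diff_ops (counit A) \<and> coassociative A \<and> counital A"

definition h_Hopf_algebroid :: "('n::finite, 'a, 'm) h_bialg_scheme \<Rightarrow> ('a \<Rightarrow> 'a) \<Rightarrow> bool"
  where "h_Hopf_algebroid A S \<longleftrightarrow>
    h_bialgebroid A \<and> S \<in> carrier A \<rightarrow> carrier A \<and>
    (\<forall>a\<in>carrier A. \<forall>b\<in>carrier A. S (a \<oplus>\<^bsub>A\<^esub> b) = S a \<oplus>\<^bsub>A\<^esub> S b) \<and>
    (\<forall>c. \<forall>a\<in>carrier A. S (c \<odot>\<^bsub>A\<^esub> a) = c \<odot>\<^bsub>A\<^esub> S a) \<and>
    (\<forall>f. \<forall>a\<in>carrier A.
       S (mu_r A f \<otimes>\<^bsub>A\<^esub> a) = S a \<otimes>\<^bsub>A\<^esub> mu_l A f \<and>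
       S (a \<otimes>\<^bsub>A\<^esub> mu_l A f) = mu_r A f \<otimes>\<^bsub>A\<^esub> S a) \<and>
    (\<forall>a\<in>carrier A.
       descend (linear_ext A (\<lambda>(b, c). b \<otimes>\<^bsub>A\<^esub> S c)) (comult A a) = mu_l A (counit A a 1)) \<and>
    (\<forall>\<alpha> \<beta>. \<forall>a\<in>grade A \<alpha> \<beta>.
       descend (linear_ext A (\<lambda>(b, c). S b \<otimes>\<^bsub>A\<^esub> c)) (comult A a) =
       mu_r A (mero_shift \<alpha> (counit A a 1)))"

definition algebra_antihom :: "(complex, 'a, 'm) module_scheme \<Rightarrow> ('a \<Rightarrow> 'a) \<Rightarrow> bool"
  where "algebra_antihom A S \<longleftrightarrow>
    S \<in> carrier A \<rightarrow> carrier A \<and> S \<one>\<^bsub>A\<^esub> = \<one>\<^bsub>A\<^esub> \<and>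
    (\<forall>x\<in>carrier A. \<forall>y\<in>carrier A.
       S (x \<oplus>\<^bsub>A\<^esub> y) = S x \<oplus>\<^bsub>A\<^esub> S y \<and> S (x \<otimes>\<^bsub>A\<^esub> y) = S y \<otimes>\<^bsub>A\<^esub> S x) \<and>
    (\<forall>c. \<forall>x\<in>carrier A. S (c \<odot>\<^bsub>A\<^esub> x) = c \<odot>\<^bsub>A\<^esub> S x)"

text \<open>All functions of \<open>q\<close> depend on the chosen logarithm \<open>logq\<close>; in particular \<open>q = q_pow logq 1\<close>.\<close>

definition q_pow :: "complex \<Rightarrow> complex \<Rightarrow> complex"
  where "q_pow logq z = exp (z * logq)"

definition h0_fun :: "complex \<Rightarrow> complex \<Rightarrow> complex"
  where "h0_fun logq z = (q_pow logq (- 1) - q_pow logq 1) / (q_pow logq (- 2 * z) - 1)"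

definition g_fun :: "complex \<Rightarrow> complex \<Rightarrow> complex"
  where "g_fun logq z =
    (q_pow logq (- 2 * z) - q_pow logq (- 2)) * (q_pow logq (- 2 * z) - q_pow logq 2) /
    (q_pow logq (- 2 * z) - 1)\<^sup>2"

definition h_fun :: "complex \<Rightarrow> complex \<Rightarrow> complex"
  where "h_fun logq z = q_pow logq 1 - h0_fun logq z"

text \<open>
  The meromorphic function \<open>\<phi>(\<lambda>\<^sub>a - \<lambda>\<^sub>b)\<close>.  The values that division by zero gives \<open>\<phi>\<close> at its poles
  do not matter, since they only concern the complement of a dense open set.
\<close>

definition at_diff :: "(complex \<Rightarrow> complex) \<Rightarrow> 'n::finite \<Rightarrow> 'n \<Rightarrow> 'n mero"
  where "at_diff \<phi> a b = abs_mero (\<lambda>v. \<phi> (v $ a - v $ b))"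

text \<open>\<open>R_mat logq a b c d\<close> is \<open>R\<close> with upper indices \<open>a b\<close> and lower indices \<open>c d\<close>.\<close>

definition R_mat :: "complex \<Rightarrow> 'n::{finite,linorder} \<Rightarrow> 'n \<Rightarrow> 'n \<Rightarrow> 'n \<Rightarrow> 'n mero"
  where "R_mat logq a b c d =
    (if a = b then (if c = a \<and> d = a then mero_const (q_pow logq 1) else 0)
     else if c = a \<and> d = b then (if a < b then 1 else at_diff (g_fun logq) a b)
     else if c = b \<and> d = a then at_diff (h0_fun logq) a b
     else 0)"

datatype 'n gen =
    GenL "('n::finite) mero"
  | GenR "'n mero"
  | GenT 'n 'n
  | GenDetInv

type_synonym 'n free = "'n gen list \<Rightarrow>\<^sub>0 complex"

definition free_algebra :: "(complex, ('n::finite) free) module"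
  where "free_algebra = monoid_algebra \<lparr>carrier = UNIV, mult = (@), one = []\<rparr>"

abbreviation word :: "'n::finite gen list \<Rightarrow> 'n free"
  where "word w \<equiv> Poly_Mapping.single w 1"

definition perm_coeff :: "complex \<Rightarrow> (nat \<Rightarrow> nat) \<Rightarrow> 'n::{finite,linorder} set \<Rightarrow> 'n mero"
  where "perm_coeff logq \<sigma> I =
    (\<Prod>(k, l)\<in>{(k, l). k < l \<and> l < card I \<and> \<sigma> k > \<sigma> l}.
       - at_diff (h_fun logq) (sorted_list_of_set I ! \<sigma> k) (sorted_list_of_set I ! \<sigma> l))"

text \<open>The dynamical quantum minor with row set \<open>I\<close> and column set \<open>J\<close>; positions count from 0.\<close>

definition free_minor ::
    "complex \<Rightarrow> 'n::{finite,linorder} set \<Rightarrow> 'n set \<Rightarrow> 'n free"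
  where "free_minor logq I J =
    (\<Sum>\<sigma>\<in>{\<sigma>. \<sigma> permutes {..<card I}}.
       word (GenL (perm_coeff logq \<sigma> I) #
         map (\<lambda>k. GenT (sorted_list_of_set I ! \<sigma> k) (sorted_list_of_set J ! k)) [0..<card I]))"

inductive M_relation ::
    "complex \<Rightarrow> 'n::{finite,linorder} free \<Rightarrow> 'n free \<Rightarrow> bool"
  for logq
  where
    L_const: "M_relation logq (word [GenL (mero_const c)]) (Poly_Mapping.single [] c)"
  | L_add: "M_relation logq (word [GenL (f + g)]) (word [GenL f] + word [GenL g])"
  | L_mult: "M_relation logq (word [GenL (f * g)]) (word [GenL f, GenL g])"
  | R_const: "M_relation logq (word [GenR (mero_const c)]) (Poly_Mapping.single [] c)"
  | R_add: "M_relation logq (word [GenR (f + g)]) (word [GenR f] + word [GenR g])"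
  | R_mult: "M_relation logq (word [GenR (f * g)]) (word [GenR f, GenR g])"
  | L_R: "M_relation logq (word [GenL f, GenR g]) (word [GenR g, GenL f])"
  | L_T: "M_relation logq (word [GenL f, GenT i j])
      (word [GenT i j, GenL (mero_shift (unit_weight i) f)])"
  | R_T: "M_relation logq (word [GenR f, GenT i j])
      (word [GenT i j, GenR (mero_shift (unit_weight j) f)])"
  | RLL: "M_relation logq
      (\<Sum>x\<in>UNIV. \<Sum>y\<in>UNIV. word [GenL (R_mat logq x y a c), GenT x b, GenT y d])
      (\<Sum>x\<in>UNIV. \<Sum>y\<in>UNIV. word [GenR (R_mat logq b d x y), GenT c y, GenT a x])"

text \<open>
  Adjoining the inverse determinant to the algebra presented by \<open>M_relation\<close> means adding the
  generator \<^const>\<open>GenDetInv\<close> and the relations below.  Here \<open>1\<close> at type \<^typ>\<open>complex^'n\<close>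
  is the vector with all entries 1.
\<close>

inductive GL_relation ::
    "complex \<Rightarrow> 'n::{finite,linorder} free \<Rightarrow> 'n free \<Rightarrow> bool"
  for logq
  where
    M_rel: "M_relation logq u v \<Longrightarrow> GL_relation logq u v"
  | det_inv_right: "GL_relation logq
      (free_minor logq UNIV UNIV \<otimes>\<^bsub>free_algebra\<^esub> word [GenDetInv]) (word [])"
  | det_inv_left: "GL_relation logq
      (word [GenDetInv] \<otimes>\<^bsub>free_algebra\<^esub> free_minor logq UNIV UNIV) (word [])"
  | T_det_inv: "GL_relation logq (word [GenT i j, GenDetInv]) (word [GenDetInv, GenT i j])"
  | L_det_inv: "GL_relation logq (word [GenL f, GenDetInv])
      (word [GenDetInv, GenL (mero_shift (- 1) f)])"
  | R_det_inv: "GL_relation logq (word [GenR f, GenDetInv])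
      (word [GenDetInv, GenR (mero_shift (- 1) f)])"

definition GL_ideal :: "complex \<Rightarrow> 'n::{finite,linorder} free set"
  where "GL_ideal logq = Idl\<^bsub>free_algebra\<^esub> {u - v | u v. GL_relation logq u v}"

type_synonym 'n GL_elt = "'n free set"

definition GL_class :: "complex \<Rightarrow> 'n::{finite,linorder} free \<Rightarrow> 'n GL_elt"
  where "GL_class logq x = GL_ideal logq +>\<^bsub>free_algebra\<^esub> x"

definition GL_t :: "complex \<Rightarrow> 'n::{finite,linorder} \<Rightarrow> 'n \<Rightarrow> 'n GL_elt"
  where "GL_t logq i j = GL_class logq (word [GenT i j])"

definition GL_det_inv :: "complex \<Rightarrow> 'n::{finite,linorder} GL_elt"
  where "GL_det_inv logq = GL_class logq (word [GenDetInv])"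

definition GL_minor :: "complex \<Rightarrow> 'n::{finite,linorder} set \<Rightarrow> 'n set \<Rightarrow> 'n GL_elt"
  where "GL_minor logq I J = GL_class logq (free_minor logq I J)"

definition GL_det :: "complex \<Rightarrow> 'n::{finite,linorder} GL_elt"
  where "GL_det logq = GL_minor logq UNIV UNIV"

fun gen_deg_l :: "'n::finite gen \<Rightarrow> complex^'n"
  where
    "gen_deg_l (GenL f) = 0"
  | "gen_deg_l (GenR f) = 0"
  | "gen_deg_l (GenT i j) = unit_weight i"
  | "gen_deg_l GenDetInv = - 1"

fun gen_deg_r :: "'n::finite gen \<Rightarrow> complex^'n"
  where
    "gen_deg_r (GenL f) = 0"
  | "gen_deg_r (GenR f) = 0"
  | "gen_deg_r (GenT i j) = unit_weight j"
  | "gen_deg_r GenDetInv = - 1"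

definition GL_h_alg :: "complex \<Rightarrow> ('n::{finite,linorder}, 'n GL_elt) h_alg"
  where "GL_h_alg logq = module.extend (quot_algebra free_algebra (GL_ideal logq))
    (h_alg.fields
      (\<lambda>\<alpha> \<beta>. GL_class logq ` {x. \<forall>w\<in>Poly_Mapping.keys x.
         sum_list (map gen_deg_l w) = \<alpha> \<and> sum_list (map gen_deg_r w) = \<beta>})
      (\<lambda>f. GL_class logq (word [GenL f]))
      (\<lambda>f. GL_class logq (word [GenR f])))"

primrec GL_comult_gen :: "complex \<Rightarrow> 'n::{finite,linorder} gen \<Rightarrow>
    (('n GL_elt \<times> 'n GL_elt) \<Rightarrow>\<^sub>0 complex) set"
  where
    "GL_comult_gen logq (GenL f) =
       tens (GL_h_alg logq) (GL_h_alg logq) (mu_l (GL_h_alg logq) f) \<one>\<^bsub>GL_h_alg logq\<^esub>"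
  | "GL_comult_gen logq (GenR f) =
       tens (GL_h_alg logq) (GL_h_alg logq) \<one>\<^bsub>GL_h_alg logq\<^esub> (mu_r (GL_h_alg logq) f)"
  | "GL_comult_gen logq (GenT i j) =
       (\<Oplus>\<^bsub>h_tensor (GL_h_alg logq) (GL_h_alg logq)\<^esub>k\<in>UNIV.
          tens (GL_h_alg logq) (GL_h_alg logq) (GL_t logq i k) (GL_t logq k j))"
  | "GL_comult_gen logq GenDetInv =
       tens (GL_h_alg logq) (GL_h_alg logq) (GL_det_inv logq) (GL_det_inv logq)"

primrec GL_counit_gen :: "'n::finite gen \<Rightarrow> 'n mero \<Rightarrow> 'n mero"
  where
    "GL_counit_gen (GenL f) = (\<lambda>g. f * g)"
  | "GL_counit_gen (GenR f) = (\<lambda>g. f * g)"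
  | "GL_counit_gen (GenT i j) = (if i = j then mero_shift (- unit_weight i) else (\<lambda>g. 0))"
  | "GL_counit_gen GenDetInv = mero_shift 1"

definition F_R_GL :: "complex \<Rightarrow> ('n::{finite,linorder}, 'n GL_elt) h_bialg"
  where "F_R_GL logq = h_alg.extend (GL_h_alg logq)
    (h_bialg.fields
      (descend (algebra_ext (h_tensor (GL_h_alg logq) (GL_h_alg logq)) (GL_comult_gen logq)))
      (descend (algebra_ext diff_ops GL_counit_gen)))"

definition dyn_sign :: "complex \<Rightarrow> 'n::{finite,linorder} set \<Rightarrow> 'n set \<Rightarrow> 'n mero"
  where "dyn_sign logq I J =
    (\<Prod>(k, m)\<in>{(k, m). k \<in> I \<and> m \<in> J \<and> k > m}. - at_diff (h_fun logq) k m)"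

end

theory Submission
  imports Defs
begin

text \<open>
  A dynamical quantum minor changes by an explicit sign factor in \<open>\<mu>\<close> when its columns are permuted and
  vanishes when two columns agree.  Expanding the determinant along its last column after such a
  permutation shows that the proposed matrix \<open>S(t\<^sub>i\<^sub>j)\<close> is a left inverse of \<open>t\<close>.  Exchanging rows and
  columns gives a right inverse built from a row determinant.  The two determinants are related by
  \<open>F(\<mu>) det = F(\<lambda>) det'\<close>, where \<open>F\<close> is a sum of products of values of \<open>h\<close> over all permutations; \<open>F\<close> is
  not zero, because at a suitable integral point all terms but one vanish.  So the right inverse
  exists and coincides with the left inverse.

  Multiplying the RLL-relation by the inverse matrices on both sides gives the relations that \<open>S\<close> has
  to respect, and multiplying the expansion of the determinant in the same way gives
  \<open>S(det) = det\<^sup>-\<^sup>1\<close>.  The comultiplication respects the RLL-relation because the balancing relation of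
  the tensor product moves \<open>R\<close> from one leg to the other, and \<open>det\<close> is group-like by the permutation
  rule for columns.  The remaining axioms compare homomorphisms, hence need only be checked on the
  generators, or follow by induction on words.
\<close>

section \<open>Meromorphic functions\<close>

text \<open>Over a noncommutative ring a left inverse of the matrix \<open>t\<close> need not be a
  right inverse, and the two antipode axioms use one each; this is what forces the row determinant.
  Minors carry their signs in \<lambda> but permute columns with factors in \<mu>, so exchanging
  rows and columns also exchanges \<lambda> with \<mu> and reverses the index order, which is why
  the order is a parameter of the computation. The function h enters it only through h(z) + h(-z) =
  q + q^-1, g(z) = h(z) h(-z), nonvanishing, and invariance under shifts that preserve the
  difference. Centrality of det follows from the relations imposed on its inverse. Another obstacle
  is that an algebra given by generators and relations could be too small. The counit bounds it from
  below: applied to 1 it recovers f from either moment map, so the moment maps are injective. The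
  sum of the homogeneous components is direct because the ideal contains the homogeneous parts of
  its elements. Directness also matters for tensor products: tensors exist only for matching
  degrees, and the associativity map is well defined because a nonzero homogeneous element has just
  one bidegree.\<close>

lemma mero_rel_refl: "meromorphic_several f \<Longrightarrow> mero_rel f f"
  by (simp add: mero_rel_def)

lemma abs_mero_eq_iff:
  assumes "meromorphic_several f" "meromorphic_several g"
  shows "abs_mero f = abs_mero g \<longleftrightarrow> generically (\<lambda>z. f z = g z)"
  using Quotient3_rel[OF Quotient3_mero, of f g] assms by (auto simp: mero_rel_def)

lemma abs_mero_simps:
  assumes "meromorphic_several f" "meromorphic_several g"
  shows "abs_mero f + abs_mero g = abs_mero (\<lambda>z. f z + g z)"
    and "abs_mero f - abs_mero g = abs_mero (\<lambda>z. f z - g z)"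
    and "abs_mero f * abs_mero g = abs_mero (\<lambda>z. f z * g z)"
    and "- abs_mero f = abs_mero (\<lambda>z. - f z)"
    and "mero_shift \<alpha> (abs_mero f) = abs_mero (\<lambda>z. f (z + \<alpha>))"
  using assms by (simp_all add: plus_mero.abs_eq minus_mero.abs_eq times_mero.abs_eq
      uminus_mero.abs_eq mero_shift.abs_eq mero_rel_refl)

lemma mero_const_abs: "mero_const c = abs_mero (\<lambda>_. c)"
  by (simp add: mero_const.abs_eq mero_rel_refl)

lemma zero_mero_abs: "0 = abs_mero (\<lambda>_. 0)" and one_mero_abs: "1 = abs_mero (\<lambda>_. 1)"
  by (simp_all add: zero_mero.abs_eq one_mero.abs_eq)

lemma mero_shift_add: "mero_shift \<alpha> (f + g) = mero_shift \<alpha> f + mero_shift \<alpha> g"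
  and mero_shift_diff: "mero_shift \<alpha> (f - g) = mero_shift \<alpha> f - mero_shift \<alpha> g"
  and mero_shift_mult: "mero_shift \<alpha> (f * g) = mero_shift \<alpha> f * mero_shift \<alpha> g"
  and mero_shift_uminus: "mero_shift \<alpha> (- f) = - mero_shift \<alpha> f"
  by (transfer; auto simp: mero_rel_def intro!: meromorphic_several_add meromorphic_several_diff
        meromorphic_several_mult meromorphic_several_uminus meromorphic_several_shift)+

lemma mero_shift_0 [simp]: "mero_shift 0 f = f"
  by transfer (auto simp: mero_rel_def)

lemma mero_shift_zero [simp]: "mero_shift \<alpha> 0 = 0"
  and mero_shift_one [simp]: "mero_shift \<alpha> 1 = 1"
  and mero_shift_const [simp]: "mero_shift \<alpha> (mero_const c) = mero_const c"
  by (transfer; simp add: mero_rel_def)+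

lemma mero_shift_shift [simp]: "mero_shift \<alpha> (mero_shift \<beta> f) = mero_shift (\<alpha> + \<beta>) f"
  by transfer (auto simp: mero_rel_def add.assoc intro!: meromorphic_several_shift[of "\<lambda>z. _ (z + _)"]
      simp flip: add.assoc intro: meromorphic_several_shift)

lemma mero_const_add: "mero_const (c + d) = mero_const c + mero_const d"
  and mero_const_mult: "mero_const (c * d) = mero_const c * mero_const d"
  and mero_const_0 [simp]: "mero_const 0 = 0"
  and mero_const_1 [simp]: "mero_const 1 = 1"
  by (transfer; simp add: mero_rel_def)+

lemma mero_shift_prod: "mero_shift \<alpha> (prod f S) = (\<Prod>x\<in>S. mero_shift \<alpha> (f x))"
  by (induction S rule: infinite_finite_induct) (auto simp: mero_shift_mult)

lemma mero_shift_eq_0_iff [simp]: "mero_shift \<alpha> f = 0 \<longleftrightarrow> f = 0"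
proof
  assume "mero_shift \<alpha> f = 0"
  then have "mero_shift (- \<alpha>) (mero_shift \<alpha> f) = 0" by simp
  then show "f = 0" by simp
qed simp

text \<open>Elements of \<open>mero\<close> are classes of functions up to agreement on a dense open
  set and have no values as such. A value at \<open>p\<close> is read off from a representative that
  is continuous there; this is enough to certify that a sum of products of h is not zero.\<close>

definition mero_val :: "complex^'n \<Rightarrow> 'n::finite mero \<Rightarrow> complex \<Rightarrow> bool"
  where "mero_val p f c \<longleftrightarrow> (\<exists>u. meromorphic_several u \<and> f = abs_mero u \<and> isCont u p \<and> u p = c)"

lemma mero_val_add: "mero_val p f c \<Longrightarrow> mero_val p g d \<Longrightarrow> mero_val p (f + g) (c + d)"
  unfolding mero_val_def
  by (elim exE conjE, rule_tac x = "\<lambda>z. u z + ua z" in exI)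
     (auto simp: abs_mero_simps intro: meromorphic_several_add)

lemma mero_val_mult: "mero_val p f c \<Longrightarrow> mero_val p g d \<Longrightarrow> mero_val p (f * g) (c * d)"
  unfolding mero_val_def
  by (elim exE conjE, rule_tac x = "\<lambda>z. u z * ua z" in exI)
     (auto simp: abs_mero_simps intro: meromorphic_several_mult)

lemma mero_val_uminus: "mero_val p f c \<Longrightarrow> mero_val p (- f) (- c)"
  unfolding mero_val_def
  by (elim exE conjE, rule_tac x = "\<lambda>z. - u z" in exI)
     (auto simp: abs_mero_simps intro: meromorphic_several_uminus)

lemma mero_val_const: "mero_val p (mero_const c) c"
  unfolding mero_val_def mero_const_abs by (rule exI[of _ "\<lambda>_. c"]) auto

lemma mero_val_sum: "(\<And>x. x \<in> S \<Longrightarrow> mero_val p (f x) (c x)) \<Longrightarrow> mero_val p (sum f S) (sum c S)"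
  by (induction S rule: infinite_finite_induct)
     (use mero_val_const[of p 0] in \<open>auto intro: mero_val_add\<close>)

lemma mero_val_prod: "(\<And>x. x \<in> S \<Longrightarrow> mero_val p (f x) (c x)) \<Longrightarrow> mero_val p (prod f S) (prod c S)"
  by (induction S rule: infinite_finite_induct)
     (use mero_val_const[of p 1] in \<open>auto intro: mero_val_mult\<close>)

text \<open>A continuous representative that is nonzero at \<open>p\<close> is nonzero near
  \<open>p\<close>, whereas a representative of 0 vanishes on a dense open set.\<close>

lemma mero_val_nonzero:
  assumes "mero_val p f c" "c \<noteq> 0"
  shows "f \<noteq> 0"
proof
  assume "f = 0"
  from assms obtain u where u: "meromorphic_several u" "f = abs_mero u" "isCont u p" "u p \<noteq> 0"
    by (auto simp: mero_val_def)
  with \<open>f = 0\<close> have "generically (\<lambda>z. u z = 0)"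
    by (simp add: zero_mero_abs abs_mero_eq_iff)
  moreover obtain V where "open V" "p \<in> V" "\<forall>z\<in>V. u z \<noteq> 0"
  proof -
    have "\<forall>\<^sub>F z in nhds p. u z \<noteq> 0"
    proof -
      have "\<forall>\<^sub>F z in at p. u z \<noteq> 0"
        using u(3,4) unfolding isCont_def by (rule tendsto_imp_eventually_ne)
      then show ?thesis
        unfolding eventually_at_filter by (rule eventually_mono) (use u(4) in auto)
    qed
    then show thesis using that by (auto simp: eventually_nhds)
  qed
  ultimately show False using generically_ex by blast
qed

section \<open>The functions h, h0 and g of a difference of coordinates\<close>

lemma holomorphic_several_diff:
  fixes F :: "complex \<Rightarrow> complex"
  assumes "\<And>z. F field_differentiable at z"
  shows "holomorphic_several (\<lambda>v::complex^'n::finite. F (v $ a - v $ b)) U"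
  unfolding holomorphic_several_def
proof
  fix v :: "complex^'n" assume "v \<in> U"
  obtain D where D: "(F has_field_derivative D) (at (v $ a - v $ b))"
    using assms unfolding field_differentiable_def by blast
  have "((\<lambda>v::complex^'n. v $ a - v $ b) has_derivative (\<lambda>h. h $ a - h $ b)) (at v)"
    by (intro has_derivative_diff bounded_linear.has_derivative[OF bounded_linear_vec_nth] has_derivative_ident)
  from has_derivative_compose[OF this D[unfolded has_field_derivative_def]]
  have "((\<lambda>v. F (v $ a - v $ b)) has_derivative (\<lambda>h. D * (h $ a - h $ b))) (at v)" .
  moreover have "D * (h $ a - h $ b) = (\<Sum>i\<in>UNIV. (D *s (axis a 1 - axis b 1)) $ i * h $ i)" for h :: "complex^'n"
  proof -
    have "(\<Sum>i\<in>UNIV. axis c 1 $ i * h $ i) = h $ c" for c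
      by (simp add: axis_def mult_delta_left)
    then show ?thesis by (simp add: algebra_simps sum_subtractf flip: sum_distrib_left)
  qed
  ultimately show "\<exists>c. ((\<lambda>v. F (v $ a - v $ b)) has_derivative (\<lambda>v. \<Sum>i\<in>UNIV. c $ i * v $ i)) (at v)"
    by (intro exI[of _ "D *s (axis a 1 - axis b 1)"]) simp
qed

lemma meromorphic_several_entire_diff:
  "(\<And>z. F field_differentiable at z) \<Longrightarrow> meromorphic_several (\<lambda>v::complex^'n::finite. F (v $ a - v $ b))"
  by (intro holomorphic_several_imp_meromorphic holomorphic_several_diff)

lemma q_pow_differentiable: "(\<lambda>z. q_pow l (c * z)) field_differentiable at z"
  unfolding q_pow_def field_differentiable_def by (rule exI) (auto intro!: derivative_eq_intros)

lemma meromorphic_several_h_fun: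
  "meromorphic_several (\<lambda>v::complex^'n::finite. h0_fun l (v $ a - v $ b))"
  "meromorphic_several (\<lambda>v::complex^'n::finite. g_fun l (v $ a - v $ b))"
  "meromorphic_several (\<lambda>v::complex^'n::finite. h_fun l (v $ a - v $ b))"
proof -
  have w: "meromorphic_several (\<lambda>v::complex^'n. q_pow l (- 2 * (v $ a - v $ b)))"
    by (rule meromorphic_several_entire_diff[where F = "\<lambda>z. q_pow l (- 2 * z)"], rule q_pow_differentiable)
  note intros = meromorphic_several_inverse meromorphic_several_mult meromorphic_several_diff w meromorphic_several_const
  show h0: "meromorphic_several (\<lambda>v::complex^'n::finite. h0_fun l (v $ a - v $ b))"
    unfolding h0_fun_def divide_inverse by (intro intros)
  show "meromorphic_several (\<lambda>v::complex^'n::finite. g_fun l (v $ a - v $ b))"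
    unfolding g_fun_def divide_inverse power2_eq_square by (intro intros)
  show "meromorphic_several (\<lambda>v::complex^'n::finite. h_fun l (v $ a - v $ b))"
    unfolding h_fun_def by (intro intros h0)
qed

lemma mero_shift_at_diff:
  fixes \<alpha> :: "complex^'n::finite"
  assumes "meromorphic_several (\<lambda>v. \<phi> (v $ a - v $ b))" "\<alpha> $ a = \<alpha> $ b"
  shows "mero_shift \<alpha> (at_diff \<phi> a b) = at_diff \<phi> a b"
proof -
  have "(z + \<alpha>) $ a - (z + \<alpha>) $ b = z $ a - z $ b" for z :: "complex^'n"
    using assms(2) by simp
  then show ?thesis using assms(1)
    by (simp only: at_diff_def abs_mero_simps)
qed

text \<open>For q = \<open>exp l\<close> this says that q is not a root of unity. The logarithm is
  the parameter because all functions of q are built from it.\<close>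

definition generic_log :: "complex \<Rightarrow> bool"
  where "generic_log l \<longleftrightarrow> (\<forall>k::nat. k > 0 \<longrightarrow> exp l ^ k \<noteq> 1)"

context
  fixes l :: complex
  assumes l: "generic_log l"
begin

lemma q_pow_of_int_neq_1: "k \<noteq> 0 \<Longrightarrow> q_pow l (of_int k) \<noteq> 1"
proof -
  assume "k \<noteq> 0"
  have 1: "q_pow l (of_nat m) \<noteq> 1" if "m > 0" for m
    using l that by (simp add: generic_log_def q_pow_def exp_of_nat_mult)
  show ?thesis
  proof (cases "k > 0")
    case True
    then show ?thesis using 1[of "nat k"] by simp
  next
    case False
    with \<open>k \<noteq> 0\<close> have "q_pow l (of_int (- k)) \<noteq> 1" using 1[of "nat (- k)"] by simp
    moreover have "q_pow l (of_int (- k)) = inverse (q_pow l (of_int k))"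
      by (simp add: q_pow_def exp_minus)
    ultimately show ?thesis by auto
  qed
qed

text \<open>By \<open>meromorphic_several_dichotomy\<close> a single nonzero value is enough. At the
  point \<open>axis a 1\<close> the difference of coordinates is 1 and the function takes the value
  q^-2 - 1.\<close>

lemma generically_q_pow_neq_1:
  assumes "a \<noteq> b"
  shows "generically (\<lambda>v::complex^'n::finite. q_pow l (- 2 * (v $ a - v $ b)) \<noteq> 1)"
proof -
  let ?f = "\<lambda>v::complex^'n. q_pow l (- 2 * (v $ a - v $ b)) - 1"
  have "meromorphic_several ?f"
    by (intro meromorphic_several_diff meromorphic_several_const
        meromorphic_several_entire_diff[where F = "\<lambda>z. q_pow l (- 2 * z)"] q_pow_differentiable)
  then consider "generically (\<lambda>v. ?f v = 0)" | "generically (\<lambda>v. ?f v \<noteq> 0)"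
    using meromorphic_several_dichotomy by blast
  then show ?thesis
  proof cases
    case 1
    have "mero_val (axis a 1) (abs_mero ?f) (?f (axis a 1))"
      unfolding mero_val_def using \<open>meromorphic_several ?f\<close>
      by (intro exI[of _ ?f]) (auto simp: q_pow_def intro!: continuous_intros)
    moreover have "?f (axis a 1) \<noteq> 0"
      using assms q_pow_of_int_neq_1[of "-2"] by (simp add: axis_def)
    ultimately have "abs_mero ?f \<noteq> 0" by (rule mero_val_nonzero)
    with 1 show ?thesis
      using \<open>meromorphic_several ?f\<close> by (simp add: zero_mero_abs abs_mero_eq_iff)
  qed auto
qed

text \<open>These identities reduce the whole R-matrix to h, since h0 is q - h by definition. The
  hypothesis excludes the poles, where division by zero gives the formulas values that violate all
  three equations.\<close>

lemma h_fun_eq: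
  assumes "q_pow l (- 2 * z) \<noteq> 1"
  shows "g_fun l z = h_fun l z * h_fun l (- z)"
    and "h_fun l z + h_fun l (- z) = q_pow l 1 + q_pow l (- 1)"
    and "h_fun l z = q_pow l 1 * (q_pow l (- 2 * z) - q_pow l (- 2)) / (q_pow l (- 2 * z) - 1)"
proof -
  define w where "w = q_pow l (- 2 * z)"
  define q where "q = q_pow l 1"
  have nz: "w \<noteq> 0" "q \<noteq> 0" by (simp_all add: w_def q_def q_pow_def)
  have "w \<noteq> 1" using assms unfolding w_def .
  \<comment> \<open>In terms of u the only denominators are q, u and w, so every claim becomes a
    rational identity that can be cleared directly.\<close>
  define u where "u = w - 1"
  have u: "w = 1 + u" "u \<noteq> 0" using \<open>w \<noteq> 1\<close> by (simp_all add: u_def)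
  have e: "q_pow l (- 2 * - z) = inverse w" "q_pow l (- 1) = inverse q"
    unfolding w_def q_def q_pow_def exp_minus[symmetric] by simp_all
  have "q_pow l 2 = q_pow l 1 * q_pow l 1"
    unfolding q_pow_def exp_add[symmetric] by simp
  then have e2: "q_pow l 2 = q * q" by (simp add: q_def)
  have "q_pow l (- 2) = inverse (q_pow l 2)" unfolding q_pow_def exp_minus[symmetric] by simp
  then have e3: "q_pow l (- 2) = inverse (q * q)" by (simp add: e2)
  have u': "w - 1 = u" by (simp add: u_def)
  have h: "h_fun l z = q - (inverse q - q) / u"
    unfolding h_fun_def h0_fun_def e(2) w_def[symmetric] q_def[symmetric] u' ..
  have "inverse w - 1 = - u / w" using nz by (simp add: field_simps u)
  then have h': "h_fun l (- z) = q + (inverse q - q) * (1 + u) / u"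
    unfolding h_fun_def h0_fun_def e q_def[symmetric] by (simp add: u)
  have h2: "h_fun l z = (q * q * (1 + u) - 1) / (q * u)"
    unfolding h using nz(2) u(2) by (simp add: field_simps)
  have h2': "h_fun l (- z) = (1 + u - q * q) / (q * u)"
    unfolding h' using nz(2) u(2) by (simp add: field_simps)
  have "h_fun l z = q * ((1 + u) - inverse (q * q)) / u"
    unfolding h2 using nz(2) u(2) by (simp add: field_simps)
  then show "h_fun l z = q_pow l 1 * (q_pow l (- 2 * z) - q_pow l (- 2)) / (q_pow l (- 2 * z) - 1)"
    unfolding e3 w_def[symmetric] q_def[symmetric] u(1) by simp
  show "h_fun l z + h_fun l (- z) = q_pow l 1 + q_pow l (- 1)"
  proof -
    have "(inverse q - q) * (1 + u) / u = (inverse q - q) / u + (inverse q - q)"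
      using u(2) by (simp add: distrib_left add_divide_distrib)
    then show ?thesis unfolding h h' e unfolding q_def[symmetric] by simp
  qed
  have "g_fun l z = ((1 + u) - inverse (q * q)) * ((1 + u) - q * q) / (u * u)"
    unfolding g_fun_def e2 e3 w_def[symmetric] power2_eq_square u' by (simp only: u(1))
  also have "\<dots> = h_fun l z * h_fun l (- z)"
    unfolding h2 h2' using nz(2) u(2) by (simp add: divide_simps)
  finally show "g_fun l z = h_fun l z * h_fun l (- z)" .
qed

lemma at_diff_g_fun:
  fixes a b :: "'n::finite"
  assumes "a \<noteq> b"
  shows "at_diff (g_fun l) a b = at_diff (h_fun l) a b * at_diff (h_fun l) b a"
proof -
  have "g_fun l (v $ a - v $ b) = h_fun l (v $ a - v $ b) * h_fun l (v $ b - v $ a)"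
    if "q_pow l (- 2 * (v $ a - v $ b)) \<noteq> 1" for v :: "complex^'n"
    using h_fun_eq(1)[OF that] by simp
  then show ?thesis
    unfolding at_diff_def using generically_mono[OF generically_q_pow_neq_1[OF assms]]
    by (simp add: abs_mero_simps meromorphic_several_h_fun abs_mero_eq_iff meromorphic_several_mult)
qed

lemma at_diff_h0_fun: "at_diff (h0_fun l) a b = mero_const (q_pow l 1) - at_diff (h_fun l) a b"
proof -
  have "mero_const (q_pow l 1) - at_diff (h_fun l) a b =
    abs_mero (\<lambda>v. q_pow l 1 - h_fun l (v $ a - v $ b))"
    unfolding at_diff_def mero_const_abs by (simp add: abs_mero_simps meromorphic_several_h_fun)
  then show ?thesis by (simp add: at_diff_def h_fun_def)
qed

lemma at_diff_h_fun_add: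
  fixes a b :: "'n::finite"
  assumes "a \<noteq> b"
  shows "at_diff (h_fun l) a b + at_diff (h_fun l) b a =
    mero_const (q_pow l 1) + mero_const (q_pow l (- 1))"
proof -
  have "h_fun l (v $ a - v $ b) + h_fun l (v $ b - v $ a) = q_pow l 1 + q_pow l (- 1)"
    if "q_pow l (- 2 * (v $ a - v $ b)) \<noteq> 1" for v :: "complex^'n"
    using h_fun_eq(2)[OF that] by simp
  then show ?thesis
    unfolding at_diff_def mero_const_abs
    using generically_mono[OF generically_q_pow_neq_1[OF assms]]
    by (simp add: abs_mero_simps meromorphic_several_h_fun abs_mero_eq_iff meromorphic_several_add)
qed

text \<open>At a nonzero integral difference k the denominator q^(-2k) - 1 does not vanish, so h is
  regular there.\<close>

lemma mero_val_h_fun: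
  fixes p :: "complex^'n::finite"
  assumes p: "p $ a - p $ b = of_int k" and "k \<noteq> 0"
  shows "mero_val p (at_diff (h_fun l) a b) (h_fun l (of_int k))"
proof -
  have "q_pow l (- 2 * of_int k) \<noteq> 1"
    using q_pow_of_int_neq_1[of "- 2 * k"] \<open>k \<noteq> 0\<close> by simp
  then have "isCont (\<lambda>v::complex^'n. h_fun l (v $ a - v $ b)) p"
    unfolding h_fun_def h0_fun_def q_pow_def using p
    by (intro continuous_intros) auto
  then show ?thesis
    unfolding mero_val_def at_diff_def
    by (intro exI[of _ "\<lambda>v. h_fun l (v $ a - v $ b)"]) (simp add: meromorphic_several_h_fun p)
qed

text \<open>Up to a nonzero factor the numerator of h(k) is q^(-2k) - q^-2, so a zero means q^(2-2k)
  = 1. That 1 is the only integral zero is what isolates a single term of the sum F at an integral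
  point.\<close>

lemma h_fun_of_int_eq_0_iff:
  assumes "k \<noteq> 0"
  shows "h_fun l (of_int k) = 0 \<longleftrightarrow> k = 1"
proof -
  have ne: "q_pow l (- 2 * of_int k) \<noteq> 1"
    using q_pow_of_int_neq_1[of "- 2 * k"] assms by simp
  have "h_fun l (of_int k) = 0 \<longleftrightarrow> q_pow l (- 2 * of_int k) = q_pow l (- 2)"
    unfolding h_fun_eq(3)[OF ne] using ne by (simp add: q_pow_def)
  also have "\<dots> \<longleftrightarrow> q_pow l (of_int (2 - 2 * k)) = 1"
  proof -
    have "q_pow l (of_int (2 - 2 * k)) = q_pow l (- 2 * of_int k) / q_pow l (- 2)"
      by (simp add: q_pow_def ring_distribs flip: exp_diff)
    then show ?thesis by (simp add: q_pow_def)
  qed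
  also have "\<dots> \<longleftrightarrow> k = 1"
    using q_pow_of_int_neq_1[of "2 - 2 * k"] by (cases "k = 1") (auto simp: q_pow_def)
  finally show ?thesis .
qed

lemma at_diff_h_fun_nonzero:
  fixes a b :: "'n::finite"
  assumes "a \<noteq> b"
  shows "at_diff (h_fun l) a b \<noteq> 0"
proof -
  \<comment> \<open>At the unit vector of \<open>b\<close> the difference of coordinates is -1,
    where h is regular and nonzero.\<close>
  have "mero_val (axis b 1) (at_diff (h_fun l) a b) (h_fun l (of_int (- 1)))"
    using assms by (intro mero_val_h_fun) (auto simp: axis_def)
  then show ?thesis
    by (rule mero_val_nonzero) (use h_fun_of_int_eq_0_iff[of "- 1"] in simp)
qed

end

section \<open>Minors of a matrix satisfying the RLL-relations\<close>

text \<open>\<open>H a b\<close> stands for h at the difference of the coordinates a and b,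
  \<open>Q\<close> and \<open>Qi\<close> for q and its inverse. The RLL-relation is kept for
  distinct rows, split into distinct columns (\<open>rll\<close>, two terms on each side) and equal
  columns (\<open>rll_column\<close>). The order is a parameter so that the transposed matrix with
  the reversed order is another instance.\<close>

locale dynamical_rll =
  fixes ml mr :: "'n::finite mero \<Rightarrow> 'r::{ring,monoid_mult}"
    and t :: "'n \<Rightarrow> 'n \<Rightarrow> 'r"
    and lt :: "'n \<Rightarrow> 'n \<Rightarrow> bool" (infix \<open>\<sqsubset>\<close> 50)
    and H :: "'n \<Rightarrow> 'n \<Rightarrow> 'n mero" and Q Qi :: "'n mero"
  assumes ml_add: "ml (f + g) = ml f + ml g" and ml_mult: "ml (f * g) = ml f * ml g" and ml_1: "ml 1 = 1"
    and mr_add: "mr (f + g) = mr f + mr g" and mr_mult: "mr (f * g) = mr f * mr g" and mr_1: "mr 1 = 1"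
    and ml_mr: "ml f * mr g = mr g * ml f"
    and ml_t: "ml f * t i j = t i j * ml (mero_shift (unit_weight i) f)"
    and mr_t: "mr f * t i j = t i j * mr (mero_shift (unit_weight j) f)"
    and lt_irrefl: "\<not> i \<sqsubset> i" and lt_trans: "i \<sqsubset> j \<Longrightarrow> j \<sqsubset> k \<Longrightarrow> i \<sqsubset> k"
    and lt_total: "i \<noteq> j \<Longrightarrow> i \<sqsubset> j \<or> j \<sqsubset> i"
    and H_nonzero: "a \<noteq> b \<Longrightarrow> H a b \<noteq> 0"
    and H_shift: "\<alpha> $ a = (\<alpha> $ b :: complex) \<Longrightarrow> mero_shift \<alpha> (H a b) = H a b"
    and H_add: "a \<noteq> b \<Longrightarrow> H a b + H b a = Q + Qi"
    and Q_central: "ml Q = mr Q" "ml Qi = mr Qi"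
    and rll: "a \<noteq> c \<Longrightarrow> b \<noteq> d \<Longrightarrow>
      ml (if a \<sqsubset> c then 1 else H a c * H c a) * t a b * t c d + ml (Q - H c a) * t c b * t a d =
      mr (if b \<sqsubset> d then 1 else H b d * H d b) * t c d * t a b + mr (Q - H b d) * t c b * t a d"
    and rll_column: "a \<noteq> c \<Longrightarrow>
      ml (if a \<sqsubset> c then 1 else H a c * H c a) * t a b * t c b + ml (Q - H c a) * t c b * t a b =
      ml Q * t c b * t a b"
begin

lemma lt_asym: "i \<sqsubset> j \<Longrightarrow> \<not> j \<sqsubset> i"
  using lt_irrefl lt_trans by blast

lemma ml_0: "ml 0 = 0" and mr_0: "mr 0 = 0"
  using ml_add[of 0 0] mr_add[of 0 0] by simp_all

lemma ml_uminus: "ml (- f) = - ml f" and mr_uminus: "mr (- f) = - mr f"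
  using ml_add[of f "- f"] mr_add[of f "- f"] by (simp_all add: ml_0 mr_0 add_eq_0_iff)

lemma ml_diff: "ml (f - g) = ml f - ml g" and mr_diff: "mr (f - g) = mr f - mr g"
  using ml_add[of f "- g"] mr_add[of f "- g"] by (simp_all add: ml_uminus mr_uminus)

lemma t_ml: "t i j * ml f = ml (mero_shift (- unit_weight i) f) * t i j"
  and t_mr: "t i j * mr f = mr (mero_shift (- unit_weight j) f) * t i j"
  by (simp_all add: ml_t mr_t)

lemma ml_commute: "ml f * ml g = ml g * ml f" and mr_commute: "mr f * mr g = mr g * mr f"
  by (simp_all add: mult.commute flip: ml_mult mr_mult)

lemma ml_cancel': "f \<noteq> 0 \<Longrightarrow> ml (inverse f) * (ml f * x) = x"
  and mr_cancel': "f \<noteq> 0 \<Longrightarrow> mr (inverse f) * (mr f * x) = x"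
  by (simp_all add: ml_1 mr_1 flip: mult.assoc ml_mult mr_mult)

lemma t_column: "a \<sqsubset> c \<Longrightarrow> t a b * t c b = ml (H c a) * t c b * t a b"
  using rll_column[of a c b] lt_irrefl[of a]
  by (cases "a = c") (simp_all add: ml_1 ml_diff algebra_simps)

text \<open>For \<open>a \<sqsubset> c\<close> this is the 2 by 2 minor on the rows a, c with the
  columns taken in the order b, d; the columns may be equal or decreasing.\<close>

definition pair_minor :: "'n \<Rightarrow> 'n \<Rightarrow> 'n \<Rightarrow> 'n \<Rightarrow> 'r"
  where "pair_minor a c b d = t a b * t c d - ml (H c a) * t c b * t a d"

lemma pair_minor_equal_columns: "a \<sqsubset> c \<Longrightarrow> pair_minor a c b b = 0"
  by (simp add: pair_minor_def t_column)

text \<open>The RLL-relation for the rows (a, c) and the one for (c, a) express both products with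
  exchanged columns through x and y. After substitution the coefficients involve K and L only
  through K + L = Q + Qi, and a multiple of the original minor remains. The weight on the left is
  the diagonal R-entry, which is divided out later.\<close>

lemma pair_minor_swap_weighted:
  assumes "a \<sqsubset> c" "b \<noteq> d"
  shows "mr (if b \<sqsubset> d then 1 else H b d * H d b) * pair_minor a c d b = - mr (H d b) * pair_minor a c b d"
proof -
  define \<beta> M where "\<beta> = mr (if b \<sqsubset> d then 1 else H b d * H d b)" and "M = mr (Q - H b d)"
  have ac: "a \<noteq> c" "c \<noteq> a" "\<not> c \<sqsubset> a" using assms lt_irrefl lt_asym by auto
  define x y u v where "x = t a b * t c d" and "y = t c b * t a d"
    and "u = t c d * t a b" and "v = t a d * t c b"
  define K L where "K = ml (H c a)" and "L = ml (H a c)"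
  have 1: "x + (ml Q - K) * y = \<beta> * u + M * y"
    using rll[OF ac(1) assms(2)] assms(1)
    by (simp add: x_def y_def u_def \<beta>_def M_def K_def ml_1 ml_diff mult.assoc)
  have 2: "(K * L) * y + (ml Q - L) * x = \<beta> * v + M * x"
    using rll[OF ac(2) assms(2)] ac(3)
    by (simp add: x_def y_def v_def \<beta>_def M_def K_def L_def ml_mult ml_diff mult.assoc)
  have KL: "K + L = ml Q + ml Qi"
    using H_add[OF ac(2)] by (simp add: K_def L_def flip: ml_add)
  \<comment> \<open>Since Q - \<open>H b d\<close> + Qi is \<open>H d b\<close>, the factor that
    arises on the \<mu>-side is again a value of \<open>H\<close>.\<close>
  have "H d b = (H b d + H d b) - H b d" by simp
  then have "H d b = (Q - H b d) + Qi" unfolding H_add[OF assms(2)] by (simp add: algebra_simps)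
  then have M: "mr (H d b) = M + mr Qi" unfolding M_def mr_add[symmetric] by (rule arg_cong)
  have com: "\<beta> * K = K * \<beta>" "K * M = M * K" "K * ml Qi = ml Qi * K" "K * L = L * K"
    by (simp_all add: \<beta>_def K_def L_def M_def ml_mr ml_commute)
  have "\<beta> * pair_minor a c d b = \<beta> * v - K * (\<beta> * u)"
    using com(1) by (simp add: pair_minor_def u_def v_def K_def right_diff_distrib flip: mult.assoc)
  also have "\<beta> * u = x + (ml Q - K) * y - M * y" using 1 by (simp add: algebra_simps)
  also have "\<beta> * v = (K * L) * y + (ml Q - L) * x - M * x" using 2 by (simp add: algebra_simps)
  also have "(K * L) * y + (ml Q - L) * x - M * x - K * (x + (ml Q - K) * y - M * y) =
      (ml Q - (K + L)) * x - K * ((ml Q - (K + L)) * y) - M * x + (K * M) * y"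
    by (simp add: algebra_simps)
  also have "\<dots> = - (M + ml Qi) * (x - K * y)"
    unfolding KL com(2) using com(3) by (simp add: algebra_simps) (simp flip: mult.assoc)
  also have "\<dots> = - mr (H d b) * pair_minor a c b d"
    by (simp add: M Q_central pair_minor_def x_def y_def K_def mult.assoc)
  finally show ?thesis by (simp add: \<beta>_def)
qed

text \<open>The factor in \<mu> picked up when the columns b, d are exchanged. If they are
  decreasing, the weight \<open>H b d * H d b\<close> cancels against - \<open>H d b\<close> and
  leaves an inverse.\<close>

definition swap_factor :: "'n \<Rightarrow> 'n \<Rightarrow> 'n mero"
  where "swap_factor b d = (if b \<sqsubset> d then - H d b else - inverse (H b d))"

lemma pair_minor_swap:
  assumes "a \<sqsubset> c" "b \<noteq> d"
  shows "pair_minor a c d b = mr (swap_factor b d) * pair_minor a c b d"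
proof (cases "b \<sqsubset> d")
  case True
  then show ?thesis using pair_minor_swap_weighted[OF assms] by (simp add: swap_factor_def mr_1 mr_uminus)
next
  case False
  have "mr (H d b) * (mr (H b d) * pair_minor a c d b) = mr (H d b) * - pair_minor a c b d"
    using pair_minor_swap_weighted[OF assms] False by (simp add: mult.commute flip: mult.assoc mr_mult)
  then have "mr (inverse (H d b)) * (mr (H d b) * (mr (H b d) * pair_minor a c d b)) =
      mr (inverse (H d b)) * (mr (H d b) * - pair_minor a c b d)" by simp
  then have "mr (H b d) * pair_minor a c d b = - pair_minor a c b d"
    unfolding mr_cancel'[OF H_nonzero[OF assms(2)[symmetric]]] .
  then have "mr (inverse (H b d)) * (mr (H b d) * pair_minor a c d b) =
      mr (inverse (H b d)) * - pair_minor a c b d" by simp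
  then show ?thesis
    using assms(2) False by (simp add: mr_cancel' H_nonzero swap_factor_def mr_uminus)
qed

section \<open>Minors with an arbitrary list of columns\<close>

definition lead_sign :: "'n \<Rightarrow> 'n set \<Rightarrow> 'n mero"
  where "lead_sign i J = (\<Prod>m\<in>{m\<in>J. m \<sqsubset> i}. - H i m)"

text \<open>Expansion along the first column, where \<open>lead_sign i (I - {i})\<close> is
  sign({i}; I - {i}). Taking a list of columns gives a meaning to permuted and repeated columns, and
  the recursion makes them accessible to induction; \<open>minor_eq_sum_arrangements\<close>
  recovers the sum over permutations.\<close>

primrec minor :: "'n set \<Rightarrow> 'n list \<Rightarrow> 'r"
  where
    "minor I [] = (if I = {} then 1 else 0)"
  | "minor I (b # bs) = (\<Sum>i\<in>I. ml (lead_sign i (I - {i})) * t i b * minor (I - {i}) bs)"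

text \<open>The differences that occur avoid the coordinate j, hence such a sign commutes with the
  entries in row j.\<close>

lemma lead_sign_shift: "i \<noteq> j \<Longrightarrow> j \<notin> J \<Longrightarrow> mero_shift (c *s unit_weight j) (lead_sign i J) = lead_sign i J"
  unfolding lead_sign_def mero_shift_prod
  by (intro prod.cong refl, subst mero_shift_uminus, subst H_shift) (auto simp: axis_def)

lemma lead_sign_shift':
  "i \<noteq> j \<Longrightarrow> j \<notin> J \<Longrightarrow> mero_shift (unit_weight j) (lead_sign i J) = lead_sign i J"
  "i \<noteq> j \<Longrightarrow> j \<notin> J \<Longrightarrow> mero_shift (- unit_weight j) (lead_sign i J) = lead_sign i J"
  using lead_sign_shift[of i j J 1] lead_sign_shift[of i j J "- 1"] by (simp_all add: vector_sneg_minus1[symmetric])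

lemma lead_sign_insert:
  "j \<notin> J \<Longrightarrow> lead_sign i (insert j J) = (if j \<sqsubset> i then - H i j else 1) * lead_sign i J"
proof -
  assume "j \<notin> J"
  have "{m \<in> insert j J. m \<sqsubset> i} = (if j \<sqsubset> i then insert j {m\<in>J. m \<sqsubset> i} else {m\<in>J. m \<sqsubset> i})" by auto
  then show ?thesis using \<open>j \<notin> J\<close> by (simp add: lead_sign_def)
qed

text \<open>Expands two columns and pairs the row choices (i, j) and (j, i). The signs against the
  remaining rows are symmetric in i and j and factor out, so that exchanging the two columns becomes
  a question about 2 by 2 minors.\<close>

lemma minor_two_columns:
  "minor I (b # d # bs) = (\<Sum>(i, j)\<in>{(i, j). i \<in> I \<and> j \<in> I \<and> i \<sqsubset> j}.
     ml (lead_sign i (I - {i, j}) * lead_sign j (I - {i, j})) * pair_minor i j b d * minor (I - {i, j}) bs)"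
proof -
  define K where "K i j = I - {i, j}" for i j
  define c where "c i j = ml (lead_sign i (K i j) * lead_sign j (K i j))" for i j
  define f where "f i j = ml (lead_sign i (I - {i})) * t i b *
      (ml (lead_sign j (I - {i} - {j})) * t j d * minor (I - {i} - {j}) bs)" for i j
  have "I - {i} = insert j (K i j)" "I - {i} - {j} = K i j" "j \<notin> K i j" "i \<notin> K i j"
    if "j \<in> I - {i}" for i j
    using that by (auto simp: K_def)
  note K = this
  have f: "f i j = ml (if j \<sqsubset> i then - H i j else 1) * c i j * (t i b * t j d) * minor (K i j) bs"
    if "j \<in> I - {i}" for i j
  proof -
    have "t i b * ml (lead_sign j (K i j)) = ml (lead_sign j (K i j)) * t i b"
      using that by (subst t_ml, subst lead_sign_shift') (auto simp: K_def)
    note com = this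
    have "f i j = ml (lead_sign i (insert j (K i j))) * (t i b * ml (lead_sign j (K i j))) * t j d * minor (K i j) bs"
      unfolding f_def K(2)[OF that] unfolding K(1)[OF that] by (simp only: mult.assoc)
    also have "\<dots> = ml (if j \<sqsubset> i then - H i j else 1) * c i j * (t i b * t j d) * minor (K i j) bs"
      unfolding com lead_sign_insert[OF K(3)[OF that]] c_def ml_mult by (simp only: mult.assoc)
    finally show ?thesis .
  qed
  have cs: "c i j = c j i" "K i j = K j i" for i j
    by (simp_all add: c_def K_def insert_commute mult.commute)
  let ?S = "{(i, j). i \<in> I \<and> j \<in> I \<and> i \<sqsubset> j}"
  have fin: "finite ?S" by (rule finite_subset[of _ "I \<times> I"]) auto
  have "minor I (b # d # bs) = (\<Sum>i\<in>I. \<Sum>j\<in>I - {i}. f i j)"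
    by (simp add: f_def sum_distrib_left)
  also have "\<dots> = (\<Sum>(i, j)\<in>Sigma I (\<lambda>i. I - {i}). f i j)"
    by (rule sum.Sigma) auto
  also have "Sigma I (\<lambda>i. I - {i}) = ?S \<union> prod.swap ` ?S"
    using lt_total lt_irrefl by (fastforce simp: image_iff)
  also have "sum (\<lambda>(i, j). f i j) (?S \<union> prod.swap ` ?S) =
      sum (\<lambda>(i, j). f i j) ?S + sum (\<lambda>(i, j). f i j) (prod.swap ` ?S)"
    by (rule sum.union_disjoint) (use fin lt_asym in auto)
  also have "sum (\<lambda>(i, j). f i j) (prod.swap ` ?S) = (\<Sum>(i, j)\<in>?S. f j i)"
    by (subst sum.reindex) (auto simp: case_prod_unfold)
  also have "sum (\<lambda>(i, j). f i j) ?S + (\<Sum>(i, j)\<in>?S. f j i) = (\<Sum>(i, j)\<in>?S. f i j + f j i)"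
    by (simp add: sum.distrib case_prod_unfold)
  also have "\<dots> = (\<Sum>(i, j)\<in>?S. c i j * pair_minor i j b d * minor (K i j) bs)"
  proof (rule sum.cong, simp, clarify)
    fix i j assume *: "i \<in> I" "j \<in> I" "i \<sqsubset> j"
    then have ij: "i \<noteq> j" "\<not> j \<sqsubset> i" using lt_irrefl lt_asym by auto
    have com: "ml (H j i) * c i j = c i j * ml (H j i)" by (simp add: c_def ml_commute)
    have "f i j + f j i = c i j * (t i b * t j d) * minor (K i j) bs -
        (ml (H j i) * c i j) * (t j b * t i d) * minor (K i j) bs"
      using * ij by (simp add: f ml_1 ml_uminus cs[of j i])
    then show "f i j + f j i = c i j * pair_minor i j b d * minor (K i j) bs"
      unfolding com by (simp add: pair_minor_def algebra_simps)
  qed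
  finally show ?thesis by (simp add: c_def K_def)
qed

lemma minor_swap_head:
  assumes "b \<noteq> d"
  shows "minor I (d # b # bs) = mr (swap_factor b d) * minor I (b # d # bs)"
  unfolding minor_two_columns sum_distrib_left
proof (intro sum.cong refl, clarify)
  fix i j assume "i \<sqsubset> j"
  have com: "ml f * (mr g * x) = mr g * (ml f * x)" for f g x
    by (simp add: ml_mr flip: mult.assoc)
  show "ml (lead_sign i (I - {i, j}) * lead_sign j (I - {i, j})) * pair_minor i j d b * minor (I - {i, j}) bs =
    mr (swap_factor b d) * (ml (lead_sign i (I - {i, j}) * lead_sign j (I - {i, j})) * pair_minor i j b d *
      minor (I - {i, j}) bs)"
    unfolding pair_minor_swap[OF \<open>i \<sqsubset> j\<close> assms] by (simp only: mult.assoc com)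
qed

lemma minor_equal_head: "minor I (b # b # bs) = 0"
  unfolding minor_two_columns by (intro sum.neutral ballI) (auto simp: pair_minor_equal_columns)

text \<open>All entries of column b shift \<mu> by the same weight, so a \<mu>-factor common to the
  minors of the remaining columns leaves the expansion, shifted once.\<close>

lemma minor_Cons_mr:
  assumes "\<And>J. minor J bs = mr f * minor J cs"
  shows "minor I (b # bs) = mr (mero_shift (- unit_weight b) f) * minor I (b # cs)"
proof -
  have "ml g * t i b * (mr f * x) = mr (mero_shift (- unit_weight b) f) * (ml g * t i b * x)" for g i x
    by (metis (no_types, lifting) ml_mr mult.assoc t_mr)
  then show ?thesis by (simp add: assms sum_distrib_left)
qed

text \<open>Serves to bring two equal columns next to each other, for which the existence of some
  factor is enough.\<close>

lemma minor_swap: "b \<noteq> d \<Longrightarrow> \<exists>f. \<forall>I. minor I (us @ d # b # vs) = mr f * minor I (us @ b # d # vs)"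
proof (induction us)
  case Nil
  then show ?case using minor_swap_head[of b d _ vs] by (intro exI[of _ "swap_factor b d"]) simp
next
  case (Cons u us)
  then obtain f where f: "\<forall>I. minor I (us @ d # b # vs) = mr f * minor I (us @ b # d # vs)" by blast
  show ?case unfolding append_Cons using minor_Cons_mr f by blast
qed

lemma minor_equal: "minor I (us @ b # b # vs) = 0"
  by (induction us arbitrary: I) (use minor_equal_head in auto)

text \<open>The left one of two equal columns is moved to the right until it meets the other
  one.\<close>

lemma minor_not_distinct:
  assumes "\<not> distinct bs"
  shows "minor I bs = 0"
proof -
  obtain us vs ws x where bs: "bs = us @ [x] @ vs @ [x] @ ws" using not_distinct_decomp[OF assms] by blast
  have "minor I (us @ [x] @ vs @ [x] @ ws) = 0"
  proof (induction vs arbitrary: us)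
    case Nil
    then show ?case using minor_equal[of I us x ws] by simp
  next
    case (Cons v vs)
    show ?case
    proof (cases "v = x")
      case True
      then show ?thesis using minor_equal[of I us x "vs @ x # ws"] by simp
    next
      case False
      then obtain f where "\<forall>I. minor I (us @ x # v # vs @ x # ws) = mr f * minor I (us @ v # x # vs @ x # ws)"
        using minor_swap by blast
      then show ?thesis using Cons[of "us @ [v]"] by simp
    qed
  qed
  then show ?thesis by (simp add: bs)
qed

text \<open>For a list without repetitions this is the product of - \<open>H\<close> over its
  inversions, that is, S(\<sigma>, I) for the corresponding permutation.\<close>

primrec list_sign :: "'n list \<Rightarrow> 'n mero"
  where "list_sign [] = 1" | "list_sign (x # xs) = lead_sign x (set xs) * list_sign xs"

lemma list_sign_shift:
  "j \<notin> set xs \<Longrightarrow> mero_shift (- unit_weight j) (list_sign xs) = list_sign xs"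
  by (induction xs) (auto simp: mero_shift_mult lead_sign_shift')

lemma list_sign_sorted: "sorted_wrt (\<sqsubset>) xs \<Longrightarrow> list_sign xs = 1"
proof (induction xs)
  case (Cons x xs)
  then have "lead_sign x (set xs) = 1"
    unfolding lead_sign_def by (intro prod.neutral) (use lt_asym in auto)
  then show ?case using Cons by simp
qed simp

text \<open>Column x passes the smaller columns one at a time, and passing u contributes the factor
  - \<open>H x u\<close>. The shift by the weight of u coming from \<open>minor_Cons_mr\<close> has
  no effect on the other factors, as they do not involve u.\<close>

lemma minor_insert:
  assumes "distinct (x # us)" "\<forall>u\<in>set us. u \<sqsubset> x"
  shows "minor I (x # us @ vs) = mr (lead_sign x (set us)) * minor I (us @ x # vs)"
  using assms
proof (induction us arbitrary: I)
  case Nil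
  then show ?case by (simp add: lead_sign_def mr_1)
next
  case (Cons u us)
  have "minor I (x # (u # us) @ vs) = mr (swap_factor u x) * minor I (u # x # us @ vs)"
    using Cons.prems by (simp only: append_Cons) (rule minor_swap_head, auto)
  also have "minor I (u # x # us @ vs) =
      mr (mero_shift (- unit_weight u) (lead_sign x (set us))) * minor I (u # us @ x # vs)"
    by (rule minor_Cons_mr, rule Cons.IH) (use Cons.prems in auto)
  also have "mr (swap_factor u x) * (mr (mero_shift (- unit_weight u) (lead_sign x (set us))) * minor I (u # us @ x # vs))
     = mr (lead_sign x (set (u # us))) * minor I (u # us @ x # vs)"
    using Cons.prems
    by (simp del: minor.simps add: lead_sign_shift' lead_sign_insert swap_factor_def mr_mult mr_uminus mult.assoc)
  finally show ?case by simp
qed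

text \<open>Insertion sort on the columns: the tail is sorted by induction, and x is then moved to
  its place. The factors collected on the way are those in the recursion for
  \<open>list_sign\<close>.\<close>

lemma minor_sort:
  assumes "distinct bs" "sorted_wrt (\<sqsubset>) L" "set L = set bs" "distinct L"
  shows "minor I bs = mr (list_sign bs) * minor I L"
  using assms
proof (induction bs arbitrary: I L)
  case Nil
  then show ?case by (simp add: mr_1)
next
  case (Cons x xs)
  then have "x \<in> set L" by auto
  then obtain us vs where L: "L = us @ x # vs" by (meson split_list)
  have *: "distinct (x # us)" "\<forall>u\<in>set us. u \<sqsubset> x" "\<forall>u\<in>set vs. x \<sqsubset> u" "sorted_wrt (\<sqsubset>) (us @ vs)"
    "set (us @ vs) = set xs" "distinct (us @ vs)"
    using Cons.prems by (auto simp: L sorted_wrt_append)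
  have "{m \<in> set us. m \<sqsubset> x} = {m \<in> set xs. m \<sqsubset> x}"
    using *(3,5) lt_asym by auto
  then have ls: "lead_sign x (set us) = lead_sign x (set xs)" by (simp add: lead_sign_def)
  have "minor I (x # xs) = mr (mero_shift (- unit_weight x) (list_sign xs)) * minor I (x # us @ vs)"
    by (rule minor_Cons_mr, rule Cons.IH) (use * Cons.prems in auto)
  also have "mero_shift (- unit_weight x) (list_sign xs) = list_sign xs"
    using Cons.prems by (intro list_sign_shift) auto
  also have "minor I (x # us @ vs) = mr (lead_sign x (set xs)) * minor I L"
    using minor_insert[OF *(1,2)] by (simp add: L ls)
  finally show ?case by (simp add: mr_mult mr_commute flip: mult.assoc)
qed

section \<open>Expansion along the last column\<close>

definition last_sign :: "'n \<Rightarrow> 'n set \<Rightarrow> 'n mero"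
  where "last_sign k J = (\<Prod>m\<in>{m\<in>J. k \<sqsubset> m}. - H m k)"

lemma last_sign_insert:
  "j \<notin> J \<Longrightarrow> last_sign i (insert j J) = (if i \<sqsubset> j then - H j i else 1) * last_sign i J"
proof -
  assume "j \<notin> J"
  have "{m \<in> insert j J. i \<sqsubset> m} = (if i \<sqsubset> j then insert j {m\<in>J. i \<sqsubset> m} else {m\<in>J. i \<sqsubset> m})" by auto
  then show ?thesis using \<open>j \<notin> J\<close> by (simp add: last_sign_def)
qed

lemma last_sign_shift:
  assumes "i \<noteq> j" "j \<notin> J"
  shows "mero_shift (- unit_weight j) (last_sign i J) = last_sign i J"
  unfolding last_sign_def mero_shift_prod using assms
  by (intro prod.cong refl, subst mero_shift_uminus, subst H_shift) (auto simp: axis_def)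

lemma sum_swap_neq:
  fixes g :: "'n \<Rightarrow> 'n \<Rightarrow> 'b::comm_monoid_add"
  shows "(\<Sum>i\<in>I. \<Sum>k\<in>I - {i}. g i k) = (\<Sum>k\<in>I. \<Sum>i\<in>I - {k}. g i k)"
proof -
  have "(\<Sum>i\<in>I. \<Sum>k\<in>I - {i}. g i k) = (\<Sum>i\<in>I. sum (g i) {k. k \<in> I \<and> i \<noteq> k})"
    by (intro sum.cong refl) auto
  also have "\<dots> = (\<Sum>k\<in>I. sum (\<lambda>i. g i k) {i. i \<in> I \<and> i \<noteq> k})"
    by (rule sum.swap_restrict) auto
  also have "\<dots> = (\<Sum>k\<in>I. \<Sum>i\<in>I - {k}. g i k)" by (intro sum.cong refl) auto
  finally show ?thesis .
qed

text \<open>Here \<open>last_sign k J\<close> is sign(J; {k}). By induction on the columns, removing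
  row i for the leading column and row k for the last one can be done in either order. The extra
  sign is - \<open>H i k\<close> if k \<sqsubset> i and 1 otherwise, in both orders.\<close>

lemma minor_last_column:
  "minor I (bs @ [b]) = (\<Sum>k\<in>I. ml (last_sign k (I - {k})) * minor (I - {k}) bs * t k b)"
proof (induction bs arbitrary: I)
  case Nil
  have "ml (lead_sign i (I - {i})) * t i b * minor (I - {i}) [] = ml (last_sign i (I - {i})) * minor (I - {i}) [] * t i b" for i
  proof (cases "I - {i} = {}")
    case True
    then show ?thesis by (simp only: lead_sign_def last_sign_def) (simp add: ml_1)
  qed simp
  then show ?case by simp
next
  case (Cons c bs)
  define K where "K i j = I - {i, j}" for i j
  have K: "I - {i} = insert j (K i j)" "I - {i} - {j} = K i j" "j \<notin> K i j" "i \<notin> K i j" "K j i = K i j"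
    if "j \<in> I - {i}" for i j
    using that by (auto simp: K_def)
  have "minor I ((c # bs) @ [b]) = (\<Sum>i\<in>I. \<Sum>k\<in>I - {i}.
      ml (lead_sign i (I - {i})) * t i c * (ml (last_sign k (I - {i} - {k})) * minor (I - {i} - {k}) bs * t k b))"
    by (simp add: Cons.IH sum_distrib_left)
  also have "\<dots> = (\<Sum>i\<in>I. \<Sum>k\<in>I - {i}.
      ml (last_sign k (I - {k})) * (ml (lead_sign i (I - {k} - {i})) * t i c * minor (I - {k} - {i}) bs) * t k b)"
  proof (intro sum.cong refl)
    fix i k assume i: "i \<in> I" and k: "k \<in> I - {i}"
    then have i': "i \<in> I - {k}" by auto
    have com: "t i c * ml (last_sign k (K i k)) = ml (last_sign k (K i k)) * t i c"
      using k by (subst t_ml, subst last_sign_shift) (auto simp: K_def)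
    have "ml (lead_sign i (I - {i})) * ml (last_sign k (K i k)) = ml (last_sign k (I - {k})) * ml (lead_sign i (K i k))"
      unfolding K(1)[OF k] K(1)[OF i'] K(5)[OF k]
      by (simp add: lead_sign_insert[OF K(3)[OF k]] last_sign_insert[OF K(4)[OF k]] mult_ac flip: ml_mult)
    note com2 = this
    have "ml (lead_sign i (I - {i})) * t i c * (ml (last_sign k (I - {i} - {k})) * minor (I - {i} - {k}) bs * t k b)
      = ml (lead_sign i (I - {i})) * (t i c * ml (last_sign k (K i k))) * minor (K i k) bs * t k b"
      unfolding K(2)[OF k] by (simp only: mult.assoc)
    also have "\<dots> = (ml (lead_sign i (I - {i})) * ml (last_sign k (K i k))) * (t i c * minor (K i k) bs * t k b)"
      unfolding com by (simp only: mult.assoc)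
    also have "\<dots> = ml (last_sign k (I - {k})) * (ml (lead_sign i (K i k)) * t i c * minor (K i k) bs) * t k b"
      unfolding com2 by (simp only: mult.assoc)
    finally show "ml (lead_sign i (I - {i})) * t i c * (ml (last_sign k (I - {i} - {k})) * minor (I - {i} - {k}) bs * t k b) =
      ml (last_sign k (I - {k})) * (ml (lead_sign i (I - {k} - {i})) * t i c * minor (I - {k} - {i}) bs) * t k b"
      unfolding K(2)[OF i'] K(5)[OF k] .
  qed
  also have "\<dots> = (\<Sum>k\<in>I. \<Sum>i\<in>I - {k}.
      ml (last_sign k (I - {k})) * (ml (lead_sign i (I - {k} - {i})) * t i c * minor (I - {k} - {i}) bs) * t k b)"
    by (rule sum_swap_neq)
  also have "\<dots> = (\<Sum>k\<in>I. ml (last_sign k (I - {k})) * minor (I - {k}) (c # bs) * t k b)"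
    by (simp add: sum_distrib_left sum_distrib_right)
  finally show ?case .
qed

end

section \<open>Determinants and inverse matrices\<close>

definition arrangements :: "'a set \<Rightarrow> 'a list set"
  where "arrangements I = {as. distinct as \<and> set as = I}"

lemma finite_arrangements: "finite I \<Longrightarrow> finite (arrangements I)"
  unfolding arrangements_def
  by (rule finite_subset[OF _ finite_lists_length_eq[of I "card I"]]) (auto simp: distinct_card)

lemma arrangements_empty [simp]: "arrangements {} = {[]}"
  by (auto simp: arrangements_def)

lemma sum_arrangements:
  fixes f :: "'a list \<Rightarrow> 'b::comm_monoid_add"
  assumes "finite I" "I \<noteq> {}"
  shows "sum f (arrangements I) = (\<Sum>i\<in>I. \<Sum>as\<in>arrangements (I - {i}). f (i # as))"
proof -
  have "sum f (arrangements I) = (\<Sum>(i, as)\<in>(SIGMA i:I. arrangements (I - {i})). f (i # as))"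
  proof (rule sum.reindex_bij_witness[of _ "\<lambda>(i, as). i # as" "\<lambda>as. (hd as, tl as)"])
    fix as assume "as \<in> arrangements I"
    then obtain b bs where as: "as = b # bs" using assms by (cases as) (auto simp: arrangements_def)
    show "(case (hd as, tl as) of (i, as) \<Rightarrow> i # as) = as" by (simp add: as)
    show "(hd as, tl as) \<in> (SIGMA i:I. arrangements (I - {i}))"
      using \<open>as \<in> arrangements I\<close> by (auto simp: as arrangements_def)
    show "(case (hd as, tl as) of (i, as) \<Rightarrow> f (i # as)) = f as" by (simp add: as)
  next
    fix b assume "b \<in> (SIGMA i:I. arrangements (I - {i}))"
    then obtain i as where b: "b = (i, as)" "i \<in> I" "distinct as" "set as = I - {i}"
      by (auto simp: arrangements_def)
    then show "(case b of (i, as) \<Rightarrow> i # as) \<in> arrangements I"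
      by (simp add: arrangements_def insert_absorb)
    show "(hd (case b of (i, as) \<Rightarrow> i # as), tl (case b of (i, as) \<Rightarrow> i # as)) = b" by (simp add: b)
  qed
  also have "\<dots> = (\<Sum>i\<in>I. \<Sum>as\<in>arrangements (I - {i}). f (i # as))"
    using assms(1) by (intro sum.Sigma[symmetric] ballI finite_arrangements finite_Diff)
  finally show ?thesis .
qed

lemma sum_lists_Suc:
  fixes f :: "'a::finite list \<Rightarrow> 'b::comm_monoid_add"
  shows "sum f {as. length as = Suc n} = (\<Sum>a\<in>UNIV. \<Sum>as\<in>{as. length as = n}. f (a # as))"
proof -
  have fin: "finite {as::'a list. length as = n}"
    using finite_lists_length_eq[of "UNIV :: 'a set" n] by simp
  have "sum f {as. length as = Suc n} = (\<Sum>(a, as)\<in>UNIV \<times> {as. length as = n}. f (a # as))"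
  proof (rule sum.reindex_bij_witness[of _ "\<lambda>(i, as). i # as" "\<lambda>as. (hd as, tl as)"])
    fix as :: "'a list" assume "as \<in> {as. length as = Suc n}"
    then obtain b bs where as: "as = b # bs" by (cases as) auto
    show "(case (hd as, tl as) of (i, as) \<Rightarrow> i # as) = as" by (simp add: as)
    show "(hd as, tl as) \<in> UNIV \<times> {as. length as = n}"
      using \<open>as \<in> _\<close> by (auto simp: as)
    show "(case (hd as, tl as) of (i, as) \<Rightarrow> f (i # as)) = f as" by (simp add: as)
  qed auto
  then show ?thesis by (simp add: sum.cartesian_product)
qed

context dynamical_rll
begin

definition t_word :: "'n list \<Rightarrow> 'n list \<Rightarrow> 'r"
  where "t_word as bs = prod_list (map2 t as bs)"

text \<open>Unfolds the recursion into a sum over orderings of the rows. The sign of the remaining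
  rows does not involve the coordinate i and therefore passes the entry in row i.\<close>

lemma minor_eq_sum_arrangements:
  "length bs = card I \<Longrightarrow>
    minor I bs = (\<Sum>as\<in>arrangements I. ml (list_sign as) * t_word as bs)"
proof (induction bs arbitrary: I)
  case Nil
  then have "I = {}" by simp
  then show ?case by (simp add: t_word_def ml_1)
next
  case (Cons b bs)
  then have I: "I \<noteq> {}" by auto
  have "minor I (b # bs) = (\<Sum>i\<in>I. \<Sum>as\<in>arrangements (I - {i}). ml (list_sign (i # as)) * t_word (i # as) (b # bs))"
  proof (simp only: minor.simps, intro sum.cong refl)
    fix i assume "i \<in> I"
    with Cons.prems have "minor (I - {i}) bs = (\<Sum>as\<in>arrangements (I - {i}). ml (list_sign as) * t_word as bs)"
      by (intro Cons.IH) simp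
    moreover have "ml (lead_sign i (I - {i})) * t i b * (ml (list_sign as) * t_word as bs) =
      ml (list_sign (i # as)) * t_word (i # as) (b # bs)" if "as \<in> arrangements (I - {i})" for as
    proof -
      have as: "set as = I - {i}" "i \<notin> set as" using that by (auto simp: arrangements_def)
      have com: "t i b * ml (list_sign as) = ml (list_sign as) * t i b"
        by (subst t_ml, subst list_sign_shift) (use as in auto)
      have "ml (lead_sign i (I - {i})) * t i b * (ml (list_sign as) * t_word as bs) =
        ml (lead_sign i (I - {i})) * (t i b * ml (list_sign as)) * t_word as bs" by (simp only: mult.assoc)
      then show ?thesis unfolding com by (simp add: t_word_def as ml_mult mult.assoc)
    qed
    ultimately show "ml (lead_sign i (I - {i})) * t i b * minor (I - {i}) bs =
      (\<Sum>as\<in>arrangements (I - {i}). ml (list_sign (i # as)) * t_word (i # as) (b # bs))"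
      by (simp add: sum_distrib_left)
  qed
  then show ?case by (simp add: sum_arrangements[OF finite I])
qed

lemma list_sign_snoc:
  "distinct (xs @ [b]) \<Longrightarrow> list_sign (xs @ [b]) = list_sign xs * last_sign b (set xs)"
proof (induction xs)
  case Nil
  then show ?case by (simp add: lead_sign_def last_sign_def)
next
  case (Cons x xs)
  then show ?case by (simp add: lead_sign_insert last_sign_insert)
qed

lemma lead_sign_nonzero: "i \<notin> J \<Longrightarrow> lead_sign i J \<noteq> 0"
  unfolding lead_sign_def by (metis (no_types, lifting) H_nonzero finite mem_Collect_eq neg_equal_0_iff_equal prod_zero_iff)

lemma last_sign_nonzero: "i \<notin> J \<Longrightarrow> last_sign i J \<noteq> 0"
  unfolding last_sign_def by (metis (no_types, lifting) H_nonzero finite mem_Collect_eq neg_equal_0_iff_equal prod_zero_iff)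

lemma list_sign_nonzero: "distinct xs \<Longrightarrow> list_sign xs \<noteq> 0"
  by (induction xs) (auto simp: lead_sign_nonzero)

text \<open>Signs depend on differences of coordinates only, so a shift by a multiple of the
  all-ones vector, the weight of det, leaves them unchanged.\<close>

lemma lead_sign_shift_const: "mero_shift (vec c) (lead_sign i J) = lead_sign i J"
  unfolding lead_sign_def by (simp add: mero_shift_prod mero_shift_uminus H_shift)

lemma list_sign_shift_const: "mero_shift (vec c) (list_sign xs) = list_sign xs"
  by (induction xs) (simp_all add: mero_shift_mult lead_sign_shift_const)

end

section \<open>Matrices over a noncommutative ring and the inverse of \<open>t\<close>\<close>

definition mat_mult :: "('k::finite \<Rightarrow> 'k \<Rightarrow> 'r::{ring,monoid_mult}) \<Rightarrow> ('k \<Rightarrow> 'k \<Rightarrow> 'r) \<Rightarrow> 'k \<Rightarrow> 'k \<Rightarrow> 'r"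
    (infixl \<open>\<bullet>\<bullet>\<close> 70)
  where "mat_mult A B i j = (\<Sum>k\<in>UNIV. A i k * B k j)"

definition mat_one :: "'k::finite \<Rightarrow> 'k \<Rightarrow> 'r::{ring,monoid_mult}"
  where "mat_one i j = (if i = j then 1 else 0)"

lemma mat_mult_assoc: "A \<bullet>\<bullet> B \<bullet>\<bullet> C = A \<bullet>\<bullet> (B \<bullet>\<bullet> C)"
proof (intro ext)
  fix i j
  have "(A \<bullet>\<bullet> B \<bullet>\<bullet> C) i j = (\<Sum>k\<in>UNIV. \<Sum>l\<in>UNIV. A i l * B l k * C k j)"
    by (simp add: mat_mult_def sum_distrib_right)
  also have "\<dots> = (\<Sum>l\<in>UNIV. \<Sum>k\<in>UNIV. A i l * B l k * C k j)" by (rule sum.swap)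
  also have "\<dots> = (A \<bullet>\<bullet> (B \<bullet>\<bullet> C)) i j"
    by (simp add: mat_mult_def sum_distrib_left mult.assoc)
  finally show "(A \<bullet>\<bullet> B \<bullet>\<bullet> C) i j = (A \<bullet>\<bullet> (B \<bullet>\<bullet> C)) i j" .
qed

lemma mat_mult_one [simp]: "A \<bullet>\<bullet> mat_one = A" "mat_one \<bullet>\<bullet> A = A"
  unfolding fun_eq_iff mat_mult_def mat_one_def
  by (simp_all add: if_distrib[of "\<lambda>x. _ * x"] if_distrib[of "\<lambda>x. x * _"] cong: if_cong)

text \<open>\<open>rll_row\<close> is the RLL-relation with equal rows. It becomes the column
  relation of the transposed matrix and thereby gives access to the row determinant.\<close>

locale dynamical_gl = dynamical_rll ml mr t "(<)" H Q Qi
  for ml mr :: "'n::{finite,linorder} mero \<Rightarrow> 'r::{ring,monoid_mult}" and t H Q Qi +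
  fixes det_inv :: 'r
  assumes rll_row: "b \<noteq> d \<Longrightarrow>
      mr (if d < b then 1 else H b d * H d b) * t a b * t a d + mr (Q - H d b) * t a d * t a b =
      mr Q * t a d * t a b"
    and det_inv_right: "minor UNIV (sorted_list_of_set UNIV) * det_inv = 1"
    and det_inv_left: "det_inv * minor UNIV (sorted_list_of_set UNIV) = 1"
    and t_det_inv: "t i j * det_inv = det_inv * t i j"
    and ml_det_inv: "ml f * det_inv = det_inv * ml (mero_shift (- 1) f)"
    and mr_det_inv: "mr f * det_inv = det_inv * mr (mero_shift (- 1) f)"
begin

text \<open>Transposing \<open>t\<close>, exchanging \<lambda> with \<mu> and reversing the order of
  the indices turns the RLL-relation into itself with its sides exchanged. What was shown for lists
  of columns thus holds for lists of rows, with the roles of \<lambda> and \<mu> exchanged.\<close>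

sublocale row: dynamical_rll mr ml "\<lambda>i j. t j i" "\<lambda>i j. j < i" H Q Qi
proof
  fix a b c d :: 'n
  assume ac: "a \<noteq> c"
  show "mr (if c < a then 1 else H a c * H c a) * t b a * t b c + mr (Q - H c a) * t b c * t b a =
    mr Q * t b c * t b a"
    using rll_row[OF ac] .
  assume bd: "b \<noteq> d"
  have 1: "(if d < b then 1 else H d b * H b d) = (if d < b then 1 else H b d * H d b)"
    by (simp add: mult.commute)
  have 2: "(if c < a then 1 else H c a * H a c) = (if c < a then 1 else H a c * H c a)"
    by (simp add: mult.commute)
  show "mr (if c < a then 1 else H a c * H c a) * t b a * t d c + mr (Q - H c a) * t b c * t d a =
    ml (if d < b then 1 else H b d * H d b) * t d c * t b a + ml (Q - H b d) * t b c * t d a"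
    using rll[OF bd[symmetric] ac[symmetric]] unfolding 1 2 by simp
qed (fact ml_add ml_mult ml_1 mr_add mr_mult mr_1 ml_mr[symmetric] ml_t mr_t H_nonzero H_shift H_add
    Q_central[symmetric] | simp | blast intro: less_trans | fastforce)+

abbreviation "index_list \<equiv> sorted_list_of_set (UNIV :: 'n set)"

definition det :: 'r where "det = minor UNIV index_list"

lemma det_right: "det * det_inv = 1" and det_left: "det_inv * det = 1"
  by (simp_all add: det_def det_inv_right det_inv_left)

text \<open>For a list without repetitions, the product of - \<open>H x y\<close> over all pairs
  with x before y: the inversions come from \<open>list_sign\<close>, the remaining pairs from the
  sign for the reversed order.\<close>

definition "full_sign xs = list_sign xs * row.list_sign xs"

definition "F_sum = sum full_sign (arrangements (UNIV :: 'n set))"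

text \<open>With respect to the reversed order the sorted list of all indices is the decreasing
  one.\<close>

definition "row_det = row.minor UNIV (rev index_list)"

lemma row_t_word: "length as = length bs \<Longrightarrow> row.t_word bs as = t_word as bs"
  unfolding row.t_word_def t_word_def
  by (rule arg_cong[of _ _ prod_list]) (induction as bs rule: list_induct2, auto)

lemma minor_UNIV: "bs \<in> arrangements UNIV \<Longrightarrow> minor UNIV bs = mr (list_sign bs) * det"
  unfolding det_def by (rule minor_sort) (auto simp: arrangements_def)

lemma row_minor_UNIV: "bs \<in> arrangements UNIV \<Longrightarrow> row.minor UNIV bs = ml (row.list_sign bs) * row_det"
  unfolding row_det_def by (rule row.minor_sort) (auto simp: arrangements_def sorted_wrt_rev)

lemma ml_sum: "ml (sum f S) = (\<Sum>x\<in>S. ml (f x))" and mr_sum: "mr (sum f S) = (\<Sum>x\<in>S. mr (f x))"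
  by (induction S rule: infinite_finite_induct) (simp_all add: ml_0 mr_0 ml_add mr_add)

text \<open>
  Both sides expand the sum of all monomials with the column signs in \<open>\<lambda>\<close> and the row signs in
  \<open>\<mu>\<close>, once along columns and once along rows.
\<close>

lemma det_row_det: "mr F_sum * det = ml F_sum * row_det"
proof -
  let ?A = "arrangements (UNIV :: 'n set)"
  have len: "length as = CARD('n)" if "as \<in> ?A" for as
    using that distinct_card[of as] by (auto simp: arrangements_def)
  have "(\<Sum>bs\<in>?A. mr (row.list_sign bs) * minor UNIV bs) =
      (\<Sum>bs\<in>?A. \<Sum>as\<in>?A. mr (row.list_sign bs) * (ml (list_sign as) * t_word as bs))"
    by (simp add: minor_eq_sum_arrangements len sum_distrib_left)
  also have "\<dots> = (\<Sum>as\<in>?A. \<Sum>bs\<in>?A. mr (row.list_sign bs) * (ml (list_sign as) * t_word as bs))"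
    by (rule sum.swap)
  also have "\<dots> = (\<Sum>as\<in>?A. \<Sum>bs\<in>?A. ml (list_sign as) * (mr (row.list_sign bs) * row.t_word bs as))"
    by (intro sum.cong refl) (simp add: row_t_word len ml_mr flip: mult.assoc)
  also have "\<dots> = (\<Sum>as\<in>?A. ml (list_sign as) * row.minor UNIV as)"
    by (simp add: row.minor_eq_sum_arrangements len sum_distrib_left)
  finally have "(\<Sum>bs\<in>?A. mr (row.list_sign bs) * (mr (list_sign bs) * det)) =
      (\<Sum>as\<in>?A. ml (list_sign as) * (ml (row.list_sign as) * row_det))"
    by (simp add: minor_UNIV row_minor_UNIV)
  then show ?thesis
    by (simp add: F_sum_def full_sign_def ml_sum mr_sum sum_distrib_right ml_mult mr_mult mult.assoc)
       (simp add: mr_commute flip: mult.assoc)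
qed

text \<open>The value prescribed for S(t_ij), with \<open>last_sign j (- {j})\<close> in the role of
  sign(hat j; {j}).\<close>

definition tinv :: "'n \<Rightarrow> 'n \<Rightarrow> 'r"
  where "tinv i j = det_inv * (ml (last_sign j (- {j})) * mr (inverse (last_sign i (- {i})))) *
    minor (- {j}) (sorted_list_of_set (- {i}))"

text \<open>Up to factors on the left, the entry (i, j) of the product is the expansion along the
  last column of the determinant whose columns are all indices except i, followed by j. For i = j,
  sorting the columns produces the sign that the factor cancels; otherwise the column j occurs
  twice.\<close>

lemma tinv_t: "tinv \<bullet>\<bullet> t = mat_one"
proof (intro ext)
  fix i j :: 'n
  let ?L = "sorted_list_of_set (- {i}) @ [j]"
  have "(tinv \<bullet>\<bullet> t) i j = det_inv * (mr (inverse (last_sign i (- {i}))) * minor UNIV ?L)"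
    unfolding mat_mult_def minor_last_column sum_distrib_left tinv_def Compl_eq_Diff_UNIV ml_mr
    by (simp add: mult.assoc)
  also have "\<dots> = mat_one i j"
  proof (cases "i = j")
    case True
    have "?L \<in> arrangements UNIV" by (auto simp: arrangements_def True)
    then have "minor UNIV ?L = mr (list_sign ?L) * det" by (rule minor_UNIV)
    also have "list_sign ?L = last_sign i (- {i})"
      by (subst list_sign_snoc) (auto simp: True list_sign_sorted)
    finally show ?thesis
      by (simp only: mr_cancel' last_sign_nonzero) (simp add: mr_cancel' last_sign_nonzero det_left mat_one_def True)
  next
    case False
    then show ?thesis by (subst minor_not_distinct) (auto simp: mat_one_def)
  qed
  finally show "(tinv \<bullet>\<bullet> t) i j = mat_one i j" .
qed

text \<open>Obtained by solving the relation \<open>det_row_det\<close> for the inverse of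
  \<open>row_det\<close>.\<close>

definition row_det_inv :: 'r
  where "row_det_inv = det_inv * mr (inverse F_sum) * ml F_sum"

lemma row_det_right:
  assumes "F_sum \<noteq> 0"
  shows "row_det * row_det_inv = 1"
proof -
  have "row_det = ml (inverse F_sum) * (mr F_sum * det)"
    unfolding det_row_det ml_cancel'[OF assms] ..
  then have "row_det * row_det_inv =
      ml (inverse F_sum) * (mr F_sum * (det * det_inv) * mr (inverse F_sum)) * ml F_sum"
    by (simp add: row_det_inv_def mult.assoc)
  also have "mr F_sum * (det * det_inv) * mr (inverse F_sum) = 1"
    using assms by (simp add: det_right mr_1 flip: mr_mult)
  finally show ?thesis using assms by (simp add: ml_1 flip: ml_mult)
qed

text \<open>Read off from the expansion of a row minor along its leading row. The signs there stand
  to the left of the entries of \<open>t\<close>; moving them to the right shifts them by the weight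
  of the column j.\<close>

definition tinv_row :: "'n \<Rightarrow> 'n \<Rightarrow> 'r"
  where "tinv_row j i = mr (mero_shift (unit_weight j) (row.lead_sign j (- {j}))) *
    row.minor (- {j}) (rev (sorted_list_of_set (- {i}))) * row_det_inv *
    ml (inverse (row.list_sign (i # rev (sorted_list_of_set (- {i})))))"

lemma t_tinv_row:
  assumes "F_sum \<noteq> 0"
  shows "t \<bullet>\<bullet> tinv_row = mat_one"
proof (intro ext)
  fix a i :: 'n
  let ?R = "rev (sorted_list_of_set (- {i}))"
  define u where "u = row.list_sign (i # ?R)"
  have "(t \<bullet>\<bullet> tinv_row) a i = row.minor UNIV (a # ?R) * (row_det_inv * ml (inverse u))"
    unfolding mat_mult_def row.minor.simps sum_distrib_right tinv_row_def Compl_eq_Diff_UNIV u_def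
    by (simp only: mult.assoc[symmetric] mr_t)
  also have "\<dots> = mat_one a i"
  proof (cases "a = i")
    case True
    have "i # ?R \<in> arrangements UNIV" by (auto simp: arrangements_def)
    then have "row.minor UNIV (a # ?R) = ml u * row_det"
      unfolding True u_def by (rule row_minor_UNIV)
    then have "row.minor UNIV (a # ?R) * (row_det_inv * ml (inverse u)) = ml u * (row_det * row_det_inv) * ml (inverse u)"
      by (simp only: mult.assoc)
    also have "\<dots> = 1"
    proof -
      have "u \<noteq> 0" unfolding u_def by (rule row.list_sign_nonzero) simp
      then show ?thesis by (simp add: row_det_right[OF assms] ml_1 flip: ml_mult)
    qed
    finally show ?thesis by (simp add: mat_one_def True)
  next
    case False
    then show ?thesis by (subst row.minor_not_distinct) (auto simp: mat_one_def)
  qed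
  finally show "(t \<bullet>\<bullet> tinv_row) a i = mat_one a i" .
qed

lemma t_tinv:
  assumes "F_sum \<noteq> 0"
  shows "t \<bullet>\<bullet> tinv = mat_one"
proof -
  have "tinv = tinv \<bullet>\<bullet> (t \<bullet>\<bullet> tinv_row)" by (simp add: t_tinv_row[OF assms])
  also have "\<dots> = tinv_row" by (simp add: tinv_t flip: mat_mult_assoc)
  finally show ?thesis using t_tinv_row[OF assms] by simp
qed

end

text \<open>The full R-matrix is carried along because the relations for S come from inverting the
  RLL-relation as an identity of matrices indexed by pairs. \<open>R_weight\<close> is conservation
  of weight; \<open>R_shift\<close> reflects that an entry depends only on the difference of the two
  coordinates concerned.\<close>

locale dynamical_gl_R = dynamical_gl ml mr t H Q Qi det_inv
  for ml mr :: "'n::{finite,linorder} mero \<Rightarrow> 'r::{ring,monoid_mult}" and t H Q Qi det_inv +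
  fixes R :: "'n \<Rightarrow> 'n \<Rightarrow> 'n \<Rightarrow> 'n \<Rightarrow> 'n mero"
  assumes rll_R: "(\<Sum>x\<in>UNIV. \<Sum>y\<in>UNIV. ml (R x y a c) * t x b * t y d) =
      (\<Sum>x\<in>UNIV. \<Sum>y\<in>UNIV. mr (R b d x y) * t c y * t a x)"
    and R_weight: "R x y a c \<noteq> 0 \<Longrightarrow> unit_weight x + unit_weight y = unit_weight a + (unit_weight c :: (complex, 'n) vec)"
    and R_shift: "mero_shift (unit_weight a + unit_weight c) (R x y a c) = R x y a c"
    and F_sum_nonzero: "F_sum \<noteq> 0"
begin

lemmas t_tinv = t_tinv[OF F_sum_nonzero]

text \<open>This is \<open>mr_t\<close> multiplied by the inverse matrix on both sides.\<close>

lemma tinv_mr: "tinv i j * mr f = mr (mero_shift (unit_weight i) f) * tinv i j"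
proof -
  have "mat_one \<bullet>\<bullet> (\<lambda>k l. mr (mero_shift (unit_weight k) f) * tinv k l) =
      tinv \<bullet>\<bullet> (t \<bullet>\<bullet> (\<lambda>k l. mr (mero_shift (unit_weight k) f) * tinv k l))"
    unfolding mat_mult_assoc[symmetric] tinv_t ..
  also have "t \<bullet>\<bullet> (\<lambda>k l. mr (mero_shift (unit_weight k) f) * tinv k l) = (\<lambda>k l. mr f * (t \<bullet>\<bullet> tinv) k l)"
    by (simp add: mat_mult_def fun_eq_iff sum_distrib_left mr_t flip: mult.assoc)
  finally have "mr (mero_shift (unit_weight i) f) * tinv i j =
      (tinv \<bullet>\<bullet> (\<lambda>k l. mr f * mat_one k l)) i j"
    by (simp add: t_tinv fun_eq_iff)
  then show ?thesis
    by (simp add: mat_mult_def mat_one_def if_distrib[of "\<lambda>x. _ * x"] cong: if_cong)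
qed

lemma tinv_ml: "tinv i j * ml f = ml (mero_shift (unit_weight j) f) * tinv i j"
proof -
  define g where "g = mero_shift (unit_weight j) f"
  \<comment> \<open>Written as a shift of g, the function f turns into the same g for every row of
    \<open>t\<close> when \<open>t_ml\<close> is applied.\<close>
  have f: "f = mero_shift (- unit_weight j) g" by (simp add: g_def)
  have "(\<lambda>k l. tinv k l * ml (mero_shift (- unit_weight l) g)) \<bullet>\<bullet> t = (\<lambda>k l. (tinv \<bullet>\<bullet> t) k l * ml g)"
    by (simp add: fun_eq_iff mat_mult_def sum_distrib_right mult.assoc t_ml)
  then have "((\<lambda>k l. tinv k l * ml (mero_shift (- unit_weight l) g)) \<bullet>\<bullet> t) \<bullet>\<bullet> tinv =
      (\<lambda>k l. (tinv \<bullet>\<bullet> t) k l * ml g) \<bullet>\<bullet> tinv"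
    by (rule arg_cong)
  then have "(\<lambda>k l. tinv k l * ml (mero_shift (- unit_weight l) g)) i j =
      ((\<lambda>k l. mat_one k l * ml g) \<bullet>\<bullet> tinv) i j"
    unfolding mat_mult_assoc t_tinv tinv_t mat_mult_one by (rule fun_cong[THEN fun_cong])
  then show ?thesis
    by (simp add: f[symmetric]) (simp add: mat_mult_def mat_one_def g_def if_distrib[of "\<lambda>x. x * _"] cong: if_cong)
qed

text \<open>The two factors together shift \<mu> by the weights of x and y. For a nonzero entry
  these add up to the weights of a and c, and R is invariant under that shift.\<close>

lemma tinv_tinv_mr:
  "mr (R x y a c) * (tinv y d * tinv x b) = tinv y d * tinv x b * mr (R x y a c)"
proof (cases "R x y a c = 0")
  case False
  have "tinv y d * tinv x b * mr (R x y a c) =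
      mr (mero_shift (unit_weight x + unit_weight y) (R x y a c)) * (tinv y d * tinv x b)"
    by (simp add: mult.assoc tinv_mr) (simp add: tinv_mr add.commute flip: mult.assoc)
  then show ?thesis using R_weight[OF False] R_shift by simp
qed (simp add: mr_0)

lemma t_t_mr: "mr (R b d x y) * t c y * t a x = t c y * t a x * mr (R b d x y)"
proof -
  have "mr (R b d x y) * t c y * t a x = t c y * t a x * mr (mero_shift (unit_weight x + unit_weight y) (R b d x y))"
    by (simp add: mult.assoc mr_t)
  then show ?thesis by (simp only: R_shift)
qed

text \<open>The RLL-relation reads L TT = TT' M for matrices indexed by pairs. The inverses XX and
  YY list their two factors in opposite order, so that the products telescope from the inside.
  Multiplying on both sides gives XX L = M YY, the relation that S has to respect.\<close>

lemma rll_tinv: "(\<Sum>x\<in>UNIV. \<Sum>y\<in>UNIV. tinv y d * tinv x b * mr (R x y a c)) =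
  (\<Sum>x\<in>UNIV. \<Sum>y\<in>UNIV. tinv a x * tinv c y * ml (R b d x y))"
proof -
  define TT TT' XX YY L M :: "'n \<times> 'n \<Rightarrow> 'n \<times> 'n \<Rightarrow> 'r"
    where "TT = (\<lambda>(x, y) (b, d). t x b * t y d)" and "TT' = (\<lambda>(a, c) (x, y). t c y * t a x)"
      and "XX = (\<lambda>(r, p) (a, c). tinv r a * tinv p c)" and "YY = (\<lambda>(b, d) (v, u). tinv d u * tinv b v)"
      and "L = (\<lambda>(a, c) (x, y). ml (R x y a c))" and "M = (\<lambda>(x, y) (b, d). mr (R b d x y))"
  note defs = TT_def TT'_def XX_def YY_def L_def M_def
  have pairs: "(\<Sum>p\<in>UNIV. f p) = (\<Sum>x\<in>UNIV. \<Sum>y\<in>UNIV. f (x, y))" for f :: "'n \<times> 'n \<Rightarrow> 'r"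
    by (simp add: sum.cartesian_product flip: UNIV_Times_UNIV)
  have X_t: "(\<Sum>k\<in>UNIV. tinv i k * (t k j * z)) = (if i = j then z else 0)" for i j z
  proof -
    have "(\<Sum>k\<in>UNIV. tinv i k * (t k j * z)) = (tinv \<bullet>\<bullet> t) i j * z"
      by (simp add: mat_mult_def sum_distrib_right mult.assoc)
    then show ?thesis by (simp add: tinv_t mat_one_def)
  qed
  have t_X: "(\<Sum>k\<in>UNIV. t i k * (tinv k j * z)) = (if i = j then z else 0)" for i j z
  proof -
    have "(\<Sum>k\<in>UNIV. t i k * (tinv k j * z)) = (t \<bullet>\<bullet> tinv) i j * z"
      by (simp add: mat_mult_def sum_distrib_right mult.assoc)
    then show ?thesis by (simp add: t_tinv mat_one_def)
  qed
  have "TT \<bullet>\<bullet> YY = mat_one"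
  proof (intro ext)
    fix p r :: "'n \<times> 'n"
    obtain x y v u where pr: "p = (x, y)" "r = (v, u)" by (cases p, cases r)
    have "(TT \<bullet>\<bullet> YY) p r = (\<Sum>b\<in>UNIV. t x b * (\<Sum>d\<in>UNIV. t y d * (tinv d u * tinv b v)))"
      by (simp add: mat_mult_def pairs defs pr sum_distrib_left mult.assoc)
    also have "\<dots> = mat_one p r"
      using t_X[of x v 1] by (cases "y = u") (simp_all add: t_X pr mat_one_def)
    finally show "(TT \<bullet>\<bullet> YY) p r = mat_one p r" .
  qed
  moreover have "XX \<bullet>\<bullet> TT' = mat_one"
  proof (intro ext)
    fix p r :: "'n \<times> 'n"
    obtain x y v u where pr: "p = (x, y)" "r = (v, u)" by (cases p, cases r)
    have "(XX \<bullet>\<bullet> TT') p r = (\<Sum>a\<in>UNIV. tinv x a * (\<Sum>c\<in>UNIV. tinv y c * (t c u * t a v)))"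
      by (simp add: mat_mult_def pairs defs pr sum_distrib_left mult.assoc)
    also have "\<dots> = mat_one p r"
      using X_t[of x v 1] by (cases "y = u") (simp_all add: X_t pr mat_one_def)
    finally show "(XX \<bullet>\<bullet> TT') p r = mat_one p r" .
  qed
  moreover have "L \<bullet>\<bullet> TT = TT' \<bullet>\<bullet> M"
    unfolding fun_eq_iff mat_mult_def pairs defs
    using rll_R by (simp add: t_t_mr[unfolded mult.assoc] mult.assoc)
  ultimately have "XX \<bullet>\<bullet> L = M \<bullet>\<bullet> YY"
    by (metis mat_mult_assoc mat_mult_one)
  from fun_cong[OF fun_cong[OF this], of "(a, c)" "(b, d)"] show ?thesis
    by (simp add: mat_mult_def pairs defs tinv_tinv_mr)
qed

text \<open>The image of \<open>t_word as bs\<close> under S; the reversal is the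
  anti-multiplicativity of S.\<close>

definition tinv_word :: "'n list \<Rightarrow> 'n list \<Rightarrow> 'r"
  where "tinv_word as bs = prod_list (rev (map2 tinv as bs))"

text \<open>The product collapses from the inside, one summation index at a time, because the
  reversed word puts matching factors next to each other.\<close>

lemma t_word_tinv_word:
  "length rs = length bs \<Longrightarrow>
    (\<Sum>as\<in>{as. length as = length bs}. t_word rs as * tinv_word as bs) = (if rs = bs then 1 else 0)"
proof (induction rs bs rule: list_induct2)
  case Nil
  then show ?case by (simp add: t_word_def tinv_word_def)
next
  case (Cons r rs b bs)
  have "(\<Sum>as\<in>{as. length as = length (b # bs)}. t_word (r # rs) as * tinv_word as (b # bs)) =
      (\<Sum>a\<in>UNIV. \<Sum>as\<in>{as. length as = length bs}. t r a * (t_word rs as * tinv_word as bs) * tinv a b)"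
    by (simp add: sum_lists_Suc t_word_def tinv_word_def mult.assoc)
  also have "\<dots> = (\<Sum>a\<in>UNIV. t r a * (if rs = bs then 1 else 0) * tinv a b)"
    by (simp add: Cons.IH flip: sum_distrib_left sum_distrib_right)
  also have "\<dots> = (if rs = bs then (t \<bullet>\<bullet> tinv) r b else 0)"
    by (simp add: mat_mult_def)
  finally show ?case by (simp add: t_tinv mat_one_def)
qed

lemma tinv_word_mr:
  "length as = length bs \<Longrightarrow>
    tinv_word as bs * mr f = mr (mero_shift (sum_list (map unit_weight as)) f) * tinv_word as bs"
proof (induction as bs arbitrary: f rule: list_induct2)
  case Nil
  then show ?case by (simp add: tinv_word_def)
next
  case (Cons a as b bs)
  have w: "tinv_word (a # as) (b # bs) = tinv_word as bs * tinv a b" by (simp add: tinv_word_def)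
  have "tinv_word (a # as) (b # bs) * mr f = (tinv_word as bs * mr (mero_shift (unit_weight a) f)) * tinv a b"
    unfolding w mult.assoc tinv_mr ..
  then show ?case unfolding Cons.IH w by (simp add: mult.assoc add.commute)
qed

text \<open>This and the next two rules come from the relations imposed on the inverse, by writing
  det x = det (x det_inv) det.\<close>

lemma det_mr: "det * mr f = mr (mero_shift (- 1) f) * det"
proof -
  have "det * mr f = det * (mr f * det_inv) * det" by (simp add: mult.assoc det_left)
  also have "\<dots> = (det * det_inv) * (mr (mero_shift (- 1) f) * det)"
    unfolding mr_det_inv by (simp only: mult.assoc)
  finally show ?thesis by (simp add: det_right)
qed

lemma det_ml: "det * ml f = ml (mero_shift (- 1) f) * det"
proof -
  have "det * ml f = det * (ml f * det_inv) * det" by (simp add: mult.assoc det_left)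
  also have "\<dots> = (det * det_inv) * (ml (mero_shift (- 1) f) * det)"
    unfolding ml_det_inv by (simp only: mult.assoc)
  finally show ?thesis by (simp add: det_right)
qed

lemma det_t: "det * t i j = t i j * det"
proof -
  have "det * t i j = det * (t i j * det_inv) * det" by (simp add: mult.assoc det_left)
  also have "\<dots> = (det * det_inv) * (t i j * det)"
    unfolding t_det_inv by (simp only: mult.assoc)
  finally show ?thesis by (simp add: det_right)
qed

lemma det_tinv: "det * tinv i j = tinv i j * det"
proof -
  have "(\<lambda>k l. det * tinv k l) = tinv \<bullet>\<bullet> (t \<bullet>\<bullet> (\<lambda>k l. det * tinv k l))"
    by (simp add: tinv_t flip: mat_mult_assoc)
  also have "t \<bullet>\<bullet> (\<lambda>k l. det * tinv k l) = (\<lambda>k l. det * (t \<bullet>\<bullet> tinv) k l)"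
    by (simp add: mat_mult_def fun_eq_iff sum_distrib_left det_t flip: mult.assoc)
  also have "tinv \<bullet>\<bullet> \<dots> = (\<lambda>k l. tinv k l * det)"
    unfolding t_tinv by (simp add: fun_eq_iff mat_mult_def mat_one_def if_distrib[of "\<lambda>x. _ * x"] cong: if_cong)
  finally show ?thesis by (simp add: fun_eq_iff)
qed

text \<open>This is S(det) = det^-1. After multiplication by det, the signs in \<mu> and det combine
  to minors with permuted columns. The sum extends to all column lists, since minors with repeated
  columns vanish. Once the minors are expanded, the words in \<open>t\<close> and
  \<open>tinv\<close> telescope, and the increasing arrangement of the rows is all that
  remains.\<close>

lemma det_antipode_det:
  "(\<Sum>as\<in>arrangements UNIV. tinv_word as index_list * mr (list_sign as)) = det_inv"
proof -
  let ?A = "arrangements (UNIV :: 'n set)"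
  have len: "length as = length index_list" if "as \<in> ?A" for as
    using that distinct_card[of as] by (auto simp: arrangements_def)
  have len': "length as = CARD('n)" if "as \<in> ?A" for as
    using len[OF that] by simp
  have fin: "finite {as::'n list. length as = length index_list}"
    using finite_lists_length_eq[of "UNIV :: 'n set"] by simp
  have "det * (tinv_word as index_list * mr (list_sign as)) = minor UNIV as * tinv_word as index_list"
    if "as \<in> ?A" for as
  proof -
    \<comment> \<open>The total weight is the all-ones vector, which changes no difference of
      coordinates, so the signs commute with \<open>tinv_word\<close>.\<close>
    have "sum_list (map unit_weight as) = sum unit_weight (UNIV :: 'n set)"
      using that by (simp add: arrangements_def sum_list_distinct_conv_sum_set)
    also have "\<dots> = (1 :: (complex, 'n) vec)" by (simp add: vec_eq_iff axis_def)
    finally have *: "sum_list (map unit_weight as) = (vec 1 :: (complex, 'n) vec)" by (simp add: vec_eq_iff)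
    have m: "mero_shift (- 1) (list_sign as) = list_sign as"
      using list_sign_shift_const[of "- 1" as] by (metis vec_1 vec_neg)
    have "det * (tinv_word as index_list * mr (list_sign as)) = (det * mr (list_sign as)) * tinv_word as index_list"
      unfolding tinv_word_mr[OF len[OF that]] * list_sign_shift_const by (simp only: mult.assoc)
    then show ?thesis by (simp add: det_mr m minor_UNIV[OF that])
  qed
  then have "det * (\<Sum>as\<in>?A. tinv_word as index_list * mr (list_sign as)) =
      (\<Sum>as\<in>?A. minor UNIV as * tinv_word as index_list)"
    by (simp add: sum_distrib_left)
  also have "\<dots> = (\<Sum>as\<in>{as. length as = length index_list}. minor UNIV as * tinv_word as index_list)"
  proof (rule sum.mono_neutral_left[OF fin])
    show "\<forall>as\<in>{as. length as = length index_list} - ?A. minor UNIV as * tinv_word as index_list = 0"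
    proof
      fix as assume as: "as \<in> {as. length as = length index_list} - ?A"
      have "\<not> distinct as"
      proof
        assume "distinct as"
        with as have "card (set as) = CARD('n)" by (simp add: distinct_card)
        then have "set as = UNIV" by (simp add: card_eq_UNIV_imp_eq_UNIV)
        with \<open>distinct as\<close> as show False by (simp add: arrangements_def)
      qed
      then show "minor UNIV as * tinv_word as index_list = 0" by (simp add: minor_not_distinct)
    qed
  qed (use len in auto)
  also have "\<dots> = (\<Sum>as\<in>{as. length as = length index_list}. \<Sum>rs\<in>?A.
      ml (list_sign rs) * (t_word rs as * tinv_word as index_list))"
    by (intro sum.cong refl) (simp add: minor_eq_sum_arrangements sum_distrib_right mult.assoc)
  also have "\<dots> = (\<Sum>rs\<in>?A. \<Sum>as\<in>{as. length as = length index_list}.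
      ml (list_sign rs) * (t_word rs as * tinv_word as index_list))"
    by (rule sum.swap)
  also have "\<dots> = (\<Sum>rs\<in>?A. ml (list_sign rs) * (if rs = index_list then 1 else 0))"
    using t_word_tinv_word[OF len] by (intro sum.cong refl) (simp flip: sum_distrib_left)
  also have "\<dots> = 1"
  proof -
    have "finite ?A" "index_list \<in> ?A" by (simp_all add: finite_arrangements) (simp add: arrangements_def)
    then show ?thesis by (simp add: if_distrib[of "\<lambda>x. _ * x"] list_sign_sorted ml_1 cong: if_cong)
  qed
  finally have "det_inv * (det * (\<Sum>as\<in>?A. tinv_word as index_list * mr (list_sign as))) = det_inv * 1" by simp
  then show ?thesis by (simp add: det_left flip: mult.assoc)
qed

end

section \<open>Complex algebras on a carrier set\<close>

abbreviation complex_ring :: "complex ring"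
  where "complex_ring \<equiv> ring_of_type_algebra"

lemma ring_of_type_simps [simp]:
  "carrier ring_of_type_algebra = UNIV" "mult ring_of_type_algebra = (*)" "one ring_of_type_algebra = 1"
  "zero ring_of_type_algebra = 0" "add ring_of_type_algebra = (+)"
  by (simp_all add: ring_of_type_algebra_def)

lemma cring_complex: "cring complex_ring"
  by (rule cring_from_type_algebra)

locale calgebra =
  fixes A :: "(complex, 'a, 'm) module_scheme" (structure)
  assumes complex_algebra: "complex_algebra A"
begin

sublocale ring A
  using complex_algebra by (simp add: complex_algebra_def)

lemma module: "Module.module complex_ring A"
  using complex_algebra by (simp add: complex_algebra_def)

lemma smult_closed [simp, intro]: "x \<in> carrier A \<Longrightarrow> c \<odot> x \<in> carrier A"
  using module.smult_closed[OF module] by simp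

lemma smult_add_left: "x \<in> carrier A \<Longrightarrow> (c + d) \<odot> x = c \<odot> x \<oplus> d \<odot> x"
  using module.smult_l_distr[OF module, of c d x] by simp

lemma smult_add_right: "x \<in> carrier A \<Longrightarrow> y \<in> carrier A \<Longrightarrow> c \<odot> (x \<oplus> y) = c \<odot> x \<oplus> c \<odot> y"
  using module.smult_r_distr[OF module, of c x y] by simp

lemma smult_smult: "x \<in> carrier A \<Longrightarrow> c \<odot> (d \<odot> x) = (c * d) \<odot> x"
  using module.smult_assoc1[OF module, of c d x] by simp

lemma smult_one [simp]: "x \<in> carrier A \<Longrightarrow> 1 \<odot> x = x"
  using module.smult_one[OF module, of x] by simp

lemma smult_mult_left: "x \<in> carrier A \<Longrightarrow> y \<in> carrier A \<Longrightarrow> (c \<odot> x) \<otimes> y = c \<odot> (x \<otimes> y)"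
  and smult_mult_right: "x \<in> carrier A \<Longrightarrow> y \<in> carrier A \<Longrightarrow> x \<otimes> (c \<odot> y) = c \<odot> (x \<otimes> y)"
  using complex_algebra by (auto simp: complex_algebra_def)

lemma smult_0_left [simp]: "x \<in> carrier A \<Longrightarrow> 0 \<odot> x = \<zero>"
  using smult_add_left[of x 0 0] by simp

lemma smult_0_right [simp]: "c \<odot> \<zero> = \<zero>"
  using smult_add_right[of \<zero> \<zero> c] by simp

lemma smult_minus: "x \<in> carrier A \<Longrightarrow> (- 1) \<odot> x = \<ominus> x"
  using smult_add_left[of x "- 1" 1] minus_equality[of "(- 1) \<odot> x" x] by simp

lemma smult_finsum: "f \<in> S \<rightarrow> carrier A \<Longrightarrow> c \<odot> finsum A f S = (\<Oplus>x\<in>S. c \<odot> f x)"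
proof (induction S rule: infinite_finite_induct)
  case (insert x S)
  then have *: "f \<in> S \<rightarrow> carrier A" "f x \<in> carrier A" by auto
  then have "finsum A f S \<in> carrier A" by (rule_tac finsum_closed)
  with * insert show ?case
    by (simp add: smult_add_right Pi_def)
qed auto

end

lemma ring_fields_cong:
  assumes "ring R" "carrier R' = carrier R" "mult R' = mult R" "one R' = one R" "zero R' = zero R" "add R' = add R"
  shows "ring R'"
proof -
  interpret ring R by fact
  show ?thesis
  proof (rule ringI)
    show "abelian_group R'"
    proof (rule abelian_groupI)
      fix x assume "x \<in> carrier R'"
      then show "\<exists>y\<in>carrier R'. y \<oplus>\<^bsub>R'\<^esub> x = \<zero>\<^bsub>R'\<^esub>"
        by (intro bexI[of _ "\<ominus>\<^bsub>R\<^esub> x"]) (simp_all add: assms l_neg)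
    qed (simp_all add: assms a_assoc a_comm a_lcomm)
    show "Group.monoid R'" by (rule monoidI) (simp_all add: assms m_assoc)
  qed (simp_all add: assms l_distr r_distr)
qed

lemma finsum_fields_cong:
  assumes "carrier R' = carrier R" "zero R' = zero R" "add R' = add R"
  shows "finsum R' = finsum R"
  using assms by (intro ext) (simp add: finsum_def finprod_def)

text \<open>Records with different extra fields have different types, so agreement of the algebra
  fields takes the place of equality.\<close>

definition same_algebra :: "(complex, 'a, 'm) module_scheme \<Rightarrow> (complex, 'a, 'k) module_scheme \<Rightarrow> bool"
  where "same_algebra A B \<longleftrightarrow> carrier A = carrier B \<and> mult A = mult B \<and> one A = one B \<and>
    zero A = zero B \<and> add A = add B \<and> smult A = smult B"

lemma complex_algebra_cong:
  assumes "complex_algebra A" "same_algebra B A"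
  shows "complex_algebra B"
proof -
  interpret A: calgebra A by unfold_locales fact
  note eqs = assms(2)[unfolded same_algebra_def, THEN conjunct1]
    assms(2)[unfolded same_algebra_def, THEN conjunct2, THEN conjunct1]
  have eqs: "carrier B = carrier A" "mult B = mult A" "one B = one A"
    "zero B = zero A" "add B = add A" "smult B = smult A"
    using assms(2) by (auto simp: same_algebra_def)
  have r: "ring B" by (rule ring_fields_cong[OF A.ring_axioms]) (simp_all add: eqs)
  then interpret B: ring B .
  have "Module.module complex_ring B"
    by (rule moduleI[OF cring_complex B.abelian_group_axioms])
       (simp_all add: eqs A.smult_add_left A.smult_add_right A.smult_smult)
  with r show ?thesis
    by (simp add: complex_algebra_def eqs A.smult_mult_left A.smult_mult_right)
qed

section \<open>Finitely supported functions and linear extension\<close>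

lemma pm_sum_singles: "(\<Sum>p\<in>Poly_Mapping.keys x. Poly_Mapping.single p (Poly_Mapping.lookup x p)) = x"
  by (rule poly_mapping_eqI)
     (simp add: lookup_sum lookup_single when_def not_in_keys_iff_lookup_eq_zero)

lemma keys_sum_subset:
  "(\<And>i. i \<in> I \<Longrightarrow> Poly_Mapping.keys (f i) \<subseteq> K) \<Longrightarrow> Poly_Mapping.keys (sum f I) \<subseteq> K"
proof (induction I rule: infinite_finite_induct)
  case (insert i I)
  then show ?case using Poly_Mapping.keys_add[of "f i" "sum f I"] by auto
qed auto

lemma pm_induct [consumes 1, case_names zero single add]:
  fixes x :: "'a \<Rightarrow>\<^sub>0 'b::comm_monoid_add"
  assumes "Poly_Mapping.keys x \<subseteq> K" "P 0" "\<And>p c. p \<in> K \<Longrightarrow> P (Poly_Mapping.single p c)"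
    and "\<And>y z. Poly_Mapping.keys y \<subseteq> K \<Longrightarrow> Poly_Mapping.keys z \<subseteq> K \<Longrightarrow> P y \<Longrightarrow> P z \<Longrightarrow> P (y + z)"
  shows "P x"
proof -
  have "P (\<Sum>p\<in>S. Poly_Mapping.single p (Poly_Mapping.lookup x p))" if "finite S" "S \<subseteq> K" for S
    using that
  proof (induction S rule: finite_induct)
    case (insert p S)
    then show ?case
      by (simp, intro assms(3,4)) (auto intro!: keys_sum_subset split: if_splits)
  qed (simp add: assms(2))
  from this[of "Poly_Mapping.keys x"] assms(1) show ?thesis by (simp add: pm_sum_singles)
qed

lemma lookup_scale_pm [simp]: "Poly_Mapping.lookup (scale_pm c x) p = c * Poly_Mapping.lookup x p"
  by (simp add: Poly_Mapping.map.rep_eq when_def)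

lemma keys_scale_pm: "Poly_Mapping.keys (scale_pm c x) \<subseteq> Poly_Mapping.keys x"
  by (auto simp: in_keys_iff)

lemma scale_pm_simps:
  "scale_pm c (x + y) = scale_pm c x + scale_pm c y" "scale_pm (c + d) x = scale_pm c x + scale_pm d x"
  "scale_pm c (scale_pm d x) = scale_pm (c * d) x" "scale_pm 1 x = x" "scale_pm 0 x = 0"
  "scale_pm c (x - y) = scale_pm c x - scale_pm c y" "scale_pm (- 1) x = - x" "scale_pm c 0 = 0"
  "scale_pm c (Poly_Mapping.single p d) = Poly_Mapping.single p (c * d)"
  by (rule poly_mapping_eqI; simp add: lookup_add lookup_minus algebra_simps lookup_single when_def)+

context calgebra
begin

lemma linear_ext_eq_finsum:
  assumes "finite S" "Poly_Mapping.keys x \<subseteq> S" "\<phi> \<in> S \<rightarrow> carrier A"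
  shows "linear_ext A \<phi> x = (\<Oplus>p\<in>S. Poly_Mapping.lookup x p \<odot> \<phi> p)"
  unfolding linear_ext_def using assms
  by (intro add.finprod_mono_neutral_cong_left)
     (auto simp: not_in_keys_iff_lookup_eq_zero Pi_def)

lemma linear_ext_closed:
  assumes "Poly_Mapping.keys x \<subseteq> K" "\<phi> \<in> K \<rightarrow> carrier A"
  shows "linear_ext A \<phi> x \<in> carrier A"
  unfolding linear_ext_def using assms by (intro finsum_closed) (auto simp: Pi_def)

lemma linear_ext_zero [simp]: "linear_ext A \<phi> 0 = \<zero>"
  by (simp add: linear_ext_def)

lemma linear_ext_single: "\<phi> p \<in> carrier A \<Longrightarrow> linear_ext A \<phi> (Poly_Mapping.single p c) = c \<odot> \<phi> p"
  by (subst linear_ext_eq_finsum[of "{p}"]) auto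

lemma linear_ext_add:
  assumes "Poly_Mapping.keys x \<subseteq> K" "Poly_Mapping.keys y \<subseteq> K" "\<phi> \<in> K \<rightarrow> carrier A"
  shows "linear_ext A \<phi> (x + y) = linear_ext A \<phi> x \<oplus> linear_ext A \<phi> y"
proof -
  let ?S = "Poly_Mapping.keys x \<union> Poly_Mapping.keys y"
  have "Poly_Mapping.keys (x + y) \<subseteq> ?S" by (rule Poly_Mapping.keys_add)
  moreover have c: "\<phi> \<in> ?S \<rightarrow> carrier A" using assms by auto
  ultimately have "linear_ext A \<phi> (x + y) = (\<Oplus>p\<in>?S. Poly_Mapping.lookup (x + y) p \<odot> \<phi> p)"
    by (intro linear_ext_eq_finsum) auto
  also have "\<dots> = (\<Oplus>p\<in>?S. Poly_Mapping.lookup x p \<odot> \<phi> p \<oplus> Poly_Mapping.lookup y p \<odot> \<phi> p)"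
    using c by (intro finsum_cong') (auto simp: lookup_add Pi_def intro!: smult_add_left)
  also have "\<dots> = (\<Oplus>p\<in>?S. Poly_Mapping.lookup x p \<odot> \<phi> p) \<oplus> (\<Oplus>p\<in>?S. Poly_Mapping.lookup y p \<odot> \<phi> p)"
    using c by (intro finsum_addf) auto
  also have "\<dots> = linear_ext A \<phi> x \<oplus> linear_ext A \<phi> y"
    using c by (simp add: linear_ext_eq_finsum[of ?S])
  finally show ?thesis .
qed

lemma linear_ext_smult:
  assumes "Poly_Mapping.keys x \<subseteq> K" "\<phi> \<in> K \<rightarrow> carrier A"
  shows "linear_ext A \<phi> (scale_pm c x) = c \<odot> linear_ext A \<phi> x"
proof -
  have c: "\<phi> \<in> Poly_Mapping.keys x \<rightarrow> carrier A" using assms by auto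
  have "linear_ext A \<phi> (scale_pm c x) = (\<Oplus>p\<in>Poly_Mapping.keys x. c \<odot> (Poly_Mapping.lookup x p \<odot> \<phi> p))"
    by (subst linear_ext_eq_finsum[OF _ keys_scale_pm c])
       (use c in \<open>auto simp: smult_smult Pi_def intro!: finsum_cong'\<close>)
  then show ?thesis unfolding linear_ext_def using c by (subst smult_finsum) (auto simp: Pi_def)
qed

lemma linear_ext_uminus:
  assumes "Poly_Mapping.keys x \<subseteq> K" "\<phi> \<in> K \<rightarrow> carrier A"
  shows "linear_ext A \<phi> (- x) = \<ominus> linear_ext A \<phi> x"
  using linear_ext_smult[OF assms, of "- 1"] linear_ext_closed[OF assms]
  by (simp add: scale_pm_simps smult_minus)

lemma linear_ext_diff:
  assumes "Poly_Mapping.keys x \<subseteq> K" "Poly_Mapping.keys y \<subseteq> K" "\<phi> \<in> K \<rightarrow> carrier A"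
  shows "linear_ext A \<phi> (x - y) = linear_ext A \<phi> x \<ominus> linear_ext A \<phi> y"
  using linear_ext_add[of x K "- y" \<phi>] linear_ext_uminus[of y K \<phi>] assms by (simp add: a_minus_def)

lemma linear_ext_sum:
  assumes "finite S" "\<And>i. i \<in> S \<Longrightarrow> Poly_Mapping.keys (f i) \<subseteq> K" "\<phi> \<in> K \<rightarrow> carrier A"
  shows "linear_ext A \<phi> (sum f S) = (\<Oplus>i\<in>S. linear_ext A \<phi> (f i))"
  using assms(1,2)
proof (induction S rule: finite_induct)
  case (insert i S)
  then have c: "(\<lambda>i. linear_ext A \<phi> (f i)) \<in> S \<rightarrow> carrier A" "linear_ext A \<phi> (f i) \<in> carrier A"
    using linear_ext_closed[OF _ assms(3)] by (auto simp: Pi_def)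
  have "linear_ext A \<phi> (f i + sum f S) = linear_ext A \<phi> (f i) \<oplus> linear_ext A \<phi> (sum f S)"
    by (rule linear_ext_add[OF _ _ assms(3)]) (use insert in \<open>auto intro!: keys_sum_subset\<close>)
  with insert c show ?case by simp
qed simp

lemma linear_ext_cong:
  assumes "Poly_Mapping.keys x \<subseteq> K" "\<phi> \<in> K \<rightarrow> carrier A" "\<And>p. p \<in> K \<Longrightarrow> \<psi> p = \<phi> p"
  shows "linear_ext A \<psi> x = linear_ext A \<phi> x"
  unfolding linear_ext_def using assms by (intro finsum_cong') (auto simp: Pi_def subset_iff)

end

section \<open>Monoid algebras\<close>

lemma monoid_algebra_simps [simp]:
  "carrier (monoid_algebra G) = {x. Poly_Mapping.keys x \<subseteq> carrier G}"
  "one (monoid_algebra G) = Poly_Mapping.single \<one>\<^bsub>G\<^esub> 1" "zero (monoid_algebra G) = 0"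
  "add (monoid_algebra G) = (+)" "smult (monoid_algebra G) = scale_pm"
  by (simp_all add: monoid_algebra_def)

context
  fixes G :: "('a, 'm) monoid_scheme" (structure)
begin

text \<open>The summation ranges may be any finite sets containing the supports, which puts the
  products of several elements on a common range.\<close>

lemma monoid_algebra_mult:
  assumes "finite S" "finite T" "Poly_Mapping.keys x \<subseteq> S" "Poly_Mapping.keys y \<subseteq> T"
  shows "x \<otimes>\<^bsub>monoid_algebra G\<^esub> y = (\<Sum>p\<in>S. \<Sum>r\<in>T.
    Poly_Mapping.single (p \<otimes> r) (Poly_Mapping.lookup x p * Poly_Mapping.lookup y r))"
proof -
  have "(\<Sum>r\<in>Poly_Mapping.keys y. Poly_Mapping.single (p \<otimes> r) (Poly_Mapping.lookup x p * Poly_Mapping.lookup y r)) =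
      (\<Sum>r\<in>T. Poly_Mapping.single (p \<otimes> r) (Poly_Mapping.lookup x p * Poly_Mapping.lookup y r))" for p
    using assms by (intro sum.mono_neutral_left) (auto simp: not_in_keys_iff_lookup_eq_zero)
  moreover have "(\<Sum>p\<in>Poly_Mapping.keys x. \<Sum>r\<in>T. Poly_Mapping.single (p \<otimes> r) (Poly_Mapping.lookup x p * Poly_Mapping.lookup y r)) =
      (\<Sum>p\<in>S. \<Sum>r\<in>T. Poly_Mapping.single (p \<otimes> r) (Poly_Mapping.lookup x p * Poly_Mapping.lookup y r))"
    using assms by (intro sum.mono_neutral_left) (auto simp: not_in_keys_iff_lookup_eq_zero)
  ultimately show ?thesis by (simp add: monoid_algebra_def)
qed

lemma monoid_algebra_mult_add:
  "(x + y) \<otimes>\<^bsub>monoid_algebra G\<^esub> z = x \<otimes>\<^bsub>monoid_algebra G\<^esub> z + y \<otimes>\<^bsub>monoid_algebra G\<^esub> z"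
  "z \<otimes>\<^bsub>monoid_algebra G\<^esub> (x + y) = z \<otimes>\<^bsub>monoid_algebra G\<^esub> x + z \<otimes>\<^bsub>monoid_algebra G\<^esub> y"
proof -
  let ?S = "Poly_Mapping.keys x \<union> Poly_Mapping.keys y" and ?T = "Poly_Mapping.keys z"
  have S: "Poly_Mapping.keys (x + y) \<subseteq> ?S" by (rule Poly_Mapping.keys_add)
  show "(x + y) \<otimes>\<^bsub>monoid_algebra G\<^esub> z = x \<otimes>\<^bsub>monoid_algebra G\<^esub> z + y \<otimes>\<^bsub>monoid_algebra G\<^esub> z"
    using S by (subst (1 2 3) monoid_algebra_mult[of ?S ?T])
      (auto simp: lookup_add algebra_simps single_add sum.distrib)
  show "z \<otimes>\<^bsub>monoid_algebra G\<^esub> (x + y) = z \<otimes>\<^bsub>monoid_algebra G\<^esub> x + z \<otimes>\<^bsub>monoid_algebra G\<^esub> y"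
    using S by (subst (1 2 3) monoid_algebra_mult[of ?T ?S])
      (auto simp: lookup_add algebra_simps single_add sum.distrib)
qed

lemma monoid_algebra_mult_zero:
  "0 \<otimes>\<^bsub>monoid_algebra G\<^esub> z = 0" "z \<otimes>\<^bsub>monoid_algebra G\<^esub> 0 = 0"
  by (simp_all add: monoid_algebra_def)

lemma monoid_algebra_mult_single:
  "Poly_Mapping.single p c \<otimes>\<^bsub>monoid_algebra G\<^esub> Poly_Mapping.single r d = Poly_Mapping.single (p \<otimes> r) (c * d)"
  by (subst monoid_algebra_mult[of "{p}" "{r}"]) auto

lemma monoid_algebra_mult_sum:
  "sum f S \<otimes>\<^bsub>monoid_algebra G\<^esub> z = (\<Sum>i\<in>S. f i \<otimes>\<^bsub>monoid_algebra G\<^esub> z)"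
  "z \<otimes>\<^bsub>monoid_algebra G\<^esub> sum f S = (\<Sum>i\<in>S. z \<otimes>\<^bsub>monoid_algebra G\<^esub> f i)"
  by (induction S rule: infinite_finite_induct) (simp_all add: monoid_algebra_mult_zero monoid_algebra_mult_add)

lemma monoid_algebra_mult_scale:
  "scale_pm c x \<otimes>\<^bsub>monoid_algebra G\<^esub> y = scale_pm c (x \<otimes>\<^bsub>monoid_algebra G\<^esub> y)"
  "x \<otimes>\<^bsub>monoid_algebra G\<^esub> scale_pm c y = scale_pm c (x \<otimes>\<^bsub>monoid_algebra G\<^esub> y)"
proof -
  have s: "scale_pm c (sum f S) = (\<Sum>i\<in>S. scale_pm c (f i))" for f and S :: "'b set"
    by (induction S rule: infinite_finite_induct) (simp_all add: scale_pm_simps)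
  show "scale_pm c x \<otimes>\<^bsub>monoid_algebra G\<^esub> y = scale_pm c (x \<otimes>\<^bsub>monoid_algebra G\<^esub> y)"
    using keys_scale_pm[of c x]
    by (subst (1 2) monoid_algebra_mult[of "Poly_Mapping.keys x" "Poly_Mapping.keys y"])
       (auto simp: s scale_pm_simps mult_ac)
  show "x \<otimes>\<^bsub>monoid_algebra G\<^esub> scale_pm c y = scale_pm c (x \<otimes>\<^bsub>monoid_algebra G\<^esub> y)"
    using keys_scale_pm[of c y]
    by (subst (1 2) monoid_algebra_mult[of "Poly_Mapping.keys x" "Poly_Mapping.keys y"])
       (auto simp: s scale_pm_simps mult_ac)
qed

end

locale monoid_alg = Group.monoid G for G :: "('a, 'm) monoid_scheme" (structure)
begin

lemma mult_closed:
  "Poly_Mapping.keys x \<subseteq> carrier G \<Longrightarrow> Poly_Mapping.keys y \<subseteq> carrier G \<Longrightarrow>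
    Poly_Mapping.keys (x \<otimes>\<^bsub>monoid_algebra G\<^esub> y) \<subseteq> carrier G"
  unfolding monoid_algebra_def by (auto intro!: keys_sum_subset m_closed split: if_splits)

lemma mult_one:
  assumes "Poly_Mapping.keys x \<subseteq> carrier G"
  shows "Poly_Mapping.single \<one> 1 \<otimes>\<^bsub>monoid_algebra G\<^esub> x = x" "x \<otimes>\<^bsub>monoid_algebra G\<^esub> Poly_Mapping.single \<one> 1 = x"
  using assms
  by (induction x rule: pm_induct)
     (simp_all add: monoid_algebra_mult_zero monoid_algebra_mult_single monoid_algebra_mult_add)

lemma mult_assoc:
  assumes "Poly_Mapping.keys x \<subseteq> carrier G" "Poly_Mapping.keys y \<subseteq> carrier G" "Poly_Mapping.keys z \<subseteq> carrier G"
  shows "(x \<otimes>\<^bsub>monoid_algebra G\<^esub> y) \<otimes>\<^bsub>monoid_algebra G\<^esub> z = x \<otimes>\<^bsub>monoid_algebra G\<^esub> (y \<otimes>\<^bsub>monoid_algebra G\<^esub> z)"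
  using assms(1)
proof (induction x rule: pm_induct)
  case (single p c)
  show ?case using assms(2)
  proof (induction y rule: pm_induct)
    case (single p' c')
    show ?case using assms(3)
      by (induction z rule: pm_induct)
         (use single \<open>p \<in> carrier G\<close> in \<open>simp_all add: monoid_algebra_mult_zero monoid_algebra_mult_single
            monoid_algebra_mult_add m_assoc mult.assoc\<close>)
  qed (simp_all add: monoid_algebra_mult_zero monoid_algebra_mult_add)
qed (simp_all add: monoid_algebra_mult_zero monoid_algebra_mult_add)

lemma complex_algebra_monoid_algebra: "complex_algebra (monoid_algebra G)"
proof -
  let ?R = "monoid_algebra G"
  have k: "Poly_Mapping.keys (- x) \<subseteq> carrier G" if "Poly_Mapping.keys x \<subseteq> carrier G" for x :: "'a \<Rightarrow>\<^sub>0 complex"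
    using that by (auto simp: in_keys_iff)
  have ka: "Poly_Mapping.keys (x + y) \<subseteq> carrier G"
    if "Poly_Mapping.keys x \<subseteq> carrier G" "Poly_Mapping.keys y \<subseteq> carrier G" for x y :: "'a \<Rightarrow>\<^sub>0 complex"
    using that Poly_Mapping.keys_add[of x y] by auto
  have ag: "abelian_group ?R"
  proof (rule abelian_groupI)
    fix x assume "x \<in> carrier ?R"
    then show "\<exists>y\<in>carrier ?R. y \<oplus>\<^bsub>?R\<^esub> x = \<zero>\<^bsub>?R\<^esub>"
      by (intro bexI[of _ "- x"]) (use k in auto)
  qed (use ka in \<open>simp_all add: add_ac\<close>)
  have r: "ring ?R"
  proof (rule ringI[OF ag])
    show "Group.monoid ?R"
      by (rule monoidI) (use mult_closed in \<open>simp_all add: mult_one mult_assoc\<close>)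
  qed (simp_all add: monoid_algebra_mult_add)
  have "Module.module complex_ring ?R"
    by (rule moduleI[OF cring_complex ag])
       (simp_all add: scale_pm_simps subset_trans[OF keys_scale_pm])
  with r show ?thesis
    by (simp add: complex_algebra_def monoid_algebra_mult_scale)
qed

end

section \<open>Presented algebras and tensor products\<close>

lemma (in calgebra) linear_ext_mult:
  assumes "Group.monoid G" and \<phi>: "\<phi> \<in> carrier G \<rightarrow> carrier A"
    and m: "\<And>p r. p \<in> carrier G \<Longrightarrow> r \<in> carrier G \<Longrightarrow> \<phi> (p \<otimes>\<^bsub>G\<^esub> r) = \<phi> p \<otimes> \<phi> r"
    and x: "Poly_Mapping.keys x \<subseteq> carrier G" and y: "Poly_Mapping.keys y \<subseteq> carrier G"
  shows "linear_ext A \<phi> (x \<otimes>\<^bsub>monoid_algebra G\<^esub> y) = linear_ext A \<phi> x \<otimes> linear_ext A \<phi> y"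
proof -
  interpret G: monoid_alg G using assms(1) by (simp add: monoid_alg_def)
  note cl = linear_ext_closed[OF _ \<phi>]
  note mc = G.mult_closed
  have s: "linear_ext A \<phi> (Poly_Mapping.single p c) = c \<odot> \<phi> p" if "p \<in> carrier G" for p c
    using that \<phi> by (intro linear_ext_single) auto
  have k: "Poly_Mapping.keys (Poly_Mapping.single p c) \<subseteq> carrier G" if "p \<in> carrier G" for p and c :: complex
    using that by auto
  show ?thesis using x
  proof (induction x rule: pm_induct)
    case (single p c)
    show ?case using y
    proof (induction y rule: pm_induct)
      case (single r d)
      have "\<phi> p \<in> carrier A" "\<phi> r \<in> carrier A" using \<phi> \<open>p \<in> _\<close> single by auto
      then show ?case
        using \<open>p \<in> _\<close> single
        by (simp add: monoid_algebra_mult_single s m smult_mult_left smult_mult_right smult_smult mult.commute)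
    next
      case (add y z)
      then show ?case using \<open>p \<in> _\<close>
        by (simp add: monoid_algebra_mult_add linear_ext_add[OF _ _ \<phi>] mc k cl r_distr)
    qed (use \<open>p \<in> _\<close> k cl in \<open>simp add: monoid_algebra_mult_zero\<close>)
  next
    case (add w z)
    then show ?case
      using y by (simp add: monoid_algebra_mult_add linear_ext_add[OF _ _ \<phi>] mc cl l_distr)
  qed (use y cl in \<open>simp add: monoid_algebra_mult_zero\<close>)
qed

text \<open>The common shape of the two quotients in play: words modulo the relations of the general
  linear group, and pairs of homogeneous elements modulo the tensor relations. \<open>Q\<close> may
  carry further record fields, such as a grading, hence \<open>same_algebra\<close>.\<close>

locale presented = monoid_alg G
  for G :: "('g, 'm) monoid_scheme" +
  fixes I :: "('g \<Rightarrow>\<^sub>0 complex) set" and Q :: "(complex, ('g \<Rightarrow>\<^sub>0 complex) set, 'k) module_scheme"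
  assumes ideal: "ideal I (monoid_algebra G)"
    and same_quot: "same_algebra Q (quot_algebra (monoid_algebra G) I)"
begin

definition cover :: "('g \<Rightarrow>\<^sub>0 complex) set"
  where "cover = carrier (monoid_algebra G)"

lemma cover_iff: "x \<in> cover \<longleftrightarrow> Poly_Mapping.keys x \<subseteq> carrier G"
  by (simp add: cover_def)

definition cl :: "('g \<Rightarrow>\<^sub>0 complex) \<Rightarrow> ('g \<Rightarrow>\<^sub>0 complex) set"
  where "cl x = I +>\<^bsub>monoid_algebra G\<^esub> x"

lemma R: "complex_algebra (monoid_algebra G)"
  by (rule complex_algebra_monoid_algebra)

lemma I_cover: "I \<subseteq> cover"
  using ideal.Icarr[OF ideal] by (auto simp: cover_def)

lemma I_keys: "i \<in> I \<Longrightarrow> Poly_Mapping.keys i \<subseteq> carrier G"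
  using I_cover cover_iff by blast

lemma I_zero: "0 \<in> I" and I_add: "x \<in> I \<Longrightarrow> y \<in> I \<Longrightarrow> x + y \<in> I"
  using additive_subgroup.zero_closed[OF ideal.axioms(1)[OF ideal]]
    additive_subgroup.a_closed[OF ideal.axioms(1)[OF ideal]] by auto

lemma I_mult_left: "x \<in> cover \<Longrightarrow> i \<in> I \<Longrightarrow> x \<otimes>\<^bsub>monoid_algebra G\<^esub> i \<in> I"
  and I_mult_right: "x \<in> cover \<Longrightarrow> i \<in> I \<Longrightarrow> i \<otimes>\<^bsub>monoid_algebra G\<^esub> x \<in> I"
  unfolding cover_def using ideal.I_l_closed[OF ideal] ideal.I_r_closed[OF ideal] by auto

text \<open>A ring ideal is closed under scalars, because scaling by c is multiplication by c times
  the unit.\<close>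

lemma I_scale: "i \<in> I \<Longrightarrow> scale_pm c i \<in> I"
proof -
  assume i: "i \<in> I"
  have "scale_pm c (Poly_Mapping.single \<one>\<^bsub>G\<^esub> 1) \<otimes>\<^bsub>monoid_algebra G\<^esub> i = scale_pm c i"
    unfolding monoid_algebra_mult_scale by (subst mult_one(1)[OF I_keys[OF i]]) (rule refl)
  moreover have "scale_pm c (Poly_Mapping.single \<one>\<^bsub>G\<^esub> 1) \<in> cover"
    by (simp add: cover_iff scale_pm_simps)
  ultimately show ?thesis using I_mult_left[OF _ i] by metis
qed

lemma I_uminus: "i \<in> I \<Longrightarrow> - i \<in> I" and I_diff: "i \<in> I \<Longrightarrow> j \<in> I \<Longrightarrow> i - j \<in> I"
proof -
  show *: "i \<in> I \<Longrightarrow> - i \<in> I" for i using I_scale[of i "- 1"] by (simp add: scale_pm_simps)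
  show "i \<in> I \<Longrightarrow> j \<in> I \<Longrightarrow> i - j \<in> I" using I_add[of i "- j"] * by simp
qed

lemma cl_mem: "y \<in> cl x \<longleftrightarrow> y - x \<in> I"
  unfolding cl_def a_r_coset_def' by (auto simp: algebra_simps) (metis diff_add_cancel)

lemma cl_eq_iff: "cl x = cl y \<longleftrightarrow> x - y \<in> I"
proof
  assume "cl x = cl y"
  moreover have "x \<in> cl x" by (simp add: cl_mem I_zero)
  ultimately show "x - y \<in> I" by (simp add: cl_mem)
next
  assume xy: "x - y \<in> I"
  have "z - x \<in> I \<longleftrightarrow> z - y \<in> I" for z
    using I_add[OF xy, of "z - x"] I_diff[of "z - y", OF _ xy] by auto
  then show "cl x = cl y" by (auto simp: set_eq_iff cl_mem)
qed

lemma cl_self: "x \<in> cl x"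
  by (simp add: cl_mem I_zero)

lemma Q_carrier: "carrier Q = cl ` cover"
  and Q_one: "\<one>\<^bsub>Q\<^esub> = cl (Poly_Mapping.single \<one>\<^bsub>G\<^esub> 1)"
  and Q_zero: "\<zero>\<^bsub>Q\<^esub> = cl 0"
proof -
  have q: "carrier Q = carrier (quot_algebra (monoid_algebra G) I)"
    "one Q = one (quot_algebra (monoid_algebra G) I)" "zero Q = zero (quot_algebra (monoid_algebra G) I)"
    using same_quot by (auto simp: same_algebra_def)
  show "carrier Q = cl ` cover"
    unfolding q quot_algebra_def ring.defs module.defs FactRing_def A_RCOSETS_def' cl_def cover_def by auto
  show "\<one>\<^bsub>Q\<^esub> = cl (Poly_Mapping.single \<one>\<^bsub>G\<^esub> 1)"
    unfolding q quot_algebra_def ring.defs module.defs FactRing_def cl_def by simp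
  show "\<zero>\<^bsub>Q\<^esub> = cl 0"
    unfolding q quot_algebra_def ring.defs module.defs FactRing_def
    by (auto simp: cl_mem)
qed

lemma Q_ops:
  assumes "x \<in> cover" "y \<in> cover"
  shows "cl x \<otimes>\<^bsub>Q\<^esub> cl y = cl (x \<otimes>\<^bsub>monoid_algebra G\<^esub> y)"
    and "cl x \<oplus>\<^bsub>Q\<^esub> cl y = cl (x + y)"
    and "c \<odot>\<^bsub>Q\<^esub> cl x = cl (scale_pm c x)"
proof -
  have q: "mult Q = mult (quot_algebra (monoid_algebra G) I)"
    "add Q = add (quot_algebra (monoid_algebra G) I)" "smult Q = smult (quot_algebra (monoid_algebra G) I)"
    using same_quot by (auto simp: same_algebra_def)
  show "cl x \<otimes>\<^bsub>Q\<^esub> cl y = cl (x \<otimes>\<^bsub>monoid_algebra G\<^esub> y)"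
    unfolding q cl_def quot_algebra_def ring.defs module.defs FactRing_def
    using ideal.rcoset_mult_add[OF ideal, of x y] assms by (simp add: cover_iff)
  show "cl x \<oplus>\<^bsub>Q\<^esub> cl y = cl (x + y)"
    unfolding q cl_def quot_algebra_def ring.defs module.defs FactRing_def
    using abelian_subgroup.a_rcos_sum[OF abelian_subgroupI3[OF ideal.axioms(1)[OF ideal]], of x y]
      ring.is_abelian_group[OF ideal.axioms(2)[OF ideal]] assms by (simp add: cover_iff)
  have "(\<Union>y\<in>cl x. cl (scale_pm c y)) = cl (scale_pm c x)"
  proof -
    have "cl (scale_pm c y) = cl (scale_pm c x)" if "y \<in> cl x" for y
      using I_scale[of "y - x" c] that unfolding cl_eq_iff cl_mem scale_pm_simps by blast
    then have "(\<lambda>y. cl (scale_pm c y)) ` cl x = {cl (scale_pm c x)}" using cl_self by blast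
    then show ?thesis by simp
  qed
  then show "c \<odot>\<^bsub>Q\<^esub> cl x = cl (scale_pm c x)"
    unfolding q cl_def quot_algebra_def ring.defs module.defs FactRing_def by simp
qed

lemma cover_closed:
  "0 \<in> cover" "Poly_Mapping.single \<one>\<^bsub>G\<^esub> c \<in> cover" "p \<in> carrier G \<Longrightarrow> Poly_Mapping.single p c \<in> cover"
  "x \<in> cover \<Longrightarrow> - x \<in> cover"
  by (auto simp: cover_iff in_keys_iff)

lemma cover_add: "x \<in> cover \<Longrightarrow> y \<in> cover \<Longrightarrow> x + y \<in> cover"
  using Poly_Mapping.keys_add[of x y] unfolding cover_iff by blast

lemma cover_scale: "x \<in> cover \<Longrightarrow> scale_pm c x \<in> cover"
  using keys_scale_pm[of c x] unfolding cover_iff by blast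

lemma cover_mult: "x \<in> cover \<Longrightarrow> y \<in> cover \<Longrightarrow> x \<otimes>\<^bsub>monoid_algebra G\<^esub> y \<in> cover"
  using mult_closed[of x y] unfolding cover_iff by blast

lemmas cover_closed' = cover_add cover_scale cover_mult

lemma complex_algebra_Q: "complex_algebra Q"
proof -
  have same: "same_algebra Q (quot_algebra (monoid_algebra G) I)" by (rule same_quot)
  then have r: "ring Q"
    by (intro ring_fields_cong[OF ideal.quotient_is_ring[OF ideal]])
       (auto simp: same_algebra_def quot_algebra_def ring.defs module.defs)
  interpret Q: ring Q by (rule r)
  have "Module.module complex_ring Q"
    by (rule moduleI[OF cring_complex Q.abelian_group_axioms])
       (auto simp: Q_carrier Q_ops cover_closed cover_closed' scale_pm_simps)
  with r show ?thesis
    by (auto simp: complex_algebra_def Q_carrier Q_ops cover_closed cover_closed' monoid_algebra_mult_scale)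
qed

sublocale Q: calgebra Q
  by unfold_locales (rule complex_algebra_Q)

lemma cl_closed: "x \<in> cover \<Longrightarrow> cl x \<in> carrier Q"
  by (auto simp: Q_carrier)

lemma cl_sum:
  "(\<And>i. i \<in> S \<Longrightarrow> f i \<in> cover) \<Longrightarrow> cl (sum f S) = (\<Oplus>\<^bsub>Q\<^esub>i\<in>S. cl (f i))"
proof (induction S rule: infinite_finite_induct)
  case (insert i S)
  then have "sum f S \<in> cover" unfolding cover_iff by (intro keys_sum_subset) auto
  moreover have "(\<lambda>i. cl (f i)) \<in> S \<rightarrow> carrier Q" using insert by (auto intro: cl_closed)
  ultimately show ?case using insert by (simp add: Q_ops(2)[symmetric] cl_closed)
qed (simp_all add: Q_zero)

text \<open>A linear map that kills the ideal is constant on each coset, so \<open>descend\<close>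
  finds exactly one value.\<close>

lemma descend_linear_ext:
  assumes "calgebra V" "\<phi> \<in> carrier G \<rightarrow> carrier V"
    and kill: "\<And>i. i \<in> I \<Longrightarrow> linear_ext V \<phi> i = \<zero>\<^bsub>V\<^esub>" and x: "x \<in> cover"
  shows "descend (linear_ext V \<phi>) (cl x) = linear_ext V \<phi> x"
proof -
  interpret V: calgebra V by fact
  have x': "Poly_Mapping.keys x \<subseteq> carrier G" using x unfolding cover_iff .
  have "linear_ext V \<phi> y = linear_ext V \<phi> x" if "y \<in> cl x" for y
  proof -
    have y: "y - x \<in> I" using that unfolding cl_mem .
    have "linear_ext V \<phi> ((y - x) + x) = linear_ext V \<phi> (y - x) \<oplus>\<^bsub>V\<^esub> linear_ext V \<phi> x"
      by (rule V.linear_ext_add[OF I_keys[OF y] x' assms(2)])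
    also have "\<dots> = linear_ext V \<phi> x"
      unfolding kill[OF y] using V.linear_ext_closed[OF x' assms(2)] by (rule V.l_zero)
    finally show ?thesis unfolding diff_add_cancel .
  qed
  then have "linear_ext V \<phi> ` cl x = {linear_ext V \<phi> x}" using cl_self by blast
  then show ?thesis by (simp add: descend_def)
qed

end

text \<open>The part of the h-algebra axioms that passes to tensor products by direct computation.
  Directness of the grading and the homomorphism and injectivity properties of the moment maps are
  established separately for the algebra of the general linear group.\<close>

locale pre_h_alg = calgebra A
  for A :: "('n::finite, 'a, 'm) h_alg_scheme" (structure) +
  assumes grade_submodule: "submodule (grade A \<alpha> \<beta>) complex_ring A"
    and one_grade: "\<one> \<in> grade A 0 0"
    and mult_grade: "x \<in> grade A \<alpha> \<beta> \<Longrightarrow> y \<in> grade A \<gamma> \<delta> \<Longrightarrow> x \<otimes> y \<in> grade A (\<alpha> + \<gamma>) (\<beta> + \<delta>)"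
    and mu_grade: "mu_l A f \<in> grade A 0 0" "mu_r A f \<in> grade A 0 0"
    and mu_l_commute: "x \<in> grade A \<alpha> \<beta> \<Longrightarrow> mu_l A f \<otimes> x = x \<otimes> mu_l A (mero_shift \<alpha> f)"
    and mu_r_commute: "x \<in> grade A \<alpha> \<beta> \<Longrightarrow> mu_r A f \<otimes> x = x \<otimes> mu_r A (mero_shift \<beta> f)"
begin

lemma grade_carrier: "x \<in> grade A \<alpha> \<beta> \<Longrightarrow> x \<in> carrier A"
  and grade_add: "x \<in> grade A \<alpha> \<beta> \<Longrightarrow> y \<in> grade A \<alpha> \<beta> \<Longrightarrow> x \<oplus> y \<in> grade A \<alpha> \<beta>"
  and grade_smult: "x \<in> grade A \<alpha> \<beta> \<Longrightarrow> c \<odot> x \<in> grade A \<alpha> \<beta>"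
  using Module.module.submoduleE(1,4,5)[OF module grade_submodule[of \<alpha> \<beta>]] by auto

lemma grade_zero: "\<zero> \<in> grade A \<alpha> \<beta>"
proof -
  obtain x where "x \<in> grade A \<alpha> \<beta>"
    using Module.module.submoduleE(2)[OF module grade_submodule[of \<alpha> \<beta>]] by auto
  then show ?thesis using grade_smult[of x \<alpha> \<beta> 0] grade_carrier by simp
qed

lemma grade_finsum: "(\<And>i. i \<in> S \<Longrightarrow> f i \<in> grade A \<alpha> \<beta>) \<Longrightarrow> finsum A f S \<in> grade A \<alpha> \<beta>"
proof (induction S rule: infinite_finite_induct)
  case (insert i S)
  then show ?case by (subst finsum_insert) (auto intro: grade_add grade_carrier)
qed (simp_all add: grade_zero)

lemma mult_grade': "x \<in> grade A \<alpha> \<beta> \<Longrightarrow> y \<in> grade A \<gamma> \<delta> \<Longrightarrow> \<alpha> + \<gamma> = \<alpha>' \<Longrightarrow> \<beta> + \<delta> = \<beta>' \<Longrightarrow> x \<otimes> y \<in> grade A \<alpha>' \<beta>'"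
  using mult_grade by blast

lemma mult_mu_l: "x \<in> grade A \<alpha> \<beta> \<Longrightarrow> x \<otimes> mu_l A f = mu_l A (mero_shift (- \<alpha>) f) \<otimes> x"
  and mult_mu_r: "x \<in> grade A \<alpha> \<beta> \<Longrightarrow> x \<otimes> mu_r A f = mu_r A (mero_shift (- \<beta>) f) \<otimes> x"
  by (simp_all add: mu_l_commute[of x \<alpha> \<beta>] mu_r_commute[of x \<alpha> \<beta>])

lemma mu_mult_grade: "x \<in> grade A \<alpha> \<beta> \<Longrightarrow> mu_l A f \<otimes> x \<in> grade A \<alpha> \<beta>" "x \<in> grade A \<alpha> \<beta> \<Longrightarrow> mu_r A f \<otimes> x \<in> grade A \<alpha> \<beta>"
  using mult_grade'[OF mu_grade(1)] mult_grade'[OF mu_grade(2)] by auto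

lemma mu_carrier [simp]: "mu_l A f \<in> carrier A" "mu_r A f \<in> carrier A"
  using mu_grade grade_carrier by blast+

end

section \<open>The tensor product of two graded algebras\<close>

lemma scale_pm_module: "Modules.module (scale_pm :: complex \<Rightarrow> ('a \<Rightarrow>\<^sub>0 complex) \<Rightarrow> _)"
  by unfold_locales (simp_all add: scale_pm_simps)

abbreviation pair_monoid :: "('n::finite, 'a, 'm) h_alg_scheme \<Rightarrow> ('n, 'b, 'k) h_alg_scheme \<Rightarrow> ('a \<times> 'b) monoid"
  where "pair_monoid A B \<equiv> \<lparr>carrier = composable A B,
    mult = (\<lambda>(a, b) (c, d). (a \<otimes>\<^bsub>A\<^esub> c, b \<otimes>\<^bsub>B\<^esub> d)), one = (\<one>\<^bsub>A\<^esub>, \<one>\<^bsub>B\<^esub>)\<rparr>"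

lemma composableI: "a \<in> grade A \<alpha> \<gamma> \<Longrightarrow> b \<in> grade B \<gamma> \<beta> \<Longrightarrow> (a, b) \<in> composable A B"
  by (auto simp: composable_def)

locale h_alg_pair = A: pre_h_alg A + B: pre_h_alg B
  for A :: "('n::finite, 'a, 'm) h_alg_scheme" and B :: "('n, 'b, 'k) h_alg_scheme"
begin

lemma pair_monoid: "Group.monoid (pair_monoid A B)"
proof (rule monoidI)
  let ?G = "pair_monoid A B"
  fix x y z assume "x \<in> carrier ?G" "y \<in> carrier ?G" "z \<in> carrier ?G"
  then obtain a b a' b' a'' b'' \<alpha> \<gamma> \<beta> \<alpha>' \<gamma>' \<beta>' where *: "x = (a, b)" "y = (a', b')" "z = (a'', b'')"
    "a \<in> grade A \<alpha> \<gamma>" "b \<in> grade B \<gamma> \<beta>" "a' \<in> grade A \<alpha>' \<gamma>'" "b' \<in> grade B \<gamma>' \<beta>'"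
    "a'' \<in> carrier A" "b'' \<in> carrier B"
    using A.grade_carrier B.grade_carrier by (auto simp: composable_def)
  have "(a \<otimes>\<^bsub>A\<^esub> a', b \<otimes>\<^bsub>B\<^esub> b') \<in> composable A B"
    by (rule composableI[OF A.mult_grade[OF *(4,6)] B.mult_grade[OF *(5,7)]])
  then show "x \<otimes>\<^bsub>?G\<^esub> y \<in> carrier ?G" by (simp add: *)
  show "x \<otimes>\<^bsub>?G\<^esub> y \<otimes>\<^bsub>?G\<^esub> z = x \<otimes>\<^bsub>?G\<^esub> (y \<otimes>\<^bsub>?G\<^esub> z)"
    using *(4,6)[THEN A.grade_carrier] *(5,7)[THEN B.grade_carrier] * by (simp add: A.m_assoc B.m_assoc)
  show "\<one>\<^bsub>?G\<^esub> \<otimes>\<^bsub>?G\<^esub> x = x" "x \<otimes>\<^bsub>?G\<^esub> \<one>\<^bsub>?G\<^esub> = x"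
    using * A.grade_carrier B.grade_carrier by auto
qed (auto intro: composableI A.one_grade B.one_grade)

sublocale G: monoid_alg "pair_monoid A B"
  by (simp add: monoid_alg_def pair_monoid)

lemma tensor_relation_keys:
  "tensor_relation A B u v \<Longrightarrow> Poly_Mapping.keys (u - v) \<subseteq> composable A B"
proof -
  assume "tensor_relation A B u v"
  then have "Poly_Mapping.keys u \<subseteq> composable A B \<and> Poly_Mapping.keys v \<subseteq> composable A B"
  proof cases
    case (add_left a \<alpha> \<gamma> a' b \<beta>)
    then show ?thesis using Poly_Mapping.keys_add[of "pair a b" "pair a' b"] A.grade_add[of a \<alpha> \<gamma> a']
      by (auto intro: composableI)
  next
    case (add_right a \<alpha> \<gamma> b \<beta> b')
    then show ?thesis using Poly_Mapping.keys_add[of "pair a b" "pair a b'"] B.grade_add[of b \<gamma> \<beta> b']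
      by (auto intro: composableI)
  next
    case (smult_left a \<alpha> \<gamma> b \<beta> c)
    then show ?thesis using A.grade_smult[of a \<alpha> \<gamma> c] keys_scale_pm[of c "pair a b"] by (auto intro: composableI)
  next
    case (smult_right a \<alpha> \<gamma> b \<beta> c)
    then show ?thesis using B.grade_smult[of b \<gamma> \<beta> c] keys_scale_pm[of c "pair a b"] by (auto intro: composableI)
  next
    case (balanced a \<alpha> \<gamma> b \<beta> f)
    then show ?thesis using A.mu_mult_grade(2)[of a \<alpha> \<gamma> f] B.mu_mult_grade(1)[of b \<gamma> \<beta> f]
      by (auto intro: composableI)
  qed
  then show ?thesis using Poly_Mapping.keys_diff[of u v] by auto
qed

text \<open>Multiplying both sides of a tensor relation by a homogeneous pair gives a tensor
  relation of the same kind. This is what makes the span of the relations a two-sided ideal.\<close>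

lemma tensor_relation_mult:
  assumes "tensor_relation A B u v" "c \<in> grade A \<alpha>' \<gamma>'" "d \<in> grade B \<gamma>' \<beta>'"
  shows "tensor_relation A B (pair c d \<otimes>\<^bsub>tensor_cover A B\<^esub> u) (pair c d \<otimes>\<^bsub>tensor_cover A B\<^esub> v)"
    and "tensor_relation A B (u \<otimes>\<^bsub>tensor_cover A B\<^esub> pair c d) (v \<otimes>\<^bsub>tensor_cover A B\<^esub> pair c d)"
proof -
  have c: "c \<in> carrier A" "d \<in> carrier B" using assms A.grade_carrier B.grade_carrier by auto
  note simps = tensor_cover_def monoid_algebra_mult_add monoid_algebra_mult_scale monoid_algebra_mult_single
    A.l_distr A.r_distr B.l_distr B.r_distr A.smult_mult_left A.smult_mult_right B.smult_mult_left B.smult_mult_right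
    A.grade_carrier B.grade_carrier c
  note l = A.mult_grade[OF assms(2)] B.mult_grade[OF assms(3)]
  note r = A.mult_grade[OF _ assms(2)] B.mult_grade[OF _ assms(3)]
  show "tensor_relation A B (pair c d \<otimes>\<^bsub>tensor_cover A B\<^esub> u) (pair c d \<otimes>\<^bsub>tensor_cover A B\<^esub> v)"
    using assms(1)
  proof cases
    case (add_left a \<alpha> \<gamma> a' b \<beta>)
    then show ?thesis using tensor_relation.add_left[OF l(1) l(1) l(2), of a \<alpha> \<gamma> a' b \<beta>]
      by (simp add: simps)
  next
    case (add_right a \<alpha> \<gamma> b \<beta> b')
    then show ?thesis using tensor_relation.add_right[OF l(1) l(2) l(2), of a \<alpha> \<gamma> b \<beta> b'] by (simp add: simps)
  next
    case (smult_left a \<alpha> \<gamma> b \<beta> e)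
    then show ?thesis using tensor_relation.smult_left[OF l(1) l(2), of a \<alpha> \<gamma> b \<beta> e] by (simp add: simps)
  next
    case (smult_right a \<alpha> \<gamma> b \<beta> e)
    then show ?thesis using tensor_relation.smult_right[OF l(1) l(2), of a \<alpha> \<gamma> b \<beta> e] by (simp add: simps)
  next
    case (balanced a \<alpha> \<gamma> b \<beta> f)
    \<comment> \<open>c and d share the middle degree \<gamma>', so moving the right moment map past
      c and the left one past d shifts f by the same amount.\<close>
    have "c \<otimes>\<^bsub>A\<^esub> (mu_r A f \<otimes>\<^bsub>A\<^esub> a) = mu_r A (mero_shift (- \<gamma>') f) \<otimes>\<^bsub>A\<^esub> (c \<otimes>\<^bsub>A\<^esub> a)"
      using c balanced A.grade_carrier A.mult_mu_r[OF assms(2), of f] by (simp flip: A.m_assoc)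
    moreover have "d \<otimes>\<^bsub>B\<^esub> (mu_l B f \<otimes>\<^bsub>B\<^esub> b) = mu_l B (mero_shift (- \<gamma>') f) \<otimes>\<^bsub>B\<^esub> (d \<otimes>\<^bsub>B\<^esub> b)"
      using c balanced B.grade_carrier B.mult_mu_l[OF assms(3), of f] by (simp flip: B.m_assoc)
    ultimately show ?thesis
      using balanced tensor_relation.balanced[OF l(1) l(2), of a \<alpha> \<gamma> b \<beta> "mero_shift (- \<gamma>') f"] by (simp add: simps)
  qed
  show "tensor_relation A B (u \<otimes>\<^bsub>tensor_cover A B\<^esub> pair c d) (v \<otimes>\<^bsub>tensor_cover A B\<^esub> pair c d)"
    using assms(1)
  proof cases
    case (add_left a \<alpha> \<gamma> a' b \<beta>)
    then show ?thesis using tensor_relation.add_left[OF r(1) r(1) r(2), of a \<alpha> \<gamma> a' b \<beta>]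
      by (simp add: simps)
  next
    case (add_right a \<alpha> \<gamma> b \<beta> b')
    then show ?thesis using tensor_relation.add_right[OF r(1) r(2) r(2), of a \<alpha> \<gamma> b \<beta> b'] by (simp add: simps)
  next
    case (smult_left a \<alpha> \<gamma> b \<beta> e)
    then show ?thesis using tensor_relation.smult_left[OF r(1) r(2), of a \<alpha> \<gamma> b \<beta> e] by (simp add: simps)
  next
    case (smult_right a \<alpha> \<gamma> b \<beta> e)
    then show ?thesis using tensor_relation.smult_right[OF r(1) r(2), of a \<alpha> \<gamma> b \<beta> e] by (simp add: simps)
  next
    case (balanced a \<alpha> \<gamma> b \<beta> f)
    then show ?thesis
      using tensor_relation.balanced[OF r(1) r(2), of a \<alpha> \<gamma> b \<beta> f] c by (simp add: simps A.m_assoc B.m_assoc)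
  qed
qed

lemma tensor_null_induct [consumes 1, case_names zero step]:
  assumes "x \<in> tensor_null A B" "P 0"
    and "\<And>c u v y. tensor_relation A B u v \<Longrightarrow> y \<in> tensor_null A B \<Longrightarrow> P y \<Longrightarrow> P (scale_pm c (u - v) + y)"
  shows "P x"
proof -
  note span = Modules.module.span_add[OF scale_pm_module] Modules.module.span_base[OF scale_pm_module]
    Modules.module.span_scale[OF scale_pm_module] Modules.module.span_zero[OF scale_pm_module]
  have "P x \<and> x \<in> tensor_null A B"
    using assms(1) unfolding tensor_null_def
  proof (induction rule: Modules.module.span_induct_alt[OF scale_pm_module, consumes 1])
    case 1
    show ?case using assms(2) span(4) by simp
  next
    case (2 c x y)
    then obtain u v where x: "x = u - v" "tensor_relation A B u v" by auto
    then have "scale_pm c x \<in> tensor_null A B" unfolding tensor_null_def by (intro span(3) span(2)) auto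
    moreover have "y \<in> tensor_null A B" "P y" using 2 by (simp_all add: tensor_null_def)
    ultimately show ?case unfolding tensor_null_def[symmetric]
      using assms(3)[OF x(2), of y c] x(1) span(1) by (auto simp: tensor_null_def)
  qed
  then show ?thesis ..
qed

lemma tensor_null_closed:
  "0 \<in> tensor_null A B" "x \<in> tensor_null A B \<Longrightarrow> y \<in> tensor_null A B \<Longrightarrow> x + y \<in> tensor_null A B"
  "x \<in> tensor_null A B \<Longrightarrow> scale_pm c x \<in> tensor_null A B"
  unfolding tensor_null_def
  by (erule Modules.module.span_zero[OF scale_pm_module] Modules.module.span_add[OF scale_pm_module]
      Modules.module.span_scale[OF scale_pm_module] | rule Modules.module.span_zero[OF scale_pm_module] | assumption)+

lemma tensor_relation_null: "tensor_relation A B u v \<Longrightarrow> u - v \<in> tensor_null A B"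
  unfolding tensor_null_def by (intro Modules.module.span_base[OF scale_pm_module]) auto

lemma tensor_null_keys: "x \<in> tensor_null A B \<Longrightarrow> Poly_Mapping.keys x \<subseteq> composable A B"
proof (induction x rule: tensor_null_induct)
  case (step c u v y)
  then show ?case
    using tensor_relation_keys[of u v] keys_scale_pm[of c "u - v"] Poly_Mapping.keys_add[of "scale_pm c (u - v)" y] by auto
qed simp

lemma tensor_null_ideal: "ideal (tensor_null A B) (tensor_cover A B)"
proof (rule idealI)
  let ?R = "tensor_cover A B"
  interpret R: calgebra ?R
    by unfold_locales (simp add: tensor_cover_def G.complex_algebra_monoid_algebra)
  have R: "carrier ?R = {x. Poly_Mapping.keys x \<subseteq> composable A B}" "add ?R = (+)" "zero ?R = 0" "smult ?R = scale_pm"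
    by (simp_all add: tensor_cover_def)
  show "ring ?R" by (rule R.ring_axioms)
  show "subgroup (tensor_null A B) (add_monoid ?R)"
  proof (rule group.subgroupI)
    show "Group.group (add_monoid ?R)" by (rule R.add.group_axioms)
    fix x assume x: "x \<in> tensor_null A B"
    have "\<ominus>\<^bsub>?R\<^esub> x = scale_pm (- 1) x"
      using R.smult_minus[of x] tensor_null_keys[OF x] by (simp add: R)
    then show "inv\<^bsub>add_monoid ?R\<^esub> x \<in> tensor_null A B"
      using tensor_null_closed(3)[OF x, of "- 1"] by (simp add: a_inv_def)
  qed (use tensor_null_keys tensor_null_closed R in auto)
  fix i x assume i: "i \<in> tensor_null A B" and x: "x \<in> carrier ?R"
  have "x \<otimes>\<^bsub>?R\<^esub> i \<in> tensor_null A B \<and> i \<otimes>\<^bsub>?R\<^esub> x \<in> tensor_null A B"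
    using x[unfolded R mem_Collect_eq]
  proof (induction x rule: pm_induct)
    case (single p e)
    then obtain c d \<alpha>' \<gamma>' \<beta>' where p: "p = (c, d)" "c \<in> grade A \<alpha>' \<gamma>'" "d \<in> grade B \<gamma>' \<beta>'"
      by (auto simp: composable_def)
    have "pair c d \<otimes>\<^bsub>?R\<^esub> i \<in> tensor_null A B \<and> i \<otimes>\<^bsub>?R\<^esub> pair c d \<in> tensor_null A B"
      using i
    proof (induction i rule: tensor_null_induct)
      case (step k u v y)
      have d: "x \<otimes>\<^bsub>?R\<^esub> (u - v) = x \<otimes>\<^bsub>?R\<^esub> u - x \<otimes>\<^bsub>?R\<^esub> v" "(u - v) \<otimes>\<^bsub>?R\<^esub> x = u \<otimes>\<^bsub>?R\<^esub> x - v \<otimes>\<^bsub>?R\<^esub> x" for x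
        unfolding tensor_cover_def eq_diff_eq monoid_algebra_mult_add[symmetric] by simp_all
      have "pair c d \<otimes>\<^bsub>?R\<^esub> (scale_pm k (u - v) + y) = scale_pm k (pair c d \<otimes>\<^bsub>?R\<^esub> u - pair c d \<otimes>\<^bsub>?R\<^esub> v) + pair c d \<otimes>\<^bsub>?R\<^esub> y"
        "(scale_pm k (u - v) + y) \<otimes>\<^bsub>?R\<^esub> pair c d = scale_pm k (u \<otimes>\<^bsub>?R\<^esub> pair c d - v \<otimes>\<^bsub>?R\<^esub> pair c d) + y \<otimes>\<^bsub>?R\<^esub> pair c d"
        unfolding d[symmetric] unfolding tensor_cover_def monoid_algebra_mult_add monoid_algebra_mult_scale by simp_all
      then show ?case
        using step tensor_relation_mult[OF step(1) p(2,3)]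
        by (simp only:) (intro conjI tensor_null_closed tensor_relation_null; simp)
    qed (simp add: tensor_cover_def monoid_algebra_mult_zero tensor_null_closed)
    moreover have e: "Poly_Mapping.single p e = scale_pm e (pair c d)" by (simp add: scale_pm_simps p)
    ultimately show ?case
      unfolding e tensor_cover_def monoid_algebra_mult_scale by (intro conjI tensor_null_closed) auto
  qed (simp_all add: tensor_cover_def monoid_algebra_mult_zero monoid_algebra_mult_add tensor_null_closed)
  then show "x \<otimes>\<^bsub>?R\<^esub> i \<in> tensor_null A B" "i \<otimes>\<^bsub>?R\<^esub> x \<in> tensor_null A B" by auto
qed

sublocale T: presented "pair_monoid A B" "tensor_null A B" "h_tensor A B"
  by (intro presented.intro presented_axioms.intro G.monoid_alg_axioms)
     (use tensor_null_ideal in \<open>simp_all add: tensor_cover_def same_algebra_def h_tensor_def module.defs h_alg.defs\<close>)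

end

section \<open>Balanced maps\<close>

definition linear_map :: "(complex, 'a, 'm) module_scheme \<Rightarrow> (complex, 'b, 'k) module_scheme \<Rightarrow> ('a \<Rightarrow> 'b) \<Rightarrow> bool"
  where "linear_map V W F \<longleftrightarrow> F \<in> carrier V \<rightarrow> carrier W \<and>
    (\<forall>x\<in>carrier V. \<forall>y\<in>carrier V. F (x \<oplus>\<^bsub>V\<^esub> y) = F x \<oplus>\<^bsub>W\<^esub> F y) \<and>
    (\<forall>c. \<forall>x\<in>carrier V. F (c \<odot>\<^bsub>V\<^esub> x) = c \<odot>\<^bsub>W\<^esub> F x)"

lemma linear_mapD:
  assumes "linear_map V W F"
  shows "x \<in> carrier V \<Longrightarrow> F x \<in> carrier W"
    and "x \<in> carrier V \<Longrightarrow> y \<in> carrier V \<Longrightarrow> F (x \<oplus>\<^bsub>V\<^esub> y) = F x \<oplus>\<^bsub>W\<^esub> F y"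
    and "x \<in> carrier V \<Longrightarrow> F (c \<odot>\<^bsub>V\<^esub> x) = c \<odot>\<^bsub>W\<^esub> F x"
  using assms by (auto simp: linear_map_def)

lemma linear_map_zero:
  assumes "calgebra V" "calgebra W" "linear_map V W F"
  shows "F \<zero>\<^bsub>V\<^esub> = \<zero>\<^bsub>W\<^esub>"
proof -
  interpret V: calgebra V by fact
  interpret W: calgebra W by fact
  have "F (0 \<odot>\<^bsub>V\<^esub> \<zero>\<^bsub>V\<^esub>) = 0 \<odot>\<^bsub>W\<^esub> F \<zero>\<^bsub>V\<^esub>"
    by (rule linear_mapD(3)[OF assms(3)]) simp
  then show ?thesis using linear_mapD(1)[OF assms(3), of "\<zero>\<^bsub>V\<^esub>"] by simp
qed

lemma linear_map_finsum:
  assumes "calgebra V" "calgebra W" "linear_map V W F" "f \<in> S \<rightarrow> carrier V"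
  shows "F (finsum V f S) = finsum W (\<lambda>i. F (f i)) S"
proof -
  interpret V: calgebra V by fact
  interpret W: calgebra W by fact
  show ?thesis using assms(4)
  proof (induction S rule: infinite_finite_induct)
    case (insert i S)
    then have c: "f i \<in> carrier V" "f \<in> S \<rightarrow> carrier V" by auto
    then have "finsum V f S \<in> carrier V" by (intro V.finsum_closed)
    moreover have "(\<lambda>i. F (f i)) \<in> S \<rightarrow> carrier W" "F (f i) \<in> carrier W"
      using c linear_mapD(1)[OF assms(3)] by auto
    ultimately show ?case using insert c by (simp add: linear_mapD(2)[OF assms(3)])
  qed (simp_all add: linear_map_zero[OF assms(1-3)])
qed

lemma linear_map_compose:
  "linear_map U V F \<Longrightarrow> linear_map V W G \<Longrightarrow> linear_map U W (\<lambda>x. G (F x))"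
  by (auto simp: linear_map_def Pi_def)

text \<open>The maps of two arguments that induce a linear map on the tensor product. The conditions
  concern composable homogeneous pairs, the ones that generate the cover.\<close>

definition balanced_map ::
    "('n::finite, 'a, 'm) h_alg_scheme \<Rightarrow> ('n, 'b, 'k) h_alg_scheme \<Rightarrow> (complex, 'v, 'l) module_scheme \<Rightarrow>
     ('a \<Rightarrow> 'b \<Rightarrow> 'v) \<Rightarrow> bool"
  where "balanced_map A B V \<phi> \<longleftrightarrow>
    (\<forall>\<alpha> \<gamma> \<beta>. \<forall>a\<in>grade A \<alpha> \<gamma>. \<forall>b\<in>grade B \<gamma> \<beta>. \<phi> a b \<in> carrier V \<and>
      (\<forall>c. \<phi> (c \<odot>\<^bsub>A\<^esub> a) b = c \<odot>\<^bsub>V\<^esub> \<phi> a b \<and> \<phi> a (c \<odot>\<^bsub>B\<^esub> b) = c \<odot>\<^bsub>V\<^esub> \<phi> a b) \<and>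
      (\<forall>f. \<phi> (mu_r A f \<otimes>\<^bsub>A\<^esub> a) b = \<phi> a (mu_l B f \<otimes>\<^bsub>B\<^esub> b)) \<and>
      (\<forall>a'\<in>grade A \<alpha> \<gamma>. \<phi> (a \<oplus>\<^bsub>A\<^esub> a') b = \<phi> a b \<oplus>\<^bsub>V\<^esub> \<phi> a' b) \<and>
      (\<forall>b'\<in>grade B \<gamma> \<beta>. \<phi> a (b \<oplus>\<^bsub>B\<^esub> b') = \<phi> a b \<oplus>\<^bsub>V\<^esub> \<phi> a b'))"

lemma balanced_mapI:
  assumes "\<And>\<alpha> \<gamma> \<beta> a b. a \<in> grade A \<alpha> \<gamma> \<Longrightarrow> b \<in> grade B \<gamma> \<beta> \<Longrightarrow> \<phi> a b \<in> carrier V"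
    and "\<And>\<alpha> \<gamma> \<beta> a b c. a \<in> grade A \<alpha> \<gamma> \<Longrightarrow> b \<in> grade B \<gamma> \<beta> \<Longrightarrow> \<phi> (c \<odot>\<^bsub>A\<^esub> a) b = c \<odot>\<^bsub>V\<^esub> \<phi> a b"
    and "\<And>\<alpha> \<gamma> \<beta> a b c. a \<in> grade A \<alpha> \<gamma> \<Longrightarrow> b \<in> grade B \<gamma> \<beta> \<Longrightarrow> \<phi> a (c \<odot>\<^bsub>B\<^esub> b) = c \<odot>\<^bsub>V\<^esub> \<phi> a b"
    and "\<And>\<alpha> \<gamma> \<beta> a b f. a \<in> grade A \<alpha> \<gamma> \<Longrightarrow> b \<in> grade B \<gamma> \<beta> \<Longrightarrow> \<phi> (mu_r A f \<otimes>\<^bsub>A\<^esub> a) b = \<phi> a (mu_l B f \<otimes>\<^bsub>B\<^esub> b)"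
    and "\<And>\<alpha> \<gamma> \<beta> a a' b. a \<in> grade A \<alpha> \<gamma> \<Longrightarrow> a' \<in> grade A \<alpha> \<gamma> \<Longrightarrow> b \<in> grade B \<gamma> \<beta> \<Longrightarrow>
      \<phi> (a \<oplus>\<^bsub>A\<^esub> a') b = \<phi> a b \<oplus>\<^bsub>V\<^esub> \<phi> a' b"
    and "\<And>\<alpha> \<gamma> \<beta> a b b'. a \<in> grade A \<alpha> \<gamma> \<Longrightarrow> b \<in> grade B \<gamma> \<beta> \<Longrightarrow> b' \<in> grade B \<gamma> \<beta> \<Longrightarrow>
      \<phi> a (b \<oplus>\<^bsub>B\<^esub> b') = \<phi> a b \<oplus>\<^bsub>V\<^esub> \<phi> a b'"
  shows "balanced_map A B V \<phi>"
  unfolding balanced_map_def by (intro allI ballI conjI) (fact assms | (rule assms; assumption))+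

lemma balanced_mapD:
  assumes "balanced_map A B V \<phi>" "a \<in> grade A \<alpha> \<gamma>" "b \<in> grade B \<gamma> \<beta>"
  shows "\<phi> a b \<in> carrier V" "\<phi> (c \<odot>\<^bsub>A\<^esub> a) b = c \<odot>\<^bsub>V\<^esub> \<phi> a b" "\<phi> a (c \<odot>\<^bsub>B\<^esub> b) = c \<odot>\<^bsub>V\<^esub> \<phi> a b"
    "\<phi> (mu_r A f \<otimes>\<^bsub>A\<^esub> a) b = \<phi> a (mu_l B f \<otimes>\<^bsub>B\<^esub> b)"
    "a' \<in> grade A \<alpha> \<gamma> \<Longrightarrow> \<phi> (a \<oplus>\<^bsub>A\<^esub> a') b = \<phi> a b \<oplus>\<^bsub>V\<^esub> \<phi> a' b"
    "b' \<in> grade B \<gamma> \<beta> \<Longrightarrow> \<phi> a (b \<oplus>\<^bsub>B\<^esub> b') = \<phi> a b \<oplus>\<^bsub>V\<^esub> \<phi> a b'"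
  using assms unfolding balanced_map_def by blast+

context h_alg_pair
begin

lemma tens_eq_cl: "tens A B a b = T.cl (pair a b)"
  by (simp add: tens_def tensor_class_def tensor_cover_def T.cl_def)

lemma pair_cover: "a \<in> grade A \<alpha> \<gamma> \<Longrightarrow> b \<in> grade B \<gamma> \<beta> \<Longrightarrow> pair a b \<in> T.cover"
  by (rule T.cover_closed(3)) (simp add: composableI)

lemma relation_cl: "tensor_relation A B u v \<Longrightarrow> T.cl u = T.cl v"
  unfolding T.cl_eq_iff by (rule tensor_relation_null)

lemma tens_closed: "a \<in> grade A \<alpha> \<gamma> \<Longrightarrow> b \<in> grade B \<gamma> \<beta> \<Longrightarrow> tens A B a b \<in> carrier (h_tensor A B)"
  unfolding tens_eq_cl by (intro T.cl_closed pair_cover)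

lemma tens_add_left:
  assumes "a \<in> grade A \<alpha> \<gamma>" "a' \<in> grade A \<alpha> \<gamma>" "b \<in> grade B \<gamma> \<beta>"
  shows "tens A B (a \<oplus>\<^bsub>A\<^esub> a') b = tens A B a b \<oplus>\<^bsub>h_tensor A B\<^esub> tens A B a' b"
  unfolding tens_eq_cl T.Q_ops(2)[OF pair_cover[OF assms(1,3)] pair_cover[OF assms(2,3)]]
  by (rule relation_cl[OF tensor_relation.add_left[OF assms]])

lemma tens_add_right:
  assumes "a \<in> grade A \<alpha> \<gamma>" "b \<in> grade B \<gamma> \<beta>" "b' \<in> grade B \<gamma> \<beta>"
  shows "tens A B a (b \<oplus>\<^bsub>B\<^esub> b') = tens A B a b \<oplus>\<^bsub>h_tensor A B\<^esub> tens A B a b'"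
  unfolding tens_eq_cl T.Q_ops(2)[OF pair_cover[OF assms(1,2)] pair_cover[OF assms(1,3)]]
  by (rule relation_cl[OF tensor_relation.add_right[OF assms]])

lemma tens_smult_left:
  assumes "a \<in> grade A \<alpha> \<gamma>" "b \<in> grade B \<gamma> \<beta>"
  shows "tens A B (c \<odot>\<^bsub>A\<^esub> a) b = c \<odot>\<^bsub>h_tensor A B\<^esub> tens A B a b"
  unfolding tens_eq_cl using pair_cover[OF assms]
  by (simp only: T.Q_ops) (rule relation_cl[OF tensor_relation.smult_left[OF assms]])

lemma tens_smult_right:
  assumes "a \<in> grade A \<alpha> \<gamma>" "b \<in> grade B \<gamma> \<beta>"
  shows "tens A B a (c \<odot>\<^bsub>B\<^esub> b) = c \<odot>\<^bsub>h_tensor A B\<^esub> tens A B a b"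
  unfolding tens_eq_cl using pair_cover[OF assms]
  by (simp only: T.Q_ops) (rule relation_cl[OF tensor_relation.smult_right[OF assms]])

lemma tens_balanced:
  "a \<in> grade A \<alpha> \<gamma> \<Longrightarrow> b \<in> grade B \<gamma> \<beta> \<Longrightarrow> tens A B (mu_r A f \<otimes>\<^bsub>A\<^esub> a) b = tens A B a (mu_l B f \<otimes>\<^bsub>B\<^esub> b)"
  unfolding tens_eq_cl by (rule relation_cl[OF tensor_relation.balanced])

lemma tens_mult:
  assumes "a \<in> grade A \<alpha> \<gamma>" "b \<in> grade B \<gamma> \<beta>" "a' \<in> grade A \<alpha>' \<gamma>'" "b' \<in> grade B \<gamma>' \<beta>'"
  shows "tens A B a b \<otimes>\<^bsub>h_tensor A B\<^esub> tens A B a' b' = tens A B (a \<otimes>\<^bsub>A\<^esub> a') (b \<otimes>\<^bsub>B\<^esub> b')"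
  unfolding tens_eq_cl T.Q_ops(1)[OF pair_cover[OF assms(1,2)] pair_cover[OF assms(3,4)]]
  by (simp add: monoid_algebra_mult_single)

lemma tens_one: "tens A B \<one>\<^bsub>A\<^esub> \<one>\<^bsub>B\<^esub> = \<one>\<^bsub>h_tensor A B\<^esub>"
  unfolding tens_eq_cl T.Q_one by simp

lemma tens_zero_left: "b \<in> grade B \<gamma> \<beta> \<Longrightarrow> tens A B \<zero>\<^bsub>A\<^esub> b = \<zero>\<^bsub>h_tensor A B\<^esub>"
  using tens_smult_left[OF A.grade_zero, where c = 0] tens_closed[OF A.grade_zero] by fastforce

lemma tens_zero_right: "a \<in> grade A \<alpha> \<gamma> \<Longrightarrow> tens A B a \<zero>\<^bsub>B\<^esub> = \<zero>\<^bsub>h_tensor A B\<^esub>"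
  using tens_smult_right[OF _ B.grade_zero, where c = 0] tens_closed[OF _ B.grade_zero] by fastforce

lemma cl_single: "p \<in> composable A B \<Longrightarrow> T.cl (Poly_Mapping.single p c) = c \<odot>\<^bsub>h_tensor A B\<^esub> tens A B (fst p) (snd p)"
proof -
  assume "p \<in> composable A B"
  then obtain a b \<alpha> \<gamma> \<beta> where p: "p = (a, b)" "a \<in> grade A \<alpha> \<gamma>" "b \<in> grade B \<gamma> \<beta>"
    by (auto simp: composable_def)
  show ?thesis unfolding p(1) fst_conv snd_conv tens_eq_cl T.Q_ops(3)[OF pair_cover[OF p(2,3)] pair_cover[OF p(2,3)]]
    by (simp add: scale_pm_simps)
qed

lemma tensor_induct_keys:
  assumes x: "Poly_Mapping.keys x \<subseteq> K" and K: "K \<subseteq> composable A B"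
    and "P \<zero>\<^bsub>h_tensor A B\<^esub>"
    and t: "\<And>a b c \<alpha> \<gamma> \<beta>. (a, b) \<in> K \<Longrightarrow> a \<in> grade A \<alpha> \<gamma> \<Longrightarrow> b \<in> grade B \<gamma> \<beta> \<Longrightarrow> P (c \<odot>\<^bsub>h_tensor A B\<^esub> tens A B a b)"
    and add: "\<And>y z. y \<in> carrier (h_tensor A B) \<Longrightarrow> z \<in> carrier (h_tensor A B) \<Longrightarrow> P y \<Longrightarrow> P z \<Longrightarrow> P (y \<oplus>\<^bsub>h_tensor A B\<^esub> z)"
  shows "P (T.cl x)"
  using x
proof (induction x rule: pm_induct)
  case zero
  show ?case using assms(3) by (simp add: T.Q_zero)
next
  case (single p c)
  then obtain a b \<alpha> \<gamma> \<beta> where p: "p = (a, b)" "a \<in> grade A \<alpha> \<gamma>" "b \<in> grade B \<gamma> \<beta>"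
    using K by (auto simp: composable_def)
  show ?case using single K t[OF _ p(2,3), of c] by (subst cl_single) (auto simp: p(1))
next
  case (add y z)
  then have yz: "y \<in> T.cover" "z \<in> T.cover" using K by (auto simp: T.cover_iff)
  show ?case using assms(5)[OF T.cl_closed[OF yz(1)] T.cl_closed[OF yz(2)]] add(3,4) by (simp add: T.Q_ops(2)[OF yz])
qed

lemma tensor_induct [consumes 1, case_names zero tens add]:
  assumes y: "y \<in> carrier (h_tensor A B)" and "P \<zero>\<^bsub>h_tensor A B\<^esub>"
    and t: "\<And>a b \<alpha> \<gamma> \<beta>. a \<in> grade A \<alpha> \<gamma> \<Longrightarrow> b \<in> grade B \<gamma> \<beta> \<Longrightarrow> P (tens A B a b)"
    and "\<And>y z. y \<in> carrier (h_tensor A B) \<Longrightarrow> z \<in> carrier (h_tensor A B) \<Longrightarrow> P y \<Longrightarrow> P z \<Longrightarrow> P (y \<oplus>\<^bsub>h_tensor A B\<^esub> z)"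
  shows "P y"
proof -
  obtain x where x: "y = T.cl x" "x \<in> T.cover" using y by (auto simp: T.Q_carrier)
  have "P (T.cl x)"
  proof (rule tensor_induct_keys[where K = "composable A B"])
    show "Poly_Mapping.keys x \<subseteq> composable A B" using x(2) by (simp add: T.cover_iff)
    fix a b c \<alpha> \<gamma> \<beta> assume ab: "a \<in> grade A \<alpha> \<gamma>" "b \<in> grade B \<gamma> \<beta>"
    show "P (c \<odot>\<^bsub>h_tensor A B\<^esub> tens A B a b)"
      using t[OF A.grade_smult[OF ab(1)] ab(2), of c] by (simp add: tens_smult_left[OF ab])
  qed (use assms in auto)
  then show ?thesis by (simp add: x)
qed

lemma h_tensor_grade: "grade (h_tensor A B) \<alpha> \<beta> = T.cl ` {x. Poly_Mapping.keys x \<subseteq> (\<Union>\<gamma>. grade A \<alpha> \<gamma> \<times> grade B \<gamma> \<beta>)}"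
proof -
  have "tensor_class A B = T.cl"
    by (simp add: tensor_class_def tensor_cover_def T.cl_def fun_eq_iff)
  then show ?thesis by (simp add: h_tensor_def module.defs h_alg.defs)
qed

lemma mu_h_tensor: "mu_l (h_tensor A B) f = tens A B (mu_l A f) \<one>\<^bsub>B\<^esub>" "mu_r (h_tensor A B) f = tens A B \<one>\<^bsub>A\<^esub> (mu_r B f)"
  by (simp_all add: h_tensor_def module.defs h_alg.defs)

lemma tens_grade: "a \<in> grade A \<alpha> \<gamma> \<Longrightarrow> b \<in> grade B \<gamma> \<beta> \<Longrightarrow> tens A B a b \<in> grade (h_tensor A B) \<alpha> \<beta>"
  unfolding h_tensor_grade tens_eq_cl by (rule imageI) auto

lemma h_tensor_grade_closed:
  "\<zero>\<^bsub>h_tensor A B\<^esub> \<in> grade (h_tensor A B) \<alpha> \<beta>"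
  "x \<in> grade (h_tensor A B) \<alpha> \<beta> \<Longrightarrow> x \<in> carrier (h_tensor A B)"
  "x \<in> grade (h_tensor A B) \<alpha> \<beta> \<Longrightarrow> y \<in> grade (h_tensor A B) \<alpha> \<beta> \<Longrightarrow> x \<oplus>\<^bsub>h_tensor A B\<^esub> y \<in> grade (h_tensor A B) \<alpha> \<beta>"
  "x \<in> grade (h_tensor A B) \<alpha> \<beta> \<Longrightarrow> c \<odot>\<^bsub>h_tensor A B\<^esub> x \<in> grade (h_tensor A B) \<alpha> \<beta>"
proof -
  let ?K = "\<Union>\<gamma>. grade A \<alpha> \<gamma> \<times> grade B \<gamma> \<beta>"
  have K: "?K \<subseteq> composable A B" by (auto simp: composable_def)
  have cov: "u \<in> T.cover" if "Poly_Mapping.keys u \<subseteq> ?K" for u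
    using that K by (auto simp: T.cover_iff)
  show "\<zero>\<^bsub>h_tensor A B\<^esub> \<in> grade (h_tensor A B) \<alpha> \<beta>"
    unfolding h_tensor_grade T.Q_zero by (rule imageI) simp
  show "x \<in> grade (h_tensor A B) \<alpha> \<beta> \<Longrightarrow> x \<in> carrier (h_tensor A B)"
    unfolding h_tensor_grade T.Q_carrier using cov by blast
  show "x \<oplus>\<^bsub>h_tensor A B\<^esub> y \<in> grade (h_tensor A B) \<alpha> \<beta>"
    if xy: "x \<in> grade (h_tensor A B) \<alpha> \<beta>" "y \<in> grade (h_tensor A B) \<alpha> \<beta>"
  proof -
    obtain u v where u: "x = T.cl u" "Poly_Mapping.keys u \<subseteq> ?K" "y = T.cl v" "Poly_Mapping.keys v \<subseteq> ?K"
      using xy unfolding h_tensor_grade by blast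
    have "Poly_Mapping.keys (u + v) \<subseteq> ?K" using u Poly_Mapping.keys_add[of u v] by blast
    then show ?thesis unfolding u(1,3) T.Q_ops(2)[OF cov[OF u(2)] cov[OF u(4)]] h_tensor_grade by blast
  qed
  show "c \<odot>\<^bsub>h_tensor A B\<^esub> x \<in> grade (h_tensor A B) \<alpha> \<beta>" if x: "x \<in> grade (h_tensor A B) \<alpha> \<beta>"
  proof -
    obtain u where u: "x = T.cl u" "Poly_Mapping.keys u \<subseteq> ?K" using x unfolding h_tensor_grade by blast
    have "Poly_Mapping.keys (scale_pm c u) \<subseteq> ?K" using u keys_scale_pm[of c u] by blast
    then show ?thesis unfolding u(1) T.Q_ops(3)[OF cov[OF u(2)] cov[OF u(2)]] h_tensor_grade by blast
  qed
qed

lemma tensor_grade_induct [consumes 1, case_names zero tens add]: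
  assumes y: "y \<in> grade (h_tensor A B) \<alpha> \<beta>" and "P \<zero>\<^bsub>h_tensor A B\<^esub>"
    and t: "\<And>a b \<gamma>. a \<in> grade A \<alpha> \<gamma> \<Longrightarrow> b \<in> grade B \<gamma> \<beta> \<Longrightarrow> P (tens A B a b)"
    and add: "\<And>y z. y \<in> carrier (h_tensor A B) \<Longrightarrow> z \<in> carrier (h_tensor A B) \<Longrightarrow> P y \<Longrightarrow> P z \<Longrightarrow> P (y \<oplus>\<^bsub>h_tensor A B\<^esub> z)"
  shows "P y"
proof -
  let ?K = "\<Union>\<gamma>. grade A \<alpha> \<gamma> \<times> grade B \<gamma> \<beta>"
  obtain u where u: "y = T.cl u" "Poly_Mapping.keys u \<subseteq> ?K" using y unfolding h_tensor_grade by blast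
  have "P (T.cl u)"
  proof (rule tensor_induct_keys[where K = ?K, OF u(2)])
    show "?K \<subseteq> composable A B" by (auto simp: composable_def)
    fix a b c assume "(a, b) \<in> ?K"
    then obtain \<gamma> where ab: "a \<in> grade A \<alpha> \<gamma>" "b \<in> grade B \<gamma> \<beta>" by blast
    show "P (c \<odot>\<^bsub>h_tensor A B\<^esub> tens A B a b)"
      using t[OF A.grade_smult[OF ab(1)] ab(2), of c] by (simp add: tens_smult_left[OF ab])
  qed (use assms in auto)
  then show ?thesis by (simp add: u)
qed

lemma pre_h_alg_h_tensor: "pre_h_alg (h_tensor A B)"
proof (intro pre_h_alg.intro pre_h_alg_axioms.intro)
  let ?T = "h_tensor A B"
  show "calgebra ?T" by (rule T.Q.calgebra_axioms)
  show "submodule (grade ?T \<alpha> \<beta>) complex_ring ?T" for \<alpha> \<beta>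
  proof (rule Module.module.submoduleI[OF T.Q.module])
    fix x assume x: "x \<in> grade ?T \<alpha> \<beta>"
    show "\<ominus>\<^bsub>?T\<^esub> x \<in> grade ?T \<alpha> \<beta>"
      using T.Q.smult_minus[OF h_tensor_grade_closed(2)[OF x]] h_tensor_grade_closed(4)[OF x, of "- 1"] by simp
  qed (auto intro: h_tensor_grade_closed)
  show "\<one>\<^bsub>?T\<^esub> \<in> grade ?T 0 0"
    unfolding tens_one[symmetric] by (rule tens_grade[OF A.one_grade B.one_grade])
  show "mu_l ?T f \<in> grade ?T 0 0" "mu_r ?T f \<in> grade ?T 0 0" for f
    unfolding mu_h_tensor
    using tens_grade[OF A.mu_grade(1) B.one_grade] tens_grade[OF A.one_grade B.mu_grade(2)] by auto
  note gc = h_tensor_grade_closed(2)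
  show "x \<otimes>\<^bsub>?T\<^esub> y \<in> grade ?T (\<alpha> + \<gamma>) (\<beta> + \<delta>)" if x: "x \<in> grade ?T \<alpha> \<beta>" and y: "y \<in> grade ?T \<gamma> \<delta>" for x y \<alpha> \<beta> \<gamma> \<delta>
    using x
  proof (induction x rule: tensor_grade_induct)
    case zero
    then show ?case using y by (simp add: gc h_tensor_grade_closed(1))
  next
    case (tens a b \<epsilon>)
    show ?case using y
    proof (induction y rule: tensor_grade_induct)
      case zero
      then show ?case using tens_closed[OF tens] by (simp add: h_tensor_grade_closed(1))
    next
      case (tens a' b' \<epsilon>')
      show ?case unfolding tens_mult[OF \<open>a \<in> _\<close> \<open>b \<in> _\<close> tens]
        by (rule tens_grade[OF A.mult_grade[OF \<open>a \<in> _\<close> tens(1)] B.mult_grade[OF \<open>b \<in> _\<close> tens(2)]])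
    next
      case (add y z)
      then show ?case using tens_closed[OF tens] by (simp add: T.Q.r_distr h_tensor_grade_closed(3))
    qed
  next
    case (add x z)
    then show ?case using gc[OF y] by (simp add: T.Q.l_distr h_tensor_grade_closed(3))
  qed
  fix x \<alpha> \<beta> f assume x: "x \<in> grade ?T \<alpha> \<beta>"
  have l: "mu_l ?T f \<in> carrier ?T" and r: "mu_r ?T f \<in> carrier ?T" for f
    unfolding mu_h_tensor
    using tens_closed[OF A.mu_grade(1) B.one_grade] tens_closed[OF A.one_grade B.mu_grade(2)] by auto
  show "mu_l ?T f \<otimes>\<^bsub>?T\<^esub> x = x \<otimes>\<^bsub>?T\<^esub> mu_l ?T (mero_shift \<alpha> f)" using x
  proof (induction x rule: tensor_grade_induct)
    case (tens a b \<gamma>)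
    then show ?case
      using tens_mult[OF A.mu_grade(1) B.one_grade tens, of f] tens_mult[OF tens A.mu_grade(1) B.one_grade, of "mero_shift \<alpha> f"]
        A.mu_l_commute[OF tens(1), of f] B.grade_carrier[OF tens(2)] by (simp add: mu_h_tensor)
  next
    case (add y z)
    then show ?case using l by (simp add: T.Q.r_distr T.Q.l_distr)
  qed (use l in simp)
  show "mu_r ?T f \<otimes>\<^bsub>?T\<^esub> x = x \<otimes>\<^bsub>?T\<^esub> mu_r ?T (mero_shift \<beta> f)" using x
  proof (induction x rule: tensor_grade_induct)
    case (tens a b \<gamma>)
    then show ?case
      using tens_mult[OF A.one_grade B.mu_grade(2) tens, of f] tens_mult[OF tens A.one_grade B.mu_grade(2), of "mero_shift \<beta> f"]
        B.mu_r_commute[OF tens(2), of f] A.grade_carrier[OF tens(1)] by (simp add: mu_h_tensor)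
  next
    case (add y z)
    then show ?case using r by (simp add: T.Q.r_distr T.Q.l_distr)
  qed (use r in simp)
qed

sublocale T: pre_h_alg "h_tensor A B"
  by (rule pre_h_alg_h_tensor)

text \<open>Each kind of tensor relation is killed by the matching clause of
  \<open>balanced_map\<close>, hence so is the span. Together with \<open>lift_tens\<close> and
  \<open>lift_linear_map\<close> this gives the universal property of the tensor product.\<close>

lemma linear_ext_kills_null:
  assumes "calgebra V" and \<phi>: "balanced_map A B V \<phi>" and x: "x \<in> tensor_null A B"
  shows "linear_ext V (\<lambda>(a, b). \<phi> a b) x = \<zero>\<^bsub>V\<^esub>"
proof -
  interpret V: calgebra V by fact
  let ?\<phi> = "\<lambda>(a, b). \<phi> a b"
  have c: "?\<phi> \<in> composable A B \<rightarrow> carrier V"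
    using balanced_mapD(1)[OF \<phi>] by (auto simp: composable_def)
  note add = V.linear_ext_add[OF _ _ c] and smult = V.linear_ext_smult[OF _ c] and diff = V.linear_ext_diff[OF _ _ c]
  have s: "linear_ext V ?\<phi> (pair a b) = \<phi> a b" "Poly_Mapping.keys (pair a b) \<subseteq> composable A B"
    if "a \<in> grade A \<alpha> \<gamma>" "b \<in> grade B \<gamma> \<beta>" for a b \<alpha> \<gamma> \<beta>
    using balanced_mapD(1)[OF \<phi> that] composableI[OF that] by (simp_all add: V.linear_ext_single)
  have ks: "Poly_Mapping.keys (scale_pm e y) \<subseteq> composable A B" if "Poly_Mapping.keys y \<subseteq> composable A B"
    for e and y :: "('a \<times> 'b) \<Rightarrow>\<^sub>0 complex" using that keys_scale_pm[of e y] by auto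
  have eq: "linear_ext V ?\<phi> (u - v) = \<zero>\<^bsub>V\<^esub>" if "tensor_relation A B u v" for u v
    using that
  proof cases
    case (add_left a \<alpha> \<gamma> a' b \<beta>)
    note g = add_left(3-5)
    show ?thesis unfolding add_left(1,2)
      using balanced_mapD(1)[OF \<phi> g(1) g(3)] balanced_mapD(1)[OF \<phi> g(2) g(3)] Poly_Mapping.keys_add[of "pair a b" "pair a' b"]
        s[OF g(1,3)] s[OF g(2,3)] s[OF A.grade_add[OF g(1,2)] g(3)] balanced_mapD(5)[OF \<phi> g(1) g(3) g(2)]
      by (subst diff) (auto simp: add V.r_right_minus_eq)
  next
    case (add_right a \<alpha> \<gamma> b \<beta> b')
    note g = add_right(3-5)
    show ?thesis unfolding add_right(1,2)
      using balanced_mapD(1)[OF \<phi> g(1) g(2)] balanced_mapD(1)[OF \<phi> g(1) g(3)] Poly_Mapping.keys_add[of "pair a b" "pair a b'"]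
        s[OF g(1,2)] s[OF g(1,3)] s[OF g(1) B.grade_add[OF g(2,3)]] balanced_mapD(6)[OF \<phi> g(1) g(2) g(3)]
      by (subst diff) (auto simp: add V.r_right_minus_eq)
  next
    case (smult_left a \<alpha> \<gamma> b \<beta> e)
    note g = smult_left(3,4)
    show ?thesis unfolding smult_left(1,2)
      using balanced_mapD(1,2)[OF \<phi> g] s[OF g] s[OF A.grade_smult[OF g(1), of e] g(2)] ks[OF s(2)[OF g], of e]
      by (subst diff) (auto simp: V.linear_ext_single V.r_right_minus_eq)
  next
    case (smult_right a \<alpha> \<gamma> b \<beta> e)
    note g = smult_right(3,4)
    show ?thesis unfolding smult_right(1,2)
      using balanced_mapD(1,3)[OF \<phi> g] s[OF g] s[OF g(1) B.grade_smult[OF g(2), of e]] ks[OF s(2)[OF g], of e]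
      by (subst diff) (auto simp: V.linear_ext_single V.r_right_minus_eq)
  next
    case (balanced a \<alpha> \<gamma> b \<beta> f)
    note g = balanced(3,4)
    show ?thesis unfolding balanced(1,2)
      using balanced_mapD(4)[OF \<phi> g, of f] s[OF A.mu_mult_grade(2)[OF g(1), of f] g(2)] s[OF g(1) B.mu_mult_grade(1)[OF g(2), of f]]
        balanced_mapD(1)[OF \<phi> g(1) B.mu_mult_grade(1)[OF g(2), of f]]
      by (subst diff) (auto simp: V.r_right_minus_eq)
  qed
  show ?thesis using x
  proof (induction x rule: tensor_null_induct)
    case (step e u v y)
    show ?case
      using tensor_relation_keys[OF step(1)] ks[OF tensor_relation_keys[OF step(1)], of e] tensor_null_keys[OF step(2)]
      by (subst add) (auto simp: smult eq[OF step(1)] step(3))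
  qed simp
qed

lemma lift_cl:
  assumes "calgebra V" "balanced_map A B V \<phi>" "x \<in> T.cover"
  shows "descend (linear_ext V (\<lambda>(a, b). \<phi> a b)) (T.cl x) = linear_ext V (\<lambda>(a, b). \<phi> a b) x"
proof (rule T.descend_linear_ext[OF assms(1) _ _ assms(3)])
  show "(\<lambda>(a, b). \<phi> a b) \<in> carrier (pair_monoid A B) \<rightarrow> carrier V"
    using balanced_mapD(1)[OF assms(2)] by (auto simp: composable_def)
qed (rule linear_ext_kills_null[OF assms(1,2)])

lemma lift_tens:
  assumes "calgebra V" "balanced_map A B V \<phi>" "a \<in> grade A \<alpha> \<gamma>" "b \<in> grade B \<gamma> \<beta>"
  shows "descend (linear_ext V (\<lambda>(a, b). \<phi> a b)) (tens A B a b) = \<phi> a b"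
proof -
  interpret V: calgebra V by fact
  show ?thesis unfolding tens_eq_cl lift_cl[OF assms(1,2) pair_cover[OF assms(3,4)]]
    using balanced_mapD(1)[OF assms(2-4)] by (simp add: V.linear_ext_single)
qed

lemma lift_linear_map:
  assumes "calgebra V" "balanced_map A B V \<phi>"
  shows "linear_map (h_tensor A B) V (descend (linear_ext V (\<lambda>(a, b). \<phi> a b)))"
proof -
  interpret V: calgebra V by fact
  have c: "(\<lambda>(a, b). \<phi> a b) \<in> carrier (pair_monoid A B) \<rightarrow> carrier V"
    using balanced_mapD(1)[OF assms(2)] by (auto simp: composable_def)
  have cl: "linear_ext V (\<lambda>(a, b). \<phi> a b) x \<in> carrier V" if "x \<in> T.cover" for x
    by (rule V.linear_ext_closed[OF _ c]) (use that in \<open>simp add: T.cover_iff\<close>)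
  have add: "linear_ext V (\<lambda>(a, b). \<phi> a b) (x + y) = linear_ext V (\<lambda>(a, b). \<phi> a b) x \<oplus>\<^bsub>V\<^esub> linear_ext V (\<lambda>(a, b). \<phi> a b) y"
    if "x \<in> T.cover" "y \<in> T.cover" for x y
    by (rule V.linear_ext_add[OF _ _ c]) (use that in \<open>simp_all add: T.cover_iff\<close>)
  have sm: "linear_ext V (\<lambda>(a, b). \<phi> a b) (scale_pm e x) = e \<odot>\<^bsub>V\<^esub> linear_ext V (\<lambda>(a, b). \<phi> a b) x"
    if "x \<in> T.cover" for x e
    by (rule V.linear_ext_smult[OF _ c]) (use that in \<open>simp add: T.cover_iff\<close>)
  show ?thesis
    unfolding linear_map_def T.Q_carrier
    by (auto simp: lift_cl[OF assms] T.Q_ops T.cover_closed' cl add sm)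
qed

end

section \<open>Difference operators and the free algebra\<close>

lemma diff_ops_simps [simp]:
  "mult diff_ops = (\<circ>)" "one diff_ops = id" "zero diff_ops = (\<lambda>g. 0)" "add diff_ops = (\<lambda>F G g. F g + G g)"
  "smult diff_ops = (\<lambda>c F g. mero_const c * F g)" "mu_l diff_ops = (\<lambda>f g. f * g)" "mu_r diff_ops = (\<lambda>f g. f * g)"
  by (simp_all add: diff_ops_def)

lemma diff_ops_carrier:
  "F \<in> carrier diff_ops \<longleftrightarrow> (\<exists>B c. finite B \<and> F = (\<lambda>g. \<Sum>\<beta>\<in>B. c \<beta> * mero_shift \<beta> g))"
  by (simp add: diff_ops_def)

lemma diff_ops_grade:
  "grade diff_ops \<alpha> \<beta> = (if \<alpha> = \<beta> then range (\<lambda>f g. f * mero_shift (- \<beta>) g) else {\<lambda>g. 0})"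
  by (auto simp: diff_ops_def)

lemma diff_ops_single: "(\<lambda>g. f * mero_shift \<beta> g) \<in> carrier diff_ops"
  unfolding diff_ops_carrier by (intro exI[of _ "{\<beta>}"] exI[of _ "\<lambda>_. f"]) simp

lemma diff_ops_zero: "(\<lambda>g. 0) \<in> carrier diff_ops"
  unfolding diff_ops_carrier by (intro exI[of _ "{}"]) simp

lemma diff_ops_add:
  assumes "F \<in> carrier diff_ops" "G \<in> carrier diff_ops"
  shows "(\<lambda>g. F g + G g) \<in> carrier diff_ops"
proof -
  obtain B c B' c' where *: "finite B" "F = (\<lambda>g. \<Sum>\<beta>\<in>B. c \<beta> * mero_shift \<beta> g)"
    "finite B'" "G = (\<lambda>g. \<Sum>\<beta>\<in>B'. c' \<beta> * mero_shift \<beta> g)"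
    using assms unfolding diff_ops_carrier by blast
  define d where "d \<beta> = (if \<beta> \<in> B then c \<beta> else 0) + (if \<beta> \<in> B' then c' \<beta> else 0)" for \<beta>
  have "(\<Sum>\<beta>\<in>B \<union> B'. (if \<beta> \<in> B then c \<beta> else 0) * mero_shift \<beta> g) = F g"
    and "(\<Sum>\<beta>\<in>B \<union> B'. (if \<beta> \<in> B' then c' \<beta> else 0) * mero_shift \<beta> g) = G g" for g
    unfolding * using *(1,3) by (intro sum.mono_neutral_cong_right; auto)+
  then have "(\<lambda>g. F g + G g) = (\<lambda>g. \<Sum>\<beta>\<in>B \<union> B'. d \<beta> * mero_shift \<beta> g)"
    by (simp add: d_def distrib_right sum.distrib)
  then show ?thesis unfolding diff_ops_carrier using *(1,3) by blast
qed

lemma diff_ops_induct [consumes 1, case_names zero single add]: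
  assumes "F \<in> carrier diff_ops" "P (\<lambda>g. 0)" "\<And>f \<beta>. P (\<lambda>g. f * mero_shift \<beta> g)"
    and "\<And>F G. F \<in> carrier diff_ops \<Longrightarrow> G \<in> carrier diff_ops \<Longrightarrow> P F \<Longrightarrow> P G \<Longrightarrow> P (\<lambda>g. F g + G g)"
  shows "P F"
proof -
  obtain B c where *: "finite B" "F = (\<lambda>g. \<Sum>\<beta>\<in>B. c \<beta> * mero_shift \<beta> g)"
    using assms(1) unfolding diff_ops_carrier by blast
  have "P (\<lambda>g. \<Sum>\<beta>\<in>B. c \<beta> * mero_shift \<beta> g)" using *(1)
  proof (induction B rule: finite_induct)
    case (insert \<beta> B)
    have "(\<lambda>g. \<Sum>\<beta>\<in>B. c \<beta> * mero_shift \<beta> g) \<in> carrier diff_ops"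
      unfolding diff_ops_carrier using insert(1) by blast
    from assms(4)[OF diff_ops_single this assms(3) insert(3)] insert(1,2) show ?case by simp
  qed (simp add: assms(2))
  then show ?thesis by (simp add: *)
qed

text \<open>The product is composition, so distributivity over a sum of inner operators, and
  likewise compatibility with scalars, rests on the operators themselves being linear over the
  complex numbers.\<close>

lemma diff_ops_linear:
  assumes "F \<in> carrier diff_ops"
  shows "F (g + h) = F g + F h" "F (mero_const c * g) = mero_const c * F g"
proof -
  have "(\<forall>g h. F (g + h) = F g + F h) \<and> (\<forall>c g. F (mero_const c * g) = mero_const c * F g)"
    using assms
    by (induction F rule: diff_ops_induct) (simp_all add: mero_shift_add mero_shift_mult algebra_simps)
  then show "F (g + h) = F g + F h" "F (mero_const c * g) = mero_const c * F g" by auto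
qed

lemma diff_ops_compose:
  assumes "F \<in> carrier diff_ops" "G \<in> carrier diff_ops"
  shows "F \<circ> G \<in> carrier diff_ops"
  using assms(1)
proof (induction F rule: diff_ops_induct)
  case zero
  then show ?case by (simp add: comp_def diff_ops_zero)
next
  case (single f \<beta>)
  show ?case using assms(2)
  proof (induction G rule: diff_ops_induct)
    case zero
    then show ?case by (simp add: comp_def diff_ops_zero)
  next
    case (single f' \<beta>')
    have "(\<lambda>g. f * mero_shift \<beta> g) \<circ> (\<lambda>g. f' * mero_shift \<beta>' g) = (\<lambda>g. (f * mero_shift \<beta> f') * mero_shift (\<beta> + \<beta>') g)"
      by (simp add: fun_eq_iff mero_shift_mult mult.assoc)
    then show ?case using diff_ops_single by metis
  next
    case (add G H)
    then show ?case using diff_ops_add[OF add(3,4)] by (simp add: comp_def mero_shift_add distrib_left)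
  qed
next
  case (add F H)
  then show ?case using diff_ops_add[OF add(3,4)] by (simp add: comp_def)
qed

lemma pre_h_alg_diff_ops: "pre_h_alg (diff_ops :: ('n::finite, 'n mero \<Rightarrow> 'n mero) h_alg)"
proof (intro pre_h_alg.intro pre_h_alg_axioms.intro)
  let ?D = "diff_ops :: ('n, 'n mero \<Rightarrow> 'n mero) h_alg"
  have scale: "(\<lambda>g. mero_const c * F g) \<in> carrier ?D" if "F \<in> carrier ?D" for c F
    using that
  proof (induction F rule: diff_ops_induct)
    case (single f \<beta>)
    then show ?case using diff_ops_single[of "mero_const c * f" \<beta>] by (simp add: mult.assoc)
  next
    case (add F G)
    then show ?case using diff_ops_add[OF add(3,4)] by (simp add: distrib_left)
  qed (simp add: diff_ops_zero)
  have id: "id \<in> carrier ?D" using diff_ops_single[of 1 0] by (simp add: id_def)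
  have m1: "mero_const (- 1) = (- 1 :: 'n mero)"
    using mero_const_add[of 1 "- 1"] by (simp add: eq_neg_iff_add_eq_0 add.commute)
  have neg: "\<exists>y\<in>carrier ?D. y \<oplus>\<^bsub>?D\<^esub> x = \<zero>\<^bsub>?D\<^esub>" if "x \<in> carrier ?D" for x
    by (rule bexI[of _ "\<lambda>g. mero_const (- 1) * x g"]) (use scale[OF that, of "- 1"] in \<open>simp_all add: m1\<close>)
  have ag: "abelian_group ?D"
    by (rule abelian_groupI) (use neg in \<open>auto simp: add_ac diff_ops_zero intro: diff_ops_add\<close>)
  have r: "ring ?D"
  proof (rule ringI[OF ag])
    show "Group.monoid ?D"
      by (rule monoidI) (auto simp: comp_assoc id intro: diff_ops_compose)
  qed (auto simp: fun_eq_iff diff_ops_linear)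
  have "Module.module complex_ring ?D"
    by (rule moduleI[OF cring_complex ag])
       (auto simp: scale fun_eq_iff mero_const_add mero_const_mult distrib_left distrib_right mult.assoc)
  with r show c: "calgebra ?D"
    by (simp add: calgebra_def complex_algebra_def fun_eq_iff diff_ops_linear)
  interpret calgebra ?D by fact
  show "submodule (grade ?D \<alpha> \<beta>) complex_ring ?D" for \<alpha> \<beta>
  proof (rule Module.module.submoduleI[OF module])
    show "grade ?D \<alpha> \<beta> \<subseteq> carrier ?D" by (auto simp: diff_ops_grade diff_ops_single diff_ops_zero)
    show "\<zero>\<^bsub>?D\<^esub> \<in> grade ?D \<alpha> \<beta>" by (auto simp: diff_ops_grade image_iff intro!: exI[of _ 0])
    show sm: "c \<odot>\<^bsub>?D\<^esub> x \<in> grade ?D \<alpha> \<beta>" if "x \<in> grade ?D \<alpha> \<beta>" for c x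
      using that by (auto simp: diff_ops_grade image_iff mult.assoc[symmetric] split: if_splits)
    show "\<ominus>\<^bsub>?D\<^esub> x \<in> grade ?D \<alpha> \<beta>" if x: "x \<in> grade ?D \<alpha> \<beta>" for x
    proof -
      have "x \<in> carrier ?D" using x by (auto simp: diff_ops_grade diff_ops_single diff_ops_zero split: if_splits)
      then show ?thesis using smult_minus[of x] sm[OF x, of "- 1"] by simp
    qed
    show "x \<oplus>\<^bsub>?D\<^esub> y \<in> grade ?D \<alpha> \<beta>" if "x \<in> grade ?D \<alpha> \<beta>" "y \<in> grade ?D \<alpha> \<beta>" for x y
      using that by (auto simp: diff_ops_grade image_iff distrib_right[symmetric] split: if_splits)
  qed
  show "\<one>\<^bsub>?D\<^esub> \<in> grade ?D 0 0"
    by (auto simp: diff_ops_grade image_iff fun_eq_iff intro!: exI[of _ 1])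
  show "mu_l ?D f \<in> grade ?D 0 0" "mu_r ?D f \<in> grade ?D 0 0" for f
    by (auto simp: diff_ops_grade image_iff fun_eq_iff intro!: exI[of _ f])
  show "x \<otimes>\<^bsub>?D\<^esub> y \<in> grade ?D (\<alpha> + \<gamma>) (\<beta> + \<delta>)" if x: "x \<in> grade ?D \<alpha> \<beta>" and y: "y \<in> grade ?D \<gamma> \<delta>" for x y \<alpha> \<beta> \<gamma> \<delta>
  proof -
    have z: "(\<lambda>g. 0) \<in> grade ?D \<epsilon> \<zeta>" for \<epsilon> \<zeta>
      by (auto simp: diff_ops_grade image_iff intro!: exI[of _ 0])
    show ?thesis
    proof (cases "\<alpha> = \<beta> \<and> \<gamma> = \<delta>")
      case True
      then obtain f f' where f: "x = (\<lambda>g. f * mero_shift (- \<beta>) g)" "y = (\<lambda>g. f' * mero_shift (- \<delta>) g)"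
        using x y by (auto simp: diff_ops_grade)
      have "x \<circ> y = (\<lambda>g. (f * mero_shift (- \<beta>) f') * mero_shift (- (\<beta> + \<delta>)) g)"
        by (simp add: f fun_eq_iff mero_shift_mult mult.assoc)
      then show ?thesis using True by (auto simp: diff_ops_grade)
    next
      case False
      then have "x = (\<lambda>g. 0) \<or> y = (\<lambda>g. 0)" using x y by (auto simp: diff_ops_grade split: if_splits)
      moreover have "x \<circ> (\<lambda>g. 0) = (\<lambda>g. 0)"
        using x by (auto simp: diff_ops_grade fun_eq_iff split: if_splits)
      ultimately have "x \<circ> y = (\<lambda>g. 0)" by (auto simp: comp_def)
      then show ?thesis using z by simp
    qed
  qed
  show "mu_l ?D f \<otimes>\<^bsub>?D\<^esub> x = x \<otimes>\<^bsub>?D\<^esub> mu_l ?D (mero_shift \<alpha> f)" if "x \<in> grade ?D \<alpha> \<beta>" for x \<alpha> \<beta> f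
    using that by (auto simp: diff_ops_grade fun_eq_iff mero_shift_mult mult_ac split: if_splits)
  show "mu_r ?D f \<otimes>\<^bsub>?D\<^esub> x = x \<otimes>\<^bsub>?D\<^esub> mu_r ?D (mero_shift \<beta> f)" if "x \<in> grade ?D \<alpha> \<beta>" for x \<alpha> \<beta> f
    using that by (auto simp: diff_ops_grade fun_eq_iff mero_shift_mult mult_ac split: if_splits)
qed

interpretation diff_ops: pre_h_alg diff_ops
  by (rule pre_h_alg_diff_ops)

section \<open>Words in the generators and the universal property of the presentation\<close>

abbreviation word_monoid :: "'g list monoid"
  where "word_monoid \<equiv> \<lparr>carrier = UNIV, mult = (@), one = []\<rparr>"

interpretation words: monoid_alg word_monoid
  unfolding monoid_alg_def by (rule monoidI) auto

lemma calgebra_free_algebra: "calgebra free_algebra"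
  unfolding calgebra_def free_algebra_def by (rule words.complex_algebra_monoid_algebra)

lemma GL_ideal: "ideal (GL_ideal l) free_algebra"
proof -
  interpret calgebra free_algebra by (rule calgebra_free_algebra)
  show ?thesis unfolding GL_ideal_def by (rule genideal_ideal) (simp add: free_algebra_def)
qed

lemma same_algebra_GL: "same_algebra (GL_h_alg l) (quot_algebra free_algebra (GL_ideal l))"
  by (simp add: same_algebra_def GL_h_alg_def module.defs h_alg.defs)

interpretation GL: presented word_monoid "GL_ideal l" "GL_h_alg l" for l
  using GL_ideal[of l] same_algebra_GL[of l]
  by (intro presented.intro presented_axioms.intro words.monoid_alg_axioms) (simp_all add: free_algebra_def)

lemma GL_cl [simp]: "GL.cl l = GL_class l"
  by (simp add: fun_eq_iff GL.cl_def GL_class_def free_algebra_def)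

lemma GL_cover [simp]: "x \<in> GL.cover"
  by (simp add: GL.cover_def)

abbreviation word_prod :: "(complex, 'b, 'm) module_scheme \<Rightarrow> ('g \<Rightarrow> 'b) \<Rightarrow> 'g list \<Rightarrow> 'b"
  where "word_prod V \<delta> w \<equiv> foldr (\<lambda>g y. \<delta> g \<otimes>\<^bsub>V\<^esub> y) w \<one>\<^bsub>V\<^esub>"

context calgebra
begin

lemma word_prod_closed: "(\<And>g. \<delta> g \<in> carrier A) \<Longrightarrow> word_prod A \<delta> w \<in> carrier A"
  by (induction w) auto

lemma word_prod_append:
  "(\<And>g. \<delta> g \<in> carrier A) \<Longrightarrow> word_prod A \<delta> (u @ v) = word_prod A \<delta> u \<otimes> word_prod A \<delta> v"
  by (induction u) (auto simp: m_assoc word_prod_closed)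

lemma algebra_ext_closed: "(\<And>g. \<delta> g \<in> carrier A) \<Longrightarrow> algebra_ext A \<delta> x \<in> carrier A"
  unfolding algebra_ext_def
  by (rule linear_ext_closed[of _ UNIV]) (auto simp: word_prod_closed)

lemma algebra_ext_add: "(\<And>g. \<delta> g \<in> carrier A) \<Longrightarrow> algebra_ext A \<delta> (x + y) = algebra_ext A \<delta> x \<oplus> algebra_ext A \<delta> y"
  unfolding algebra_ext_def
  by (rule linear_ext_add[of _ UNIV]) (auto simp: word_prod_closed)

lemma algebra_ext_diff: "(\<And>g. \<delta> g \<in> carrier A) \<Longrightarrow> algebra_ext A \<delta> (x - y) = algebra_ext A \<delta> x \<ominus> algebra_ext A \<delta> y"
  unfolding algebra_ext_def
  by (rule linear_ext_diff[of _ UNIV]) (auto simp: word_prod_closed)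

lemma algebra_ext_smult: "(\<And>g. \<delta> g \<in> carrier A) \<Longrightarrow> algebra_ext A \<delta> (scale_pm c x) = c \<odot> algebra_ext A \<delta> x"
  unfolding algebra_ext_def
  by (rule linear_ext_smult[of _ UNIV]) (auto simp: word_prod_closed)

lemma algebra_ext_sum: "(\<And>g. \<delta> g \<in> carrier A) \<Longrightarrow> finite S \<Longrightarrow> algebra_ext A \<delta> (sum f S) = (\<Oplus>i\<in>S. algebra_ext A \<delta> (f i))"
  unfolding algebra_ext_def
  by (rule linear_ext_sum[of _ _ UNIV]) (auto simp: word_prod_closed)

lemma algebra_ext_single: "(\<And>g. \<delta> g \<in> carrier A) \<Longrightarrow> algebra_ext A \<delta> (Poly_Mapping.single w c) = c \<odot> word_prod A \<delta> w"
  unfolding algebra_ext_def by (rule linear_ext_single) (auto simp: word_prod_closed)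

lemma algebra_ext_mult:
  "(\<And>g. \<delta> g \<in> carrier A) \<Longrightarrow> algebra_ext A \<delta> (x \<otimes>\<^bsub>free_algebra\<^esub> y) = algebra_ext A \<delta> x \<otimes> algebra_ext A \<delta> y"
  unfolding algebra_ext_def free_algebra_def
  by (rule linear_ext_mult[OF words.monoid_axioms])
     (auto simp: word_prod_closed word_prod_append simp del: foldr_append)

text \<open>The elements with zero image form a two-sided ideal; it contains the relations and hence
  the ideal that they generate.\<close>

lemma algebra_ext_kills_GL_ideal:
  assumes \<delta>: "\<And>g. \<delta> g \<in> carrier A"
    and rel: "\<And>u v. GL_relation l u v \<Longrightarrow> algebra_ext A \<delta> u = algebra_ext A \<delta> v"
    and x: "x \<in> GL_ideal l"
  shows "algebra_ext A \<delta> x = \<zero>"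
proof -
  interpret F: calgebra free_algebra by (rule calgebra_free_algebra)
  have car: "carrier free_algebra = UNIV" "add free_algebra = (+)" "zero free_algebra = 0" "smult free_algebra = scale_pm"
    by (simp_all add: free_algebra_def)
  let ?J = "{x. algebra_ext A \<delta> x = \<zero>}"
  have z: "algebra_ext A \<delta> 0 = \<zero>" by (simp add: algebra_ext_def)
  have "ideal ?J free_algebra"
  proof (rule idealI)
    show "subgroup ?J (add_monoid free_algebra)"
    proof (rule group.subgroupI)
      show "Group.group (add_monoid free_algebra)" by (rule F.add.group_axioms)
      fix a assume a: "a \<in> ?J"
      have "\<ominus>\<^bsub>free_algebra\<^esub> a = scale_pm (- 1) a" using F.smult_minus[of a] by (simp add: car)
      then show "inv\<^bsub>add_monoid free_algebra\<^esub> a \<in> ?J"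
        using a by (simp add: algebra_ext_smult[OF \<delta>] flip: a_inv_def)
    qed (use z in \<open>auto simp: car algebra_ext_add[OF \<delta>]\<close>)
  qed (auto simp: F.ring_axioms algebra_ext_mult[OF \<delta>] algebra_ext_closed[OF \<delta>])
  moreover have "{u - v |u v. GL_relation l u v} \<subseteq> ?J"
    using rel by (auto simp: algebra_ext_diff[OF \<delta>] a_minus_def r_neg algebra_ext_closed[where \<delta> = \<delta>, OF \<delta>])
  ultimately have "GL_ideal l \<subseteq> ?J"
    unfolding GL_ideal_def by (rule F.genideal_minimal)
  then show ?thesis using x by auto
qed

lemma GL_lift:
  assumes \<delta>: "\<And>g. \<delta> g \<in> carrier A"
    and rel: "\<And>u v. GL_relation l u v \<Longrightarrow> algebra_ext A \<delta> u = algebra_ext A \<delta> v"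
  shows "descend (algebra_ext A \<delta>) (GL_class l x) = algebra_ext A \<delta> x"
    and "descend (algebra_ext A \<delta>) \<in> ring_hom (GL_h_alg l) A"
    and "linear_map (GL_h_alg l) A (descend (algebra_ext A \<delta>))"
proof -
  show 1: "descend (algebra_ext A \<delta>) (GL_class l x) = algebra_ext A \<delta> x" for x
    unfolding algebra_ext_def GL_cl[symmetric]
    by (rule GL.descend_linear_ext)
       (use calgebra_axioms \<delta> algebra_ext_kills_GL_ideal[OF \<delta> rel] in \<open>auto simp: word_prod_closed algebra_ext_def\<close>)
  have ops: "GL_class l x \<otimes>\<^bsub>GL_h_alg l\<^esub> GL_class l y = GL_class l (x \<otimes>\<^bsub>free_algebra\<^esub> y)"
    "GL_class l x \<oplus>\<^bsub>GL_h_alg l\<^esub> GL_class l y = GL_class l (x + y)"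
    "c \<odot>\<^bsub>GL_h_alg l\<^esub> GL_class l x = GL_class l (scale_pm c x)" for c x y
    using GL.Q_ops[of x y l] by (simp_all add: free_algebra_def)
  have car: "carrier (GL_h_alg l) = range (GL_class l)" using GL.Q_carrier[of l] GL_cover by auto
  show "descend (algebra_ext A \<delta>) \<in> ring_hom (GL_h_alg l) A"
  proof (rule ring_hom_memI)
    show "descend (algebra_ext A \<delta>) \<one>\<^bsub>GL_h_alg l\<^esub> = \<one>"
      by (simp add: GL.Q_one 1 algebra_ext_single[OF \<delta>])
  qed (auto simp: car ops 1 algebra_ext_closed[OF \<delta>] algebra_ext_mult[OF \<delta>] algebra_ext_add[OF \<delta>])
  show "linear_map (GL_h_alg l) A (descend (algebra_ext A \<delta>))"
    by (auto simp: linear_map_def car ops 1 algebra_ext_closed[OF \<delta>] algebra_ext_add[OF \<delta>] algebra_ext_smult[OF \<delta>])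
qed

end

section \<open>Relations and minors in the algebra of the general linear group\<close>

lemma GL_carrier: "carrier (GL_h_alg l) = range (GL_class l)"
  using GL.Q_carrier[of l] GL_cover by auto

lemma GL_ops:
  "GL_class l x \<otimes>\<^bsub>GL_h_alg l\<^esub> GL_class l y = GL_class l (x \<otimes>\<^bsub>free_algebra\<^esub> y)"
  "GL_class l x \<oplus>\<^bsub>GL_h_alg l\<^esub> GL_class l y = GL_class l (x + y)"
  "c \<odot>\<^bsub>GL_h_alg l\<^esub> GL_class l x = GL_class l (scale_pm c x)"
  "\<one>\<^bsub>GL_h_alg l\<^esub> = GL_class l (word [])" "\<zero>\<^bsub>GL_h_alg l\<^esub> = GL_class l 0"
  using GL.Q_ops[of x y l] by (simp_all add: free_algebra_def GL.Q_one GL.Q_zero)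

lemma GL_class_closed [simp]: "GL_class l x \<in> carrier (GL_h_alg l)"
  by (simp add: GL_carrier)

lemma GL_class_eq_iff: "GL_class l x = GL_class l y \<longleftrightarrow> x - y \<in> GL_ideal l"
  using GL.cl_eq_iff[of l x y] by simp

lemma GL_relation_ideal: "GL_relation l u v \<Longrightarrow> u - v \<in> GL_ideal l"
proof -
  interpret F: calgebra free_algebra by (rule calgebra_free_algebra)
  assume "GL_relation l u v"
  moreover have "{u - v |u v. GL_relation l u v} \<subseteq> GL_ideal l"
    unfolding GL_ideal_def by (rule F.genideal_self) (simp add: free_algebra_def)
  ultimately show ?thesis by blast
qed

lemma GL_relation_eq: "GL_relation l u v \<Longrightarrow> GL_class l u = GL_class l v"
  by (simp add: GL_class_eq_iff GL_relation_ideal)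

lemma word_mult: "Poly_Mapping.single u c \<otimes>\<^bsub>free_algebra\<^esub> Poly_Mapping.single v d = Poly_Mapping.single (u @ v) (c * d)"
  unfolding free_algebra_def by (simp add: monoid_algebra_mult_single)

lemma GL_word_append: "GL_class l (word (u @ v)) = GL_class l (word u) \<otimes>\<^bsub>GL_h_alg l\<^esub> GL_class l (word v)"
  by (simp add: GL_ops word_mult)

lemma GL_word_Cons: "GL_class l (word (g # v)) = GL_class l (word [g]) \<otimes>\<^bsub>GL_h_alg l\<^esub> GL_class l (word v)"
  using GL_word_append[of l "[g]" v] by simp

lemma GL_class_sum: "GL_class l (sum f S) = (\<Oplus>\<^bsub>GL_h_alg l\<^esub>i\<in>S. GL_class l (f i))"
  using GL.cl_sum[of S f l] by simp

lemma GL_class_single: "GL_class l (Poly_Mapping.single w c) = c \<odot>\<^bsub>GL_h_alg l\<^esub> GL_class l (word w)"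
  by (simp add: GL_ops scale_pm_simps)

lemma GL_mu: "mu_l (GL_h_alg l) f = GL_class l (word [GenL f])" "mu_r (GL_h_alg l) f = GL_class l (word [GenR f])"
  by (simp_all add: GL_h_alg_def module.defs h_alg.defs)

abbreviation deg_l :: "'n::finite gen list \<Rightarrow> complex^'n"
  where "deg_l w \<equiv> sum_list (map gen_deg_l w)"

abbreviation deg_r :: "'n::finite gen list \<Rightarrow> complex^'n"
  where "deg_r w \<equiv> sum_list (map gen_deg_r w)"

lemma GL_grade: "grade (GL_h_alg l) \<alpha> \<beta> = GL_class l ` {x. Poly_Mapping.keys x \<subseteq> {w. deg_l w = \<alpha> \<and> deg_r w = \<beta>}}"
  by (auto simp: GL_h_alg_def module.defs h_alg.defs)

lemma GL_grade_word: "deg_l w = \<alpha> \<Longrightarrow> deg_r w = \<beta> \<Longrightarrow> GL_class l (word w) \<in> grade (GL_h_alg l) \<alpha> \<beta>"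
  unfolding GL_grade by (rule imageI) simp

lemma GL_induct_keys:
  assumes x: "Poly_Mapping.keys x \<subseteq> K" and "P \<zero>\<^bsub>GL_h_alg l\<^esub>"
    and t: "\<And>w c. w \<in> K \<Longrightarrow> P (c \<odot>\<^bsub>GL_h_alg l\<^esub> GL_class l (word w))"
    and add: "\<And>y z. y \<in> carrier (GL_h_alg l) \<Longrightarrow> z \<in> carrier (GL_h_alg l) \<Longrightarrow> P y \<Longrightarrow> P z \<Longrightarrow> P (y \<oplus>\<^bsub>GL_h_alg l\<^esub> z)"
  shows "P (GL_class l x)"
  using x
proof (induction x rule: pm_induct)
  case zero
  show ?case using assms(2) by (simp add: GL_ops)
next
  case (single w c)
  then show ?case using t by (subst GL_class_single) blast
next
  case (add y z)
  then show ?case using assms(4)[of "GL_class l y" "GL_class l z"] by (simp add: GL_ops)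
qed

lemma GL_induct [consumes 1, case_names zero word add]:
  assumes "y \<in> carrier (GL_h_alg l)" and "P \<zero>\<^bsub>GL_h_alg l\<^esub>"
    and "\<And>w c. P (c \<odot>\<^bsub>GL_h_alg l\<^esub> GL_class l (word w))"
    and "\<And>y z. y \<in> carrier (GL_h_alg l) \<Longrightarrow> z \<in> carrier (GL_h_alg l) \<Longrightarrow> P y \<Longrightarrow> P z \<Longrightarrow> P (y \<oplus>\<^bsub>GL_h_alg l\<^esub> z)"
  shows "P y"
proof -
  obtain x where x: "y = GL_class l x" using assms(1) by (auto simp: GL_carrier)
  show ?thesis unfolding x by (rule GL_induct_keys[where K = UNIV]) (use assms in auto)
qed

lemma GL_grade_induct [consumes 1, case_names zero word add]:
  assumes "y \<in> grade (GL_h_alg l) \<alpha> \<beta>" and "P \<zero>\<^bsub>GL_h_alg l\<^esub>"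
    and "\<And>w c. deg_l w = \<alpha> \<Longrightarrow> deg_r w = \<beta> \<Longrightarrow> P (c \<odot>\<^bsub>GL_h_alg l\<^esub> GL_class l (word w))"
    and "\<And>y z. y \<in> carrier (GL_h_alg l) \<Longrightarrow> z \<in> carrier (GL_h_alg l) \<Longrightarrow> P y \<Longrightarrow> P z \<Longrightarrow> P (y \<oplus>\<^bsub>GL_h_alg l\<^esub> z)"
  shows "P y"
proof -
  obtain x where x: "y = GL_class l x" "Poly_Mapping.keys x \<subseteq> {w. deg_l w = \<alpha> \<and> deg_r w = \<beta>}"
    using assms(1) unfolding GL_grade by blast
  show ?thesis unfolding x by (rule GL_induct_keys[OF x(2)]) (use assms in auto)
qed

lemmas GL_rels = GL_relation_eq[OF M_rel[OF L_const]] GL_relation_eq[OF M_rel[OF L_add]] GL_relation_eq[OF M_rel[OF L_mult]]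
  GL_relation_eq[OF M_rel[OF R_const]] GL_relation_eq[OF M_rel[OF R_add]] GL_relation_eq[OF M_rel[OF R_mult]]
  GL_relation_eq[OF M_rel[OF L_R]] GL_relation_eq[OF M_rel[OF L_T]] GL_relation_eq[OF M_rel[OF R_T]]
  GL_relation_eq[OF T_det_inv] GL_relation_eq[OF L_det_inv] GL_relation_eq[OF R_det_inv]

text \<open>Moment map generators have degree zero, so commuting past one of them is the case of a
  trivial shift, and one rule covers all kinds of generators.\<close>

lemma GL_gen_commute:
  "GL_class l (word [GenL f, g]) = GL_class l (word [g, GenL (mero_shift (gen_deg_l g) f)])"
  "GL_class l (word [GenR f, g]) = GL_class l (word [g, GenR (mero_shift (gen_deg_r g) f)])"
proof -
  have L: "GL_class l (word [GenL f, GenL f']) = GL_class l (word [GenL f', GenL f])" for f'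
    unfolding GL_rels(3)[symmetric] by (simp only: mult.commute)
  have R: "GL_class l (word [GenR f, GenR f']) = GL_class l (word [GenR f', GenR f])" for f'
    unfolding GL_rels(6)[symmetric] by (simp only: mult.commute)
  show "GL_class l (word [GenL f, g]) = GL_class l (word [g, GenL (mero_shift (gen_deg_l g) f)])"
    by (cases g) (simp_all only: gen_deg_l.simps mero_shift_0 L[of] GL_rels(7,8,11))
  show "GL_class l (word [GenR f, g]) = GL_class l (word [g, GenR (mero_shift (gen_deg_r g) f)])"
    by (cases g) (simp_all only: gen_deg_r.simps mero_shift_0 R GL_rels(7)[symmetric] GL_rels(9,12))
qed

lemma GL_word_commute:
  "GL_class l (word (GenL f # w)) = GL_class l (word (w @ [GenL (mero_shift (deg_l w) f)]))"
  "GL_class l (word (GenR f # w)) = GL_class l (word (w @ [GenR (mero_shift (deg_r w) f)]))"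
proof (induction w arbitrary: f)
  case (Cons g w)
  have swap: "GL_class l (word (a # g # w)) = GL_class l (word (g # w @ [c]))"
    if "GL_class l (word [a, g]) = GL_class l (word [g, b])" "GL_class l (word (b # w)) = GL_class l (word (w @ [c]))" for a b c
  proof -
    have "GL_class l (word ([a, g] @ w)) = GL_class l (word ([g, b] @ w))"
      unfolding GL_word_append that(1) ..
    also have "\<dots> = GL_class l (word ([g] @ (b # w)))" by simp
    also have "\<dots> = GL_class l (word ([g] @ (w @ [c])))"
      unfolding GL_word_append[of l "[g]"] that(2) ..
    finally show ?thesis by simp
  qed
  show "GL_class l (word (GenL f # g # w)) = GL_class l (word ((g # w) @ [GenL (mero_shift (deg_l (g # w)) f)]))" for f
    using swap[OF GL_gen_commute(1)[of l f g] Cons.IH(1)]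
    by (simp only: mero_shift_shift list.map sum_list.Cons append_Cons add.commute[of "sum_list _"])
  show "GL_class l (word (GenR f # g # w)) = GL_class l (word ((g # w) @ [GenR (mero_shift (deg_r (g # w)) f)]))" for f
    using swap[OF GL_gen_commute(2)[of l f g] Cons.IH(2)]
    by (simp only: mero_shift_shift list.map sum_list.Cons append_Cons add.commute[of "sum_list _"])
qed simp_all

lemma pre_h_alg_GL: "pre_h_alg (GL_h_alg l :: ('n::{finite,linorder}, 'n GL_elt) h_alg)"
proof (intro pre_h_alg.intro pre_h_alg_axioms.intro)
  let ?A = "GL_h_alg l :: ('n, 'n GL_elt) h_alg"
  let ?K = "\<lambda>\<alpha> \<beta>. {w. deg_l w = \<alpha> \<and> deg_r w = \<beta>}"
  show "calgebra ?A" by (rule GL.Q.calgebra_axioms)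
  show "submodule (grade ?A \<alpha> \<beta>) complex_ring ?A" for \<alpha> \<beta>
  proof (rule Module.module.submoduleI[OF GL.Q.module])
    show "grade ?A \<alpha> \<beta> \<subseteq> carrier ?A" unfolding GL_grade by auto
    show "\<zero>\<^bsub>?A\<^esub> \<in> grade ?A \<alpha> \<beta>" unfolding GL_grade GL_ops by (rule imageI) simp
    show sm: "c \<odot>\<^bsub>?A\<^esub> x \<in> grade ?A \<alpha> \<beta>" if x: "x \<in> grade ?A \<alpha> \<beta>" for c x
    proof -
      obtain u where u: "x = GL_class l u" "Poly_Mapping.keys u \<subseteq> ?K \<alpha> \<beta>" using x unfolding GL_grade by blast
      have "Poly_Mapping.keys (scale_pm c u) \<subseteq> ?K \<alpha> \<beta>" using u(2) keys_scale_pm[of c u] by blast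
      then show ?thesis unfolding u(1) GL_ops GL_grade by blast
    qed
    show "\<ominus>\<^bsub>?A\<^esub> x \<in> grade ?A \<alpha> \<beta>" if x: "x \<in> grade ?A \<alpha> \<beta>" for x
    proof -
      have "x \<in> carrier ?A" using x unfolding GL_grade by auto
      then show ?thesis using GL.Q.smult_minus[of x] sm[OF x, of "- 1"] by simp
    qed
    show "x \<oplus>\<^bsub>?A\<^esub> y \<in> grade ?A \<alpha> \<beta>" if x: "x \<in> grade ?A \<alpha> \<beta>" "y \<in> grade ?A \<alpha> \<beta>" for x y
    proof -
      obtain u v where u: "x = GL_class l u" "Poly_Mapping.keys u \<subseteq> ?K \<alpha> \<beta>" "y = GL_class l v" "Poly_Mapping.keys v \<subseteq> ?K \<alpha> \<beta>"
        using x unfolding GL_grade by blast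
      have "Poly_Mapping.keys (u + v) \<subseteq> ?K \<alpha> \<beta>" using u Poly_Mapping.keys_add[of u v] by blast
      then show ?thesis unfolding u(1,3) GL_ops GL_grade by blast
    qed
  qed
  show "\<one>\<^bsub>?A\<^esub> \<in> grade ?A 0 0" unfolding GL_ops by (rule GL_grade_word) auto
  show "mu_l ?A f \<in> grade ?A 0 0" "mu_r ?A f \<in> grade ?A 0 0" for f
    unfolding GL_mu by (rule GL_grade_word; simp)+
  show "x \<otimes>\<^bsub>?A\<^esub> y \<in> grade ?A (\<alpha> + \<gamma>) (\<beta> + \<delta>)" if x: "x \<in> grade ?A \<alpha> \<beta>" and y: "y \<in> grade ?A \<gamma> \<delta>" for x y \<alpha> \<beta> \<gamma> \<delta>
  proof -
    obtain u v where u: "x = GL_class l u" "Poly_Mapping.keys u \<subseteq> ?K \<alpha> \<beta>" "y = GL_class l v" "Poly_Mapping.keys v \<subseteq> ?K \<gamma> \<delta>"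
      using x y unfolding GL_grade by blast
    have "Poly_Mapping.keys (u \<otimes>\<^bsub>free_algebra\<^esub> v) \<subseteq> ?K (\<alpha> + \<gamma>) (\<beta> + \<delta>)"
      unfolding free_algebra_def monoid_algebra_def partial_object.simps monoid.simps
    proof (intro keys_sum_subset)
      fix i j assume "i \<in> Poly_Mapping.keys u" "j \<in> Poly_Mapping.keys v"
      then have "i \<in> ?K \<alpha> \<beta>" "j \<in> ?K \<gamma> \<delta>" using u by auto
      then show "Poly_Mapping.keys (Poly_Mapping.single (i @ j) (Poly_Mapping.lookup u i * Poly_Mapping.lookup v j))
          \<subseteq> ?K (\<alpha> + \<gamma>) (\<beta> + \<delta>)" by auto
    qed
    then show ?thesis unfolding u(1,3) GL_ops GL_grade by blast
  qed
  fix x \<alpha> \<beta> f assume x: "x \<in> grade ?A \<alpha> \<beta>"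
  have m: "mu_l ?A f \<in> carrier ?A" "mu_r ?A f \<in> carrier ?A" for f by (simp_all add: GL_mu)
  show "mu_l ?A f \<otimes>\<^bsub>?A\<^esub> x = x \<otimes>\<^bsub>?A\<^esub> mu_l ?A (mero_shift \<alpha> f)" using x
  proof (induction x rule: GL_grade_induct)
    case (word w c)
    then have "mu_l ?A f \<otimes>\<^bsub>?A\<^esub> GL_class l (word w) = GL_class l (word w) \<otimes>\<^bsub>?A\<^esub> mu_l ?A (mero_shift \<alpha> f)"
      using GL_word_commute(1)[of l f w] by (simp add: GL_mu GL_word_append flip: GL_word_Cons)
    then show ?case using m by (simp add: GL.Q.smult_mult_left GL.Q.smult_mult_right)
  next
    case (add y z)
    then show ?case using m by (simp add: GL.Q.l_distr GL.Q.r_distr)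
  qed (use m in simp)
  show "mu_r ?A f \<otimes>\<^bsub>?A\<^esub> x = x \<otimes>\<^bsub>?A\<^esub> mu_r ?A (mero_shift \<beta> f)" using x
  proof (induction x rule: GL_grade_induct)
    case (word w c)
    then have "mu_r ?A f \<otimes>\<^bsub>?A\<^esub> GL_class l (word w) = GL_class l (word w) \<otimes>\<^bsub>?A\<^esub> mu_r ?A (mero_shift \<beta> f)"
      using GL_word_commute(2)[of l f w] by (simp add: GL_mu GL_word_append flip: GL_word_Cons)
    then show ?case using m by (simp add: GL.Q.smult_mult_left GL.Q.smult_mult_right)
  next
    case (add y z)
    then show ?case using m by (simp add: GL.Q.l_distr GL.Q.r_distr)
  qed (use m in simp)
qed

section \<open>Minors as sums over arrangements of the rows\<close>

primrec word_sign :: "complex \<Rightarrow> 'n::{finite,linorder} list \<Rightarrow> 'n mero"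
  where "word_sign l [] = 1"
  | "word_sign l (x # xs) = (\<Prod>m\<in>{m\<in>set xs. m < x}. - at_diff (h_fun l) x m) * word_sign l xs"

text \<open>The inversions of a list are those of its tail, with positions raised by one, and those
  that involve its head; the latter correspond to the smaller entries of the tail.\<close>

lemma word_sign_eq_prod:
  "distinct xs \<Longrightarrow> word_sign l xs =
    (\<Prod>(k, m)\<in>{(k, m). k < m \<and> m < length xs \<and> xs ! k > xs ! m}. - at_diff (h_fun l) (xs ! k) (xs ! m))"
proof (induction xs)
  case (Cons x xs)
  let ?f = "\<lambda>(k, m). - at_diff (h_fun l) ((x # xs) ! k) ((x # xs) ! m)"
  let ?S = "{(k, m). k < m \<and> m < length xs \<and> xs ! k > xs ! m}" and ?J = "{m. m < length xs \<and> xs ! m < x}"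
  have fin: "finite ?S" by (rule finite_subset[of _ "{..<length xs} \<times> {..<length xs}"]) auto
  have "{(k, m). k < m \<and> m < length (x # xs) \<and> (x # xs) ! k > (x # xs) ! m} =
      (\<lambda>m. (0, Suc m)) ` ?J \<union> (\<lambda>(k, m). (Suc k, Suc m)) ` ?S" (is "?L = ?R")
  proof (rule equalityI; rule subsetI)
    fix p assume "p \<in> ?L"
    then obtain k m where p: "p = (k, m)" "k < m" "m < Suc (length xs)" "(x # xs) ! k > (x # xs) ! m" by auto
    then obtain m' where m: "m = Suc m'" by (cases m) auto
    show "p \<in> ?R" using p by (cases k) (auto simp: m image_iff)
  qed auto
  moreover have "prod ?f ((\<lambda>m. (0, Suc m)) ` ?J \<union> (\<lambda>(k, m). (Suc k, Suc m)) ` ?S) =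
      prod ?f ((\<lambda>m. (0, Suc m)) ` ?J) * prod ?f ((\<lambda>(k, m). (Suc k, Suc m)) ` ?S)"
    using fin by (intro prod.union_disjoint) auto
  moreover have "prod ?f ((\<lambda>m. (0, Suc m)) ` ?J) = (\<Prod>m\<in>?J. - at_diff (h_fun l) x (xs ! m))"
    by (subst prod.reindex) (auto simp: inj_on_def)
  moreover have "(\<Prod>m\<in>?J. - at_diff (h_fun l) x (xs ! m)) = (\<Prod>m\<in>{m\<in>set xs. m < x}. - at_diff (h_fun l) x m)"
    by (rule prod.reindex_bij_betw[of "\<lambda>m. xs ! m" ?J "{m\<in>set xs. m < x}" "\<lambda>m. - at_diff (h_fun l) x m"])
       (use Cons.prems in \<open>auto simp: bij_betw_def inj_on_def nth_eq_iff_index_eq in_set_conv_nth image_iff\<close>)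
  moreover have "prod ?f ((\<lambda>(k, m). (Suc k, Suc m)) ` ?S) = word_sign l xs"
    using Cons by (subst prod.reindex) (auto simp: inj_on_def case_prod_unfold)
  ultimately show ?case by (simp only: word_sign.simps)
qed simp

text \<open>Permuting the sorted list of I identifies permutations of positions with orderings of I.
  As that list is increasing, the inversions of \<sigma> are the inversions of the resulting
  ordering.\<close>

lemma free_minor_arrangements:
  fixes I J :: "'n::{finite,linorder} set"
  assumes "card J = card I"
  shows "free_minor l I J =
    (\<Sum>as\<in>arrangements I. word (GenL (word_sign l as) # map2 GenT as (sorted_list_of_set J)))"
proof -
  define L where "L = sorted_list_of_set I"
  have L: "length L = card I" "distinct L" "set L = I" "sorted_wrt (<) L" by (simp_all add: L_def strict_sorted_list_of_set)
  let ?P = "{\<sigma>. \<sigma> permutes {..<card I}}"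
  have bij: "bij_betw (\<lambda>\<sigma>. permute_list \<sigma> L) ?P (arrangements I)"
  proof (rule bij_betw_imageI)
    show "inj_on (\<lambda>\<sigma>. permute_list \<sigma> L) ?P"
    proof (intro inj_onI ext)
      fix \<sigma> \<tau> k assume *: "\<sigma> \<in> ?P" "\<tau> \<in> ?P" "permute_list \<sigma> L = permute_list \<tau> L"
      show "\<sigma> k = \<tau> k"
      proof (cases "k < card I")
        case True
        then have "L ! \<sigma> k = L ! \<tau> k"
          using * permute_list_nth[of \<sigma> L k] permute_list_nth[of \<tau> L k] by (simp add: L(1))
        moreover have "\<sigma> k < card I" "\<tau> k < card I"
          using * True permutes_in_image[of _ "{..<card I}" k] by auto
        ultimately show ?thesis using L by (simp add: nth_eq_iff_index_eq)
      next
        case False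
        then show ?thesis using * by (simp add: permutes_not_in)
      qed
    qed
    show "(\<lambda>\<sigma>. permute_list \<sigma> L) ` ?P = arrangements I"
    proof (rule equalityI; rule subsetI)
      fix as assume "as \<in> (\<lambda>\<sigma>. permute_list \<sigma> L) ` ?P"
      then show "as \<in> arrangements I" using L by (auto simp: arrangements_def)
    next
      fix as assume "as \<in> arrangements I"
      then have "mset as = mset L"
        using L(2,3) set_eq_iff_mset_eq_distinct[of as L] by (simp add: arrangements_def)
      then obtain \<sigma> where "\<sigma> permutes {..<length L}" "permute_list \<sigma> L = as"
        using mset_eq_permutation by metis
      then show "as \<in> (\<lambda>\<sigma>. permute_list \<sigma> L) ` ?P" using L by auto
    qed
  qed
  have summand: "word (GenL (perm_coeff l \<sigma> I) # map (\<lambda>k. GenT (L ! \<sigma> k) (sorted_list_of_set J ! k)) [0..<card I]) =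
      word (GenL (word_sign l (permute_list \<sigma> L)) # map2 GenT (permute_list \<sigma> L) (sorted_list_of_set J))"
    if \<sigma>: "\<sigma> \<in> ?P" for \<sigma>
  proof -
    have nth: "permute_list \<sigma> L ! k = L ! \<sigma> k" if "k < card I" for k
      using \<sigma> that permute_list_nth[of \<sigma> L k] by (simp add: L)
    have lt: "\<sigma> k < card I" if "k < card I" for k
      using \<sigma> that permutes_in_image[of \<sigma> "{..<card I}" k] by auto
    have ord: "L ! i < L ! j \<longleftrightarrow> i < j" if "i < card I" "j < card I" for i j
      using that L sorted_wrt_nth_less[OF L(4)] by (metis linorder_cases order_less_asym order_less_irrefl)
    have "perm_coeff l \<sigma> I = word_sign l (permute_list \<sigma> L)"
      unfolding perm_coeff_def L_def[symmetric]
    proof (subst word_sign_eq_prod)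
      show "distinct (permute_list \<sigma> L)" using L \<sigma> by auto
      have "\<sigma> m < \<sigma> k \<longleftrightarrow> permute_list \<sigma> L ! m < permute_list \<sigma> L ! k" if "k < m" "m < card I" for k m
        using that nth[of k] nth[of m] ord[OF lt[of m] lt[of k]] by simp
      then show "(\<Prod>(k, m)\<in>{(k, m). k < m \<and> m < card I \<and> \<sigma> m < \<sigma> k}. - at_diff (h_fun l) (L ! \<sigma> k) (L ! \<sigma> m)) =
        (\<Prod>(k, m)\<in>{(k, m). k < m \<and> m < length (permute_list \<sigma> L) \<and> permute_list \<sigma> L ! m < permute_list \<sigma> L ! k}.
          - at_diff (h_fun l) (permute_list \<sigma> L ! k) (permute_list \<sigma> L ! m))"
        by (intro prod.cong) (auto simp: L(1) nth)
    qed
    moreover have "map (\<lambda>k. GenT (L ! \<sigma> k) (sorted_list_of_set J ! k)) [0..<card I] =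
        map2 GenT (permute_list \<sigma> L) (sorted_list_of_set J)"
      using assms by (intro nth_equalityI) (simp_all add: L nth)
    ultimately show ?thesis by simp
  qed
  have "free_minor l I J = (\<Sum>\<sigma>\<in>?P. word (GenL (word_sign l (permute_list \<sigma> L)) #
      map2 GenT (permute_list \<sigma> L) (sorted_list_of_set J)))"
    unfolding free_minor_def L_def[symmetric] by (intro sum.cong refl summand)
  also have "\<dots> = (\<Sum>as\<in>arrangements I. word (GenL (word_sign l as) # map2 GenT as (sorted_list_of_set J)))"
    by (rule sum.reindex_bij_betw[OF bij])
  finally show ?thesis .
qed

section \<open>Counit and bigrading\<close>

lemma word_sign_sorted: "sorted_wrt (<) xs \<Longrightarrow> word_sign l xs = 1"
proof (induction xs)
  case (Cons x xs)
  then have "(\<Prod>m\<in>{m\<in>set xs. m < x}. - at_diff (h_fun l) x m) = 1"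
    by (intro prod.neutral) auto
  then show ?case using Cons by simp
qed simp

lemma sum_unit_weight: "sum unit_weight (UNIV :: 'n::finite set) = (1 :: complex^'n)"
  by (simp add: vec_eq_iff axis_def)

lemma sum_list_unit_weight:
  "as \<in> arrangements (UNIV :: 'n::finite set) \<Longrightarrow> sum_list (map unit_weight as) = (1 :: complex^'n)"
  by (simp add: arrangements_def sum_list_distinct_conv_sum_set sum_unit_weight)

lemma sorted_list_arrangement: "sorted_list_of_set I \<in> arrangements (I :: 'n::{finite,linorder} set)"
  by (simp add: arrangements_def)

lemma length_arrangement: "as \<in> arrangements I \<Longrightarrow> length as = card I"
  by (auto simp: arrangements_def distinct_card)

text \<open>A nonzero entry has the same unordered pair of indices above and below.\<close>

lemma R_mat_weight:
  "R_mat l x y a c \<noteq> 0 \<Longrightarrow> unit_weight x + unit_weight y = unit_weight a + (unit_weight c :: complex^'n::{finite,linorder})"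
proof -
  assume "R_mat l x y a c \<noteq> 0"
  then consider "a = x" "c = y" | "a = y" "c = x"
    by (cases "x = y"; cases "a = x \<and> c = y"; cases "a = y \<and> c = x") (simp_all add: R_mat_def split: if_splits)
  then show ?thesis
  proof cases
    case 2
    show ?thesis unfolding 2 by (rule add.commute)
  qed simp
qed

section \<open>The counit\<close>

lemma finsum_diff_ops:
  "f \<in> S \<rightarrow> carrier diff_ops \<Longrightarrow> finsum diff_ops f S = (\<lambda>g. \<Sum>i\<in>S. f i g)"
proof (induction S rule: infinite_finite_induct)
  case (insert i S)
  then have f: "f \<in> S \<rightarrow> carrier diff_ops" "f i \<in> carrier diff_ops" by (auto simp: Pi_def)
  show ?case unfolding diff_ops.finsum_insert[OF insert(1,2) f] insert.IH[OF f(1)] using insert(1,2) by simp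
qed (simp_all add: diff_ops.finsum_infinite)

lemma GL_counit_gen_carrier [simp]: "GL_counit_gen g \<in> carrier diff_ops"
  using diff_ops_single[of "case g of GenL f \<Rightarrow> f | GenR f \<Rightarrow> f" 0] diff_ops_single[of 1] diff_ops_zero
  by (cases g) auto

abbreviation free_counit :: "'n::finite free \<Rightarrow> 'n mero \<Rightarrow> 'n mero"
  where "free_counit \<equiv> algebra_ext diff_ops GL_counit_gen"

lemma free_counit_word_Cons: "free_counit (word (g # w)) h = GL_counit_gen g (free_counit (word w) h)"
  and free_counit_Nil: "free_counit (word []) h = h"
  and free_counit_single: "free_counit (Poly_Mapping.single w c) h = mero_const c * free_counit (word w) h"
  by (simp_all add: diff_ops.algebra_ext_single)

lemma free_counit_sum: "finite S \<Longrightarrow> free_counit (sum f S) h = (\<Sum>i\<in>S. free_counit (f i) h)"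
  by (subst diff_ops.algebra_ext_sum, simp, simp, subst finsum_diff_ops)
     (auto intro: diff_ops.algebra_ext_closed)

lemma free_counit_add: "free_counit (x + y) h = free_counit x h + free_counit y h"
  by (simp add: diff_ops.algebra_ext_add)

lemma free_counit_mult: "free_counit (x \<otimes>\<^bsub>free_algebra\<^esub> y) = free_counit x \<circ> free_counit y"
  by (simp add: diff_ops.algebra_ext_mult)

lemma free_counit_T_word:
  "length as = length bs \<Longrightarrow> free_counit (word (map2 GenT as bs)) h =
    (if as = bs then mero_shift (- sum_list (map unit_weight as)) h else 0)"
proof (induction as bs rule: list_induct2)
  case Nil
  then show ?case by (simp add: free_counit_Nil)
next
  case (Cons a as b bs)
  then show ?case by (simp add: free_counit_word_Cons)
qed

text \<open>The counit kills the off-diagonal generators, so only the increasing arrangement of the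
  rows contributes, with sign 1 and total weight the all-ones vector.\<close>

lemma free_counit_det: "free_counit (free_minor l UNIV UNIV) h = mero_shift (- 1) (h :: 'n::{finite,linorder} mero)"
proof -
  let ?L = "sorted_list_of_set (UNIV :: 'n set)"
  have "free_counit (free_minor l UNIV UNIV) h =
      (\<Sum>as\<in>arrangements UNIV. word_sign l as * (if as = ?L then mero_shift (- sum_list (map unit_weight as)) h else 0))"
    unfolding free_minor_arrangements[of UNIV UNIV, OF refl] free_counit_sum[OF finite_arrangements[OF finite]]
    by (intro sum.cong refl) (simp add: free_counit_word_Cons free_counit_T_word length_arrangement)
  also have "\<dots> = word_sign l ?L * mero_shift (- sum_list (map unit_weight ?L)) h"
    using sorted_list_arrangement[of "UNIV :: 'n set"]
    by (simp add: if_distrib[of "\<lambda>x. _ * x"] finite_arrangements cong: if_cong)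
  finally show ?thesis
    by (simp add: word_sign_sorted sum_list_unit_weight[OF sorted_list_arrangement])
qed

lemma sum_delta_delta:
  fixes F :: "'n::finite \<Rightarrow> 'n \<Rightarrow> 'b::comm_monoid_add"
  shows "(\<Sum>x\<in>UNIV. \<Sum>y\<in>UNIV. if b = x then if d = y then F x y else 0 else 0) = F b d"
proof -
  have "(\<Sum>y\<in>UNIV. if b = x then if d = y then F x y else 0 else 0) = (if b = x then F x d else 0)" for x
    by simp
  then show ?thesis by simp
qed

lemma free_counit_M_relation: "M_relation l u v \<Longrightarrow> free_counit u h = free_counit v h"
proof (induction rule: M_relation.induct)
  case (RLL a c b d)
  have 1: "free_counit (word [GenL f, GenT x b, GenT y d]) h =
      (if b = x then if d = y then f * mero_shift (- (unit_weight b + unit_weight d)) h else 0 else 0)" for f x y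
    by (simp add: free_counit_word_Cons free_counit_Nil)
  have 2: "free_counit (word [GenR f, GenT c y, GenT a x]) h =
      (if a = x then if c = y then f * mero_shift (- (unit_weight c + unit_weight a)) h else 0 else 0)" for f x y
    by (simp add: free_counit_word_Cons free_counit_Nil)
  \<comment> \<open>Both sides collapse to the entry with upper indices b, d and lower indices a, c.
    If it is nonzero, conservation of weight makes the two shifts equal.\<close>
  have "R_mat l b d a c * mero_shift (- (unit_weight b + unit_weight d)) h =
      R_mat l b d a c * mero_shift (- (unit_weight c + unit_weight a)) h"
    using R_mat_weight[of l b d a c] by (cases "R_mat l b d a c = 0") (simp_all only: add.commute mult_zero_left not_False_eq_True)
  then show ?case by (simp only: free_counit_sum finite_class.finite_UNIV finite 1 2 sum_delta_delta)
next
  case (L_T f i j)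
  then show ?case by (simp add: free_counit_word_Cons free_counit_Nil mero_shift_mult)
next
  case (R_T f i j)
  then show ?case by (simp add: free_counit_word_Cons free_counit_Nil mero_shift_mult)
next
  case (L_R f g)
  then show ?case by (simp only: free_counit_word_Cons free_counit_Nil GL_counit_gen.simps mult.left_commute)
next
  case (L_const c)
  show ?case by (subst free_counit_single) (simp only: free_counit_word_Cons free_counit_Nil GL_counit_gen.simps)
next
  case (R_const c)
  show ?case by (subst free_counit_single) (simp only: free_counit_word_Cons free_counit_Nil GL_counit_gen.simps)
qed (simp_all only: free_counit_word_Cons free_counit_Nil free_counit_add GL_counit_gen.simps distrib_right mult.assoc)

lemma free_counit_relation: "GL_relation l u v \<Longrightarrow> free_counit u = free_counit v"
proof (rule ext)
  fix h assume "GL_relation l u v"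
  then show "free_counit u h = free_counit v h"
    by (induction rule: GL_relation.induct)
       (auto simp: free_counit_M_relation free_counit_mult free_counit_det free_counit_word_Cons free_counit_Nil
         mero_shift_mult)
qed

definition GL_counit :: "complex \<Rightarrow> 'n::{finite,linorder} GL_elt \<Rightarrow> 'n mero \<Rightarrow> 'n mero"
  where "GL_counit l = descend free_counit"

lemma GL_counit_class: "GL_counit l (GL_class l x) = free_counit x"
  unfolding GL_counit_def by (rule diff_ops.GL_lift(1)[OF _ free_counit_relation]) auto

lemma GL_counit_ring_hom: "GL_counit l \<in> ring_hom (GL_h_alg l) diff_ops"
  unfolding GL_counit_def by (rule diff_ops.GL_lift(2)[OF _ free_counit_relation]) auto

lemma GL_counit_linear_map: "linear_map (GL_h_alg l) diff_ops (GL_counit l)"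
  unfolding GL_counit_def by (rule diff_ops.GL_lift(3)[OF _ free_counit_relation]) auto

lemma GL_counit_mu: "GL_counit l (mu_l (GL_h_alg l) f) h = f * h" "GL_counit l (mu_r (GL_h_alg l) f) h = f * h"
  by (simp_all add: GL_mu GL_counit_class free_counit_word_Cons free_counit_Nil)

text \<open>A word acts as one weighted shift, and as zero unless its two degrees agree. This is
  what membership in a component of \<open>diff_ops\<close> asks for, as the components off the
  diagonal are zero.\<close>

lemma free_counit_word_deg:
  "\<exists>f. free_counit (word w) = (\<lambda>h. f * mero_shift (- deg_r w) h) \<and> (f = 0 \<or> deg_l w = deg_r w)"
proof (induction w)
  case Nil
  show ?case by (intro exI[of _ 1]) (auto simp: free_counit_Nil)
next
  case (Cons g w)
  then obtain f where f: "free_counit (word w) = (\<lambda>h. f * mero_shift (- deg_r w) h)" "f = 0 \<or> deg_l w = deg_r w" by blast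
  have e: "free_counit (word (g # w)) = (\<lambda>h. GL_counit_gen g (f * mero_shift (- deg_r w) h))"
    unfolding fun_eq_iff free_counit_word_Cons f(1) by simp
  show ?case
  proof (cases g)
    case (GenL f')
    then show ?thesis using f(2) unfolding e by (intro exI[of _ "f' * f"]) (auto simp: mult.assoc)
  next
    case (GenR f')
    then show ?thesis using f(2) unfolding e by (intro exI[of _ "f' * f"]) (auto simp: mult.assoc)
  next
    case (GenT i j)
    show ?thesis
    proof (cases "i = j")
      case True
      then show ?thesis using f(2) unfolding e
        by (intro exI[of _ "mero_shift (- unit_weight i) f"]) (auto simp: GenT mero_shift_mult)
    next
      case False
      then show ?thesis unfolding e by (intro exI[of _ 0]) (simp add: GenT)
    qed
  next
    case GenDetInv
    then show ?thesis using f(2) unfolding e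
      by (intro exI[of _ "mero_shift 1 f"]) (auto simp: mero_shift_mult)
  qed
qed

lemma GL_counit_grade: "a \<in> grade (GL_h_alg l) \<alpha> \<beta> \<Longrightarrow> GL_counit l a \<in> grade diff_ops \<alpha> \<beta>"
proof (induction a rule: GL_grade_induct)
  case zero
  then show ?case
    using linear_map_zero[OF GL.Q.calgebra_axioms diff_ops.calgebra_axioms GL_counit_linear_map] diff_ops.grade_zero
    by metis
next
  case (word w c)
  obtain f where f: "free_counit (word w) = (\<lambda>h. f * mero_shift (- deg_r w) h)" "f = 0 \<or> deg_l w = deg_r w"
    using free_counit_word_deg by blast
  have "free_counit (word w) \<in> grade diff_ops \<alpha> \<beta>"
    unfolding f(1) using f(2) word by (auto simp: diff_ops_grade image_iff intro: exI[of _ 0])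
  then show ?case
    using diff_ops.grade_smult by (simp add: linear_mapD(3)[OF GL_counit_linear_map] GL_counit_class del: diff_ops_simps)
next
  case (add y z)
  then show ?case
    using diff_ops.grade_add by (simp add: linear_mapD(2)[OF GL_counit_linear_map] del: diff_ops_simps)
qed

lemma GL_counit_hom: "h_algebra_hom (GL_h_alg l) diff_ops (GL_counit l)"
  unfolding h_algebra_hom_def
proof (intro conjI allI ballI GL_counit_ring_hom linear_mapD(3)[OF GL_counit_linear_map])
  show "GL_counit l ` grade (GL_h_alg l) \<alpha> \<beta> \<subseteq> grade diff_ops \<alpha> \<beta>" for \<alpha> \<beta>
    using GL_counit_grade by blast
  show "GL_counit l (mu_l (GL_h_alg l) f) = mu_l diff_ops f" "GL_counit l (mu_r (GL_h_alg l) f) = mu_r diff_ops f" for f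
    by (simp_all add: fun_eq_iff GL_counit_mu)
qed

text \<open>Injectivity is detected by the counit: for either moment map, the counit of the image of
  f, applied to the function 1, returns f.\<close>

lemma moment_map_GL:
  fixes l :: complex
  shows "moment_map (GL_h_alg l :: ('n::{finite,linorder}, 'n GL_elt) h_alg) (mu_l (GL_h_alg l))"
    and "moment_map (GL_h_alg l :: ('n, 'n GL_elt) h_alg) (mu_r (GL_h_alg l))"
proof -
  let ?A = "GL_h_alg l :: ('n, 'n GL_elt) h_alg"
  interpret A: pre_h_alg ?A by (rule pre_h_alg_GL)
  have c: "GL_class l (Poly_Mapping.single [] c) = c \<odot>\<^bsub>?A\<^esub> \<one>\<^bsub>?A\<^esub>" for c
    by (simp add: GL_ops scale_pm_simps)
  have inj: "inj \<mu>" if "\<And>f h. GL_counit l (\<mu> f) h = f * h" for \<mu> :: "'n mero \<Rightarrow> 'n GL_elt"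
  proof (rule injI)
    fix f f' assume "\<mu> f = \<mu> f'"
    then have "f * 1 = f' * 1" using that by metis
    then show "f = f'" by simp
  qed
  have hom: "moment_map ?A \<mu>" if "inj \<mu>" "\<And>f. \<mu> f \<in> grade ?A 0 0"
    "\<And>f g. \<mu> (f + g) = \<mu> f \<oplus>\<^bsub>?A\<^esub> \<mu> g" "\<And>f g. \<mu> (f * g) = \<mu> f \<otimes>\<^bsub>?A\<^esub> \<mu> g"
    "\<And>c. \<mu> (mero_const c) = c \<odot>\<^bsub>?A\<^esub> \<one>\<^bsub>?A\<^esub>" for \<mu>
  proof -
    have car: "\<mu> f \<in> carrier ?A" for f using that(2) A.grade_carrier by blast
    have "\<mu> 1 = \<one>\<^bsub>?A\<^esub>" using that(5)[of 1] by simp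
    then have r1: "\<mu> \<in> ring_hom ring_of_type_algebra ?A"
      by (intro ring_hom_memI) (simp_all add: that(3,4) car)
    have r2: "\<mu> (mero_const c * f) = c \<odot>\<^bsub>?A\<^esub> \<mu> f" for c f
      unfolding that(4,5) by (subst GL.Q.smult_mult_left) (simp_all add: car)
    have r3: "range \<mu> \<subseteq> grade ?A 0 0" using that(2) by blast
    show ?thesis unfolding moment_map_def using r1 r2 r3 that(1) by simp
  qed
  show "moment_map ?A (mu_l ?A)"
  proof (rule hom[OF inj[OF GL_counit_mu(1)] A.mu_grade(1)])
    show "mu_l ?A (f + g) = mu_l ?A f \<oplus>\<^bsub>?A\<^esub> mu_l ?A g" for f g
      unfolding GL_mu GL_rels(2) GL_ops(2) ..
    show "mu_l ?A (f * g) = mu_l ?A f \<otimes>\<^bsub>?A\<^esub> mu_l ?A g" for f g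
      unfolding GL_mu GL_rels(3) GL_word_Cons[of l _ "[_]"] ..
    show "mu_l ?A (mero_const c) = c \<odot>\<^bsub>?A\<^esub> \<one>\<^bsub>?A\<^esub>" for c
      unfolding GL_mu GL_rels(1) by (rule c)
  qed
  show "moment_map ?A (mu_r ?A)"
  proof (rule hom[OF inj[OF GL_counit_mu(2)] A.mu_grade(2)])
    show "mu_r ?A (f + g) = mu_r ?A f \<oplus>\<^bsub>?A\<^esub> mu_r ?A g" for f g
      unfolding GL_mu GL_rels(5) GL_ops(2) ..
    show "mu_r ?A (f * g) = mu_r ?A f \<otimes>\<^bsub>?A\<^esub> mu_r ?A g" for f g
      unfolding GL_mu GL_rels(6) GL_word_Cons[of l _ "[_]"] ..
    show "mu_r ?A (mero_const c) = c \<odot>\<^bsub>?A\<^esub> \<one>\<^bsub>?A\<^esub>" for c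
      unfolding GL_mu GL_rels(4) by (rule c)
  qed
qed

section \<open>The bigrading of the presented algebra\<close>

definition restrict_pm :: "('a \<Rightarrow> bool) \<Rightarrow> ('a \<Rightarrow>\<^sub>0 complex) \<Rightarrow> ('a \<Rightarrow>\<^sub>0 complex)"
  where "restrict_pm P x = (\<Sum>k\<in>{k \<in> Poly_Mapping.keys x. P k}. Poly_Mapping.single k (Poly_Mapping.lookup x k))"

lemma lookup_restrict_pm: "Poly_Mapping.lookup (restrict_pm P x) k = (if P k then Poly_Mapping.lookup x k else 0)"
  by (auto simp: restrict_pm_def lookup_sum lookup_single when_def not_in_keys_iff_lookup_eq_zero)

lemma keys_restrict_pm: "Poly_Mapping.keys (restrict_pm P x) = {k \<in> Poly_Mapping.keys x. P k}"
  by (auto simp: in_keys_iff lookup_restrict_pm split: if_splits)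

lemma restrict_pm_simps:
  "restrict_pm P (x + y) = restrict_pm P x + restrict_pm P y"
  "restrict_pm P (x - y) = restrict_pm P x - restrict_pm P y"
  "restrict_pm P (- x) = - restrict_pm P x"
  "restrict_pm P 0 = 0"
  "restrict_pm P (Poly_Mapping.single k c) = (if P k then Poly_Mapping.single k c else 0)"
  by (rule poly_mapping_eqI; auto simp: lookup_restrict_pm lookup_add lookup_minus lookup_single lookup_sum when_def)+

definition word_deg :: "'n::finite gen list \<Rightarrow> (complex^'n) \<times> (complex^'n)"
  where "word_deg w = (deg_l w, deg_r w)"

lemma word_deg_append: "word_deg (u @ v) = word_deg u + word_deg v"
  by (simp add: word_deg_def)

definition deg_part :: "(complex^'n) \<times> (complex^'n) \<Rightarrow> 'n::finite free \<Rightarrow> 'n free"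
  where "deg_part p = restrict_pm (\<lambda>w. word_deg w = p)"

lemma deg_part_mult_single:
  "deg_part p (Poly_Mapping.single w c \<otimes>\<^bsub>free_algebra\<^esub> x) = Poly_Mapping.single w c \<otimes>\<^bsub>free_algebra\<^esub> deg_part (p - word_deg w) x"
  "deg_part p (x \<otimes>\<^bsub>free_algebra\<^esub> Poly_Mapping.single w c) = deg_part (p - word_deg w) x \<otimes>\<^bsub>free_algebra\<^esub> Poly_Mapping.single w c"
proof -
  have k: "Poly_Mapping.keys x \<subseteq> UNIV" by simp
  show "deg_part p (Poly_Mapping.single w c \<otimes>\<^bsub>free_algebra\<^esub> x) = Poly_Mapping.single w c \<otimes>\<^bsub>free_algebra\<^esub> deg_part (p - word_deg w) x"
    using k unfolding free_algebra_def deg_part_def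
    by (induction x rule: pm_induct)
       (auto simp: monoid_algebra_mult_zero monoid_algebra_mult_add monoid_algebra_mult_single restrict_pm_simps
         word_deg_append algebra_simps)
  show "deg_part p (x \<otimes>\<^bsub>free_algebra\<^esub> Poly_Mapping.single w c) = deg_part (p - word_deg w) x \<otimes>\<^bsub>free_algebra\<^esub> Poly_Mapping.single w c"
    using k unfolding free_algebra_def deg_part_def
    by (induction x rule: pm_induct)
       (auto simp: monoid_algebra_mult_zero monoid_algebra_mult_add monoid_algebra_mult_single restrict_pm_simps
         word_deg_append algebra_simps)
qed

definition homogeneous_mod :: "complex \<Rightarrow> (complex, 'n) vec \<times> (complex, 'n) vec \<Rightarrow> 'n::{finite,linorder} free \<Rightarrow> bool"
  where "homogeneous_mod l p x \<longleftrightarrow>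
    x - deg_part p x \<in> GL_ideal l \<and> (\<forall>p'. p' \<noteq> p \<longrightarrow> deg_part p' x \<in> GL_ideal l)"

lemma homogeneous_mod_ideal: "word w \<in> GL_ideal l \<Longrightarrow> homogeneous_mod l p (word w)"
  by (auto simp: homogeneous_mod_def deg_part_def restrict_pm_simps GL.I_zero)

lemma homogeneous_mod_single: "word_deg w = p \<Longrightarrow> homogeneous_mod l p (Poly_Mapping.single w c)"
  by (auto simp: homogeneous_mod_def deg_part_def restrict_pm_simps GL.I_zero)

lemma homogeneous_mod_add:
  assumes "homogeneous_mod l p x" "homogeneous_mod l p y"
  shows "homogeneous_mod l p (x + y)"
proof -
  have "x + y - deg_part p (x + y) = (x - deg_part p x) + (y - deg_part p y)"
    "deg_part p' (x + y) = deg_part p' x + deg_part p' y" for p'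
    by (simp_all add: deg_part_def restrict_pm_simps)
  then show ?thesis
    using assms unfolding homogeneous_mod_def by (metis GL.I_add)
qed

lemma homogeneous_mod_sum:
  "(\<And>i. i \<in> S \<Longrightarrow> homogeneous_mod l p (f i)) \<Longrightarrow> homogeneous_mod l p (sum f S)"
proof (induction S rule: infinite_finite_induct)
  case (insert i S)
  then show ?case by (simp add: homogeneous_mod_add)
qed (simp_all add: homogeneous_mod_def deg_part_def restrict_pm_simps GL.I_zero)

text \<open>
  The relations are homogeneous only modulo the ideal: the RLL-relation contains words of the wrong
  degree with a coefficient \<open>GenL 0\<close> or \<open>GenR 0\<close>, which represents zero.
\<close>

lemma GL_ideal_zero_coeff: "word (GenL 0 # w) \<in> GL_ideal l" "word (GenR 0 # w) \<in> GL_ideal l"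
proof -
  have z: "GL_class l (word [GenL 0]) = GL_class l 0" "GL_class l (word [GenR 0]) = GL_class l 0"
    using GL_rels(1)[of l 0] GL_rels(4)[of l 0] by simp_all
  have "GL_class l (word (GenL 0 # w)) = GL_class l 0" "GL_class l (word (GenR 0 # w)) = GL_class l 0"
    by (subst GL_word_Cons, simp only: z, simp add: GL_ops free_algebra_def monoid_algebra_mult_zero)+
  then show "word (GenL 0 # w) \<in> GL_ideal l" "word (GenR 0 # w) \<in> GL_ideal l"
    unfolding GL_class_eq_iff by simp_all
qed

lemma word_deg_minor:
  "as \<in> arrangements (UNIV :: 'n::{finite,linorder} set) \<Longrightarrow>
    word_deg (GenL f # map2 GenT as (sorted_list_of_set UNIV)) = (1, 1)"
proof -
  assume as: "as \<in> arrangements (UNIV :: 'n set)"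
  have "deg_l (map2 GenT xs ys) = sum_list (map unit_weight xs)" "deg_r (map2 GenT xs ys) = sum_list (map unit_weight ys)"
    if "length xs = length ys" for xs ys :: "'n list"
    using that by (induction xs ys rule: list_induct2) auto
  then show ?thesis
    using as length_arrangement[OF as] sum_list_unit_weight[OF as] sum_list_unit_weight[OF sorted_list_arrangement]
    by (simp add: word_deg_def)
qed

lemma GL_relation_homogeneous:
  "GL_relation l u v \<Longrightarrow> \<exists>p. homogeneous_mod l p u \<and> homogeneous_mod l p v"
proof (induction rule: GL_relation.induct)
  case (M_rel u v)
  then show ?case
  proof (induction rule: M_relation.induct)
    case (RLL a c b d)
    let ?p = "(unit_weight a + unit_weight c, unit_weight b + unit_weight d)"
    have "homogeneous_mod l ?p (word [GenL (R_mat l x y a c), GenT x b, GenT y d])" for x y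
    proof (cases "R_mat l x y a c = 0")
      case True
      show ?thesis unfolding True by (rule homogeneous_mod_ideal[OF GL_ideal_zero_coeff(1)])
    next
      case False
      show ?thesis by (rule homogeneous_mod_single) (simp add: word_deg_def R_mat_weight[OF False])
    qed
    moreover have "homogeneous_mod l ?p (word [GenR (R_mat l b d x y), GenT c y, GenT a x])" for x y
    proof (cases "R_mat l b d x y = 0")
      case True
      show ?thesis unfolding True by (rule homogeneous_mod_ideal[OF GL_ideal_zero_coeff(2)])
    next
      case False
      show ?thesis
        by (rule homogeneous_mod_single)
           (simp add: word_deg_def R_mat_weight[OF False] add.commute[of "unit_weight c"] add.commute[of "unit_weight y"])
    qed
    ultimately show ?case by (intro exI[of _ ?p] conjI homogeneous_mod_sum)
  qed (rule exI, intro conjI homogeneous_mod_add homogeneous_mod_single; simp add: word_deg_def)+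
next
  case det_inv_right
  show ?case unfolding free_minor_arrangements[of UNIV UNIV, OF refl]
    by (intro exI[of _ 0] conjI homogeneous_mod_single)
       (auto simp: free_algebra_def monoid_algebra_mult_sum monoid_algebra_mult_single word_deg_append word_deg_minor
         zero_prod_def word_deg_def[of "[_]"] word_deg_def[of "[]"] simp del: append_Cons
         intro!: homogeneous_mod_sum homogeneous_mod_single)
next
  case det_inv_left
  have "word (GenDetInv # GenL f # map2 GenT as (sorted_list_of_set UNIV)) = word ([GenDetInv] @ (GenL f # map2 GenT as (sorted_list_of_set UNIV)))" for f and as
    by simp
  show ?case unfolding free_minor_arrangements[of UNIV UNIV, OF refl]
    by (intro exI[of _ 0] conjI homogeneous_mod_single)
       (auto simp: free_algebra_def monoid_algebra_mult_sum monoid_algebra_mult_single word_deg_append[of "[_]" "_ # _", simplified] word_deg_minor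
         zero_prod_def word_deg_def[of "[_]"] word_deg_def[of "[]"]
         intro!: homogeneous_mod_sum homogeneous_mod_single)
qed (rule exI, intro conjI homogeneous_mod_single; simp add: word_deg_def add.commute)+

lemma deg_part_sum: "(\<Sum>p\<in>word_deg ` Poly_Mapping.keys x. deg_part p x) = x"
  by (rule poly_mapping_eqI)
     (auto simp: lookup_sum deg_part_def lookup_restrict_pm not_in_keys_iff_lookup_eq_zero image_iff)

text \<open>The elements all of whose homogeneous parts lie in the ideal again form an ideal. It
  contains the relations, since these are homogeneous modulo the ideal. As a consequence the
  projections to homogeneous parts descend to the quotient.\<close>

lemma deg_part_ideal:
  fixes x :: "'n::{finite,linorder} free"
  assumes "x \<in> GL_ideal l"
  shows "deg_part p x \<in> GL_ideal l"
proof -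
  interpret F: calgebra free_algebra by (rule calgebra_free_algebra)
  have car: "carrier free_algebra = UNIV" "add free_algebra = (+)" "zero free_algebra = 0" "smult free_algebra = scale_pm"
    by (simp_all add: free_algebra_def)
  let ?J = "{x :: 'n free. \<forall>p. deg_part p x \<in> GL_ideal l}"
  have lin: "deg_part p (x + y) = deg_part p x + deg_part p y" "deg_part p (x - y) = deg_part p x - deg_part p y"
    "deg_part p (- x) = - deg_part p x" "deg_part p 0 = 0" for p x y
    by (simp_all add: deg_part_def restrict_pm_simps)
  have "ideal ?J free_algebra"
  proof (rule idealI)
    show "subgroup ?J (add_monoid free_algebra)"
    proof (rule group.subgroupI)
      show "Group.group (add_monoid free_algebra)" by (rule F.add.group_axioms)
      fix a assume a: "a \<in> ?J"
      have "\<ominus>\<^bsub>free_algebra\<^esub> a = - a" using F.smult_minus[of a] by (simp add: car scale_pm_simps)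
      then show "inv\<^bsub>add_monoid free_algebra\<^esub> a \<in> ?J"
        using a by (simp add: lin GL.I_uminus flip: a_inv_def)
    next
      have "0 \<in> ?J" by (simp add: lin GL.I_zero)
      then show "?J \<noteq> {}" by blast
    qed (simp_all add: car lin GL.I_add)
    fix a y :: "'n free" assume a: "a \<in> ?J"
    have "Poly_Mapping.keys y \<subseteq> UNIV" by simp
    then have "y \<otimes>\<^bsub>free_algebra\<^esub> a \<in> ?J \<and> a \<otimes>\<^bsub>free_algebra\<^esub> y \<in> ?J"
    proof (induction y rule: pm_induct)
      case zero
      then show ?case by (simp add: free_algebra_def monoid_algebra_mult_zero lin GL.I_zero)
    next
      case (single w c)
      then show ?case
      proof -
        have "Poly_Mapping.single w c \<otimes>\<^bsub>free_algebra\<^esub> i \<in> GL_ideal l \<and> i \<otimes>\<^bsub>free_algebra\<^esub> Poly_Mapping.single w c \<in> GL_ideal l"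
          if "i \<in> GL_ideal l" for i :: "'n free"
          using GL.I_mult_left[OF GL_cover that] GL.I_mult_right[OF GL_cover that] by (simp add: free_algebra_def)
        then show ?thesis using a unfolding mem_Collect_eq deg_part_mult_single by blast
      qed
    next
      case (add y z)
      then show ?case by (simp add: free_algebra_def monoid_algebra_mult_add lin GL.I_add)
    qed
    then show "y \<otimes>\<^bsub>free_algebra\<^esub> a \<in> ?J" "a \<otimes>\<^bsub>free_algebra\<^esub> y \<in> ?J" by auto
  qed (rule F.ring_axioms)
  moreover have "{u - v |u v. GL_relation l u v} \<subseteq> ?J"
  proof clarify
    fix u v p' assume uv: "GL_relation l u v"
    then obtain p where p: "homogeneous_mod l p u" "homogeneous_mod l p v" using GL_relation_homogeneous by blast
    show "deg_part p' (u - v) \<in> GL_ideal l"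
    proof (cases "p' = p")
      case True
      \<comment> \<open>In the distinguished degree the homogeneous part of u - v differs from u - v
        itself only by elements of the ideal.\<close>
      have "deg_part p (u - v) = (u - v) - ((u - deg_part p u) - (v - deg_part p v))" by (simp add: lin)
      also have "\<dots> \<in> GL_ideal l"
        by (rule GL.I_diff[OF GL_relation_ideal[OF uv] GL.I_diff]) (use p in \<open>simp_all add: homogeneous_mod_def\<close>)
      finally show ?thesis by (simp add: True)
    next
      case False
      then have "deg_part p' u \<in> GL_ideal l" "deg_part p' v \<in> GL_ideal l"
        using p unfolding homogeneous_mod_def by blast+
      then show ?thesis unfolding lin by (rule GL.I_diff)
    qed
  qed
  ultimately have "GL_ideal l \<subseteq> ?J"
    unfolding GL_ideal_def by (rule F.genideal_minimal)
  then show ?thesis using assms by blast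
qed

text \<open>By \<open>deg_part_ideal\<close> the projection \<open>pr p\<close> is independent of
  the chosen representative. Applied to any decomposition into homogeneous elements it returns the
  component of degree p, which gives uniqueness.\<close>

lemma bigraded_GL: "bigraded (GL_h_alg l :: ('n::{finite,linorder}, 'n GL_elt) h_alg)"
proof -
  let ?A = "GL_h_alg l :: ('n, 'n GL_elt) h_alg"
  interpret A: pre_h_alg ?A by (rule pre_h_alg_GL)
  define pr where "pr p y = GL_class l (deg_part p (SOME x. GL_class l x = y))" for p and y :: "'n GL_elt"
  have pr: "pr p (GL_class l x) = GL_class l (deg_part p x)" for p x
  proof -
    define x' where "x' = (SOME x'. GL_class l x' = GL_class l x)"
    have "GL_class l x' = GL_class l x" unfolding x'_def by (rule someI_ex) blast
    then have "deg_part p (x' - x) \<in> GL_ideal l" unfolding GL_class_eq_iff by (rule deg_part_ideal)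
    then show ?thesis
      unfolding pr_def x'_def[symmetric] unfolding GL_class_eq_iff by (simp add: deg_part_def restrict_pm_simps)
  qed
  have lin: "linear_map ?A ?A (pr p)" for p
    unfolding linear_map_def GL_carrier
    by (auto simp: GL_ops pr deg_part_def restrict_pm_simps intro!: arg_cong[of _ _ "GL_class l"] poly_mapping_eqI)
       (simp add: lookup_restrict_pm)
  have pr_grade: "pr p y = (if p = p' then y else \<zero>\<^bsub>?A\<^esub>)" if that': "y \<in> grade ?A (fst p') (snd p')" for p p' y
  proof -
    have "{w. deg_l w = fst p' \<and> deg_r w = snd p'} = {w. word_deg w = p'}"
      by (auto simp: word_deg_def)
    then have "y \<in> GL_class l ` {x. Poly_Mapping.keys x \<subseteq> {w. word_deg w = p'}}"
      using that' unfolding GL_grade by simp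
    then obtain x where x: "y = GL_class l x" "Poly_Mapping.keys x \<subseteq> {w. word_deg w = p'}" by blast
    have "deg_part p x = (if p = p' then x else 0)"
      using x(2) by (intro poly_mapping_eqI) (auto simp: deg_part_def lookup_restrict_pm in_keys_iff subset_iff)
    then show ?thesis unfolding x(1) pr by (simp add: GL_ops)
  qed
  have in_grade: "pr p y \<in> grade ?A (fst p) (snd p)" if y: "y \<in> carrier ?A" for p y
  proof -
    obtain x where x: "y = GL_class l x" using y unfolding GL_carrier by blast
    show ?thesis unfolding x pr GL_grade
      by (rule imageI) (auto simp: deg_part_def keys_restrict_pm word_deg_def)
  qed
  have "\<exists>!c. (\<forall>\<alpha> \<beta>. c (\<alpha>, \<beta>) \<in> grade ?A \<alpha> \<beta>) \<and> finite {p. c p \<noteq> \<zero>\<^bsub>?A\<^esub>} \<and>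
       y = (\<Oplus>\<^bsub>?A\<^esub>p\<in>{p. c p \<noteq> \<zero>\<^bsub>?A\<^esub>}. c p)" if y: "y \<in> carrier ?A" for y
  proof (rule ex1I[of _ "\<lambda>p. pr p y"])
    obtain x where x: "y = GL_class l x" using y unfolding GL_carrier by blast
    let ?D = "word_deg ` Poly_Mapping.keys x"
    have sub: "{p. pr p y \<noteq> \<zero>\<^bsub>?A\<^esub>} \<subseteq> ?D"
    proof
      fix p assume "p \<in> {p. pr p y \<noteq> \<zero>\<^bsub>?A\<^esub>}"
      then have "deg_part p x \<noteq> 0" by (auto simp: x pr GL_ops)
      then have "Poly_Mapping.keys (deg_part p x) \<noteq> {}" by simp
      then show "p \<in> ?D" by (auto simp: deg_part_def keys_restrict_pm)
    qed
    have "y = (\<Oplus>\<^bsub>?A\<^esub>p\<in>?D. pr p y)"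
      unfolding x pr GL_class_sum[symmetric] deg_part_sum ..
    also have "\<dots> = (\<Oplus>\<^bsub>?A\<^esub>p\<in>{p. pr p y \<noteq> \<zero>\<^bsub>?A\<^esub>}. pr p y)"
      using sub linear_mapD(1)[OF lin y] by (intro GL.Q.add.finprod_mono_neutral_cong_right) auto
    finally show "(\<forall>\<alpha> \<beta>. pr (\<alpha>, \<beta>) y \<in> grade ?A \<alpha> \<beta>) \<and> finite {p. pr p y \<noteq> \<zero>\<^bsub>?A\<^esub>} \<and>
       y = (\<Oplus>\<^bsub>?A\<^esub>p\<in>{p. pr p y \<noteq> \<zero>\<^bsub>?A\<^esub>}. pr p y)"
      using in_grade[OF y] finite_subset[OF sub] by (metis finite_imageI finite_keys fst_conv snd_conv)
  next
    fix c assume c: "(\<forall>\<alpha> \<beta>. c (\<alpha>, \<beta>) \<in> grade ?A \<alpha> \<beta>) \<and> finite {p. c p \<noteq> \<zero>\<^bsub>?A\<^esub>} \<and>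
       y = (\<Oplus>\<^bsub>?A\<^esub>p\<in>{p. c p \<noteq> \<zero>\<^bsub>?A\<^esub>}. c p)"
    let ?S = "{p. c p \<noteq> \<zero>\<^bsub>?A\<^esub>}"
    have cg: "c p \<in> grade ?A (fst p) (snd p)" for p using c by (cases p) auto
    then have cc: "c p \<in> carrier ?A" for p using A.grade_carrier by blast
    show "c = (\<lambda>p. pr p y)"
    proof
      fix p
      have "pr p (\<Oplus>\<^bsub>?A\<^esub>p\<in>?S. c p) = (\<Oplus>\<^bsub>?A\<^esub>p'\<in>?S. pr p (c p'))"
        using cc by (intro linear_map_finsum[OF GL.Q.calgebra_axioms GL.Q.calgebra_axioms lin]) auto
      also have "\<dots> = (\<Oplus>\<^bsub>?A\<^esub>p'\<in>?S. if p = p' then c p' else \<zero>\<^bsub>?A\<^esub>)"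
        using cc by (intro GL.Q.finsum_cong') (auto simp: pr_grade[OF cg])
      also have "\<dots> = c p"
      proof (cases "p \<in> ?S")
        case True
        then show ?thesis using cc c by (intro GL.Q.finsum_singleton) auto
      next
        case False
        then have "(\<Oplus>\<^bsub>?A\<^esub>p'\<in>?S. if p = p' then c p' else \<zero>\<^bsub>?A\<^esub>) = (\<Oplus>\<^bsub>?A\<^esub>p'\<in>?S. \<zero>\<^bsub>?A\<^esub>)"
          by (intro GL.Q.finsum_cong') auto
        then show ?thesis using False by simp
      qed
      finally show "c p = pr p y" using c by simp
    qed
  qed
  then show ?thesis
    unfolding bigraded_def by (intro conjI allI ballI A.grade_submodule A.one_grade A.mult_grade)
qed

interpretation GL: pre_h_alg "GL_h_alg l" for l
  by (rule pre_h_alg_GL)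

lemma h_algebra_GL: "h_algebra (GL_h_alg l :: ('n::{finite,linorder}, 'n GL_elt) h_alg)"
proof -
  show ?thesis
    unfolding h_algebra_def
    by (intro conjI allI ballI bigraded_GL moment_map_GL GL.complex_algebra_Q GL.mu_l_commute GL.mu_r_commute)
qed

section \<open>The antipode relations\<close>

primrec full_sign :: "complex \<Rightarrow> 'n::finite list \<Rightarrow> 'n mero"
  where "full_sign l [] = 1"
  | "full_sign l (x # xs) = (\<Prod>m\<in>set xs. - at_diff (h_fun l) x m) * full_sign l xs"

text \<open>The coordinates of the evaluation point. Distinct indices have nonzero integral
  differences, so every factor is regular there, and consecutive indices differ by 1, the zero of
  h.\<close>

definition rank :: "'n::{finite,linorder} \<Rightarrow> int"
  where "rank x = int (card {y. y < x})"

primrec full_sign_val :: "complex \<Rightarrow> 'n::{finite,linorder} list \<Rightarrow> complex"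
  where "full_sign_val l [] = 1"
  | "full_sign_val l (x # xs) = (\<Prod>m\<in>set xs. - h_fun l (of_int (rank x - rank m))) * full_sign_val l xs"

lemma rank_less: "x < y \<Longrightarrow> rank x < rank y"
  unfolding rank_def by (simp, rule psubset_card_mono) auto

lemma rank_eq_iff [simp]: "rank x = rank y \<longleftrightarrow> x = y"
  using rank_less[of x y] rank_less[of y x] by (cases x y rule: linorder_cases) auto

lemma mero_val_full_sign:
  assumes "generic_log l" "distinct xs"
  shows "mero_val (\<chi> i. of_int (rank i)) (full_sign l xs) (full_sign_val l xs)"
  using assms(2)
proof (induction xs)
  case Nil
  show ?case using mero_val_const[of _ 1] by simp
next
  case (Cons x xs)
  have "mero_val (\<chi> i. of_int (rank i)) (- at_diff (h_fun l) x m) (- h_fun l (of_int (rank x - rank m)))"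
    if "m \<in> set xs" for m
    by (intro mero_val_uminus mero_val_h_fun[OF assms(1)]) (use that Cons.prems in auto)
  then show ?case using Cons by (simp add: mero_val_mult mero_val_prod)
qed

text \<open>
  At the point \<open>rank\<close> the factor \<open>h(\<lambda>\<^sub>x - \<lambda>\<^sub>m)\<close> vanishes exactly when \<open>m\<close> is the predecessor of \<open>x\<close>, so
  only the increasing arrangement contributes.
\<close>

lemma sum_full_sign_val_nonzero:
  fixes I :: "'n::{finite,linorder} set"
  assumes "generic_log l" "\<forall>x\<in>I. \<forall>y. x < y \<longrightarrow> y \<in> I"
  shows "sum (full_sign_val l) (arrangements I) \<noteq> 0"
  using assms(2)
proof (induction "card I" arbitrary: I)
  case 0
  then show ?case by simp
next
  case (Suc n)
  then have I: "I \<noteq> {}" by auto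
  define P where "P x = (\<Prod>m\<in>I - {x}. - h_fun l (of_int (rank x - rank m)))" for x
  have "sum (full_sign_val l) (arrangements I) =
      (\<Sum>x\<in>I. \<Sum>as\<in>arrangements (I - {x}). full_sign_val l (x # as))"
    using I by (intro sum_arrangements) simp_all
  also have "\<dots> = (\<Sum>x\<in>I. P x * sum (full_sign_val l) (arrangements (I - {x})))"
    unfolding sum_distrib_left by (intro sum.cong refl) (simp add: arrangements_def P_def)
  also have "\<dots> = (\<Sum>x\<in>{Min I}. P x * sum (full_sign_val l) (arrangements (I - {x})))"
  proof (rule sum.mono_neutral_right)
    show "\<forall>x\<in>I - {Min I}. P x * sum (full_sign_val l) (arrangements (I - {x})) = 0"
    proof
      fix x assume x: "x \<in> I - {Min I}"
      then have less: "Min I < x" by (metis DiffE Min_le finite insertI1 order.not_eq_order_implies_strict)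
      define y where "y = Max {z. z < x}"
      have "y \<in> {z. z < x}" unfolding y_def by (rule Max_in) (use less in auto)
      then have y: "y < x" by simp
      have max: "z \<le> y" if "z < x" for z unfolding y_def using that by (intro Max_ge) auto
      have "{z. z < x} = insert y {z. z < y}" using y max by force
      then have "rank x - rank y = 1" by (simp add: rank_def)
      then have h: "h_fun l (of_int (rank x - rank y)) = 0"
        using h_fun_of_int_eq_0_iff[OF assms(1), of "rank x - rank y"] by simp
      \<comment> \<open>y is the predecessor of x in the whole type. It is not below
        \<open>Min I\<close>, and I is closed upwards, so y belongs to I and the factor for y occurs
        in \<open>P x\<close>.\<close>
      have "Min I \<in> I" using I by simp
      then have "y \<in> I" using max[OF less] Suc.prems by (metis order.order_iff_strict)
      then have "y \<in> I - {x}" using y by auto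
      then have "P x = 0" unfolding P_def using h by (intro prod_zero) auto
      then show "P x * sum (full_sign_val l) (arrangements (I - {x})) = 0" by simp
    qed
  qed (use I in auto)
  also have "\<dots> = P (Min I) * sum (full_sign_val l) (arrangements (I - {Min I}))" by simp
  also have "\<dots> \<noteq> 0"
  proof -
    have "h_fun l (of_int (rank (Min I) - rank m)) \<noteq> 0" if "m \<in> I - {Min I}" for m
    proof -
      have "Min I < m" using that by (metis DiffE Min_le finite insertI1 order.not_eq_order_implies_strict)
      then have "rank (Min I) < rank m" by (rule rank_less)
      then show ?thesis using h_fun_of_int_eq_0_iff[OF assms(1), of "rank (Min I) - rank m"] \<open>Min I < m\<close> by auto
    qed
    then have "P (Min I) \<noteq> 0" unfolding P_def by simp
    moreover have "sum (full_sign_val l) (arrangements (I - {Min I})) \<noteq> 0"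
    proof (rule Suc.hyps(1))
      show "n = card (I - {Min I})" using Suc.hyps(2) I by simp
      show "\<forall>x\<in>I - {Min I}. \<forall>y. x < y \<longrightarrow> y \<in> I - {Min I}"
        using Suc.prems by (metis DiffD1 Min_le finite insert_Diff insert_iff linorder_not_less Diff_iff singletonD)
    qed
    ultimately show ?thesis by simp
  qed
  finally show ?case .
qed

lemma sum_full_sign_nonzero:
  assumes "generic_log l"
  shows "sum (full_sign l) (arrangements (UNIV :: 'n::{finite,linorder} set)) \<noteq> 0"
proof (rule mero_val_nonzero)
  show "mero_val (\<chi> i. of_int (rank i)) (sum (full_sign l) (arrangements (UNIV :: 'n set)))
      (sum (full_sign_val l) (arrangements (UNIV :: 'n set)))"
    by (intro mero_val_sum mero_val_full_sign[OF assms]) (simp add: arrangements_def)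
qed (rule sum_full_sign_val_nonzero[OF assms], simp)

text \<open>An anti-homomorphism is a homomorphism into the opposite algebra, which allows S to be
  defined through the universal property of the presentation.\<close>

definition opposite :: "(complex, 'a, 'm) module_scheme \<Rightarrow> (complex, 'a, 'm) module_scheme"
  where "opposite A = A\<lparr>mult := \<lambda>x y. y \<otimes>\<^bsub>A\<^esub> x\<rparr>"

lemma opposite_simps [simp]:
  "carrier (opposite A) = carrier A" "mult (opposite A) = (\<lambda>x y. y \<otimes>\<^bsub>A\<^esub> x)" "one (opposite A) = one A"
  "zero (opposite A) = zero A" "add (opposite A) = add A" "smult (opposite A) = smult A"
  by (simp_all add: opposite_def)

lemma (in calgebra) calgebra_opposite: "calgebra (opposite A)"
proof -
  have ag: "abelian_group (opposite A)"
  proof (rule abelian_groupI)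
    fix x assume "x \<in> carrier (opposite A)"
    then show "\<exists>y\<in>carrier (opposite A). y \<oplus>\<^bsub>opposite A\<^esub> x = \<zero>\<^bsub>opposite A\<^esub>"
      by (intro bexI[of _ "\<ominus> x"]) (simp_all add: l_neg)
  qed (simp_all add: a_assoc a_comm a_lcomm)
  have "ring (opposite A)"
  proof (rule ringI[OF ag])
    show "Group.monoid (opposite A)" by (rule monoidI) (simp_all add: m_assoc)
  qed (simp_all add: l_distr r_distr)
  moreover have "Module.module complex_ring (opposite A)"
    by (rule moduleI[OF cring_complex ag]) (simp_all add: smult_add_left smult_add_right smult_smult)
  ultimately show ?thesis
    by (simp add: calgebra_def complex_algebra_def smult_mult_left smult_mult_right)
qed

definition free_tinv :: "complex \<Rightarrow> 'n::{finite,linorder} \<Rightarrow> 'n \<Rightarrow> 'n free"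
  where "free_tinv l i j =
    word [GenDetInv, GenL (dyn_sign l (- {j}) {j}), GenR (inverse (dyn_sign l (- {i}) {i}))]
      \<otimes>\<^bsub>free_algebra\<^esub> free_minor l (- {j}) (- {i})"

primrec free_antipode_gen :: "complex \<Rightarrow> 'n::{finite,linorder} gen \<Rightarrow> 'n free"
  where "free_antipode_gen l (GenL f) = word [GenR f]"
  | "free_antipode_gen l (GenR f) = word [GenL f]"
  | "free_antipode_gen l (GenT i j) = free_tinv l i j"
  | "free_antipode_gen l GenDetInv = free_minor l UNIV UNIV"

abbreviation antipode_gen :: "complex \<Rightarrow> 'n::{finite,linorder} gen \<Rightarrow> 'n GL_elt"
  where "antipode_gen l g \<equiv> GL_class l (free_antipode_gen l g)"

text \<open>Everything that the later sections take from the computation in a ring type: both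
  inverse relations, the rule for minors with any list of columns, and compatibility of S with the
  defining relations. It is phrased through words in the free algebra, so that it makes sense for
  each value of the parameter.\<close>

definition gl_identities :: "'n::{finite,linorder} itself \<Rightarrow> complex \<Rightarrow> bool"
  where "gl_identities _ l \<longleftrightarrow>
    (\<forall>i j :: 'n. GL_class l (\<Sum>k\<in>UNIV. word [GenT i k] \<otimes>\<^bsub>free_algebra\<^esub> free_tinv l k j) = GL_class l (if i = j then word [] else 0)) \<and>
    (\<forall>i j :: 'n. GL_class l (\<Sum>k\<in>UNIV. free_tinv l i k \<otimes>\<^bsub>free_algebra\<^esub> word [GenT k j]) = GL_class l (if i = j then word [] else 0)) \<and>
    (\<forall>bs :: 'n list. length bs = CARD('n) \<longrightarrow>
      GL_class l (\<Sum>as\<in>arrangements UNIV. word (GenL (word_sign l as) # map2 GenT as bs)) =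
      GL_class l (if distinct bs then word [GenR (word_sign l bs)] \<otimes>\<^bsub>free_algebra\<^esub> free_minor l UNIV UNIV else 0)) \<and>
    (\<forall>u v :: 'n free. GL_relation l u v \<longrightarrow>
      algebra_ext (opposite (GL_h_alg l)) (antipode_gen l) u = algebra_ext (opposite (GL_h_alg l)) (antipode_gen l) v)"

text \<open>
  The noncommutative computations are done in a type of class \<open>ring\<close>, but the carrier of the
  algebra depends on the parameter.  It suffices to treat one parameter value, namely a
  counterexample to \<^const>\<open>gl_identities\<close> if there is any, and that value can be used in a type
  definition.
\<close>

definition worst_log :: "'n::{finite,linorder} itself \<Rightarrow> complex"
  where "worst_log n = (SOME l. generic_log l \<and>
    ((\<exists>l'. generic_log l' \<and> \<not> gl_identities n l') \<longrightarrow> \<not> gl_identities n l))"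

lemma worst_log: "generic_log (worst_log n)"
  and worst_log_suffices: "gl_identities n (worst_log n) \<Longrightarrow> generic_log l \<Longrightarrow> gl_identities n l"
proof -
  \<comment> \<open>The choice needs at least one admissible parameter. The logarithm 1 is one: the
    positive powers of e have modulus above 1, so e is not a root of unity.\<close>
  have "exp 1 ^ k \<noteq> (1 :: complex)" if "k > 0" for k :: nat
  proof -
    have "norm (exp (of_nat k) :: complex) = exp (real k)" by simp
    then show ?thesis using that by (metis exp_eq_one_iff exp_of_nat_mult less_numeral_extra(3) mult.right_neutral norm_one of_nat_eq_0_iff)
  qed
  then have "generic_log 1" by (simp add: generic_log_def)
  then have "\<exists>l. generic_log l \<and> ((\<exists>l'. generic_log l' \<and> \<not> gl_identities n l') \<longrightarrow> \<not> gl_identities n l)"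
    by blast
  from someI_ex[OF this, folded worst_log_def]
  show "generic_log (worst_log n)" "gl_identities n (worst_log n) \<Longrightarrow> generic_log l \<Longrightarrow> gl_identities n l"
    by blast+
qed

typedef (overloaded) ('n::"{finite,linorder}") gl_ring =
  "carrier (GL_h_alg (worst_log TYPE('n)) :: ('n, 'n GL_elt) h_alg)"
  morphisms rep_gl abs_gl
  by (rule exI[of _ "GL_class (worst_log TYPE('n)) 0"]) simp

section \<open>The algebra for the chosen parameter as a ring type\<close>

definition gl_cl :: "'n::{finite,linorder} free \<Rightarrow> 'n gl_ring"
  where "gl_cl x = abs_gl (GL_class (worst_log TYPE('n)) x)"

lemma rep_gl_cl: "rep_gl (gl_cl x) = GL_class (worst_log TYPE('n)) (x :: 'n::{finite,linorder} free)"
  unfolding gl_cl_def by (rule abs_gl_inverse) simp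

lemma gl_cl_surj: "\<exists>x. a = gl_cl x"
  using rep_gl[of a] unfolding GL_carrier gl_cl_def by (metis imageE rep_gl_inverse)

lemma gl_cl_eq_iff: "gl_cl x = gl_cl y \<longleftrightarrow> GL_class (worst_log TYPE('n)) x = GL_class (worst_log TYPE('n)) (y :: 'n::{finite,linorder} free)"
  by (metis rep_gl_cl rep_gl_inject)

instantiation gl_ring :: ("{finite,linorder}") "{ring,monoid_mult}"
begin

definition "zero_gl_ring = gl_cl 0"
definition "one_gl_ring = gl_cl (word [])"
definition "plus_gl_ring a b = abs_gl (rep_gl a \<oplus>\<^bsub>GL_h_alg (worst_log TYPE('a))\<^esub> rep_gl b)" for a b :: "'a gl_ring"
definition "times_gl_ring a b = abs_gl (rep_gl a \<otimes>\<^bsub>GL_h_alg (worst_log TYPE('a))\<^esub> rep_gl b)" for a b :: "'a gl_ring"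
definition "uminus_gl_ring a = gl_cl (- (SOME x. a = gl_cl x))" for a :: "'a gl_ring"
definition "minus_gl_ring a b = a + - b" for a b :: "'a gl_ring"

lemma gl_cl_add: "gl_cl (x + y) = gl_cl x + gl_cl y"
  by (simp add: plus_gl_ring_def rep_gl_cl GL_ops) (simp add: gl_cl_def)

lemma gl_cl_mult: "gl_cl (x \<otimes>\<^bsub>free_algebra\<^esub> y) = gl_cl x * gl_cl y"
  by (simp add: times_gl_ring_def rep_gl_cl GL_ops) (simp add: gl_cl_def)

lemma gl_cl_zero: "gl_cl 0 = 0" and gl_cl_one: "gl_cl (word []) = 1"
  by (simp_all add: zero_gl_ring_def one_gl_ring_def)

lemma gl_cl_uminus: "gl_cl (- x) = - gl_cl x"
proof -
  define y where "y = (SOME y. gl_cl x = gl_cl y)"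
  have "gl_cl x = gl_cl y" unfolding y_def by (rule someI_ex) blast
  then have "gl_cl x + gl_cl (- x) = gl_cl y + gl_cl (- x)" by simp
  then have "y - x \<in> GL_ideal (worst_log TYPE('a))"
    by (simp add: GL_class_eq_iff gl_cl_eq_iff GL.I_uminus flip: gl_cl_add)
       (metis \<open>gl_cl x = gl_cl y\<close> GL_class_eq_iff gl_cl_eq_iff)
  then have "gl_cl (- x) = gl_cl (- y)" by (simp add: gl_cl_eq_iff GL_class_eq_iff)
  then show ?thesis by (simp add: uminus_gl_ring_def y_def)
qed

instance
proof
  interpret F: calgebra "free_algebra :: (complex, 'a free) module" by (rule calgebra_free_algebra)
  have car: "x \<in> carrier free_algebra" for x :: "'a free" by (simp add: free_algebra_def)
  have add: "add free_algebra = ((+) :: 'a free \<Rightarrow> _)" by (simp add: free_algebra_def)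
  fix a b c :: "'a gl_ring"
  obtain x y z where *: "a = gl_cl x" "b = gl_cl y" "c = gl_cl z" using gl_cl_surj by metis
  show "a + b + c = a + (b + c)" "a + b = b + a" "0 + a = a"
    by (simp_all add: * add_ac flip: gl_cl_add gl_cl_zero)
  show "- a + a = 0" by (simp add: * gl_cl_zero flip: gl_cl_add gl_cl_uminus)
  show "a - b = a + - b" by (rule minus_gl_ring_def)
  show "a * b * c = a * (b * c)" unfolding * gl_cl_mult[symmetric] by (simp add: F.m_assoc car)
  show "(a + b) * c = a * c + b * c" "a * (b + c) = a * b + a * c"
    unfolding * gl_cl_add[symmetric] gl_cl_mult[symmetric]
    using F.l_distr[OF car car car, of x y z] F.r_distr[OF car car car, of x y z] by (simp_all add: add)
  have one: "word [] = \<one>\<^bsub>free_algebra\<^esub>" by (simp add: free_algebra_def)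
  show "1 * a = a" "a * 1 = a"
    unfolding * gl_cl_one[symmetric] gl_cl_mult[symmetric] one by (simp_all add: car)
qed

end

definition gl_gen :: "'n::{finite,linorder} gen \<Rightarrow> 'n gl_ring"
  where "gl_gen g = gl_cl (word [g])"

lemma gl_word: "gl_cl (word w) = prod_list (map gl_gen w)"
proof (induction w)
  case Nil
  then show ?case by (simp add: gl_cl_one)
next
  case (Cons g w)
  have "gl_cl (word (g # w)) = gl_cl (word [g] \<otimes>\<^bsub>free_algebra\<^esub> word w)" by (simp add: word_mult)
  then show ?case by (simp add: gl_cl_mult Cons gl_gen_def)
qed

lemma gl_sum: "gl_cl (sum f S) = (\<Sum>i\<in>S. gl_cl (f i))"
  by (induction S rule: infinite_finite_induct) (simp_all add: gl_cl_zero gl_cl_add)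

lemma gl_rel: "GL_relation (worst_log TYPE('n)) u v \<Longrightarrow> gl_cl u = gl_cl (v :: 'n::{finite,linorder} free)"
  unfolding gl_cl_eq_iff by (rule GL_relation_eq)

lemma sum_two:
  fixes F :: "'n::finite \<Rightarrow> 'n \<Rightarrow> 'b::comm_monoid_add"
  assumes "\<And>x y. (x, y) \<noteq> (a, c) \<Longrightarrow> (x, y) \<noteq> (c, a) \<Longrightarrow> F x y = 0" "a \<noteq> c"
  shows "(\<Sum>x\<in>UNIV. \<Sum>y\<in>UNIV. F x y) = F a c + F c a"
proof -
  have "(\<Sum>x\<in>UNIV. \<Sum>y\<in>UNIV. F x y) = (\<Sum>(x, y)\<in>UNIV. F x y)"
    by (simp add: sum.cartesian_product)
  also have "\<dots> = (\<Sum>(x, y)\<in>{(a, c), (c, a)}. F x y)"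
    by (rule sum.mono_neutral_right) (use assms(1) in auto)
  finally show ?thesis using assms(2) by simp
qed

lemma sum_one:
  fixes F :: "'n::finite \<Rightarrow> 'n \<Rightarrow> 'b::comm_monoid_add"
  assumes "\<And>x y. (x, y) \<noteq> (a, a) \<Longrightarrow> F x y = 0"
  shows "(\<Sum>x\<in>UNIV. \<Sum>y\<in>UNIV. F x y) = F a a"
proof -
  have "(\<Sum>x\<in>UNIV. \<Sum>y\<in>UNIV. F x y) = (\<Sum>(x, y)\<in>UNIV. F x y)"
    by (simp add: sum.cartesian_product)
  also have "\<dots> = (\<Sum>(x, y)\<in>{(a, a)}. F x y)"
    by (rule sum.mono_neutral_right) (use assms(1) in auto)
  finally show ?thesis by simp
qed

lemma R_mat_entries:
  fixes a b :: "'n::{finite,linorder}"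
  assumes l: "generic_log l" and ab: "a \<noteq> b"
  shows "R_mat l a b a b = (if a < b then 1 else at_diff (h_fun l) a b * at_diff (h_fun l) b a)"
    and "R_mat l a b b a = mero_const (q_pow l 1) - at_diff (h_fun l) a b"
  unfolding at_diff_g_fun[OF assms, symmetric] at_diff_h0_fun[OF l, symmetric] using ab by (simp_all add: R_mat_def)

lemma R_mat_diagonal: "R_mat l a a a a = mero_const (q_pow l 1)"
  by (simp add: R_mat_def)

lemma R_mat_zero: "(x, y) \<noteq> (a, c) \<Longrightarrow> (x, y) \<noteq> (c, a) \<Longrightarrow> R_mat l x y a c = 0"
  and R_mat_zero': "(x, y) \<noteq> (a, c) \<Longrightarrow> (x, y) \<noteq> (c, a) \<Longrightarrow> R_mat l a c x y = 0"
  unfolding R_mat_def by (cases "x = y"; cases "a = c"; simp; blast)+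

text \<open>For fixed lower indices at most two pairs of upper indices have a nonzero entry, and one
  if the lower indices coincide. The summand is an arbitrary function of the entry that vanishes at
  0, so that it can be instantiated with noncommutative products.\<close>

lemma R_mat_lower:
  fixes a c :: "'n::{finite,linorder}" and F :: "'n \<Rightarrow> 'n \<Rightarrow> 'n mero \<Rightarrow> 'b::comm_monoid_add"
  assumes l: "generic_log l" and F: "\<And>x y. F x y 0 = 0"
  shows "a \<noteq> c \<Longrightarrow> (\<Sum>x\<in>UNIV. \<Sum>y\<in>UNIV. F x y (R_mat l x y a c)) =
      F a c (if a < c then 1 else at_diff (h_fun l) a c * at_diff (h_fun l) c a) +
      F c a (mero_const (q_pow l 1) - at_diff (h_fun l) c a)"
    and "(\<Sum>x\<in>UNIV. \<Sum>y\<in>UNIV. F x y (R_mat l x y a a)) = F a a (mero_const (q_pow l 1))"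
proof -
  assume ac: "a \<noteq> c"
  show "(\<Sum>x\<in>UNIV. \<Sum>y\<in>UNIV. F x y (R_mat l x y a c)) =
      F a c (if a < c then 1 else at_diff (h_fun l) a c * at_diff (h_fun l) c a) +
      F c a (mero_const (q_pow l 1) - at_diff (h_fun l) c a)"
    unfolding R_mat_entries(1)[OF l ac, symmetric] R_mat_entries(2)[OF l ac[symmetric], symmetric]
    by (rule sum_two[OF _ ac]) (simp only: R_mat_zero F not_False_eq_True)
next
  show "(\<Sum>x\<in>UNIV. \<Sum>y\<in>UNIV. F x y (R_mat l x y a a)) = F a a (mero_const (q_pow l 1))"
    unfolding R_mat_diagonal[of l a, symmetric]
    by (rule sum_one) (simp only: R_mat_zero F not_False_eq_True)
qed

lemma R_mat_upper:
  fixes b d :: "'n::{finite,linorder}" and F :: "'n \<Rightarrow> 'n \<Rightarrow> 'n mero \<Rightarrow> 'b::comm_monoid_add"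
  assumes l: "generic_log l" and F: "\<And>x y. F x y 0 = 0"
  shows "b \<noteq> d \<Longrightarrow> (\<Sum>x\<in>UNIV. \<Sum>y\<in>UNIV. F x y (R_mat l b d x y)) =
      F b d (if b < d then 1 else at_diff (h_fun l) b d * at_diff (h_fun l) d b) +
      F d b (mero_const (q_pow l 1) - at_diff (h_fun l) b d)"
    and "(\<Sum>x\<in>UNIV. \<Sum>y\<in>UNIV. F x y (R_mat l b b x y)) = F b b (mero_const (q_pow l 1))"
proof -
  assume bd: "b \<noteq> d"
  show "(\<Sum>x\<in>UNIV. \<Sum>y\<in>UNIV. F x y (R_mat l b d x y)) =
      F b d (if b < d then 1 else at_diff (h_fun l) b d * at_diff (h_fun l) d b) +
      F d b (mero_const (q_pow l 1) - at_diff (h_fun l) b d)"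
    unfolding R_mat_entries[OF l bd, symmetric]
    by (rule sum_two[OF _ bd]) (simp only: R_mat_zero' F not_False_eq_True)
next
  show "(\<Sum>x\<in>UNIV. \<Sum>y\<in>UNIV. F x y (R_mat l b b x y)) = F b b (mero_const (q_pow l 1))"
    unfolding R_mat_diagonal[of l b, symmetric]
    by (rule sum_one) (simp only: R_mat_zero' F not_False_eq_True)
qed

section \<open>The RLL-relations and minors in the ring type\<close>

abbreviation gl_ml :: "'n::{finite,linorder} mero \<Rightarrow> 'n gl_ring" where "gl_ml f \<equiv> gl_gen (GenL f)"
abbreviation gl_mr :: "'n::{finite,linorder} mero \<Rightarrow> 'n gl_ring" where "gl_mr f \<equiv> gl_gen (GenR f)"
abbreviation gl_t :: "'n::{finite,linorder} \<Rightarrow> 'n \<Rightarrow> 'n gl_ring" where "gl_t i j \<equiv> gl_gen (GenT i j)"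

lemma gl_rels:
  fixes f g :: "'n::{finite,linorder} mero" and i j a b c d :: 'n
  shows "gl_ml (f + g) = gl_ml f + gl_ml g" "gl_ml (f * g) = gl_ml f * gl_ml g"
    "gl_mr (f + g) = gl_mr f + gl_mr g" "gl_mr (f * g) = gl_mr f * gl_mr g"
    "gl_ml f * gl_mr g = gl_mr g * gl_ml f"
    "gl_ml f * gl_t i j = gl_t i j * gl_ml (mero_shift (unit_weight i) f)"
    "gl_mr f * gl_t i j = gl_t i j * gl_mr (mero_shift (unit_weight j) f)"
    "gl_t i j * gl_gen GenDetInv = gl_gen GenDetInv * gl_t i j"
    "gl_ml f * gl_gen GenDetInv = gl_gen GenDetInv * gl_ml (mero_shift (- 1) f)"
    "gl_mr f * gl_gen GenDetInv = gl_gen GenDetInv * gl_mr (mero_shift (- 1) f)"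
    "(\<Sum>x\<in>UNIV. \<Sum>y\<in>UNIV. gl_ml (R_mat (worst_log TYPE('n)) x y a c) * gl_t x b * gl_t y d) =
     (\<Sum>x\<in>UNIV. \<Sum>y\<in>UNIV. gl_mr (R_mat (worst_log TYPE('n)) b d x y) * gl_t c y * gl_t a x)"
  using gl_rel[OF M_rel[OF L_add[where f = f and g = g]]] gl_rel[OF M_rel[OF L_mult[where f = f and g = g]]]
    gl_rel[OF M_rel[OF R_add[where f = f and g = g]]] gl_rel[OF M_rel[OF R_mult[where f = f and g = g]]]
    gl_rel[OF M_rel[OF L_R[where f = f and g = g]]] gl_rel[OF M_rel[OF L_T[where f = f and i = i and j = j]]]
    gl_rel[OF M_rel[OF R_T[where f = f and i = i and j = j]]] gl_rel[OF T_det_inv[where i = i and j = j]]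
    gl_rel[OF L_det_inv[where f = f]] gl_rel[OF R_det_inv[where f = f]]
    gl_rel[OF M_rel[OF RLL[where a = a and b = b and c = c and d = d]]]
  by (simp_all add: gl_word gl_cl_add gl_sum mult.assoc)

lemma gl_const: "gl_ml (mero_const c) = gl_mr (mero_const c :: 'n::{finite,linorder} mero)"
proof -
  have "gl_cl (word [GenL (mero_const c)]) = gl_cl (word [GenR (mero_const c :: 'n mero)])"
    by (rule trans[OF gl_rel[OF M_rel[OF L_const]] gl_rel[OF M_rel[OF R_const], symmetric]])
  then show ?thesis by (simp add: gl_word)
qed

lemma gl_one: "gl_ml 1 = 1" "gl_mr 1 = 1"
  using gl_rel[OF M_rel[OF L_const[where c = 1]]] gl_rel[OF M_rel[OF R_const[where c = 1]]] by (simp_all add: gl_word)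

lemma gl_zero: "gl_ml 0 = 0" "gl_mr 0 = 0"
  using gl_rels(1)[of 0 0] gl_rels(3)[of 0 0] by simp_all

lemma at_diff_h_shift: "\<alpha> $ a = (\<alpha> $ b :: complex) \<Longrightarrow> mero_shift \<alpha> (at_diff (h_fun l) a b) = at_diff (h_fun l) a b"
  by (rule mero_shift_at_diff[OF meromorphic_several_h_fun(3)])

interpretation gl: dynamical_rll "gl_ml :: 'n::{finite,linorder} mero \<Rightarrow> _" gl_mr gl_t "(<)" "at_diff (h_fun (worst_log TYPE('n)))"
  "mero_const (q_pow (worst_log TYPE('n)) 1)" "mero_const (q_pow (worst_log TYPE('n)) (- 1))"
proof
  fix a b c d :: 'n
  assume ac: "a \<noteq> c"
  show "gl_ml (if a < c then 1 else at_diff (h_fun (worst_log TYPE('n))) a c * at_diff (h_fun (worst_log TYPE('n))) c a) *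
      gl_t a b * gl_t c b + gl_ml (mero_const (q_pow (worst_log TYPE('n)) 1) - at_diff (h_fun (worst_log TYPE('n))) c a) * gl_t c b * gl_t a b =
      gl_ml (mero_const (q_pow (worst_log TYPE('n)) 1)) * gl_t c b * gl_t a b"
    using gl_rels(11)[of a c b b] unfolding R_mat_upper(2)[OF worst_log, of "\<lambda>x y f. gl_mr f * gl_t c y * gl_t a x", simplified gl_zero mult_zero_left, OF refl]
      R_mat_lower(1)[OF worst_log, of "\<lambda>x y f. gl_ml f * gl_t x b * gl_t y b", simplified gl_zero mult_zero_left, OF refl ac] gl_const .
  assume bd: "b \<noteq> d"
  show "gl_ml (if a < c then 1 else at_diff (h_fun (worst_log TYPE('n))) a c * at_diff (h_fun (worst_log TYPE('n))) c a) *
      gl_t a b * gl_t c d + gl_ml (mero_const (q_pow (worst_log TYPE('n)) 1) - at_diff (h_fun (worst_log TYPE('n))) c a) * gl_t c b * gl_t a d =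
      gl_mr (if b < d then 1 else at_diff (h_fun (worst_log TYPE('n))) b d * at_diff (h_fun (worst_log TYPE('n))) d b) *
      gl_t c d * gl_t a b + gl_mr (mero_const (q_pow (worst_log TYPE('n)) 1) - at_diff (h_fun (worst_log TYPE('n))) b d) * gl_t c b * gl_t a d"
    using gl_rels(11)[of a c b d] unfolding R_mat_upper(1)[OF worst_log, of "\<lambda>x y f. gl_mr f * gl_t c y * gl_t a x", simplified gl_zero mult_zero_left, OF refl bd]
      R_mat_lower(1)[OF worst_log, of "\<lambda>x y f. gl_ml f * gl_t x b * gl_t y d", simplified gl_zero mult_zero_left, OF refl ac] .
qed (auto simp: gl_rels gl_one gl_const at_diff_h_shift at_diff_h_fun_add[OF worst_log] at_diff_h_fun_nonzero[OF worst_log])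

lemma gl_lead_sign: "gl.lead_sign i J = (\<Prod>m\<in>{m\<in>J. m < i}. - at_diff (h_fun (worst_log TYPE('n))) (i :: 'n::{finite,linorder}) m)"
  by (simp add: gl.lead_sign_def)

lemma gl_list_sign: "gl.list_sign xs = word_sign (worst_log TYPE('n)) (xs :: 'n::{finite,linorder} list)"
  by (induction xs) (simp_all add: gl_lead_sign)

lemma gl_last_sign: "gl.last_sign k J = dyn_sign (worst_log TYPE('n)) J {k :: 'n::{finite,linorder}}"
proof -
  have "{(x, m). x \<in> J \<and> m \<in> {k} \<and> m < x} = (\<lambda>x. (x, k)) ` {m \<in> J. k < m}" by auto
  then show ?thesis by (simp add: gl.last_sign_def dyn_sign_def prod.reindex inj_on_def)
qed

lemma gl_t_word: "gl.t_word as bs = gl_cl (word (map2 GenT as bs))"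
  by (simp add: gl.t_word_def gl_word case_prod_unfold comp_def)

lemma gl_minor_list:
  "length bs = card I \<Longrightarrow> gl.minor I bs = gl_cl (\<Sum>as\<in>arrangements I. word (GenL (word_sign (worst_log TYPE('n)) as) # map2 GenT as bs))"
  for I :: "'n::{finite,linorder} set"
  by (simp add: gl.minor_eq_sum_arrangements gl_sum gl_t_word gl_list_sign gl_word)

lemma gl_minor:
  "card J = card I \<Longrightarrow> gl.minor I (sorted_list_of_set J) = gl_cl (free_minor (worst_log TYPE('n)) I (J :: 'n::{finite,linorder} set))"
  by (simp add: gl_minor_list free_minor_arrangements)

interpretation gl: dynamical_gl "gl_ml :: 'n::{finite,linorder} mero \<Rightarrow> _" gl_mr gl_t "at_diff (h_fun (worst_log TYPE('n)))"
  "mero_const (q_pow (worst_log TYPE('n)) 1)" "mero_const (q_pow (worst_log TYPE('n)) (- 1))" "gl_gen GenDetInv"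
proof
  fix a b d :: 'n
  assume bd: "b \<noteq> d"
  \<comment> \<open>The RLL-relation with equal rows and columns in the order d, b; on the
    \<lambda>-side only the diagonal entry q is left.\<close>
  have "gl_mr (if d < b then 1 else at_diff (h_fun (worst_log TYPE('n))) d b * at_diff (h_fun (worst_log TYPE('n))) b d) * gl_t a b * gl_t a d +
      gl_mr (mero_const (q_pow (worst_log TYPE('n)) 1) - at_diff (h_fun (worst_log TYPE('n))) d b) * gl_t a d * gl_t a b =
      gl_mr (mero_const (q_pow (worst_log TYPE('n)) 1)) * gl_t a d * gl_t a b"
    using gl_rels(11)[of a a d b] unfolding R_mat_upper(1)[OF worst_log, of "\<lambda>x y f. gl_mr f * gl_t a y * gl_t a x", simplified gl_zero mult_zero_left, OF refl bd[symmetric]]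
      R_mat_lower(2)[OF worst_log, of "\<lambda>x y f. gl_ml f * gl_t x d * gl_t y b", simplified gl_zero mult_zero_left, OF refl] gl_const by (rule sym)
  then show "gl_mr (if d < b then 1 else at_diff (h_fun (worst_log TYPE('n))) b d * at_diff (h_fun (worst_log TYPE('n))) d b) * gl_t a b * gl_t a d +
      gl_mr (mero_const (q_pow (worst_log TYPE('n)) 1) - at_diff (h_fun (worst_log TYPE('n))) d b) * gl_t a d * gl_t a b =
      gl_mr (mero_const (q_pow (worst_log TYPE('n)) 1)) * gl_t a d * gl_t a b"
    by (simp only: mult.commute)
next
  show "gl.minor UNIV (sorted_list_of_set UNIV) * gl_gen GenDetInv = (1 :: 'n gl_ring)"
    using gl_rel[OF det_inv_right] by (simp add: gl_minor gl_cl_mult gl_word)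
  show "gl_gen GenDetInv * gl.minor UNIV (sorted_list_of_set UNIV) = (1 :: 'n gl_ring)"
    using gl_rel[OF det_inv_left] by (simp add: gl_minor gl_cl_mult gl_word)
qed (simp_all only: gl_rels)

text \<open>The entries after x are either smaller or larger than x; the smaller ones enter the sign
  for the given order and the larger ones the sign for the reversed order. This identifies F with
  the sum evaluated at the integral point.\<close>

lemma gl_full_sign: "distinct xs \<Longrightarrow> gl.full_sign xs = full_sign (worst_log TYPE('n)) (xs :: 'n::{finite,linorder} list)"
proof (induction xs)
  case Nil
  show ?case by (simp add: gl.full_sign_def)
next
  case (Cons x xs)
  have "m < x \<or> x < m" if "m \<in> set xs" for m using that Cons.prems by (metis distinct.simps(2) linorder_neqE)
  then have "set xs = {m \<in> set xs. m < x} \<union> {m \<in> set xs. x < m}" by blast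
  then have "(\<Prod>m\<in>set xs. - at_diff (h_fun (worst_log TYPE('n))) x m) =
      (\<Prod>m\<in>{m \<in> set xs. m < x} \<union> {m \<in> set xs. x < m}. - at_diff (h_fun (worst_log TYPE('n))) x m)" by simp
  also have "\<dots> = gl.lead_sign x (set xs) * gl.row.lead_sign x (set xs)"
    unfolding gl.lead_sign_def gl.row.lead_sign_def by (intro prod.union_disjoint) auto
  finally show ?case using Cons by (simp add: gl.full_sign_def mult_ac)
qed

interpretation glR: dynamical_gl_R "gl_ml :: 'n::{finite,linorder} mero \<Rightarrow> _" gl_mr gl_t "at_diff (h_fun (worst_log TYPE('n)))"
  "mero_const (q_pow (worst_log TYPE('n)) 1)" "mero_const (q_pow (worst_log TYPE('n)) (- 1))" "gl_gen GenDetInv"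
  "R_mat (worst_log TYPE('n))"
proof
  fix a b c d x y :: 'n
  show "mero_shift (unit_weight a + unit_weight c) (R_mat (worst_log TYPE('n)) x y a c) = R_mat (worst_log TYPE('n)) x y a c"
    by (auto simp: R_mat_def at_diff_h0_fun[OF worst_log] at_diff_g_fun[OF worst_log] mero_shift_diff mero_shift_mult at_diff_h_shift axis_def)
  have "gl.F_sum = (sum (full_sign (worst_log TYPE('n))) (arrangements UNIV) :: 'n mero)"
    unfolding gl.F_sum_def by (intro sum.cong refl) (simp add: arrangements_def gl_full_sign)
  then show "gl.F_sum \<noteq> (0 :: 'n mero)" using sum_full_sign_nonzero[OF worst_log] by simp
qed (fact R_mat_weight gl_rels(11))+

lemma gl_tinv: "gl.tinv i j = gl_cl (free_tinv (worst_log TYPE('n)) i (j :: 'n::{finite,linorder}))"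
proof -
  have "card (- {i}) = card (- {j})" by (simp add: Compl_eq_Diff_UNIV card_Diff_singleton)
  then show ?thesis by (simp add: gl.tinv_def free_tinv_def gl_cl_mult gl_word gl_last_sign gl_minor mult.assoc)
qed

text \<open>The anti-multiplicative extension of S to the free algebra, with values in the ring
  type; the task is to see that it respects the relations.\<close>

definition gl_anti :: "'n::{finite,linorder} free \<Rightarrow> 'n gl_ring"
  where "gl_anti x = abs_gl (algebra_ext (opposite (GL_h_alg (worst_log TYPE('n)))) (antipode_gen (worst_log TYPE('n))) x)"

lemma rep_gl_anti: "rep_gl (gl_anti x) = algebra_ext (opposite (GL_h_alg (worst_log TYPE('n)))) (antipode_gen (worst_log TYPE('n))) (x :: 'n::{finite,linorder} free)"
proof -
  interpret O: calgebra "opposite (GL_h_alg (worst_log TYPE('n)) :: ('n, 'n GL_elt) h_alg)"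
    by (rule GL.Q.calgebra_opposite)
  show ?thesis unfolding gl_anti_def
    by (rule abs_gl_inverse, subst opposite_simps(1)[symmetric], rule O.algebra_ext_closed, simp)
qed

lemma gl_anti_simps:
  fixes x y :: "'n::{finite,linorder} free"
  shows "gl_anti (x + y) = gl_anti x + gl_anti y" "gl_anti (0 :: 'n free) = 0"
    "gl_anti (x \<otimes>\<^bsub>free_algebra\<^esub> y) = gl_anti y * gl_anti x"
    "gl_anti (Poly_Mapping.single [] c :: 'n free) = gl_cl (Poly_Mapping.single [] c)"
    "gl_anti (word [g]) = gl_cl (free_antipode_gen (worst_log TYPE('n)) (g :: 'n gen))"
proof -
  let ?A = "GL_h_alg (worst_log TYPE('n)) :: ('n, 'n GL_elt) h_alg"
  interpret O: calgebra "opposite ?A" by (rule GL.Q.calgebra_opposite)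
  have car: "antipode_gen (worst_log TYPE('n)) g \<in> carrier (opposite ?A)" for g :: "'n gen" by simp
  show add: "gl_anti (x + y) = gl_anti x + gl_anti y" for x y :: "'n free"
    by (simp add: plus_gl_ring_def rep_gl_anti) (simp add: gl_anti_def O.algebra_ext_add[OF car])
  show "gl_anti (0 :: 'n free) = 0" using add[of 0 0] by simp
  show "gl_anti (x \<otimes>\<^bsub>free_algebra\<^esub> y) = gl_anti y * gl_anti x"
    by (simp add: times_gl_ring_def rep_gl_anti) (simp add: gl_anti_def O.algebra_ext_mult[OF car])
  show "gl_anti (Poly_Mapping.single [] c :: 'n free) = gl_cl (Poly_Mapping.single [] c)"
    unfolding gl_anti_def gl_cl_def O.algebra_ext_single[OF car] by (subst GL_class_single) (simp add: GL_ops)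
  show "gl_anti (word [g]) = gl_cl (free_antipode_gen (worst_log TYPE('n)) (g :: 'n gen))"
    unfolding gl_anti_def gl_cl_def O.algebra_ext_single[OF car]
    by (simp add: GL.Q.l_one GL.Q.smult_one)
qed

lemma gl_anti_sum: "gl_anti (sum f S) = (\<Sum>i\<in>S. gl_anti (f i))"
  by (induction S rule: infinite_finite_induct) (simp_all add: gl_anti_simps)

lemma gl_anti_Nil: "gl_anti (word []) = 1"
  by (simp add: gl_anti_simps gl_cl_one)

definition gl_anti_gen :: "'n::{finite,linorder} gen \<Rightarrow> 'n gl_ring"
  where "gl_anti_gen g = gl_cl (free_antipode_gen (worst_log TYPE('n)) g)"

lemma gl_anti_gen_simps:
  "gl_anti_gen (GenL f) = gl_mr f" "gl_anti_gen (GenR f) = gl_ml f" "gl_anti_gen (GenT i j) = gl.tinv i j"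
  "gl_anti_gen GenDetInv = gl.det"
  by (simp_all add: gl_anti_gen_def gl_tinv gl.det_def gl_minor) (simp_all add: gl_gen_def)

lemma gl_anti_word: "gl_anti (word w) = prod_list (rev (map gl_anti_gen w))"
proof (induction w)
  case Nil
  show ?case by (simp add: gl_anti_Nil)
next
  case (Cons g w)
  have "gl_anti (word (g # w)) = gl_anti (word [g] \<otimes>\<^bsub>free_algebra\<^esub> word w)" by (simp add: word_mult)
  also have "\<dots> = gl_anti (word w) * gl_anti_gen g" unfolding gl_anti_simps gl_anti_gen_def ..
  finally show ?case by (simp add: Cons)
qed

lemma gl_anti_minor: "gl_anti (free_minor (worst_log TYPE('n)) UNIV UNIV) = gl_gen (GenDetInv :: 'n::{finite,linorder} gen)"
proof -
  have "gl_anti (word (map2 GenT as bs)) = glR.tinv_word as bs" for as bs :: "'n list"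
    by (simp add: gl_anti_word glR.tinv_word_def case_prod_unfold comp_def gl_anti_gen_simps)
  then have "gl_anti (word (GenL f # map2 GenT as bs)) = glR.tinv_word as bs * gl_mr f" for f and as bs :: "'n list"
    unfolding gl_anti_word by (simp add: gl_anti_gen_simps)
  then show ?thesis
    using glR.det_antipode_det by (simp add: free_minor_arrangements gl_anti_sum gl_list_sign)
qed

lemma gl_anti_M_relation: "M_relation (worst_log TYPE('n)) u v \<Longrightarrow> gl_anti u = gl_anti (v :: 'n::{finite,linorder} free)"
proof (induction rule: M_relation.induct)
  case (L_const c)
  have "gl_mr (mero_const c :: 'n mero) = gl_cl (Poly_Mapping.single [] c)"
    using gl_rel[OF M_rel[OF R_const[where c = c]]] by (simp only: gl_gen_def)
  then show ?case unfolding gl_anti_simps(4) by (simp add: gl_anti_word gl_anti_gen_simps)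
next
  case (R_const c)
  have "gl_ml (mero_const c :: 'n mero) = gl_cl (Poly_Mapping.single [] c)"
    using gl_rel[OF M_rel[OF L_const[where c = c]]] by (simp only: gl_gen_def)
  then show ?case unfolding gl_anti_simps(4) by (simp add: gl_anti_word gl_anti_gen_simps)
next
  case (RLL a c b d)
  then show ?case
    using glR.rll_tinv[of d b a c] by (simp add: gl_anti_sum gl_anti_word gl_anti_gen_simps mult.assoc)
next
  case (L_mult f g)
  show ?case by (simp add: gl_anti_word gl_anti_gen_simps mult.commute[of f g] gl_rels)
next
  case (R_mult f g)
  show ?case by (simp add: gl_anti_word gl_anti_gen_simps mult.commute[of f g] gl_rels)
qed (simp_all add: gl_anti_simps(1) gl_anti_word gl_anti_gen_simps gl_rels glR.tinv_mr glR.tinv_ml)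

lemma gl_anti_relation: "GL_relation (worst_log TYPE('n)) u v \<Longrightarrow> gl_anti u = gl_anti (v :: 'n::{finite,linorder} free)"
proof (induction rule: GL_relation.induct)
  case (T_det_inv i j)
  show ?case by (simp add: gl_anti_word gl_anti_gen_simps glR.det_tinv)
qed (simp_all add: gl_anti_M_relation gl_anti_simps(3) gl_anti_word gl_anti_minor gl_anti_gen_simps gl.det_right gl.det_left
      glR.det_mr glR.det_ml)

theorem gl_identities:
  assumes "generic_log l"
  shows "gl_identities TYPE('n::{finite,linorder}) l"
proof (rule worst_log_suffices[OF _ assms])
  let ?W = "worst_log TYPE('n)"
  have 1: "GL_class ?W (\<Sum>k\<in>UNIV. word [GenT i k] \<otimes>\<^bsub>free_algebra\<^esub> free_tinv ?W k j) = GL_class ?W (if i = j then word [] else 0)" for i j :: 'n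
  proof -
    have "gl_t \<bullet>\<bullet> gl.tinv = (mat_one :: 'n \<Rightarrow> 'n \<Rightarrow> 'n gl_ring)" by (rule glR.t_tinv)
    then have "(gl_t \<bullet>\<bullet> gl.tinv) i j = (mat_one i j :: 'n gl_ring)" by simp
    then show ?thesis unfolding gl_cl_eq_iff[symmetric]
      by (simp add: mat_mult_def mat_one_def gl_sum gl_cl_mult gl_word gl_tinv gl_cl_zero)
  qed
  have 2: "GL_class ?W (\<Sum>k\<in>UNIV. free_tinv ?W i k \<otimes>\<^bsub>free_algebra\<^esub> word [GenT k j]) = GL_class ?W (if i = j then word [] else 0)" for i j :: 'n
  proof -
    have "gl.tinv \<bullet>\<bullet> gl_t = (mat_one :: 'n \<Rightarrow> 'n \<Rightarrow> 'n gl_ring)" by (rule gl.tinv_t)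
    then have "(gl.tinv \<bullet>\<bullet> gl_t) i j = (mat_one i j :: 'n gl_ring)" by simp
    then show ?thesis unfolding gl_cl_eq_iff[symmetric]
      by (simp add: mat_mult_def mat_one_def gl_sum gl_cl_mult gl_word gl_tinv gl_cl_zero)
  qed
  have 3: "GL_class ?W (\<Sum>as\<in>arrangements UNIV. word (GenL (word_sign ?W as) # map2 GenT as bs)) =
      GL_class ?W (if distinct bs then word [GenR (word_sign ?W bs)] \<otimes>\<^bsub>free_algebra\<^esub> free_minor ?W UNIV UNIV else 0)"
    if "length bs = CARD('n)" for bs :: "'n list"
  proof (cases "distinct bs")
    case True
    then have "bs \<in> arrangements UNIV" using that by (simp add: arrangements_def card_eq_UNIV_imp_eq_UNIV distinct_card)
    moreover have det: "(gl.det :: 'n gl_ring) = gl_cl (free_minor ?W UNIV UNIV)" by (simp only: gl.det_def gl_minor)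
    ultimately show ?thesis unfolding gl_cl_eq_iff[symmetric]
      using that True gl.minor_UNIV[of bs] det by (simp add: gl_minor_list gl_cl_mult gl_word gl_list_sign)
  next
    case False
    from gl.minor_not_distinct[OF this, of UNIV] show ?thesis unfolding gl_cl_eq_iff[symmetric]
      using that False by (simp add: gl_minor_list gl_cl_zero)
  qed
  have 4: "algebra_ext (opposite (GL_h_alg ?W)) (antipode_gen ?W) u = algebra_ext (opposite (GL_h_alg ?W)) (antipode_gen ?W) v"
    if "GL_relation ?W u v" for u v :: "'n free"
    using gl_anti_relation[OF that] unfolding rep_gl_anti[symmetric] by simp
  show "gl_identities TYPE('n) ?W"
    unfolding gl_identities_def using 1 2 3 4 by blast
qed

section \<open>Comultiplication\<close>

lemma (in presented) cover_sum: "(\<And>i. i \<in> S \<Longrightarrow> f i \<in> cover) \<Longrightarrow> sum f S \<in> cover"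
  by (induction S rule: infinite_finite_induct) (auto intro: cover_closed cover_add)

lemma (in presented) cl_cong_sum: "(\<And>i. i \<in> S \<Longrightarrow> cl (f i) = cl (g i)) \<Longrightarrow> cl (sum f S) = cl (sum g S)"
proof -
  assume "\<And>i. i \<in> S \<Longrightarrow> cl (f i) = cl (g i)"
  then have "(\<Sum>i\<in>S. f i - g i) \<in> I" unfolding cl_eq_iff
    by (induction S rule: infinite_finite_induct) (auto intro: I_zero I_add)
  then show ?thesis unfolding cl_eq_iff by (simp add: sum_subtractf)
qed

lemma grade_finsum:
  fixes A (structure)
  assumes "pre_h_alg A" "\<And>i. i \<in> S \<Longrightarrow> f i \<in> grade A \<alpha> \<beta>"
  shows "finsum A f S \<in> grade A \<alpha> \<beta>"
proof -
  interpret pre_h_alg A by (rule assms(1))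
  show ?thesis using assms(2)
  proof (induction S rule: infinite_finite_induct)
    case (insert i S)
    then have "f \<in> S \<rightarrow> carrier A" "f i \<in> carrier A" using grade_carrier by auto
    then show ?case using insert by (simp add: finsum_insert grade_add)
  qed (simp_all add: finsum_infinite grade_zero)
qed

context h_alg_pair
begin

text \<open>The tensor is additive only within a fixed degree, so the left factors have to share
  both of their degrees to be collected in one tensor.\<close>

lemma cl_sum_left:
  assumes "finite S" "\<And>i. i \<in> S \<Longrightarrow> a i \<in> grade A \<alpha> \<gamma>" "b \<in> grade B \<gamma> \<beta>"
  shows "T.cl (\<Sum>i\<in>S. pair (a i) b) = tens A B (\<Oplus>\<^bsub>A\<^esub>i\<in>S. a i) b"
  using assms(1,2)
proof (induction S rule: finite_induct)
  case empty
  show ?case using tens_zero_left[OF assms(3)] by (simp add: T.Q_zero)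
next
  case (insert i S)
  have a: "a \<in> S \<rightarrow> carrier A" "a i \<in> carrier A" using insert.prems A.grade_carrier by auto
  have "(\<Oplus>\<^bsub>A\<^esub>i\<in>S. a i) \<in> grade A \<alpha> \<gamma>" using insert.prems by (intro grade_finsum[OF A.pre_h_alg_axioms]) simp
  then have "tens A B (a i \<oplus>\<^bsub>A\<^esub> (\<Oplus>\<^bsub>A\<^esub>i\<in>S. a i)) b = tens A B (a i) b \<oplus>\<^bsub>h_tensor A B\<^esub> tens A B (\<Oplus>\<^bsub>A\<^esub>i\<in>S. a i) b"
    by (intro tens_add_left[OF _ _ assms(3)]) (use insert.prems in auto)
  also have "\<dots> = T.cl (pair (a i) b) \<oplus>\<^bsub>h_tensor A B\<^esub> T.cl (\<Sum>i\<in>S. pair (a i) b)"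
    using insert by (simp add: tens_eq_cl)
  also have "\<dots> = T.cl (pair (a i) b + (\<Sum>i\<in>S. pair (a i) b))"
    using insert.prems assms(3) by (intro T.Q_ops(2) T.cover_sum pair_cover) auto
  finally show ?case using insert.hyps a by (simp add: A.finsum_insert)
qed

lemma cl_sum_right:
  assumes "finite S" "a \<in> grade A \<alpha> \<gamma>" "\<And>i. i \<in> S \<Longrightarrow> b i \<in> grade B \<gamma> \<beta>"
  shows "T.cl (\<Sum>i\<in>S. pair a (b i)) = tens A B a (\<Oplus>\<^bsub>B\<^esub>i\<in>S. b i)"
  using assms(1,3)
proof (induction S rule: finite_induct)
  case empty
  show ?case using tens_zero_right[OF assms(2)] by (simp add: T.Q_zero)
next
  case (insert i S)
  have b: "b \<in> S \<rightarrow> carrier B" "b i \<in> carrier B" using insert.prems B.grade_carrier by auto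
  have "(\<Oplus>\<^bsub>B\<^esub>i\<in>S. b i) \<in> grade B \<gamma> \<beta>" using insert.prems by (intro grade_finsum[OF B.pre_h_alg_axioms]) simp
  then have "tens A B a (b i \<oplus>\<^bsub>B\<^esub> (\<Oplus>\<^bsub>B\<^esub>i\<in>S. b i)) = tens A B a (b i) \<oplus>\<^bsub>h_tensor A B\<^esub> tens A B a (\<Oplus>\<^bsub>B\<^esub>i\<in>S. b i)"
    by (intro tens_add_right[OF assms(2)]) (use insert.prems in auto)
  also have "\<dots> = T.cl (pair a (b i)) \<oplus>\<^bsub>h_tensor A B\<^esub> T.cl (\<Sum>i\<in>S. pair a (b i))"
    using insert by (simp add: tens_eq_cl)
  also have "\<dots> = T.cl (pair a (b i) + (\<Sum>i\<in>S. pair a (b i)))"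
    using insert.prems assms(2) by (intro T.Q_ops(2) T.cover_sum pair_cover) auto
  finally show ?case using insert.hyps b by (simp add: B.finsum_insert)
qed

end

interpretation GG: h_alg_pair "GL_h_alg l" "GL_h_alg l" for l
  using pre_h_alg_GL by (simp add: h_alg_pair_def)

section \<open>Comultiplication of words\<close>

abbreviation GL_tensor :: "complex \<Rightarrow> ('n::{finite,linorder}, (('n GL_elt \<times> 'n GL_elt) \<Rightarrow>\<^sub>0 complex) set) h_alg"
  where "GL_tensor l \<equiv> h_tensor (GL_h_alg l) (GL_h_alg l)"

definition word_pair :: "complex \<Rightarrow> 'n::{finite,linorder} gen list \<Rightarrow> 'n gen list \<Rightarrow> ('n GL_elt \<times> 'n GL_elt) \<Rightarrow>\<^sub>0 complex"
  where "word_pair l u v = pair (GL_class l (word u)) (GL_class l (word v))"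

abbreviation pair_mult :: "complex \<Rightarrow> (('n::{finite,linorder} GL_elt \<times> 'n GL_elt) \<Rightarrow>\<^sub>0 complex) \<Rightarrow> _ \<Rightarrow> _"
  where "pair_mult l \<equiv> mult (monoid_algebra (pair_monoid (GL_h_alg l) (GL_h_alg l)))"

text \<open>Representatives of the coproducts as formal sums of pairs. Sums can be rearranged freely
  at this level, and classes are taken only for the steps that use a relation.\<close>

primrec pre_comult_gen :: "complex \<Rightarrow> 'n::{finite,linorder} gen \<Rightarrow> ('n GL_elt \<times> 'n GL_elt) \<Rightarrow>\<^sub>0 complex"
  where "pre_comult_gen l (GenL f) = word_pair l [GenL f] []"
  | "pre_comult_gen l (GenR f) = word_pair l [] [GenR f]"
  | "pre_comult_gen l (GenT i j) = (\<Sum>k\<in>UNIV. word_pair l [GenT i k] [GenT k j])"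
  | "pre_comult_gen l GenDetInv = word_pair l [GenDetInv] [GenDetInv]"

primrec pre_comult :: "complex \<Rightarrow> 'n::{finite,linorder} gen list \<Rightarrow> ('n GL_elt \<times> 'n GL_elt) \<Rightarrow>\<^sub>0 complex"
  where "pre_comult l [] = word_pair l [] []"
  | "pre_comult l (g # w) = pair_mult l (pre_comult_gen l g) (pre_comult l w)"

lemma word_pair_mult: "pair_mult l (word_pair l u v) (word_pair l u' v') = word_pair l (u @ u') (v @ v')"
  by (simp add: word_pair_def monoid_algebra_mult_single GL_word_append)

lemma word_pair_cong:
  "GL_class l (word u) = GL_class l (word u') \<Longrightarrow> GL_class l (word v) = GL_class l (word v') \<Longrightarrow>
    word_pair l u v = word_pair l u' v'"
  by (simp add: word_pair_def)

lemma word_pair_cover: "deg_r u = deg_l v \<Longrightarrow> word_pair l u v \<in> GG.T.cover l"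
  unfolding word_pair_def by (rule GG.pair_cover[OF GL_grade_word GL_grade_word]) simp_all

lemma tens_word_pair: "tens (GL_h_alg l) (GL_h_alg l) (GL_class l (word u)) (GL_class l (word v)) = GG.T.cl l (word_pair l u v)"
  by (simp add: GG.tens_eq_cl word_pair_def)

lemma pre_comult_gen_cover: "pre_comult_gen l g \<in> GG.T.cover l"
  by (cases g) (auto intro!: word_pair_cover GG.T.cover_sum)

lemma pre_comult_cover: "pre_comult l w \<in> GG.T.cover l"
  by (induction w) (auto intro!: word_pair_cover GG.T.cover_mult pre_comult_gen_cover)

lemma GL_comult_gen_cl: "GL_comult_gen l g = GG.T.cl l (pre_comult_gen l g)"
proof (cases g)
  case (GenT i j)
  have "GG.T.cl l (\<Sum>k\<in>UNIV. word_pair l [GenT i k] [GenT k j]) = (\<Oplus>\<^bsub>GL_tensor l\<^esub>k\<in>UNIV. GG.T.cl l (word_pair l [GenT i k] [GenT k j]))"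
    by (rule GG.T.cl_sum) (simp add: word_pair_cover)
  then show ?thesis by (simp add: GenT GL_t_def tens_word_pair)
qed (simp_all add: GL_mu GL_ops tens_word_pair GL_det_inv_def)

lemma GL_comult_gen_carrier [simp]: "GL_comult_gen l g \<in> carrier (GL_tensor l)"
  unfolding GL_comult_gen_cl by (rule GG.T.cl_closed[OF pre_comult_gen_cover])

abbreviation free_comult :: "complex \<Rightarrow> 'n::{finite,linorder} free \<Rightarrow> (('n GL_elt \<times> 'n GL_elt) \<Rightarrow>\<^sub>0 complex) set"
  where "free_comult l \<equiv> algebra_ext (GL_tensor l) (GL_comult_gen l)"

lemma free_comult_word: "free_comult l (word w) = GG.T.cl l (pre_comult l w)"
proof (induction w)
  case Nil
  show ?case
    by (simp add: GG.T.Q.algebra_ext_single GG.T.Q.smult_one) (simp add: GG.T.Q_one word_pair_def GL_ops)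
next
  case (Cons g w)
  have "free_comult l (word (g # w)) = GL_comult_gen l g \<otimes>\<^bsub>GL_tensor l\<^esub> free_comult l (word w)"
    by (simp add: GG.T.Q.algebra_ext_single GG.T.Q.word_prod_closed)
  also have "\<dots> = GG.T.cl l (pre_comult_gen l g) \<otimes>\<^bsub>GL_tensor l\<^esub> GG.T.cl l (pre_comult l w)"
    by (simp only: Cons GL_comult_gen_cl)
  also have "\<dots> = GG.T.cl l (pre_comult l (g # w))"
    by (simp add: GG.T.Q_ops(1)[OF pre_comult_gen_cover pre_comult_cover])
  finally show ?case .
qed

lemma free_comult_sum:
  assumes "finite S" "\<And>i. i \<in> S \<Longrightarrow> F i \<in> GG.T.cover l" "\<And>i. i \<in> S \<Longrightarrow> free_comult l (f i) = GG.T.cl l (F i)"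
  shows "free_comult l (sum f S) = GG.T.cl l (sum F S)"
proof -
  have "free_comult l (sum f S) = (\<Oplus>\<^bsub>GL_tensor l\<^esub>i\<in>S. free_comult l (f i))"
    using assms(1) by (rule GG.T.Q.algebra_ext_sum[rotated]) simp
  also have "\<dots> = (\<Oplus>\<^bsub>GL_tensor l\<^esub>i\<in>S. GG.T.cl l (F i))"
    by (rule GG.T.Q.add.finprod_cong') (auto intro: GG.T.cl_closed assms(2) simp: assms(3))
  finally show ?thesis using GG.T.cl_sum[of S F l] assms(2) by simp
qed

lemma free_comult_mult: "free_comult l (x \<otimes>\<^bsub>free_algebra\<^esub> y) = free_comult l x \<otimes>\<^bsub>GL_tensor l\<^esub> free_comult l y"
  by (rule GG.T.Q.algebra_ext_mult) simp

lemmas pair_mult_sum = monoid_algebra_mult_sum[where G = "pair_monoid (GL_h_alg l) (GL_h_alg l)" for l]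

lemma pre_comult_T_word:
  "length as = length bs \<Longrightarrow> pre_comult l (map2 GenT as bs) =
    (\<Sum>ks\<in>{ks. length ks = length bs}. word_pair l (map2 GenT as ks) (map2 GenT ks bs))"
proof (induction as bs rule: list_induct2)
  case Nil
  then show ?case by simp
next
  case (Cons a as b bs)
  then show ?case
    by (simp add: sum_lists_Suc pair_mult_sum word_pair_mult)
       (simp add: sum.swap[of _ UNIV])
qed

lemma deg_T_word:
  "length as = length bs \<Longrightarrow> deg_l (map2 GenT as bs) = sum_list (map unit_weight as)"
  "length as = length bs \<Longrightarrow> deg_r (map2 GenT as bs) = sum_list (map unit_weight bs)"
  by (induction as bs rule: list_induct2) simp_all

text \<open>A word with coefficient 0 represents 0, which lies in every component. All terms of an
  RLL-sum may therefore be treated as homogeneous of one degree, including those with a vanishing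
  R-entry.\<close>

lemma grade_zero_coeff:
  "deg_l w = \<alpha> \<and> deg_r w = \<beta> \<or> f = 0 \<Longrightarrow> GL_class l (word (GenL f # w)) \<in> grade (GL_h_alg l) \<alpha> \<beta>"
  "deg_l w = \<alpha> \<and> deg_r w = \<beta> \<or> f = 0 \<Longrightarrow> GL_class l (word (GenR f # w)) \<in> grade (GL_h_alg l) \<alpha> \<beta>"
proof -
  have z: "GL_class l (word (GenL 0 # w)) = \<zero>\<^bsub>GL_h_alg l\<^esub>" "GL_class l (word (GenR 0 # w)) = \<zero>\<^bsub>GL_h_alg l\<^esub>"
    using GL_ideal_zero_coeff[of w l] unfolding GL_ops GL_class_eq_iff by simp_all
  show "deg_l w = \<alpha> \<and> deg_r w = \<beta> \<or> f = 0 \<Longrightarrow> GL_class l (word (GenL f # w)) \<in> grade (GL_h_alg l) \<alpha> \<beta>"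
    "deg_l w = \<alpha> \<and> deg_r w = \<beta> \<or> f = 0 \<Longrightarrow> GL_class l (word (GenR f # w)) \<in> grade (GL_h_alg l) \<alpha> \<beta>"
    by (cases "f = 0"; simp add: z GL.grade_zero GL_grade_word)+
qed

text \<open>Balancing presupposes matching middle degrees. For f = 0 both sides are 0, which covers
  the terms of an RLL-sum whose degrees do not match.\<close>

lemma word_pair_balanced:
  assumes "deg_r u = deg_l v \<or> f = 0"
  shows "GG.T.cl l (word_pair l (GenR f # u) v) = GG.T.cl l (word_pair l u (GenL f # v))"
proof (cases "deg_r u = deg_l v")
  case True
  show ?thesis
    using GG.tens_balanced[OF GL_grade_word[OF refl refl] GL_grade_word[OF True[symmetric] refl], of l f]
    unfolding GL_mu tens_word_pair[symmetric] GL_word_Cons[of l "GenR f" u] GL_word_Cons[of l "GenL f" v] by simp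
next
  case False
  then have f: "f = 0" using assms by simp
  have z: "GL_class l (word (GenR 0 # u)) = \<zero>\<^bsub>GL_h_alg l\<^esub>" "GL_class l (word (GenL 0 # v)) = \<zero>\<^bsub>GL_h_alg l\<^esub>"
    using GL_ideal_zero_coeff(2)[of u l] GL_ideal_zero_coeff(1)[of v l] unfolding GL_ops GL_class_eq_iff by simp_all
  show ?thesis
    unfolding f tens_word_pair[symmetric] z
    using GG.tens_zero_left[OF GL_grade_word[OF refl refl]] GG.tens_zero_right[OF GL_grade_word[OF refl refl]] by metis
qed

lemma sum_UNIV_pairs:
  fixes F :: "'n::finite \<Rightarrow> 'n \<Rightarrow> 'b::comm_monoid_add"
  shows "(\<Sum>x\<in>UNIV. \<Sum>y\<in>UNIV. F x y) = (\<Sum>p\<in>UNIV. F (fst p) (snd p))"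
  by (simp add: sum.cartesian_product case_prod_unfold)

text \<open>The RLL-relation is used once in each leg, with the balancing step in between. Each use
  is made for fixed indices of the other leg, whose word then has a fixed degree.\<close>

lemma comult_RLL:
  fixes a b c d :: "'n::{finite,linorder}"
  shows "GG.T.cl l (\<Sum>x\<in>UNIV. \<Sum>y\<in>UNIV. pre_comult l [GenL (R_mat l x y a c), GenT x b, GenT y d]) =
    GG.T.cl l (\<Sum>x\<in>UNIV. \<Sum>y\<in>UNIV. pre_comult l [GenR (R_mat l b d x y), GenT c y, GenT a x])"
proof -
  let ?R = "R_mat l :: 'n \<Rightarrow> 'n \<Rightarrow> 'n \<Rightarrow> 'n \<Rightarrow> 'n mero"
  let ?UU = "UNIV :: ('n \<times> 'n) set"
  let ?cl = "\<lambda>x. GG.T.cl l (x :: ('n GL_elt \<times> 'n GL_elt) \<Rightarrow>\<^sub>0 complex)"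
  let ?L = "\<lambda>p a c b d. [GenL (?R (fst p) (snd p) a c), GenT (fst p) b, GenT (snd p) d]"
  let ?M = "\<lambda>p a c b d. [GenR (?R b d (fst p) (snd p)), GenT c (snd p), GenT a (fst p)]"
  have R0: "?R x y a c = 0 \<or> unit_weight x + unit_weight y = unit_weight a + (unit_weight c :: (complex, 'n) vec)" for x y a c
    using R_mat_weight by blast
  have rll: "GL_class l (\<Sum>p\<in>?UU. word (?L p a c b d)) = GL_class l (\<Sum>p\<in>?UU. word (?M p a c b d))" for a b c d
  proof -
    have "GL_class l (\<Sum>x\<in>UNIV. \<Sum>y\<in>UNIV. word [GenL (?R x y a c), GenT x b, GenT y d]) =
        GL_class l (\<Sum>x\<in>UNIV. \<Sum>y\<in>UNIV. word [GenR (?R b d x y), GenT c y, GenT a x])"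
      by (rule GL_relation_eq, rule M_rel, rule RLL)
    then show ?thesis unfolding sum_UNIV_pairs .
  qed
  have gl: "GL_class l (word (?L p a c b d)) \<in> grade (GL_h_alg l) (unit_weight a + unit_weight c) (unit_weight b + unit_weight d)" for p a b c d
    by (rule grade_zero_coeff(1)) (use R0[of "fst p" "snd p" a c] in auto)
  have gr: "GL_class l (word (?M p a c b d)) \<in> grade (GL_h_alg l) (unit_weight a + unit_weight c) (unit_weight b + unit_weight d)" for p a b c d
    by (rule grade_zero_coeff(2)) (use R0[of b d "fst p" "snd p"] in \<open>auto simp: add.commute\<close>)
  have 1: "?cl (\<Sum>p\<in>?UU. word_pair l (?L p a c k m) [GenT k b, GenT m d]) =
      ?cl (\<Sum>p\<in>?UU. word_pair l (?M p a c k m) [GenT k b, GenT m d])" for k m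
  proof -
    have v: "GL_class l (word [GenT k b, GenT m d]) \<in> grade (GL_h_alg l) (unit_weight k + unit_weight m) (unit_weight b + unit_weight d)"
      by (rule GL_grade_word) simp_all
    show ?thesis unfolding word_pair_def GG.cl_sum_left[OF finite gl v] GG.cl_sum_left[OF finite gr v]
      unfolding GL_class_sum[symmetric] rll ..
  qed
  have 2: "?cl (\<Sum>r\<in>?UU. word_pair l [GenT c y, GenT a x] (?L r x y b d)) =
      ?cl (\<Sum>r\<in>?UU. word_pair l [GenT c y, GenT a x] (?M r x y b d))" for x y
  proof -
    have v: "GL_class l (word [GenT c y, GenT a x]) \<in> grade (GL_h_alg l) (unit_weight c + unit_weight a) (unit_weight x + unit_weight y)"
      by (rule GL_grade_word) (simp_all add: add.commute)
    show ?thesis unfolding word_pair_def GG.cl_sum_right[OF finite v gl] GG.cl_sum_right[OF finite v gr]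
      unfolding GL_class_sum[symmetric] rll ..
  qed
  have pre: "pre_comult l [g, GenT x b, GenT y d] =
      (\<Sum>r\<in>?UU. pair_mult l (pre_comult_gen l g) (word_pair l [GenT x (fst r), GenT y (snd r)] [GenT (fst r) b, GenT (snd r) d]))"
    for g x y b d
  proof -
    have "pre_comult l [GenT x b, GenT y d] = (\<Sum>k\<in>UNIV. \<Sum>m\<in>UNIV. word_pair l [GenT x k, GenT y m] [GenT k b, GenT m d])"
      by (simp add: pair_mult_sum word_pair_mult) (rule sum.swap)
    also have "\<dots> = (\<Sum>r\<in>?UU. word_pair l [GenT x (fst r), GenT y (snd r)] [GenT (fst r) b, GenT (snd r) d])"
      by (rule sum_UNIV_pairs)
    finally show ?thesis by (simp only: pre_comult.simps(2)[of l g] pair_mult_sum)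
  qed
  have pairs: "(\<Sum>x\<in>UNIV. \<Sum>y\<in>UNIV. F x y) = (\<Sum>p\<in>?UU. F (fst p) (snd p))" for F :: "'n \<Rightarrow> 'n \<Rightarrow> ('n GL_elt \<times> 'n GL_elt) \<Rightarrow>\<^sub>0 complex"
    by (rule sum_UNIV_pairs)
  have "?cl (\<Sum>x\<in>UNIV. \<Sum>y\<in>UNIV. pre_comult l [GenL (?R x y a c), GenT x b, GenT y d]) =
      ?cl (\<Sum>p\<in>?UU. \<Sum>r\<in>?UU. word_pair l (?L p a c (fst r) (snd r)) [GenT (fst r) b, GenT (snd r) d])"
    unfolding pre pairs by (simp add: word_pair_mult)
  also have "\<dots> = ?cl (\<Sum>r\<in>?UU. \<Sum>p\<in>?UU. word_pair l (?L p a c (fst r) (snd r)) [GenT (fst r) b, GenT (snd r) d])"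
    by (rule arg_cong[OF sum.swap])
  also have "\<dots> = ?cl (\<Sum>r\<in>?UU. \<Sum>p\<in>?UU. word_pair l (?M p a c (fst r) (snd r)) [GenT (fst r) b, GenT (snd r) d])"
    by (rule GG.T.cl_cong_sum) (rule 1)
  \<comment> \<open>R now stands in the right moment map of the left leg, and balancing turns it
    into the left moment map of the right leg. The outer summation index p of the old R becomes the
    fixed index for the RLL-relation in the right leg.\<close>
  also have "\<dots> = ?cl (\<Sum>r\<in>?UU. \<Sum>p\<in>?UU. word_pair l [GenT c (snd p), GenT a (fst p)] (?L r (fst p) (snd p) b d))"
  proof (intro GG.T.cl_cong_sum word_pair_balanced)
    show "deg_r [GenT c (snd p), GenT a (fst p)] = deg_l [GenT (fst r) b, GenT (snd r) d] \<or> ?R (fst r) (snd r) (fst p) (snd p) = 0" for p r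
      using R0[of "fst r" "snd r" "fst p" "snd p"] by (auto simp: add.commute)
  qed
  also have "\<dots> = ?cl (\<Sum>p\<in>?UU. \<Sum>r\<in>?UU. word_pair l [GenT c (snd p), GenT a (fst p)] (?L r (fst p) (snd p) b d))"
    by (rule arg_cong[OF sum.swap])
  also have "\<dots> = ?cl (\<Sum>p\<in>?UU. \<Sum>r\<in>?UU. word_pair l [GenT c (snd p), GenT a (fst p)] (?M r (fst p) (snd p) b d))"
    by (rule GG.T.cl_cong_sum) (rule 2)
  also have "(\<Sum>p\<in>?UU. \<Sum>r\<in>?UU. word_pair l [GenT c (snd p), GenT a (fst p)] (?M r (fst p) (snd p) b d)) =
      (\<Sum>r\<in>?UU. \<Sum>p\<in>?UU. word_pair l [GenT c (snd p), GenT a (fst p)] (?M r (fst p) (snd p) b d))"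
    by (rule sum.swap)
  \<comment> \<open>The components of p are exchanged because the coproduct of the word with row c
    ahead of row a numbers its middle indices in that order.\<close>
  also have "\<dots> = (\<Sum>r\<in>?UU. \<Sum>p\<in>?UU. word_pair l [GenT c (fst p), GenT a (snd p)] (?M r (snd p) (fst p) b d))"
  proof (rule sum.cong[OF refl])
    show "(\<Sum>p\<in>?UU. word_pair l [GenT c (snd p), GenT a (fst p)] (?M r (fst p) (snd p) b d)) =
        (\<Sum>p\<in>?UU. word_pair l [GenT c (fst p), GenT a (snd p)] (?M r (snd p) (fst p) b d))" for r
      by (rule sum.reindex_bij_witness[of _ prod.swap prod.swap]) auto
  qed
  also have "?cl \<dots> = ?cl (\<Sum>x\<in>UNIV. \<Sum>y\<in>UNIV. pre_comult l [GenR (?R b d x y), GenT c y, GenT a x])"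
    unfolding pre pairs by (simp add: word_pair_mult)
  finally show ?thesis .
qed

lemma GL_det_grade: "GL_class l (free_minor l UNIV (UNIV :: 'n::{finite,linorder} set)) \<in> grade (GL_h_alg l) 1 1"
  unfolding free_minor_arrangements[of UNIV UNIV, OF refl] GL_class_sum
proof (rule grade_finsum[OF pre_h_alg_GL])
  fix as :: "'n list" assume as: "as \<in> arrangements UNIV"
  note I = sorted_list_arrangement[of "UNIV :: 'n set"]
  show "GL_class l (word (GenL (word_sign l as) # map2 GenT as (sorted_list_of_set UNIV))) \<in> grade (GL_h_alg l) 1 1"
    by (rule GL_grade_word)
       (use length_arrangement[OF as] length_arrangement[OF I] sum_list_unit_weight[OF as] sum_list_unit_weight[OF I]
        in \<open>simp_all add: deg_T_word del: map_map\<close>)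
qed

text \<open>The coproduct of det is a sum over lists ks of middle indices, with the minor of columns
  ks in the left leg. This minor is 0 or a sign in \<mu> times det. Balancing moves the sign to the
  right leg, where the sum over ks becomes the expansion of det.\<close>

lemma comult_det:
  assumes "generic_log l"
  shows "free_comult l (free_minor l UNIV (UNIV :: 'n::{finite,linorder} set)) =
    tens (GL_h_alg l) (GL_h_alg l) (GL_class l (free_minor l UNIV UNIV)) (GL_class l (free_minor l UNIV UNIV))"
proof -
  let ?A = "GL_h_alg l :: ('n, 'n GL_elt) h_alg"
  let ?cl = "\<lambda>x. GG.T.cl l (x :: ('n GL_elt \<times> 'n GL_elt) \<Rightarrow>\<^sub>0 complex)"
  let ?N = "{ks :: 'n list. length ks = CARD('n)}"
  let ?I = "sorted_list_of_set (UNIV :: 'n set)"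
  let ?det = "GL_class l (free_minor l UNIV (UNIV :: 'n set))"
  let ?w = "\<lambda>f as bs. GenL f # map2 GenT as bs"
  define M where "M ks = (\<Sum>as\<in>arrangements UNIV. word (?w (word_sign l as) as ks))" for ks :: "'n list"
  have M: "GL_class l (M ks) = (if distinct ks then GL_class l (word [GenR (word_sign l ks)] \<otimes>\<^bsub>free_algebra\<^esub> free_minor l UNIV UNIV) else GL_class l 0)"
    if "ks \<in> ?N" for ks
    using gl_identities[OF assms, where 'n = 'n] that unfolding gl_identities_def M_def by auto
  have fin: "finite ?N" using finite_lists_length_eq[of "UNIV :: 'n set"] by simp
  have arr: "arrangements UNIV = {ks \<in> ?N. distinct ks}"
  proof -
    have "set ks = UNIV" if "length ks = CARD('n)" "distinct ks" for ks :: "'n list"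
      using that by (intro card_eq_UNIV_imp_eq_UNIV) (simp_all add: distinct_card)
    then show ?thesis unfolding arrangements_def using distinct_card[where ?'a = 'n] by fastforce
  qed
  have wt: "sum_list (map unit_weight ks) = (1 :: (complex, 'n) vec)" if "ks \<in> arrangements UNIV" for ks :: "'n list"
    using sum_list_unit_weight[OF that] .
  have I: "?I \<in> arrangements UNIV" by (rule sorted_list_arrangement)
  have len: "length as = CARD('n)" if "as \<in> arrangements UNIV" for as :: "'n list"
    using that by (simp add: length_arrangement)
  have pre: "pre_comult l (?w f as ?I) = (\<Sum>ks\<in>?N. word_pair l (?w f as ks) (map2 GenT ks ?I))" if "as \<in> arrangements UNIV" for f as
    using pre_comult_T_word[of as ?I l] len[OF that] by (simp add: pair_mult_sum word_pair_mult)
  have right: "GL_class l (word (map2 GenT ks ?I)) \<in> grade ?A (sum_list (map unit_weight ks)) 1" if "ks \<in> ?N" for ks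
    by (rule GL_grade_word) (use that len[OF I] wt[OF I] in \<open>simp_all add: deg_T_word del: map_map\<close>)
  have "free_comult l (free_minor l UNIV UNIV) = ?cl (\<Sum>as\<in>arrangements UNIV. pre_comult l (?w (word_sign l as) as ?I))"
    unfolding free_minor_arrangements[of UNIV UNIV, OF refl]
    by (rule free_comult_sum) (simp_all add: finite_arrangements pre_comult_cover free_comult_word del: pre_comult.simps)
  also have "\<dots> = ?cl (\<Sum>as\<in>arrangements UNIV. \<Sum>ks\<in>?N. word_pair l (?w (word_sign l as) as ks) (map2 GenT ks ?I))"
    using pre by (intro arg_cong[of _ _ ?cl] sum.cong refl)
  also have "\<dots> = ?cl (\<Sum>ks\<in>?N. \<Sum>as\<in>arrangements UNIV. word_pair l (?w (word_sign l as) as ks) (map2 GenT ks ?I))"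
    by (rule arg_cong[OF sum.swap])
  also have "\<dots> = ?cl (\<Sum>ks\<in>?N. if distinct ks then pair ?det (GL_class l (word (?w (word_sign l ks) ks ?I))) else 0)"
  proof (rule GG.T.cl_cong_sum)
    fix ks assume ks: "ks \<in> ?N"
    have "?cl (\<Sum>as\<in>arrangements UNIV. word_pair l (?w (word_sign l as) as ks) (map2 GenT ks ?I)) =
        tens ?A ?A (GL_class l (M ks)) (GL_class l (word (map2 GenT ks ?I)))"
      unfolding word_pair_def M_def GL_class_sum
    proof (rule GG.cl_sum_left[OF finite_arrangements[OF finite] _ right[OF ks]])
      fix as :: "'n list" assume as: "as \<in> arrangements UNIV"
      show "GL_class l (word (?w (word_sign l as) as ks)) \<in> grade ?A 1 (sum_list (map unit_weight ks))"
        by (rule GL_grade_word) (use len[OF as] ks wt[OF as] in \<open>simp_all add: deg_T_word del: map_map\<close>)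
    qed
    also have "\<dots> = ?cl (if distinct ks then pair ?det (GL_class l (word (?w (word_sign l ks) ks ?I))) else 0)"
    proof (cases "distinct ks")
      case True
      have g: "GL_class l (word (map2 GenT ks ?I)) \<in> grade ?A 1 1" using right[OF ks] wt[of ks] arr ks True by simp
      have "GL_class l (M ks) = mu_r ?A (word_sign l ks) \<otimes>\<^bsub>?A\<^esub> ?det" using M[OF ks] True by (simp add: GL_mu GL_ops)
      then show ?thesis using True GG.tens_balanced[OF GL_det_grade g, of "word_sign l ks"]
        unfolding GL_mu GL_word_Cons[of l "GenL f" "map2 _ _ _" for f, symmetric] GG.tens_eq_cl by simp
    next
      case False
      then show ?thesis using M[OF ks] GG.tens_zero_left[OF right[OF ks]] by (simp add: GL_ops GG.T.Q_zero)
    qed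
    finally show "?cl (\<Sum>as\<in>arrangements UNIV. word_pair l (?w (word_sign l as) as ks) (map2 GenT ks ?I)) = \<dots>" .
  qed
  also have "(\<Sum>ks\<in>?N. if distinct ks then pair ?det (GL_class l (word (?w (word_sign l ks) ks ?I))) else 0) =
      (\<Sum>ks\<in>arrangements UNIV. pair ?det (GL_class l (word (?w (word_sign l ks) ks ?I))))"
    unfolding arr by (rule sum.inter_filter[OF fin, symmetric])
  also have "?cl \<dots> = tens ?A ?A ?det (\<Oplus>\<^bsub>?A\<^esub>ks\<in>arrangements UNIV. GL_class l (word (?w (word_sign l ks) ks ?I)))"
  proof (rule GG.cl_sum_right[OF finite_arrangements[OF finite] GL_det_grade])
    fix ks :: "'n list" assume ks: "ks \<in> arrangements UNIV"
    show "GL_class l (word (?w (word_sign l ks) ks ?I)) \<in> grade ?A 1 1"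
      by (rule GL_grade_word) (use len[OF ks] len[OF I] wt[OF ks] wt[OF I] in \<open>simp_all add: deg_T_word del: map_map\<close>)
  qed
  finally show ?thesis unfolding free_minor_arrangements[of UNIV UNIV, OF refl] GL_class_sum .
qed

lemma GL_class_scalar: "GL_class l (Poly_Mapping.single [] c) = c \<odot>\<^bsub>GL_h_alg l\<^esub> \<one>\<^bsub>GL_h_alg l\<^esub>"
  by (subst GL_class_single) (simp add: GL_ops)

lemma free_comult_gen: "free_comult l (word [g]) = GL_comult_gen l g"
  by (simp add: GG.T.Q.algebra_ext_single GG.T.Q.r_one GG.T.Q.smult_one del: GL_comult_gen.simps)

lemma free_comult_scalar: "free_comult l (Poly_Mapping.single [] c) = c \<odot>\<^bsub>GL_tensor l\<^esub> \<one>\<^bsub>GL_tensor l\<^esub>"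
  by (simp add: GG.T.Q.algebra_ext_single del: GL_comult_gen.simps)

lemma free_comult_M_relation: "M_relation l u v \<Longrightarrow> free_comult l u = free_comult l v"
proof (induction rule: M_relation.induct)
  case (L_const c)
  have "tens (GL_h_alg l) (GL_h_alg l) (c \<odot>\<^bsub>GL_h_alg l\<^esub> \<one>\<^bsub>GL_h_alg l\<^esub>) \<one>\<^bsub>GL_h_alg l\<^esub> = c \<odot>\<^bsub>GL_tensor l\<^esub> \<one>\<^bsub>GL_tensor l\<^esub>"
    using GG.tens_smult_left[OF GL.one_grade GL.one_grade] GG.tens_one by metis
  then show ?case
    by (simp only: free_comult_gen free_comult_scalar GL_comult_gen.simps GL_mu GL_rels(1) GL_class_scalar)
next
  case (R_const c)
  have "tens (GL_h_alg l) (GL_h_alg l) \<one>\<^bsub>GL_h_alg l\<^esub> (c \<odot>\<^bsub>GL_h_alg l\<^esub> \<one>\<^bsub>GL_h_alg l\<^esub>) = c \<odot>\<^bsub>GL_tensor l\<^esub> \<one>\<^bsub>GL_tensor l\<^esub>"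
    using GG.tens_smult_right[OF GL.one_grade GL.one_grade] GG.tens_one by metis
  then show ?case
    by (simp only: free_comult_gen free_comult_scalar GL_comult_gen.simps GL_mu GL_rels(4) GL_class_scalar)
next
  case (L_add f g)
  have "GL_comult_gen l (GenL (f + g)) = GL_comult_gen l (GenL f) \<oplus>\<^bsub>GL_tensor l\<^esub> GL_comult_gen l (GenL g)"
    using GG.tens_add_left[OF GL.mu_grade(1) GL.mu_grade(1) GL.one_grade] by (simp add: GL_mu GL_rels(2) GL_ops(2)[symmetric])
  then show ?case
    by (simp only: GG.T.Q.algebra_ext_add GL_comult_gen_carrier free_comult_gen)
next
  case (R_add f g)
  have "GL_comult_gen l (GenR (f + g)) = GL_comult_gen l (GenR f) \<oplus>\<^bsub>GL_tensor l\<^esub> GL_comult_gen l (GenR g)"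
    using GG.tens_add_right[OF GL.one_grade GL.mu_grade(2) GL.mu_grade(2)] by (simp add: GL_mu GL_rels(5) GL_ops(2)[symmetric])
  then show ?case
    by (simp only: GG.T.Q.algebra_ext_add GL_comult_gen_carrier free_comult_gen)
next
  case (RLL a c b d)
  have "free_comult l (\<Sum>x\<in>UNIV. \<Sum>y\<in>UNIV. word (f x y)) = GG.T.cl l (\<Sum>x\<in>UNIV. \<Sum>y\<in>UNIV. pre_comult l (f x y))"
    for f :: "'a \<Rightarrow> 'a \<Rightarrow> 'a gen list"
    by (intro free_comult_sum GG.T.cover_sum pre_comult_cover free_comult_word finite)
  then show ?case by (simp only: comult_RLL)
qed (simp_all add: free_comult_word pair_mult_sum word_pair_mult;
     intro arg_cong[of _ _ "GG.T.cl l"] sum.cong refl word_pair_cong; simp add: GL_rels)+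

lemma pre_comult_DetInv: "pre_comult l [GenDetInv] = word_pair l [GenDetInv] [GenDetInv]" "pre_comult l [] = word_pair l [] []"
  by (simp_all add: word_pair_mult)

lemma GL_det_inv_grade: "GL_class l (word [GenDetInv]) \<in> grade (GL_h_alg l) (- 1) (- 1)"
  by (rule GL_grade_word) simp_all

lemma free_comult_relation:
  assumes "generic_log l"
  shows "GL_relation l u v \<Longrightarrow> free_comult l u = free_comult l v"
proof (induction rule: GL_relation.induct)
  case (M_rel u v)
  then show ?case by (rule free_comult_M_relation)
next
  case det_inv_right
  show ?case unfolding free_comult_mult comult_det[OF assms] free_comult_word pre_comult_DetInv tens_word_pair[symmetric]
    by (subst GG.tens_mult[OF GL_det_grade GL_det_grade GL_det_inv_grade GL_det_inv_grade])
       (simp only: GL_ops GL_relation_eq[OF GL_relation.det_inv_right])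
next
  case det_inv_left
  show ?case unfolding free_comult_mult comult_det[OF assms] free_comult_word pre_comult_DetInv tens_word_pair[symmetric]
    by (subst GG.tens_mult[OF GL_det_inv_grade GL_det_inv_grade GL_det_grade GL_det_grade])
       (simp only: GL_ops GL_relation_eq[OF GL_relation.det_inv_left])
qed (simp_all add: free_comult_word pair_mult_sum word_pair_mult;
     intro arg_cong[of _ _ "GG.T.cl l"] sum.cong refl word_pair_cong; simp add: GL_rels)+

definition GL_comult :: "complex \<Rightarrow> 'n::{finite,linorder} GL_elt \<Rightarrow> (('n GL_elt \<times> 'n GL_elt) \<Rightarrow>\<^sub>0 complex) set"
  where "GL_comult l = descend (free_comult l)"

context
  fixes l :: complex
  assumes l: "generic_log l"
begin

lemma GL_comult_class: "GL_comult l (GL_class l x) = free_comult l x"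
  unfolding GL_comult_def by (rule GG.T.Q.GL_lift(1)[OF GL_comult_gen_carrier free_comult_relation[OF l]])

lemma GL_comult_ring_hom: "GL_comult l \<in> ring_hom (GL_h_alg l) (GL_tensor l)"
  unfolding GL_comult_def by (rule GG.T.Q.GL_lift(2)[OF GL_comult_gen_carrier free_comult_relation[OF l]])

lemma GL_comult_linear_map: "linear_map (GL_h_alg l) (GL_tensor l) (GL_comult l)"
  unfolding GL_comult_def by (rule GG.T.Q.GL_lift(3)[OF GL_comult_gen_carrier free_comult_relation[OF l]])

lemma GL_comult_word: "GL_comult l (GL_class l (word [g])) = GL_comult_gen l g"
  unfolding GL_comult_class by (rule free_comult_gen)

lemma GL_comult_Cons: "GL_comult l (GL_class l (word (g # w))) = GL_comult_gen l g \<otimes>\<^bsub>GL_tensor l\<^esub> GL_comult l (GL_class l (word w))"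
  unfolding GL_word_Cons[of l g w] GL_comult_word[symmetric] by (rule ring_hom_mult[OF GL_comult_ring_hom]) simp_all

lemma GL_comult_Nil: "GL_comult l (GL_class l (word [])) = \<one>\<^bsub>GL_tensor l\<^esub>"
  using ring_hom_one[OF GL_comult_ring_hom] by (simp add: GL_ops)

lemma GL_comult_gen_grade: "GL_comult_gen l g \<in> grade (GL_tensor l) (gen_deg_l g) (gen_deg_r g)"
proof (cases g)
  case (GenT i j)
  have "tens (GL_h_alg l) (GL_h_alg l) (GL_t l i k) (GL_t l k j) \<in> grade (GL_tensor l) (unit_weight i) (unit_weight j)" for k
    unfolding GL_t_def by (rule GG.tens_grade[where \<gamma> = "unit_weight k"]; rule GL_grade_word; simp)
  then show ?thesis unfolding GenT GL_comult_gen.simps gen_deg_l.simps gen_deg_r.simps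
    by (intro grade_finsum[OF GG.pre_h_alg_h_tensor])
qed (auto intro!: GG.tens_grade GL.mu_grade GL.one_grade GL_det_inv_grade simp: GL_det_inv_def)

lemma GL_comult_word_grade: "GL_comult l (GL_class l (word w)) \<in> grade (GL_tensor l) (deg_l w) (deg_r w)"
proof (induction w)
  case Nil
  show ?case unfolding GL_comult_Nil using GG.T.one_grade by simp
next
  case (Cons g w)
  show ?case unfolding GL_comult_Cons using GG.T.mult_grade[OF GL_comult_gen_grade Cons] by simp
qed

lemma GL_comult_hom: "h_algebra_hom (GL_h_alg l) (GL_tensor l) (GL_comult l)"
  unfolding h_algebra_hom_def
proof (intro conjI allI ballI GL_comult_ring_hom linear_mapD(3)[OF GL_comult_linear_map])
  show "GL_comult l ` grade (GL_h_alg l) \<alpha> \<beta> \<subseteq> grade (GL_tensor l) \<alpha> \<beta>" for \<alpha> \<beta>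
  proof (rule image_subsetI)
    fix a assume "a \<in> grade (GL_h_alg l) \<alpha> \<beta>"
    then show "GL_comult l a \<in> grade (GL_tensor l) \<alpha> \<beta>"
    proof (induction a rule: GL_grade_induct)
      case zero
      then show ?case
        using linear_map_zero[OF GL.Q.calgebra_axioms GG.T.Q.calgebra_axioms GL_comult_linear_map] GG.T.grade_zero by metis
    next
      case (word w c)
      then show ?case using GG.T.grade_smult[OF GL_comult_word_grade[of w]] by (simp add: linear_mapD(3)[OF GL_comult_linear_map])
    next
      case (add y z)
      then show ?case using GG.T.grade_add by (simp add: linear_mapD(2)[OF GL_comult_linear_map])
    qed
  qed
  show "GL_comult l (mu_l (GL_h_alg l) f) = mu_l (GL_tensor l) f" "GL_comult l (mu_r (GL_h_alg l) f) = mu_r (GL_tensor l) f" for f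
    by (simp_all add: GL_mu GL_comult_word GG.mu_h_tensor)
qed

end

section \<open>Coassociativity and the counit axioms\<close>

lemma h_homD:
  assumes "h_algebra_hom A C \<phi>"
  shows "pre_h_alg A \<Longrightarrow> a \<in> grade A \<alpha> \<beta> \<Longrightarrow> \<phi> a \<in> grade C \<alpha> \<beta>"
    and "linear_map A C \<phi>"
    and "pre_h_alg A \<Longrightarrow> a \<in> grade A \<alpha> \<beta> \<Longrightarrow> b \<in> grade A \<gamma> \<delta> \<Longrightarrow> \<phi> (a \<otimes>\<^bsub>A\<^esub> b) = \<phi> a \<otimes>\<^bsub>C\<^esub> \<phi> b"
    and "\<phi> (mu_l A f) = mu_l C f" "\<phi> (mu_r A f) = mu_r C f" "\<phi> \<one>\<^bsub>A\<^esub> = \<one>\<^bsub>C\<^esub>"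
proof -
  have h: "\<phi> \<in> ring_hom A C" "\<And>c x. x \<in> carrier A \<Longrightarrow> \<phi> (c \<odot>\<^bsub>A\<^esub> x) = c \<odot>\<^bsub>C\<^esub> \<phi> x"
    "\<And>\<alpha> \<beta>. \<phi> ` grade A \<alpha> \<beta> \<subseteq> grade C \<alpha> \<beta>" "\<And>f. \<phi> (mu_l A f) = mu_l C f" "\<And>f. \<phi> (mu_r A f) = mu_r C f"
    using assms unfolding h_algebra_hom_def by blast+
  show "a \<in> grade A \<alpha> \<beta> \<Longrightarrow> \<phi> a \<in> grade C \<alpha> \<beta>" using h(3) by blast
  show "linear_map A C \<phi>" using h(1,2) by (auto simp: linear_map_def ring_hom_def)
  show "\<phi> (mu_l A f) = mu_l C f" "\<phi> (mu_r A f) = mu_r C f" by (rule h)+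
  show "\<phi> \<one>\<^bsub>A\<^esub> = \<one>\<^bsub>C\<^esub>" by (rule ring_hom_one[OF h(1)])
  assume "pre_h_alg A" and ab: "a \<in> grade A \<alpha> \<beta>" "b \<in> grade A \<gamma> \<delta>"
  then interpret A: pre_h_alg A by simp
  show "\<phi> (a \<otimes>\<^bsub>A\<^esub> b) = \<phi> a \<otimes>\<^bsub>C\<^esub> \<phi> b" by (rule ring_hom_mult[OF h(1)]) (use ab A.grade_carrier in auto)
qed

lemma h_hom_id: "h_algebra_hom A A id"
  by (simp add: h_algebra_hom_def ring_hom_def)

context h_alg_pair
begin

text \<open>Pure tensors of homogeneous elements generate the tensor product additively, so
  multiplicativity of a linear map can be tested on them.\<close>

lemma ring_hom_tensI:
  assumes "calgebra V" and F: "linear_map (h_tensor A B) V F" "F \<one>\<^bsub>h_tensor A B\<^esub> = \<one>\<^bsub>V\<^esub>"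
    and m: "\<And>a b a' b' \<alpha> \<gamma> \<beta> \<alpha>' \<gamma>' \<beta>'. a \<in> grade A \<alpha> \<gamma> \<Longrightarrow> b \<in> grade B \<gamma> \<beta> \<Longrightarrow>
      a' \<in> grade A \<alpha>' \<gamma>' \<Longrightarrow> b' \<in> grade B \<gamma>' \<beta>' \<Longrightarrow>
      F (tens A B (a \<otimes>\<^bsub>A\<^esub> a') (b \<otimes>\<^bsub>B\<^esub> b')) = F (tens A B a b) \<otimes>\<^bsub>V\<^esub> F (tens A B a' b')"
  shows "F \<in> ring_hom (h_tensor A B) V"
proof -
  interpret V: calgebra V by fact
  note F0 = linear_map_zero[OF T.Q.calgebra_axioms assms(1) F(1)]
  have 1: "F (tens A B a b \<otimes>\<^bsub>h_tensor A B\<^esub> y) = F (tens A B a b) \<otimes>\<^bsub>V\<^esub> F y"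
    if ab: "a \<in> grade A \<alpha> \<gamma>" "b \<in> grade B \<gamma> \<beta>" and y: "y \<in> carrier (h_tensor A B)" for a b y \<alpha> \<gamma> \<beta>
    using y
  proof (induction y rule: tensor_induct)
    case zero
    then show ?case using tens_closed[OF ab] by (simp add: T.Q.r_null F0 V.r_null linear_mapD(1)[OF F(1)])
  next
    case (tens a' b' \<alpha> \<gamma> \<beta>)
    then show ?case using ab by (simp add: tens_mult m)
  next
    case (add y z)
    then show ?case using tens_closed[OF ab]
      by (simp add: T.Q.r_distr linear_mapD[OF F(1)] V.r_distr)
  qed
  show ?thesis
  proof (rule ring_hom_memI)
    fix x y assume x: "x \<in> carrier (h_tensor A B)" and y: "y \<in> carrier (h_tensor A B)"
    show "F x \<in> carrier V" by (rule linear_mapD(1)[OF F(1) x])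
    show "F (x \<oplus>\<^bsub>h_tensor A B\<^esub> y) = F x \<oplus>\<^bsub>V\<^esub> F y" by (rule linear_mapD(2)[OF F(1) x y])
    show "F (x \<otimes>\<^bsub>h_tensor A B\<^esub> y) = F x \<otimes>\<^bsub>V\<^esub> F y"
      using x
    proof (induction x rule: tensor_induct)
      case zero
      then show ?case using y by (simp add: T.Q.l_null F0 V.l_null linear_mapD(1)[OF F(1)])
    next
      case (tens a b \<alpha> \<gamma> \<beta>)
      then show ?case using y by (rule 1)
    next
      case (add x x')
      then show ?case using y by (simp add: T.Q.l_distr linear_mapD[OF F(1)] V.l_distr)
    qed
  qed (rule F(2))
qed

lemma tens_finsum_left:
  assumes "finite S" "\<And>i. i \<in> S \<Longrightarrow> a i \<in> grade A \<alpha> \<gamma>" "b \<in> grade B \<gamma> \<beta>"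
  shows "tens A B (\<Oplus>\<^bsub>A\<^esub>i\<in>S. a i) b = (\<Oplus>\<^bsub>h_tensor A B\<^esub>i\<in>S. tens A B (a i) b)"
proof -
  have "T.cl (\<Sum>i\<in>S. pair (a i) b) = (\<Oplus>\<^bsub>h_tensor A B\<^esub>i\<in>S. T.cl (pair (a i) b))"
    by (rule T.cl_sum) (rule pair_cover[OF assms(2,3)])
  then show ?thesis using cl_sum_left[OF assms] unfolding tens_eq_cl by simp
qed

lemma tens_finsum_right:
  assumes "finite S" "a \<in> grade A \<alpha> \<gamma>" "\<And>i. i \<in> S \<Longrightarrow> b i \<in> grade B \<gamma> \<beta>"
  shows "tens A B a (\<Oplus>\<^bsub>B\<^esub>i\<in>S. b i) = (\<Oplus>\<^bsub>h_tensor A B\<^esub>i\<in>S. tens A B a (b i))"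
proof -
  have "T.cl (\<Sum>i\<in>S. pair a (b i)) = (\<Oplus>\<^bsub>h_tensor A B\<^esub>i\<in>S. T.cl (pair a (b i)))"
    by (rule T.cl_sum) (rule pair_cover[OF assms(2,3)])
  then show ?thesis using cl_sum_right[OF assms] unfolding tens_eq_cl by simp
qed

end

lemma (in calgebra) finsum_swap:
  assumes "finite S" "finite U" and f: "\<And>i j. f i j \<in> carrier A"
  shows "(\<Oplus>i\<in>S. \<Oplus>j\<in>U. f i j) = (\<Oplus>j\<in>U. \<Oplus>i\<in>S. f i j)"
  using assms(1)
proof (induction S rule: finite_induct)
  case empty
  then show ?case by simp
next
  case (insert i S)
  have "(\<Oplus>i\<in>insert i S. \<Oplus>j\<in>U. f i j) = (\<Oplus>j\<in>U. f i j) \<oplus> (\<Oplus>j\<in>U. \<Oplus>i\<in>S. f i j)"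
    using insert f by (simp add: finsum_insert finsum_closed)
  also have "\<dots> = (\<Oplus>j\<in>U. f i j \<oplus> (\<Oplus>i\<in>S. f i j))"
    using f by (intro finsum_addf[symmetric]) (auto intro: finsum_closed)
  also have "\<dots> = (\<Oplus>j\<in>U. \<Oplus>i\<in>insert i S. f i j)"
    using insert.hyps f by (intro finsum_cong') (auto simp: finsum_insert intro!: finsum_closed)
  finally show ?case .
qed

lemma tensor_map:
  assumes AB: "h_alg_pair A B" and CD: "h_alg_pair C D"
    and \<phi>: "h_algebra_hom A C \<phi>" and \<psi>: "h_algebra_hom B D \<psi>"
  shows tensor_map_tens: "a \<in> grade A \<alpha> \<gamma> \<Longrightarrow> b \<in> grade B \<gamma> \<beta> \<Longrightarrow>
      tensor_map C D \<phi> \<psi> (tens A B a b) = tens C D (\<phi> a) (\<psi> b)"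
    and tensor_map_linear_map: "linear_map (h_tensor A B) (h_tensor C D) (tensor_map C D \<phi> \<psi>)"
    and tensor_map_ring_hom: "tensor_map C D \<phi> \<psi> \<in> ring_hom (h_tensor A B) (h_tensor C D)"
proof -
  interpret AB: h_alg_pair A B by fact
  interpret CD: h_alg_pair C D by fact
  have V: "calgebra (h_tensor C D)" by (rule CD.T.Q.calgebra_axioms)
  note \<phi>g = h_homD(1)[OF \<phi> AB.A.pre_h_alg_axioms] and \<psi>g = h_homD(1)[OF \<psi> AB.B.pre_h_alg_axioms]
  note lin = linear_mapD[OF h_homD(2)[OF \<phi>]] linear_mapD[OF h_homD(2)[OF \<psi>]]
  note \<phi>m = h_homD(3)[OF \<phi> AB.A.pre_h_alg_axioms] and \<psi>m = h_homD(3)[OF \<psi> AB.B.pre_h_alg_axioms]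
  have bal: "balanced_map A B (h_tensor C D) (\<lambda>a b. tens C D (\<phi> a) (\<psi> b))"
  proof (rule balanced_mapI)
    fix \<alpha> \<gamma> \<beta> a b assume a: "a \<in> grade A \<alpha> \<gamma>" and b: "b \<in> grade B \<gamma> \<beta>"
    note car = AB.A.grade_carrier[OF a] AB.B.grade_carrier[OF b]
    show "tens C D (\<phi> a) (\<psi> b) \<in> carrier (h_tensor C D)" by (rule CD.tens_closed[OF \<phi>g[OF a] \<psi>g[OF b]])
    show "tens C D (\<phi> (c \<odot>\<^bsub>A\<^esub> a)) (\<psi> b) = c \<odot>\<^bsub>h_tensor C D\<^esub> tens C D (\<phi> a) (\<psi> b)" for c
      using CD.tens_smult_left[OF \<phi>g[OF a] \<psi>g[OF b]] car by (simp add: lin)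
    show "tens C D (\<phi> a) (\<psi> (c \<odot>\<^bsub>B\<^esub> b)) = c \<odot>\<^bsub>h_tensor C D\<^esub> tens C D (\<phi> a) (\<psi> b)" for c
      using CD.tens_smult_right[OF \<phi>g[OF a] \<psi>g[OF b]] car by (simp add: lin)
    show "tens C D (\<phi> (mu_r A f \<otimes>\<^bsub>A\<^esub> a)) (\<psi> b) = tens C D (\<phi> a) (\<psi> (mu_l B f \<otimes>\<^bsub>B\<^esub> b))" for f
      unfolding \<phi>m[OF AB.A.mu_grade(2) a] \<psi>m[OF AB.B.mu_grade(1) b] h_homD(5)[OF \<phi>] h_homD(4)[OF \<psi>]
      by (rule CD.tens_balanced[OF \<phi>g[OF a] \<psi>g[OF b]])
    show "tens C D (\<phi> (a \<oplus>\<^bsub>A\<^esub> a')) (\<psi> b) = tens C D (\<phi> a) (\<psi> b) \<oplus>\<^bsub>h_tensor C D\<^esub> tens C D (\<phi> a') (\<psi> b)"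
      if a': "a' \<in> grade A \<alpha> \<gamma>" for a'
      using CD.tens_add_left[OF \<phi>g[OF a] \<phi>g[OF a'] \<psi>g[OF b]] car AB.A.grade_carrier[OF a'] by (simp add: lin)
    show "tens C D (\<phi> a) (\<psi> (b \<oplus>\<^bsub>B\<^esub> b')) = tens C D (\<phi> a) (\<psi> b) \<oplus>\<^bsub>h_tensor C D\<^esub> tens C D (\<phi> a) (\<psi> b')"
      if b': "b' \<in> grade B \<gamma> \<beta>" for b'
      using CD.tens_add_right[OF \<phi>g[OF a] \<psi>g[OF b] \<psi>g[OF b']] car AB.B.grade_carrier[OF b'] by (simp add: lin)
  qed
  show tens: "tensor_map C D \<phi> \<psi> (tens A B a b) = tens C D (\<phi> a) (\<psi> b)"
    if "a \<in> grade A \<alpha> \<gamma>" "b \<in> grade B \<gamma> \<beta>" for a b \<alpha> \<gamma> \<beta>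
    unfolding tensor_map_def by (rule AB.lift_tens[OF V bal that])
  show lm: "linear_map (h_tensor A B) (h_tensor C D) (tensor_map C D \<phi> \<psi>)"
    unfolding tensor_map_def by (rule AB.lift_linear_map[OF V bal])
  show "tensor_map C D \<phi> \<psi> \<in> ring_hom (h_tensor A B) (h_tensor C D)"
  proof (rule AB.ring_hom_tensI[OF V lm])
    show "tensor_map C D \<phi> \<psi> \<one>\<^bsub>h_tensor A B\<^esub> = \<one>\<^bsub>h_tensor C D\<^esub>"
      unfolding AB.tens_one[symmetric] tens[OF AB.A.one_grade AB.B.one_grade] h_homD(6)[OF \<phi>] h_homD(6)[OF \<psi>]
      by (rule CD.tens_one)
    fix a b a' b' \<alpha> \<gamma> \<beta> \<alpha>' \<gamma>' \<beta>'
    assume h: "a \<in> grade A \<alpha> \<gamma>" "b \<in> grade B \<gamma> \<beta>" "a' \<in> grade A \<alpha>' \<gamma>'" "b' \<in> grade B \<gamma>' \<beta>'"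
    show "tensor_map C D \<phi> \<psi> (tens A B (a \<otimes>\<^bsub>A\<^esub> a') (b \<otimes>\<^bsub>B\<^esub> b')) =
      tensor_map C D \<phi> \<psi> (tens A B a b) \<otimes>\<^bsub>h_tensor C D\<^esub> tensor_map C D \<phi> \<psi> (tens A B a' b')"
      unfolding tens[OF h(1,2)] tens[OF h(3,4)] tens[OF AB.A.mult_grade[OF h(1,3)] AB.B.mult_grade[OF h(2,4)]]
        \<phi>m[OF h(1,3)] \<psi>m[OF h(2,4)]
      by (rule CD.tens_mult[OF \<phi>g[OF h(1)] \<psi>g[OF h(2)] \<phi>g[OF h(3)] \<psi>g[OF h(4)], symmetric])
  qed
qed

section \<open>Associativity of the tensor product\<close>

definition disjoint_grades :: "('n::finite, 'a, 'm) h_alg_scheme \<Rightarrow> bool"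
  where "disjoint_grades A \<longleftrightarrow> (\<forall>x \<alpha> \<beta> \<alpha>' \<beta>'. x \<in> grade A \<alpha> \<beta> \<longrightarrow> x \<in> grade A \<alpha>' \<beta>' \<longrightarrow> (\<alpha>, \<beta>) \<noteq> (\<alpha>', \<beta>') \<longrightarrow> x = \<zero>\<^bsub>A\<^esub>)"

text \<open>A nonzero element of two components would have two decompositions, each concentrated in
  one of the degrees.\<close>

lemma bigraded_disjoint:
  fixes A :: "('n::finite, 'a, 'm) h_alg_scheme"
  assumes "pre_h_alg A" "bigraded A"
  shows "disjoint_grades A"
  unfolding disjoint_grades_def
proof (intro allI impI)
  interpret A: pre_h_alg A by fact
  fix x \<alpha> \<beta> \<alpha>' \<beta>' assume x: "x \<in> grade A \<alpha> \<beta>" "x \<in> grade A \<alpha>' \<beta>'" and ne: "(\<alpha>, \<beta>) \<noteq> (\<alpha>', \<beta>')"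
  have car: "x \<in> carrier A" using A.grade_carrier x by blast
  show "x = \<zero>\<^bsub>A\<^esub>"
  proof (rule ccontr)
    assume nz: "x \<noteq> \<zero>\<^bsub>A\<^esub>"
    define e where "e p q = (if q = p then x else \<zero>\<^bsub>A\<^esub>)" for p q :: "(complex, 'n) vec \<times> (complex, 'n) vec"
    have P: "(\<forall>\<alpha> \<beta>. e p (\<alpha>, \<beta>) \<in> grade A \<alpha> \<beta>) \<and> finite {q. e p q \<noteq> \<zero>\<^bsub>A\<^esub>} \<and>
        x = (\<Oplus>\<^bsub>A\<^esub>q\<in>{q. e p q \<noteq> \<zero>\<^bsub>A\<^esub>}. e p q)" if "p = (\<alpha>, \<beta>) \<or> p = (\<alpha>', \<beta>')" for p
    proof -
      have s: "{q. e p q \<noteq> \<zero>\<^bsub>A\<^esub>} = {p}" using nz by (auto simp: e_def)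
      have "(\<Oplus>\<^bsub>A\<^esub>q\<in>{p}. e p q) = x" using car by (simp add: e_def A.finsum_insert)
      then show ?thesis unfolding s using that x A.grade_zero by (auto simp: e_def)
    qed
    have "\<exists>!c. (\<forall>\<alpha> \<beta>. c (\<alpha>, \<beta>) \<in> grade A \<alpha> \<beta>) \<and> finite {p. c p \<noteq> \<zero>\<^bsub>A\<^esub>} \<and>
        x = (\<Oplus>\<^bsub>A\<^esub>p\<in>{p. c p \<noteq> \<zero>\<^bsub>A\<^esub>}. c p)"
      using assms(2) car unfolding bigraded_def by blast
    from ex1E[OF this] P[of "(\<alpha>, \<beta>)"] P[of "(\<alpha>', \<beta>')"] have "e (\<alpha>, \<beta>) = e (\<alpha>', \<beta>')" by metis
    then have "e (\<alpha>, \<beta>) (\<alpha>, \<beta>) = e (\<alpha>', \<beta>') (\<alpha>, \<beta>)" by simp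
    then show False using nz ne by (simp add: e_def split: if_splits)
  qed
qed

locale h_alg_triple = AB: h_alg_pair A B + BC: h_alg_pair B C
  for A :: "('n::finite, 'a, 'm) h_alg_scheme" and B :: "('n, 'b, 'k) h_alg_scheme" and C :: "('n, 'c, 'l) h_alg_scheme" +
  assumes disjoint: "disjoint_grades B" "disjoint_grades C"
begin

abbreviation "V \<equiv> h_tensor A (h_tensor B C)"

sublocale L: h_alg_pair "h_tensor A B" C
  by (simp add: h_alg_pair_def AB.pre_h_alg_h_tensor BC.B.pre_h_alg_axioms)

sublocale R: h_alg_pair A "h_tensor B C"
  by (simp add: h_alg_pair_def BC.pre_h_alg_h_tensor AB.A.pre_h_alg_axioms)

text \<open>
  An extension of \<open>(a, b) \<mapsto> a \<otimes> (b \<otimes> c)\<close> to all composable pairs that is still balanced: by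
  uniqueness of degrees it vanishes on every bidegree of \<open>b\<close> that does not fit that of \<open>c\<close>.
\<close>

definition assoc_fun :: "'c \<Rightarrow> 'a \<Rightarrow> 'b \<Rightarrow> (('a \<times> (('b \<times> 'c) \<Rightarrow>\<^sub>0 complex) set) \<Rightarrow>\<^sub>0 complex) set"
  where "assoc_fun c a b = (if (b, c) \<in> composable B C then tens A (h_tensor B C) a (tens B C b c) else \<zero>\<^bsub>V\<^esub>)"

text \<open>If b and c are composable although the given degrees do not match, one of them lies in
  two different components and is therefore 0, and then the tensor is 0 as well.\<close>

lemma assoc_fun_eq:
  assumes a: "a \<in> grade A \<alpha> \<gamma>" and b: "b \<in> grade B \<gamma> \<beta>" and c: "c \<in> grade C \<epsilon> \<delta>"
  shows "assoc_fun c a b = (if \<beta> = \<epsilon> then tens A (h_tensor B C) a (tens B C b c) else \<zero>\<^bsub>V\<^esub>)"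
proof (cases "\<beta> = \<epsilon>")
  case True
  then show ?thesis using b c by (auto simp: assoc_fun_def intro: composableI)
next
  case False
  have "tens A (h_tensor B C) a (tens B C b c) = \<zero>\<^bsub>V\<^esub>" if comp: "(b, c) \<in> composable B C"
  proof -
    obtain \<alpha>' \<gamma>' \<beta>' where *: "b \<in> grade B \<alpha>' \<gamma>'" "c \<in> grade C \<gamma>' \<beta>'" using comp by (auto simp: composable_def)
    have "b = \<zero>\<^bsub>B\<^esub> \<or> c = \<zero>\<^bsub>C\<^esub>"
      using disjoint * b c False unfolding disjoint_grades_def by (metis prod.inject)
    then have "tens B C b c = \<zero>\<^bsub>h_tensor B C\<^esub>"
      using BC.tens_zero_left[OF *(2)] BC.tens_zero_right[OF *(1)] by auto
    then show ?thesis using R.tens_zero_right[OF a] by simp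
  qed
  then show ?thesis using False by (simp add: assoc_fun_def)
qed

lemma assoc_fun_balanced:
  assumes c: "c \<in> grade C \<epsilon> \<delta>"
  shows "balanced_map A B V (assoc_fun c)"
proof (rule balanced_mapI)
  fix \<alpha> \<gamma> \<beta> a b assume a: "a \<in> grade A \<alpha> \<gamma>" and b: "b \<in> grade B \<gamma> \<beta>"
  note eq = assoc_fun_eq[OF _ _ c]
  have bc: "tens B C b c \<in> grade (h_tensor B C) \<gamma> \<delta>" if "\<beta> = \<epsilon>"
    using BC.tens_grade[OF b] c that by simp
  show "assoc_fun c a b \<in> carrier V" unfolding eq[OF a b] using R.tens_closed[OF a bc] R.T.Q.zero_closed by simp
  show "assoc_fun c (k \<odot>\<^bsub>A\<^esub> a) b = k \<odot>\<^bsub>V\<^esub> assoc_fun c a b" for k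
    unfolding eq[OF a b] eq[OF AB.A.grade_smult[OF a] b] using R.tens_smult_left[OF a bc] by (simp add: R.T.Q.smult_0_right)
  show "assoc_fun c a (k \<odot>\<^bsub>B\<^esub> b) = k \<odot>\<^bsub>V\<^esub> assoc_fun c a b" for k
    unfolding eq[OF a b] eq[OF a AB.B.grade_smult[OF b]]
    using R.tens_smult_right[OF a bc] BC.tens_smult_left[OF b, of c \<delta>] c by (simp add: R.T.Q.smult_0_right)
  show "assoc_fun c (mu_r A f \<otimes>\<^bsub>A\<^esub> a) b = assoc_fun c a (mu_l B f \<otimes>\<^bsub>B\<^esub> b)" for f
  proof -
    have a': "mu_r A f \<otimes>\<^bsub>A\<^esub> a \<in> grade A \<alpha> \<gamma>" and b': "mu_l B f \<otimes>\<^bsub>B\<^esub> b \<in> grade B \<gamma> \<beta>"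
      using AB.A.mult_grade[OF AB.A.mu_grade(2) a] AB.B.mult_grade[OF AB.B.mu_grade(1) b] by simp_all
    show ?thesis
    proof (cases "\<beta> = \<epsilon>")
      case True
      have "tens A (h_tensor B C) (mu_r A f \<otimes>\<^bsub>A\<^esub> a) (tens B C b c) =
          tens A (h_tensor B C) a (mu_l (h_tensor B C) f \<otimes>\<^bsub>h_tensor B C\<^esub> tens B C b c)"
        by (rule R.tens_balanced[OF a bc[OF True]])
      also have "mu_l (h_tensor B C) f \<otimes>\<^bsub>h_tensor B C\<^esub> tens B C b c = tens B C (mu_l B f \<otimes>\<^bsub>B\<^esub> b) (\<one>\<^bsub>C\<^esub> \<otimes>\<^bsub>C\<^esub> c)"
        unfolding BC.mu_h_tensor by (rule BC.tens_mult[OF AB.B.mu_grade(1) BC.B.one_grade b]) (use c True in simp)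
      also have "\<one>\<^bsub>C\<^esub> \<otimes>\<^bsub>C\<^esub> c = c" using BC.B.grade_carrier[OF c] by simp
      finally show ?thesis unfolding eq[OF a' b] eq[OF a b'] using True by simp
    next
      case False
      then show ?thesis unfolding eq[OF a' b] eq[OF a b'] by simp
    qed
  qed
  show "assoc_fun c (a \<oplus>\<^bsub>A\<^esub> a') b = assoc_fun c a b \<oplus>\<^bsub>V\<^esub> assoc_fun c a' b" if a': "a' \<in> grade A \<alpha> \<gamma>" for a'
    unfolding eq[OF a b] eq[OF a' b] eq[OF AB.A.grade_add[OF a a'] b]
    using R.tens_add_left[OF a a' bc] R.T.Q.l_zero R.T.Q.zero_closed by auto
  show "assoc_fun c a (b \<oplus>\<^bsub>B\<^esub> b') = assoc_fun c a b \<oplus>\<^bsub>V\<^esub> assoc_fun c a b'" if b': "b' \<in> grade B \<gamma> \<beta>" for b'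
  proof (cases "\<beta> = \<epsilon>")
    case True
    have c': "c \<in> grade C \<beta> \<delta>" using c True by simp
    show ?thesis
      unfolding eq[OF a b] eq[OF a b'] eq[OF a AB.B.grade_add[OF b b']] BC.tens_add_left[OF b b' c']
      using True R.tens_add_right[OF a bc[OF True] BC.tens_grade[OF b' c']] by simp
  next
    case False
    then show ?thesis unfolding eq[OF a b] eq[OF a b'] eq[OF a AB.B.grade_add[OF b b']]
      using R.T.Q.l_zero R.T.Q.zero_closed by auto
  qed
qed

definition assoc_left :: "'c \<Rightarrow> (('a \<times> 'b) \<Rightarrow>\<^sub>0 complex) set \<Rightarrow> (('a \<times> (('b \<times> 'c) \<Rightarrow>\<^sub>0 complex) set) \<Rightarrow>\<^sub>0 complex) set"
  where "assoc_left c = descend (linear_ext V (\<lambda>(a, b). assoc_fun c a b))"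

lemmas calgebra_V = R.T.Q.calgebra_axioms

lemma assoc_left_linear_map: "c \<in> grade C \<epsilon> \<delta> \<Longrightarrow> linear_map (h_tensor A B) V (assoc_left c)"
  unfolding assoc_left_def by (rule AB.lift_linear_map[OF calgebra_V assoc_fun_balanced])

lemma assoc_left_tens:
  assumes "a \<in> grade A \<alpha> \<gamma>" "b \<in> grade B \<gamma> \<beta>" "c \<in> grade C \<beta> \<delta>"
  shows "assoc_left c (tens A B a b) = tens A (h_tensor B C) a (tens B C b c)"
  unfolding assoc_left_def AB.lift_tens[OF calgebra_V assoc_fun_balanced[OF assms(3)] assms(1,2)] assoc_fun_eq[OF assms]
  by simp

text \<open>On pairs whose second leg is composable with c the two formulas agree, so every
  admissible representative of Y yields the value of the balanced extension. A homogeneous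
  representative is admissible, hence there is such a value.\<close>

lemma assoc_left:
  assumes Y: "Y \<in> grade (h_tensor A B) \<alpha> \<gamma>" and c: "c \<in> grade C \<gamma> \<delta>"
  shows "descend (linear_ext V (\<lambda>(a, b). tens A (h_tensor B C) a (tens B C b c)))
      {x \<in> Y. \<forall>(a, b)\<in>Poly_Mapping.keys x. (b, c) \<in> composable B C} = assoc_left c Y"
proof -
  let ?\<phi> = "\<lambda>(a, b). tens A (h_tensor B C) a (tens B C b c)"
  let ?S = "{x \<in> Y. \<forall>(a, b)\<in>Poly_Mapping.keys x. (b, c) \<in> composable B C}"
  obtain x where x: "Y = AB.T.cl x" "Poly_Mapping.keys x \<subseteq> (\<Union>\<gamma>'. grade A \<alpha> \<gamma>' \<times> grade B \<gamma>' \<gamma>)"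
    using Y unfolding AB.h_tensor_grade by blast
  have xc: "x \<in> AB.T.cover" using x(2) unfolding AB.T.cover_iff by (fastforce intro: composableI)
  have bal: "balanced_map A B V (assoc_fun c)" by (rule assoc_fun_balanced[OF c])
  have "linear_ext V ?\<phi> x' = assoc_left c Y" if x': "x' \<in> ?S" for x'
  proof -
    have x'Y: "x' \<in> AB.T.cl x" and good: "\<forall>(a, b)\<in>Poly_Mapping.keys x'. (b, c) \<in> composable B C" using x' x(1) by auto
    then have i: "x' - x \<in> tensor_null A B" by (simp add: AB.T.cl_mem)
    then have "(x' - x) + x \<in> AB.T.cover" using AB.T.I_cover xc by (intro AB.T.cover_add) auto
    then have cov: "x' \<in> AB.T.cover" by simp
    have cl: "AB.T.cl x' = Y" using i unfolding x(1) AB.T.cl_eq_iff .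
    let ?K = "{p \<in> composable A B. (snd p, c) \<in> composable B C}"
    have "linear_ext V ?\<phi> x' = linear_ext V (\<lambda>(a, b). assoc_fun c a b) x'"
    proof (rule R.T.Q.linear_ext_cong[of _ ?K])
      show "Poly_Mapping.keys x' \<subseteq> ?K" using cov good unfolding AB.T.cover_iff by auto
      show "(\<lambda>(a, b). assoc_fun c a b) \<in> ?K \<rightarrow> carrier V"
        using balanced_mapD(1)[OF bal] by (auto simp: composable_def)
      show "?\<phi> p = (\<lambda>(a, b). assoc_fun c a b) p" if "p \<in> ?K" for p
        using that by (auto simp: assoc_fun_def)
    qed
    also have "\<dots> = assoc_left c Y"
      unfolding cl[symmetric] assoc_left_def by (rule AB.lift_cl[OF calgebra_V bal cov, symmetric])
    finally show ?thesis .
  qed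
  moreover have "x \<in> ?S"
  proof -
    have "(b, c) \<in> composable B C" if "(a, b) \<in> Poly_Mapping.keys x" for a b
      using x(2) c that by (fastforce intro: composableI)
    then show ?thesis using AB.T.cl_self[of x] unfolding x(1) by auto
  qed
  ultimately have "linear_ext V ?\<phi> ` ?S = {assoc_left c Y}" by blast
  then show ?thesis by (simp add: descend_def)
qed

lemma tensor_assoc_balanced:
  "balanced_map (h_tensor A B) C V (\<lambda>Y c. descend (linear_ext V (\<lambda>(a, b). tens A (h_tensor B C) a (tens B C b c)))
      {x \<in> Y. \<forall>(a, b)\<in>Poly_Mapping.keys x. (b, c) \<in> composable B C})"
proof (rule balanced_mapI)
  fix \<alpha> \<gamma> \<beta> Y c assume Y: "Y \<in> grade (h_tensor A B) \<alpha> \<gamma>" and c: "c \<in> grade C \<gamma> \<beta>"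
  note lin = linear_mapD[OF assoc_left_linear_map] and car = AB.T.grade_carrier[OF Y]
  let ?F = "\<lambda>Y c. descend (linear_ext V (\<lambda>(a, b). tens A (h_tensor B C) a (tens B C b c)))
      {x \<in> Y. \<forall>(a, b)\<in>Poly_Mapping.keys x. (b, c) \<in> composable B C}"
  have z0: "assoc_left c' \<zero>\<^bsub>h_tensor A B\<^esub> = \<zero>\<^bsub>V\<^esub>" if "c' \<in> grade C \<gamma> \<beta>" for c'
    by (rule linear_map_zero[OF AB.T.Q.calgebra_axioms calgebra_V assoc_left_linear_map[OF that]])
  show "?F Y c \<in> carrier V" unfolding assoc_left[OF Y c] by (rule lin(1)[OF c car])
  show "?F (k \<odot>\<^bsub>h_tensor A B\<^esub> Y) c = k \<odot>\<^bsub>V\<^esub> ?F Y c" for k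
    unfolding assoc_left[OF Y c] assoc_left[OF AB.T.grade_smult[OF Y] c] by (rule lin(3)[OF c car])
  show "?F (Y \<oplus>\<^bsub>h_tensor A B\<^esub> Y') c = ?F Y c \<oplus>\<^bsub>V\<^esub> ?F Y' c" if Y': "Y' \<in> grade (h_tensor A B) \<alpha> \<gamma>" for Y'
    unfolding assoc_left[OF Y c] assoc_left[OF Y' c] assoc_left[OF AB.T.grade_add[OF Y Y'] c]
    by (rule lin(2)[OF c car AB.T.grade_carrier[OF Y']])
  show "?F Y (k \<odot>\<^bsub>C\<^esub> c) = k \<odot>\<^bsub>V\<^esub> ?F Y c" for k
    unfolding assoc_left[OF Y c] assoc_left[OF Y BC.B.grade_smult[OF c]]
    using Y
  proof (induction Y rule: AB.tensor_grade_induct)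
    case zero
    show ?case using z0[OF c] z0[OF BC.B.grade_smult[OF c]] by (simp add: R.T.Q.smult_0_right)
  next
    case (tens a b \<gamma>')
    show ?case
      unfolding assoc_left_tens[OF tens c] assoc_left_tens[OF tens BC.B.grade_smult[OF c]] BC.tens_smult_right[OF tens(2) c]
      by (rule R.tens_smult_right[OF tens(1) BC.tens_grade[OF tens(2) c]])
  next
    case (add y z)
    then show ?case using lin(1)[OF c] by (simp add: lin(2)[OF c] lin(2)[OF BC.B.grade_smult[OF c]] R.T.Q.smult_add_right)
  qed
  show "?F (mu_r (h_tensor A B) f \<otimes>\<^bsub>h_tensor A B\<^esub> Y) c = ?F Y (mu_l C f \<otimes>\<^bsub>C\<^esub> c)" for f
  proof -
    have c': "mu_l C f \<otimes>\<^bsub>C\<^esub> c \<in> grade C \<gamma> \<beta>" using BC.B.mult_grade[OF BC.B.mu_grade(1) c] by simp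
    have Y': "mu_r (h_tensor A B) f \<otimes>\<^bsub>h_tensor A B\<^esub> Y \<in> grade (h_tensor A B) \<alpha> \<gamma>"
      using AB.T.mult_grade[OF AB.T.mu_grade(2) Y] by simp
    have mc: "mu_r (h_tensor A B) f \<in> carrier (h_tensor A B)" by (rule AB.T.grade_carrier[OF AB.T.mu_grade(2)])
    show ?thesis unfolding assoc_left[OF Y c'] assoc_left[OF Y' c]
      using Y
    proof (induction Y rule: AB.tensor_grade_induct)
      case zero
      show ?case using z0[OF c] z0[OF c'] mc by (simp add: AB.T.Q.r_null)
    next
      case (tens a b \<gamma>')
      have b': "mu_r B f \<otimes>\<^bsub>B\<^esub> b \<in> grade B \<gamma>' \<gamma>" using AB.B.mult_grade[OF AB.B.mu_grade(2) tens(2)] by simp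
      have "mu_r (h_tensor A B) f \<otimes>\<^bsub>h_tensor A B\<^esub> tens A B a b = tens A B (\<one>\<^bsub>A\<^esub> \<otimes>\<^bsub>A\<^esub> a) (mu_r B f \<otimes>\<^bsub>B\<^esub> b)"
        unfolding AB.mu_h_tensor by (rule AB.tens_mult[OF AB.A.one_grade AB.B.mu_grade(2) tens])
      also have "\<one>\<^bsub>A\<^esub> \<otimes>\<^bsub>A\<^esub> a = a" using AB.A.grade_carrier[OF tens(1)] by simp
      finally show ?case
        using assoc_left_tens[OF tens(1) b' c] assoc_left_tens[OF tens c'] BC.tens_balanced[OF tens(2) c, of f] by simp
    next
      case (add y z)
      then show ?case using mc
        by (simp add: AB.T.Q.r_distr lin(2)[OF c] lin(2)[OF c'])
    qed
  qed
  show "?F Y (c \<oplus>\<^bsub>C\<^esub> c') = ?F Y c \<oplus>\<^bsub>V\<^esub> ?F Y c'" if c': "c' \<in> grade C \<gamma> \<beta>" for c'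
    unfolding assoc_left[OF Y c] assoc_left[OF Y c'] assoc_left[OF Y BC.B.grade_add[OF c c']]
    using Y
  proof (induction Y rule: AB.tensor_grade_induct)
    case zero
    show ?case using z0[OF c] z0[OF c'] z0[OF BC.B.grade_add[OF c c']] R.T.Q.l_zero R.T.Q.zero_closed by simp
  next
    case (tens a b \<gamma>')
    show ?case
      unfolding assoc_left_tens[OF tens c] assoc_left_tens[OF tens c'] assoc_left_tens[OF tens BC.B.grade_add[OF c c']]
        BC.tens_add_right[OF tens(2) c c']
      by (rule R.tens_add_right[OF tens(1) BC.tens_grade[OF tens(2) c] BC.tens_grade[OF tens(2) c']])
  next
    case (add y z)
    then show ?case using lin(1)[OF c] lin(1)[OF c']
      by (simp add: lin(2)[OF c] lin(2)[OF c'] lin(2)[OF BC.B.grade_add[OF c c']] R.T.Q.a_assoc R.T.Q.a_lcomm R.T.Q.a_closed)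
  qed
qed

lemma tensor_assoc_tens':
  "Y \<in> grade (h_tensor A B) \<alpha> \<gamma> \<Longrightarrow> c \<in> grade C \<gamma> \<delta> \<Longrightarrow> tensor_assoc A B C (tens (h_tensor A B) C Y c) = assoc_left c Y"
  unfolding tensor_assoc_def
  by (subst L.lift_tens[OF calgebra_V tensor_assoc_balanced]) (auto simp: assoc_left)

lemma tensor_assoc_tens:
  "a \<in> grade A \<alpha> \<gamma> \<Longrightarrow> b \<in> grade B \<gamma> \<beta> \<Longrightarrow> c \<in> grade C \<beta> \<delta> \<Longrightarrow>
    tensor_assoc A B C (tens (h_tensor A B) C (tens A B a b) c) = tens A (h_tensor B C) a (tens B C b c)"
  using tensor_assoc_tens'[OF AB.tens_grade] assoc_left_tens by metis

lemma tensor_assoc_linear_map: "linear_map (h_tensor (h_tensor A B) C) V (tensor_assoc A B C)"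
  unfolding tensor_assoc_def by (rule L.lift_linear_map[OF calgebra_V tensor_assoc_balanced])

lemma assoc_left_mult:
  assumes Y: "Y \<in> grade (h_tensor A B) \<alpha> \<gamma>" "c \<in> grade C \<gamma> \<delta>" "Y' \<in> grade (h_tensor A B) \<alpha>' \<gamma>'" "c' \<in> grade C \<gamma>' \<delta>'"
  shows "assoc_left (c \<otimes>\<^bsub>C\<^esub> c') (Y \<otimes>\<^bsub>h_tensor A B\<^esub> Y') = assoc_left c Y \<otimes>\<^bsub>V\<^esub> assoc_left c' Y'"
proof -
  have cc: "c \<otimes>\<^bsub>C\<^esub> c' \<in> grade C (\<gamma> + \<gamma>') (\<delta> + \<delta>')" by (rule BC.B.mult_grade[OF Y(2,4)])
  note z0 = linear_map_zero[OF AB.T.Q.calgebra_axioms calgebra_V assoc_left_linear_map]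
  note lin = linear_mapD[OF assoc_left_linear_map]
  note car = lin(1)[OF Y(2)] lin(1)[OF Y(4)]
  have 1: "assoc_left (c \<otimes>\<^bsub>C\<^esub> c') (tens A B a b \<otimes>\<^bsub>h_tensor A B\<^esub> Y') = assoc_left c (tens A B a b) \<otimes>\<^bsub>V\<^esub> assoc_left c' Y'"
    if ab: "a \<in> grade A \<alpha> \<epsilon>" "b \<in> grade B \<epsilon> \<gamma>" for a b \<epsilon>
    using Y(3)
  proof (induction Y' rule: AB.tensor_grade_induct)
    case zero
    show ?case using car AB.tens_closed[OF ab] by (simp add: z0[OF Y(4)] z0[OF cc] AB.T.Q.r_null R.T.Q.r_null)
  next
    case (tens a' b' \<epsilon>')
    show ?case
      unfolding AB.tens_mult[OF ab tens] assoc_left_tens[OF ab Y(2)] assoc_left_tens[OF tens Y(4)]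
        assoc_left_tens[OF AB.A.mult_grade[OF ab(1) tens(1)] AB.B.mult_grade[OF ab(2) tens(2)] cc]
        R.tens_mult[OF ab(1) BC.tens_grade[OF ab(2) Y(2)] tens(1) BC.tens_grade[OF tens(2) Y(4)]]
        BC.tens_mult[OF ab(2) Y(2) tens(2) Y(4)] ..
  next
    case (add y z)
    then show ?case using car AB.tens_closed[OF ab]
      by (simp add: lin(2)[OF cc] lin(2)[OF Y(4)] AB.T.Q.r_distr R.T.Q.r_distr)
  qed
  show ?thesis using Y(1)
  proof (induction Y rule: AB.tensor_grade_induct)
    case zero
    show ?case using car AB.T.grade_carrier[OF Y(3)] by (simp add: z0[OF Y(2)] z0[OF cc] AB.T.Q.l_null R.T.Q.l_null)
  next
    case (tens a b \<epsilon>)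
    then show ?case by (rule 1)
  next
    case (add y z)
    then show ?case using car AB.T.grade_carrier[OF Y(3)]
      by (simp add: lin(2)[OF cc] lin(2)[OF Y(2)] AB.T.Q.l_distr R.T.Q.l_distr)
  qed
qed

lemma tensor_assoc_ring_hom: "tensor_assoc A B C \<in> ring_hom (h_tensor (h_tensor A B) C) V"
proof (rule L.ring_hom_tensI[OF calgebra_V tensor_assoc_linear_map])
  show "tensor_assoc A B C \<one>\<^bsub>h_tensor (h_tensor A B) C\<^esub> = \<one>\<^bsub>V\<^esub>"
    unfolding L.tens_one[symmetric] AB.tens_one[symmetric]
      tensor_assoc_tens[OF AB.A.one_grade AB.B.one_grade BC.B.one_grade] R.tens_one[symmetric] BC.tens_one ..
  fix Y c Y' c' \<alpha> \<gamma> \<beta> \<alpha>' \<gamma>' \<beta>'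
  assume h: "Y \<in> grade (h_tensor A B) \<alpha> \<gamma>" "c \<in> grade C \<gamma> \<beta>" "Y' \<in> grade (h_tensor A B) \<alpha>' \<gamma>'" "c' \<in> grade C \<gamma>' \<beta>'"
  show "tensor_assoc A B C (tens (h_tensor A B) C (Y \<otimes>\<^bsub>h_tensor A B\<^esub> Y') (c \<otimes>\<^bsub>C\<^esub> c')) =
      tensor_assoc A B C (tens (h_tensor A B) C Y c) \<otimes>\<^bsub>V\<^esub> tensor_assoc A B C (tens (h_tensor A B) C Y' c')"
    unfolding tensor_assoc_tens'[OF h(1,2)] tensor_assoc_tens'[OF h(3,4)]
      tensor_assoc_tens'[OF AB.T.mult_grade[OF h(1,3)] BC.B.mult_grade[OF h(2,4)]]
    by (rule assoc_left_mult[OF h])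
qed

end

section \<open>Verification on the generators of the general linear group\<close>

lemma GL_hom_eqI:
  assumes "calgebra V" and F: "F \<in> ring_hom (GL_h_alg l) V" "linear_map (GL_h_alg l) V F"
    and G: "G \<in> ring_hom (GL_h_alg l) V" "linear_map (GL_h_alg l) V G"
    and gen: "\<And>g. F (GL_class l (word [g])) = G (GL_class l (word [g]))"
    and a: "a \<in> carrier (GL_h_alg l)"
  shows "F a = G a"
proof -
  have word: "F (GL_class l (word w)) = G (GL_class l (word w))" for w
  proof (induction w)
    case Nil
    show ?case using ring_hom_one[OF F(1)] ring_hom_one[OF G(1)] by (simp add: GL_ops)
  next
    case (Cons g w)
    then show ?case unfolding GL_word_Cons[of l g w]
      using gen[of g] by (simp add: ring_hom_mult[OF F(1)] ring_hom_mult[OF G(1)])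
  qed
  show ?thesis using a
  proof (induction a rule: GL_induct)
    case zero
    show ?case using linear_map_zero[OF GL.Q.calgebra_axioms assms(1)] F(2) G(2) by metis
  next
    case (word w c)
    show ?case using \<open>F (GL_class l (word w)) = G (GL_class l (word w))\<close>
      by (simp add: linear_mapD(3)[OF F(2)] linear_mapD(3)[OF G(2)])
  next
    case (add y z)
    then show ?case by (simp add: linear_mapD(2)[OF F(2)] linear_mapD(2)[OF G(2)])
  qed
qed

lemma GL_triple: "h_alg_triple (GL_h_alg l) (GL_h_alg l) (GL_h_alg l)"
  by (intro h_alg_triple.intro h_alg_triple_axioms.intro GG.h_alg_pair_axioms bigraded_disjoint pre_h_alg_GL bigraded_GL)

lemma GL_pairs: "h_alg_pair (GL_tensor l) (GL_h_alg l)" "h_alg_pair (GL_h_alg l) (GL_tensor l)"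
    "h_alg_pair (GL_h_alg l) diff_ops" "h_alg_pair diff_ops (GL_h_alg l)"
  by (simp_all add: h_alg_pair_def GG.pre_h_alg_h_tensor pre_h_alg_GL pre_h_alg_diff_ops)

lemma GL_t_grade: "GL_t l i j \<in> grade (GL_h_alg l) (unit_weight i) (unit_weight j)"
  unfolding GL_t_def by (rule GL_grade_word) simp_all

context
  fixes l :: complex
  assumes l: "generic_log l"
begin

lemma GL_coassociative:
  assumes "a \<in> carrier (GL_h_alg l)"
  shows "tensor_assoc (GL_h_alg l) (GL_h_alg l) (GL_h_alg l) (tensor_map (GL_tensor l) (GL_h_alg l) (GL_comult l) id (GL_comult l a)) =
    tensor_map (GL_h_alg l) (GL_tensor l) id (GL_comult l) (GL_comult l (a :: 'n::{finite,linorder} GL_elt))"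
proof -
  let ?A = "GL_h_alg l :: ('n, 'n GL_elt) h_alg"
  let ?T = "GL_tensor l :: ('n, (('n GL_elt \<times> 'n GL_elt) \<Rightarrow>\<^sub>0 complex) set) h_alg"
  let ?\<Delta> = "GL_comult l :: 'n GL_elt \<Rightarrow> _"
  let ?m1 = "tensor_map ?T ?A ?\<Delta> id" and ?m2 = "tensor_map ?A ?T id ?\<Delta>" and ?as = "tensor_assoc ?A ?A ?A"
  interpret TA: h_alg_pair ?T ?A by (rule GL_pairs)
  interpret AT: h_alg_pair ?A ?T by (rule GL_pairs)
  note homs = GL_comult_hom[OF l, where 'a = 'n] h_hom_id
  note m1 = tensor_map[OF GG.h_alg_pair_axioms GL_pairs(1) homs] and m2 = tensor_map[OF GG.h_alg_pair_axioms GL_pairs(2) homs(2,1)]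
  note as = h_alg_triple.tensor_assoc_tens[OF GL_triple[where 'a = 'n, of l]] h_alg_triple.tensor_assoc_linear_map[OF GL_triple[where 'a = 'n, of l]]
    h_alg_triple.tensor_assoc_ring_hom[OF GL_triple[where 'a = 'n, of l]]
  note \<Delta> = GL_comult_linear_map[OF l, where 'a = 'n] GL_comult_ring_hom[OF l, where 'a = 'n]
  note one = GL.one_grade[of l, where 'a = 'n]
  have \<Delta>1: "?\<Delta> \<one>\<^bsub>?A\<^esub> = tens ?A ?A \<one>\<^bsub>?A\<^esub> \<one>\<^bsub>?A\<^esub>" unfolding GG.tens_one by (rule ring_hom_one[OF \<Delta>(2)])
  have \<Delta>t: "?\<Delta> (GL_t l i j) = (\<Oplus>\<^bsub>?T\<^esub>k\<in>UNIV. tens ?A ?A (GL_t l i k) (GL_t l k j))" for i j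
    unfolding GL_t_def GL_comult_word[OF l] by (simp add: GL_t_def)
  note t = GL_t_grade[of l, where 'a = 'n]
  have tt: "tens ?A ?A (GL_t l i k) (GL_t l k j) \<in> grade ?T (unit_weight i) (unit_weight j)" for i k j
    by (rule GG.tens_grade[OF t t])
  have gen: "?as (?m1 (?\<Delta> (GL_class l (word [g])))) = ?m2 (?\<Delta> (GL_class l (word [g])))" for g
    unfolding GL_comult_word[OF l]
  proof (cases g)
    case (GenL f)
    note mu = GL.mu_grade(1)[of l f]
    show "?as (?m1 (GL_comult_gen l g)) = ?m2 (GL_comult_gen l g)"
      unfolding GenL GL_comult_gen.simps m1(1)[OF mu one] m2(1)[OF mu one] h_homD(4)[OF homs(1)] id_apply \<Delta>1 GG.mu_h_tensor
        as(1)[OF mu one one] ..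
  next
    case (GenR f)
    note mu = GL.mu_grade(2)[of l f]
    show "?as (?m1 (GL_comult_gen l g)) = ?m2 (GL_comult_gen l g)"
      unfolding GenR GL_comult_gen.simps m1(1)[OF one mu] m2(1)[OF one mu] h_homD(5)[OF homs(1)] id_apply \<Delta>1 GG.mu_h_tensor
        as(1)[OF one one mu] ..
  next
    case GenDetInv
    note d = GL_det_inv_grade[of l, where 'a = 'n, folded GL_det_inv_def]
    have \<Delta>d: "?\<Delta> (GL_det_inv l) = tens ?A ?A (GL_det_inv l) (GL_det_inv l)"
      unfolding GL_det_inv_def GL_comult_word[OF l] by (simp add: GL_det_inv_def)
    show "?as (?m1 (GL_comult_gen l g)) = ?m2 (GL_comult_gen l g)"
      unfolding GenDetInv GL_comult_gen.simps m1(1)[OF d d] m2(1)[OF d d] id_apply \<Delta>d as(1)[OF d d d] ..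
  next
    case (GenT i j)
    have c2: "tens ?A ?T (GL_t l i k) (tens ?A ?A (GL_t l k m) (GL_t l m j)) \<in> carrier (h_tensor ?A ?T)" for k m
      by (rule AT.tens_closed[OF t tt])
    have 1: "?as (?m1 (tens ?A ?A (GL_t l i k) (GL_t l k j))) =
        (\<Oplus>\<^bsub>h_tensor ?A ?T\<^esub>m\<in>UNIV. tens ?A ?T (GL_t l i m) (tens ?A ?A (GL_t l m k) (GL_t l k j)))" for k
    proof -
      have "?m1 (tens ?A ?A (GL_t l i k) (GL_t l k j)) = tens ?T ?A (\<Oplus>\<^bsub>?T\<^esub>m\<in>UNIV. tens ?A ?A (GL_t l i m) (GL_t l m k)) (GL_t l k j)"
        unfolding m1(1)[OF t t] id_apply \<Delta>t ..
      also have "\<dots> = (\<Oplus>\<^bsub>h_tensor ?T ?A\<^esub>m\<in>UNIV. tens ?T ?A (tens ?A ?A (GL_t l i m) (GL_t l m k)) (GL_t l k j))"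
        by (rule TA.tens_finsum_left[OF finite tt t])
      finally have "?as (?m1 (tens ?A ?A (GL_t l i k) (GL_t l k j))) =
          (\<Oplus>\<^bsub>h_tensor ?A ?T\<^esub>m\<in>UNIV. ?as (tens ?T ?A (tens ?A ?A (GL_t l i m) (GL_t l m k)) (GL_t l k j)))"
        by (simp only:) (rule linear_map_finsum[OF TA.T.Q.calgebra_axioms AT.T.Q.calgebra_axioms as(2)],
          use TA.tens_closed[OF tt t] in auto)
      then show ?thesis unfolding as(1)[OF t t t] .
    qed
    have 2: "?m2 (tens ?A ?A (GL_t l i k) (GL_t l k j)) =
        (\<Oplus>\<^bsub>h_tensor ?A ?T\<^esub>m\<in>UNIV. tens ?A ?T (GL_t l i k) (tens ?A ?A (GL_t l k m) (GL_t l m j)))" for k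
      unfolding m2(1)[OF t t] id_apply \<Delta>t by (rule AT.tens_finsum_right[OF finite t tt])
    have tc: "(\<lambda>k. tens ?A ?A (GL_t l i k) (GL_t l k j)) \<in> UNIV \<rightarrow> carrier ?T" using GG.tens_closed[OF t t] by auto
    have "?m1 (GL_comult_gen l g) = (\<Oplus>\<^bsub>h_tensor ?T ?A\<^esub>k\<in>UNIV. ?m1 (tens ?A ?A (GL_t l i k) (GL_t l k j)))"
      unfolding GenT GL_comult_gen.simps
      by (rule linear_map_finsum[OF GG.T.Q.calgebra_axioms TA.T.Q.calgebra_axioms m1(2) tc])
    then have "?as (?m1 (GL_comult_gen l g)) = (\<Oplus>\<^bsub>h_tensor ?A ?T\<^esub>k\<in>UNIV. ?as (?m1 (tens ?A ?A (GL_t l i k) (GL_t l k j))))"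
      by (simp only:) (rule linear_map_finsum[OF TA.T.Q.calgebra_axioms AT.T.Q.calgebra_axioms as(2)],
          use linear_mapD(1)[OF m1(2)] tc in auto)
    \<comment> \<open>After reassociation both sides are the same double sum over the two middle
      indices, taken in different orders.\<close>
    also have "\<dots> = (\<Oplus>\<^bsub>h_tensor ?A ?T\<^esub>k\<in>UNIV. ?m2 (tens ?A ?A (GL_t l i k) (GL_t l k j)))"
      unfolding 1 2 by (rule AT.T.Q.finsum_swap[OF finite finite c2])
    also have "\<dots> = ?m2 (GL_comult_gen l g)"
      unfolding GenT GL_comult_gen.simps
      by (rule linear_map_finsum[OF GG.T.Q.calgebra_axioms AT.T.Q.calgebra_axioms m2(2) tc, symmetric])
    finally show "?as (?m1 (GL_comult_gen l g)) = ?m2 (GL_comult_gen l g)" .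
  qed
  show ?thesis
  proof (rule GL_hom_eqI[where F = "\<lambda>a. ?as (?m1 (?\<Delta> a))" and G = "\<lambda>a. ?m2 (?\<Delta> a)", OF AT.T.Q.calgebra_axioms _ _ _ _ gen assms])
    show "(\<lambda>a. ?as (?m1 (?\<Delta> a))) \<in> ring_hom ?A (h_tensor ?A ?T)"
      using ring_hom_trans[OF ring_hom_trans[OF \<Delta>(2) m1(3)] as(3)] by (simp add: comp_def)
    show "(\<lambda>a. ?m2 (?\<Delta> a)) \<in> ring_hom ?A (h_tensor ?A ?T)"
      using ring_hom_trans[OF \<Delta>(2) m2(3)] by (simp add: comp_def)
    show "linear_map ?A (h_tensor ?A ?T) (\<lambda>a. ?as (?m1 (?\<Delta> a)))"
      by (rule linear_map_compose[OF linear_map_compose[OF \<Delta>(1) m1(2)] as(2)])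
    show "linear_map ?A (h_tensor ?A ?T) (\<lambda>a. ?m2 (?\<Delta> a))"
      by (rule linear_map_compose[OF \<Delta>(1) m2(2)])
  qed
qed

text \<open>The shift on the right-hand sides depends on the degree of a, so these are not given as
  linear maps on the whole algebra. The claim is proved for words by multiplicativity and then
  extended linearly within a fixed bidegree.\<close>

lemma GL_counital:
  assumes "(a :: 'n::{finite,linorder} GL_elt) \<in> grade (GL_h_alg l) \<alpha> \<beta>"
  shows "tensor_map (GL_h_alg l) diff_ops id (GL_counit l) (GL_comult l a) = tens (GL_h_alg l) diff_ops a (mero_shift (- \<beta>))"
    and "tensor_map diff_ops (GL_h_alg l) (GL_counit l) id (GL_comult l a) = tens diff_ops (GL_h_alg l) (mero_shift (- \<alpha>)) a"
proof -
  let ?A = "GL_h_alg l :: ('n, 'n GL_elt) h_alg"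
  let ?D = "diff_ops :: ('n, 'n mero \<Rightarrow> 'n mero) h_alg"
  let ?T = "GL_tensor l :: ('n, (('n GL_elt \<times> 'n GL_elt) \<Rightarrow>\<^sub>0 complex) set) h_alg"
  let ?\<Delta> = "GL_comult l :: 'n GL_elt \<Rightarrow> _" and ?\<epsilon> = "GL_counit l :: 'n GL_elt \<Rightarrow> _"
  let ?n1 = "tensor_map ?A ?D id ?\<epsilon>" and ?n2 = "tensor_map ?D ?A ?\<epsilon> id"
  interpret AD: h_alg_pair ?A ?D by (rule GL_pairs)
  interpret DA: h_alg_pair ?D ?A by (rule GL_pairs)
  note homs = GL_counit_hom[of l, where 'a = 'n] h_hom_id
  note n1 = tensor_map[OF GG.h_alg_pair_axioms GL_pairs(3) homs(2,1)] and n2 = tensor_map[OF GG.h_alg_pair_axioms GL_pairs(4) homs]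
  note \<Delta> = GL_comult_linear_map[OF l, where 'a = 'n] GL_comult_ring_hom[OF l, where 'a = 'n]
  note one = GL.one_grade[of l, where 'a = 'n]
  have sg: "mero_shift (- \<beta>) \<in> grade ?D \<beta> \<beta>" for \<beta> by (simp add: diff_ops_grade image_iff) (rule exI[of _ 1], simp)
  have shift0: "mero_shift 0 = (\<lambda>f :: 'n mero. f)" by (rule ext) (rule mero_shift_0)
  have oneD: "\<one>\<^bsub>?D\<^esub> = mero_shift (- 0)" by (simp add: fun_eq_iff)
  have shift: "mero_shift (- \<alpha>) \<otimes>\<^bsub>?D\<^esub> mero_shift (- \<beta>) = mero_shift (- (\<alpha> + \<beta>))" for \<alpha> \<beta> :: "(complex, 'n) vec"
    by (simp add: fun_eq_iff add.commute)
  have mu: "mu_r ?D f \<otimes>\<^bsub>?D\<^esub> mero_shift (- 0) = mu_r ?D f" "mu_l ?D f \<otimes>\<^bsub>?D\<^esub> mero_shift (- 0) = mu_l ?D f"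
    "mu_r ?D f = mu_l ?D f" for f
    by (simp_all add: fun_eq_iff)
  have muA: "mu_l ?A f \<otimes>\<^bsub>?A\<^esub> \<one>\<^bsub>?A\<^esub> = mu_l ?A f" "mu_r ?A f \<otimes>\<^bsub>?A\<^esub> \<one>\<^bsub>?A\<^esub> = mu_r ?A f" for f
    using GL.grade_carrier[OF GL.mu_grade(1)[of l f]] GL.grade_carrier[OF GL.mu_grade(2)[of l f]] by (simp_all add: GL.Q.r_one)
  have \<epsilon>1: "?\<epsilon> \<one>\<^bsub>?A\<^esub> = mero_shift (- 0)" unfolding oneD[symmetric] by (rule h_homD(6)[OF homs(1)])
  have \<epsilon>t: "?\<epsilon> (GL_t l i j) = (if i = j then mero_shift (- unit_weight i) else \<zero>\<^bsub>?D\<^esub>)" for i j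
    unfolding GL_t_def GL_counit_class fun_eq_iff by (simp add: free_counit_word_Cons free_counit_Nil)
  have \<epsilon>d: "?\<epsilon> (GL_det_inv l) = mero_shift (- (- 1))"
    unfolding GL_det_inv_def GL_counit_class fun_eq_iff by (simp add: free_counit_word_Cons free_counit_Nil)
  note t = GL_t_grade[of l, where 'a = 'n]
  have tc: "(\<lambda>k. tens ?A ?A (GL_t l i k) (GL_t l k j)) \<in> UNIV \<rightarrow> carrier ?T" for i j using GG.tens_closed[OF t t] by auto
  have d: "GL_det_inv l \<in> grade ?A (- 1) (- 1)" unfolding GL_det_inv_def by (rule GL_det_inv_grade)
  have gen: "?n1 (GL_comult_gen l g) = tens ?A ?D (GL_class l (word [g])) (mero_shift (- gen_deg_r g)) \<and>
      ?n2 (GL_comult_gen l g) = tens ?D ?A (mero_shift (- gen_deg_l g)) (GL_class l (word [g]))" for g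
  proof (cases g)
    case (GenL f)
    note m = GL.mu_grade(1)[of l f]
    show ?thesis
      unfolding GenL GL_comult_gen.simps n1(1)[OF m one] n2(1)[OF m one] h_homD(4)[OF homs(1)] id_apply \<epsilon>1 gen_deg_l.simps gen_deg_r.simps
        GL_mu[symmetric]
      using DA.tens_balanced[OF sg[of 0] one, of f] unfolding mu muA by simp
  next
    case (GenR f)
    note m = GL.mu_grade(2)[of l f]
    show ?thesis
      unfolding GenR GL_comult_gen.simps n1(1)[OF one m] n2(1)[OF one m] h_homD(5)[OF homs(1)] id_apply \<epsilon>1 gen_deg_l.simps gen_deg_r.simps
        GL_mu[symmetric]
      using AD.tens_balanced[OF one sg[of 0], of f] unfolding mu muA by simp
  next
    case GenDetInv
    show ?thesis
      unfolding GenDetInv GL_comult_gen.simps n1(1)[OF d d] n2(1)[OF d d] id_apply \<epsilon>d by (simp add: GL_det_inv_def)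
  next
    case (GenT i j)
    have s1: "tens ?A ?D (GL_t l i k) (?\<epsilon> (GL_t l k j)) = (if j = k then tens ?A ?D (GL_t l i k) (mero_shift (- unit_weight k)) else \<zero>\<^bsub>h_tensor ?A ?D\<^esub>)" for k
      unfolding \<epsilon>t using AD.tens_zero_right[OF t[of i k]] by auto
    have s2: "tens ?D ?A (?\<epsilon> (GL_t l i k)) (GL_t l k j) = (if i = k then tens ?D ?A (mero_shift (- unit_weight k)) (GL_t l k j) else \<zero>\<^bsub>h_tensor ?D ?A\<^esub>)" for k
      unfolding \<epsilon>t using DA.tens_zero_left[OF t[of k j]] by auto
    have "?n1 (GL_comult_gen l g) = (\<Oplus>\<^bsub>h_tensor ?A ?D\<^esub>k\<in>UNIV. ?n1 (tens ?A ?A (GL_t l i k) (GL_t l k j)))"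
      unfolding GenT GL_comult_gen.simps
      by (rule linear_map_finsum[OF GG.T.Q.calgebra_axioms AD.T.Q.calgebra_axioms n1(2) tc])
    also have "\<dots> = tens ?A ?D (GL_t l i j) (mero_shift (- unit_weight j))"
      unfolding n1(1)[OF t t] id_apply s1
      by (rule AD.T.Q.add.finprod_singleton) (use AD.tens_closed[OF t sg] in auto)
    finally have 1: "?n1 (GL_comult_gen l g) = tens ?A ?D (GL_t l i j) (mero_shift (- unit_weight j))" .
    have "?n2 (GL_comult_gen l g) = (\<Oplus>\<^bsub>h_tensor ?D ?A\<^esub>k\<in>UNIV. ?n2 (tens ?A ?A (GL_t l i k) (GL_t l k j)))"
      unfolding GenT GL_comult_gen.simps
      by (rule linear_map_finsum[OF GG.T.Q.calgebra_axioms DA.T.Q.calgebra_axioms n2(2) tc])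
    also have "\<dots> = tens ?D ?A (mero_shift (- unit_weight i)) (GL_t l i j)"
      unfolding n2(1)[OF t t] id_apply s2
      by (rule DA.T.Q.add.finprod_singleton) (use DA.tens_closed[OF sg t] in auto)
    finally show ?thesis using 1 by (simp add: GenT GL_t_def)
  qed
  have wd: "?n1 (?\<Delta> (GL_class l (word w))) = tens ?A ?D (GL_class l (word w)) (mero_shift (- deg_r w)) \<and>
      ?n2 (?\<Delta> (GL_class l (word w))) = tens ?D ?A (mero_shift (- deg_l w)) (GL_class l (word w))" for w
  proof (induction w)
    case Nil
    show ?case unfolding GL_comult_Nil[OF l] ring_hom_one[OF n1(3)] ring_hom_one[OF n2(3)] AD.tens_one[symmetric] DA.tens_one[symmetric] oneD
      by (simp add: GL_ops shift0)
  next
    case (Cons g w)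
    have g: "GL_class l (word [g]) \<in> grade ?A (gen_deg_l g) (gen_deg_r g)" by (rule GL_grade_word) simp_all
    have w: "GL_class l (word w) \<in> grade ?A (deg_l w) (deg_r w)" by (rule GL_grade_word) simp_all
    have c: "GL_comult_gen l g \<in> carrier ?T" "?\<Delta> (GL_class l (word w)) \<in> carrier ?T"
      using linear_mapD(1)[OF \<Delta>(1)] by simp_all
    show ?case
      unfolding GL_comult_Cons[OF l] ring_hom_mult[OF n1(3) c] ring_hom_mult[OF n2(3) c] Cons[THEN conjunct1] Cons[THEN conjunct2]
        gen[THEN conjunct1] gen[THEN conjunct2] AD.tens_mult[OF g sg w sg] DA.tens_mult[OF sg g sg w] shift GL_word_Cons[of l g w, symmetric]
      by simp
  qed
  \<comment> \<open>Membership in the component is carried along, because additivity of the tensor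
    applies to summands of equal degree.\<close>
  have "a \<in> grade ?A \<alpha> \<beta> \<and> ?n1 (?\<Delta> a) = tens ?A ?D a (mero_shift (- \<beta>)) \<and> ?n2 (?\<Delta> a) = tens ?D ?A (mero_shift (- \<alpha>)) a"
    using assms
  proof (induction a rule: GL_grade_induct)
    case zero
    show ?case
      unfolding linear_map_zero[OF GL.Q.calgebra_axioms GG.T.Q.calgebra_axioms \<Delta>(1)]
        linear_map_zero[OF GG.T.Q.calgebra_axioms AD.T.Q.calgebra_axioms n1(2)]
        linear_map_zero[OF GG.T.Q.calgebra_axioms DA.T.Q.calgebra_axioms n2(2)]
        AD.tens_zero_left[OF sg] DA.tens_zero_right[OF sg] by (intro conjI refl GL.grade_zero)
  next
    case (word w c)
    have w: "GL_class l (word w) \<in> grade ?A \<alpha> \<beta>" by (rule GL_grade_word) (use word in simp_all)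
    have c: "?\<Delta> (GL_class l (word w)) \<in> carrier ?T" using linear_mapD(1)[OF \<Delta>(1)] by simp
    note W = wd[of w, unfolded word]
    show ?case
      unfolding linear_mapD(3)[OF \<Delta>(1) GL_class_closed] linear_mapD(3)[OF n1(2) c] linear_mapD(3)[OF n2(2) c]
        W[THEN conjunct1] W[THEN conjunct2] AD.tens_smult_left[OF w sg] DA.tens_smult_right[OF sg w]
      by (intro conjI refl GL.grade_smult w)
  next
    case (add y z)
    have c: "?\<Delta> y \<in> carrier ?T" "?\<Delta> z \<in> carrier ?T" using linear_mapD(1)[OF \<Delta>(1)] add(1,2) by simp_all
    note g = add(3)[THEN conjunct1] add(4)[THEN conjunct1]
    show ?case
      unfolding linear_mapD(2)[OF \<Delta>(1) add(1,2)] linear_mapD(2)[OF n1(2) c] linear_mapD(2)[OF n2(2) c]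
        AD.tens_add_left[OF g sg] DA.tens_add_right[OF sg g] add(3,4)[THEN conjunct2, THEN conjunct1] add(3,4)[THEN conjunct2, THEN conjunct2]
      by (intro conjI refl GL.grade_add g)
  qed
  then show "?n1 (?\<Delta> a) = tens ?A ?D a (mero_shift (- \<beta>))" "?n2 (?\<Delta> a) = tens ?D ?A (mero_shift (- \<alpha>)) a" by blast+
qed

end

section \<open>Antipode\<close>

definition GL_antipode :: "complex \<Rightarrow> 'n::{finite,linorder} GL_elt \<Rightarrow> 'n GL_elt"
  where "GL_antipode l = descend (algebra_ext (opposite (GL_h_alg l)) (antipode_gen l))"

lemma sum_list_unit_weight_Compl:
  assumes "as \<in> arrangements (- {j} :: 'n::finite set)"
  shows "sum_list (map unit_weight as) = 1 - (unit_weight j :: (complex, 'n) vec)"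
proof -
  have "sum_list (map unit_weight as) = sum unit_weight (- {j})"
    using assms by (simp add: arrangements_def sum_list_distinct_conv_sum_set)
  also have "\<dots> = sum unit_weight UNIV - (unit_weight j :: (complex, 'n) vec)"
    by (simp add: Compl_eq_Diff_UNIV sum_diff1)
  finally show ?thesis by (simp add: sum_unit_weight)
qed

text \<open>The inverse determinant contributes minus the all-ones vector on both sides, and the
  minor misses j among its rows and i among its columns. So S exchanges the two degrees of a
  generator and negates them.\<close>

lemma free_tinv_grade:
  fixes i j :: "'n::{finite,linorder}"
  shows "GL_class l (free_tinv l i j) \<in> grade (GL_h_alg l) (- unit_weight j) (- unit_weight i)"
proof -
  let ?A = "GL_h_alg l :: ('n, 'n GL_elt) h_alg"
  let ?J = "sorted_list_of_set (- {i})"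
  have card: "card (- {i}) = card (- {j})" by (simp add: Compl_eq_Diff_UNIV card_Diff_singleton)
  have J: "?J \<in> arrangements (- {i})" by (rule sorted_list_arrangement)
  have "GL_class l (free_minor l (- {j}) (- {i})) \<in> grade ?A (1 - unit_weight j) (1 - unit_weight i)"
    unfolding free_minor_arrangements[OF card] GL_class_sum
  proof (rule grade_finsum[OF pre_h_alg_GL])
    fix as assume as: "as \<in> arrangements (- {j})"
    show "GL_class l (word (GenL (word_sign l as) # map2 GenT as ?J)) \<in> grade ?A (1 - unit_weight j) (1 - unit_weight i)"
      by (rule GL_grade_word)
         (use length_arrangement[OF as] length_arrangement[OF J] card sum_list_unit_weight_Compl[OF as] sum_list_unit_weight_Compl[OF J]
          in \<open>simp_all add: deg_T_word del: map_map\<close>)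
  qed
  moreover have "GL_class l (word [GenDetInv, GenL f, GenR g]) \<in> grade ?A (- 1) (- 1)" for f g
    by (rule GL_grade_word) simp_all
  ultimately show ?thesis unfolding free_tinv_def GL_ops(1)[symmetric]
    using GL.mult_grade[of "GL_class l (word [GenDetInv, GenL _, GenR _])" l "- 1" "- 1"] by fastforce
qed

context
  fixes l :: complex and A :: "('n::{finite,linorder}, 'n GL_elt) h_alg"
  assumes l: "generic_log l" and A: "A = GL_h_alg l"
begin

abbreviation "S \<equiv> GL_antipode l :: 'n GL_elt \<Rightarrow> 'n GL_elt"
abbreviation "\<Delta> \<equiv> GL_comult l :: 'n GL_elt \<Rightarrow> _"
abbreviation "\<epsilon> \<equiv> GL_counit l :: 'n GL_elt \<Rightarrow> _"
abbreviation "T \<equiv> h_tensor A A"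

lemma pre_A: "pre_h_alg A" unfolding A by (rule pre_h_alg_GL)

lemma GL_antipode_hom: "S \<in> ring_hom A (opposite A)" "linear_map A (opposite A) S"
    "S (GL_class l x) = algebra_ext (opposite A) (antipode_gen l) x"
proof -
  interpret O: calgebra "opposite (GL_h_alg l) :: ('n, 'n GL_elt) h_alg" by (rule GL.Q.calgebra_opposite)
  have car: "antipode_gen l g \<in> carrier (opposite (GL_h_alg l) :: ('n, 'n GL_elt) h_alg)" for g by simp
  have rel: "GL_relation l u v \<Longrightarrow> algebra_ext (opposite (GL_h_alg l) :: ('n, 'n GL_elt) h_alg) (antipode_gen l) u =
      algebra_ext (opposite (GL_h_alg l)) (antipode_gen l) v" for u v
    using gl_identities[OF l, where 'n = 'n] unfolding gl_identities_def by blast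
  show "S \<in> ring_hom A (opposite A)" "linear_map A (opposite A) S" "S (GL_class l x) = algebra_ext (opposite A) (antipode_gen l) x"
    unfolding A GL_antipode_def
    by (rule O.GL_lift(2)[OF car rel] O.GL_lift(3)[OF car rel] O.GL_lift(1)[OF car rel]; assumption)+
qed

interpretation pre_h_alg A by (rule pre_A)
interpretation AA: h_alg_pair A A by (simp add: h_alg_pair_def pre_A)

lemma antipode:
  "a \<in> carrier A \<Longrightarrow> S a \<in> carrier A"
  "a \<in> carrier A \<Longrightarrow> b \<in> carrier A \<Longrightarrow> S (a \<oplus>\<^bsub>A\<^esub> b) = S a \<oplus>\<^bsub>A\<^esub> S b"
  "a \<in> carrier A \<Longrightarrow> b \<in> carrier A \<Longrightarrow> S (a \<otimes>\<^bsub>A\<^esub> b) = S b \<otimes>\<^bsub>A\<^esub> S a"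
  "a \<in> carrier A \<Longrightarrow> S (c \<odot>\<^bsub>A\<^esub> a) = c \<odot>\<^bsub>A\<^esub> S a"
  "S \<one>\<^bsub>A\<^esub> = \<one>\<^bsub>A\<^esub>"
  using linear_mapD[OF GL_antipode_hom(2)] ring_hom_mult[OF GL_antipode_hom(1)] ring_hom_one[OF GL_antipode_hom(1)]
  by simp_all

lemma antipode_zero: "S \<zero>\<^bsub>A\<^esub> = \<zero>\<^bsub>A\<^esub>"
  using linear_map_zero[OF calgebra_axioms calgebra_opposite GL_antipode_hom(2)] by simp

lemma antipode_gen: "S (GL_class l (word [g])) = antipode_gen l g"
proof -
  interpret O: calgebra "opposite A" by (rule calgebra_opposite)
  have car: "antipode_gen l g \<in> carrier (opposite A)" for g unfolding A by simp
  then show ?thesis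
    unfolding GL_antipode_hom(3) by (subst O.algebra_ext_single[OF car]) (use car in simp)
qed

lemma antipode_gens:
  "S (mu_l A f) = mu_r A f" "S (mu_r A f) = mu_l A f" "S (GL_t l i j) = GL_class l (free_tinv l i j)"
  "S (GL_det_inv l) = GL_class l (free_minor l UNIV UNIV)"
  by (simp_all add: A GL_mu GL_t_def GL_det_inv_def antipode_gen)

lemma antipode_gen_grade: "S (GL_class l (word [g])) \<in> grade A (- gen_deg_r g) (- gen_deg_l g)"
  unfolding antipode_gen A
  by (cases g) (auto simp: free_tinv_grade GL_det_grade intro: GL_grade_word)

lemma antipode_word_grade: "S (GL_class l (word w)) \<in> grade A (- deg_r w) (- deg_l w)"
proof (induction w)
  case Nil
  show ?case using antipode(5) one_grade by (simp add: A GL_ops)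
next
  case (Cons g w)
  have car: "GL_class l x \<in> carrier A" for x unfolding A by simp
  have "GL_class l (word (g # w)) = GL_class l (word [g]) \<otimes>\<^bsub>A\<^esub> GL_class l (word w)" unfolding A by (rule GL_word_Cons)
  then have "S (GL_class l (word (g # w))) = S (GL_class l (word w)) \<otimes>\<^bsub>A\<^esub> S (GL_class l (word [g]))"
    by (simp only: antipode(3)[OF car car])
  moreover have "- (x + y) = - y + - x" for x y :: "(complex, 'n) vec" by (metis minus_add_distrib add.commute)
  ultimately show ?case using mult_grade[OF Cons antipode_gen_grade[of g]]
    by (simp only: list.map sum_list.Cons)
qed

lemma antipode_grade: "a \<in> grade A \<alpha> \<beta> \<Longrightarrow> S a \<in> grade A (- \<beta>) (- \<alpha>)"
proof -
  assume "a \<in> grade A \<alpha> \<beta>"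
  then have "a \<in> grade (GL_h_alg l) \<alpha> \<beta>" unfolding A .
  then show ?thesis
  proof (induction a rule: GL_grade_induct)
    case zero
    show ?case using antipode_zero grade_zero by (simp add: A)
  next
    case (word w c)
    have car: "GL_class l x \<in> carrier A" for x unfolding A by simp
    show ?case using antipode(4)[OF car, of c "word w"] grade_smult[OF antipode_word_grade[of w]] word by (simp add: A)
  next
    case (add y z)
    then show ?case using antipode(2)[of y z] grade_add by (simp add: A)
  qed
qed

section \<open>The two convolutions of S with the identity\<close>

definition "conv1 = descend (linear_ext A (\<lambda>(b, c). b \<otimes>\<^bsub>A\<^esub> S c))"
definition "conv2 = descend (linear_ext A (\<lambda>(b, c). S b \<otimes>\<^bsub>A\<^esub> c))"

lemmas gc = grade_carrier

text \<open>The product of b and S(c) has right degree \<gamma> - \<gamma> = 0 and hence commutes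
  with \<open>mu_r A f\<close>. In this way f gets from the left of b to the right of S(c), where S
  puts it when f is attached to c.\<close>

lemma balanced1: "balanced_map A A A (\<lambda>b c. b \<otimes>\<^bsub>A\<^esub> S c)"
proof (rule balanced_mapI)
  fix \<alpha> \<gamma> \<beta> b c f assume b: "b \<in> grade A \<alpha> \<gamma>" and c: "c \<in> grade A \<gamma> \<beta>"
  note car = gc[OF b] gc[OF c] gc[OF mu_grade(1)[of f]] gc[OF mu_grade(2)[of f]] antipode(1)
  have "b \<otimes>\<^bsub>A\<^esub> S c \<in> grade A (\<alpha> + - \<beta>) (\<gamma> + - \<gamma>)" by (rule mult_grade[OF b antipode_grade[OF c]])
  from mu_r_commute[OF this, of f] show "mu_r A f \<otimes>\<^bsub>A\<^esub> b \<otimes>\<^bsub>A\<^esub> S c = b \<otimes>\<^bsub>A\<^esub> S (mu_l A f \<otimes>\<^bsub>A\<^esub> c)"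
    using car by (simp add: antipode antipode_gens m_assoc)
qed (auto dest!: gc simp: antipode smult_mult_left smult_mult_right l_distr r_distr)

lemma balanced2: "balanced_map A A A (\<lambda>b c. S b \<otimes>\<^bsub>A\<^esub> c)"
proof (rule balanced_mapI)
  fix \<alpha> \<gamma> \<beta> b c f assume b: "b \<in> grade A \<alpha> \<gamma>" and c: "c \<in> grade A \<gamma> \<beta>"
  note car = gc[OF b] gc[OF c] gc[OF mu_grade(1)[of f]] gc[OF mu_grade(2)[of f]] antipode(1)
  show "S (mu_r A f \<otimes>\<^bsub>A\<^esub> b) \<otimes>\<^bsub>A\<^esub> c = S b \<otimes>\<^bsub>A\<^esub> (mu_l A f \<otimes>\<^bsub>A\<^esub> c)"
    using car by (simp add: antipode antipode_gens m_assoc)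
qed (auto dest!: gc simp: antipode smult_mult_left smult_mult_right l_distr r_distr)

lemma conv_tens:
  assumes "b \<in> grade A \<alpha> \<gamma>" "c \<in> grade A \<gamma> \<beta>"
  shows "conv1 (tens A A b c) = b \<otimes>\<^bsub>A\<^esub> S c" "conv2 (tens A A b c) = S b \<otimes>\<^bsub>A\<^esub> c"
  unfolding conv1_def conv2_def
  by (rule AA.lift_tens[OF calgebra_axioms balanced1 assms] AA.lift_tens[OF calgebra_axioms balanced2 assms])+

lemma conv_linear: "linear_map T A conv1" "linear_map T A conv2"
  unfolding conv1_def conv2_def
  by (rule AA.lift_linear_map[OF calgebra_axioms balanced1] AA.lift_linear_map[OF calgebra_axioms balanced2])+

lemmas conv = linear_mapD[OF conv_linear(1)] linear_mapD[OF conv_linear(2)]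

lemma conv_zero: "conv1 \<zero>\<^bsub>T\<^esub> = \<zero>\<^bsub>A\<^esub>" "conv2 \<zero>\<^bsub>T\<^esub> = \<zero>\<^bsub>A\<^esub>"
  by (rule linear_map_zero[OF AA.T.Q.calgebra_axioms calgebra_axioms conv_linear(1)]
      linear_map_zero[OF AA.T.Q.calgebra_axioms calgebra_axioms conv_linear(2)])+

text \<open>A convolution is not a homomorphism. But since S reverses products, a new factor on the
  left is wrapped around the value already obtained, which suits an induction on words. For
  \<open>conv2\<close> the same happens with factors on the right.\<close>

lemma conv1_mult:
  assumes b: "b \<in> grade A \<alpha> \<gamma>" and c: "c \<in> grade A \<gamma> \<beta>" and y: "y \<in> carrier T"
  shows "conv1 (tens A A b c \<otimes>\<^bsub>T\<^esub> y) = b \<otimes>\<^bsub>A\<^esub> conv1 y \<otimes>\<^bsub>A\<^esub> S c"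
  using y
proof (induction y rule: AA.tensor_induct)
  case zero
  then show ?case using AA.tens_closed[OF b c] gc[OF b] gc[OF c] by (simp add: AA.T.Q.r_null conv_zero antipode)
next
  case (tens b' c' \<alpha>' \<gamma>' \<beta>')
  show ?case
    unfolding AA.tens_mult[OF b c tens] conv_tens(1)[OF tens] conv_tens(1)[OF mult_grade[OF b tens(1)] mult_grade[OF c tens(2)]]
    using gc[OF b] gc[OF c] gc[OF tens(1)] gc[OF tens(2)] by (simp add: antipode m_assoc)
next
  case (add y z)
  then show ?case using AA.tens_closed[OF b c] gc[OF b] gc[OF c]
    by (simp add: AA.T.Q.r_distr conv antipode l_distr r_distr)
qed

lemma conv2_mult:
  assumes b: "b \<in> grade A \<alpha> \<gamma>" and c: "c \<in> grade A \<gamma> \<beta>" and y: "y \<in> carrier T"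
  shows "conv2 (y \<otimes>\<^bsub>T\<^esub> tens A A b c) = S b \<otimes>\<^bsub>A\<^esub> conv2 y \<otimes>\<^bsub>A\<^esub> c"
  using y
proof (induction y rule: AA.tensor_induct)
  case zero
  then show ?case using AA.tens_closed[OF b c] gc[OF b] gc[OF c] by (simp add: AA.T.Q.l_null conv_zero antipode)
next
  case (tens b' c' \<alpha>' \<gamma>' \<beta>')
  show ?case
    unfolding AA.tens_mult[OF tens b c] conv_tens(2)[OF tens] conv_tens(2)[OF mult_grade[OF tens(1) b] mult_grade[OF tens(2) c]]
    using gc[OF b] gc[OF c] gc[OF tens(1)] gc[OF tens(2)] by (simp add: antipode m_assoc)
next
  case (add y z)
  then show ?case using AA.tens_closed[OF b c] gc[OF b] gc[OF c]
    by (simp add: AA.T.Q.l_distr conv antipode l_distr r_distr)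
qed

lemma t_grade: "GL_t l i j \<in> grade A (unit_weight i) (unit_weight j)"
  unfolding A by (rule GL_t_grade)

lemma det_inv_grade: "GL_det_inv l \<in> grade A (- 1) (- 1)"
  unfolding A GL_det_inv_def by (rule GL_det_inv_grade)

lemma antipode_t:
  "(\<Oplus>\<^bsub>A\<^esub>k\<in>UNIV. GL_t l i k \<otimes>\<^bsub>A\<^esub> S (GL_t l k j)) = (if i = j then \<one>\<^bsub>A\<^esub> else \<zero>\<^bsub>A\<^esub>)"
  "(\<Oplus>\<^bsub>A\<^esub>k\<in>UNIV. S (GL_t l i k) \<otimes>\<^bsub>A\<^esub> GL_t l k j) = (if i = j then \<one>\<^bsub>A\<^esub> else \<zero>\<^bsub>A\<^esub>)"
proof -
  have 1: "GL_class l (\<Sum>k\<in>UNIV. word [GenT i k] \<otimes>\<^bsub>free_algebra\<^esub> free_tinv l k j) = GL_class l (if i = j then word [] else 0)"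
    and 2: "GL_class l (\<Sum>k\<in>UNIV. free_tinv l i k \<otimes>\<^bsub>free_algebra\<^esub> word [GenT k j]) = GL_class l (if i = j then word [] else 0)"
    using gl_identities[OF l, where 'n = 'n] unfolding gl_identities_def by blast+
  show "(\<Oplus>\<^bsub>A\<^esub>k\<in>UNIV. GL_t l i k \<otimes>\<^bsub>A\<^esub> S (GL_t l k j)) = (if i = j then \<one>\<^bsub>A\<^esub> else \<zero>\<^bsub>A\<^esub>)"
    using 1 unfolding antipode_gens unfolding GL_class_sum GL_t_def A GL_ops by (cases "i = j") simp_all
  show "(\<Oplus>\<^bsub>A\<^esub>k\<in>UNIV. S (GL_t l i k) \<otimes>\<^bsub>A\<^esub> GL_t l k j) = (if i = j then \<one>\<^bsub>A\<^esub> else \<zero>\<^bsub>A\<^esub>)"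
    using 2 unfolding antipode_gens unfolding GL_class_sum GL_t_def A GL_ops by (cases "i = j") simp_all
qed

lemma antipode_det:
  "GL_det_inv l \<otimes>\<^bsub>A\<^esub> S (GL_det_inv l) = \<one>\<^bsub>A\<^esub>" "S (GL_det_inv l) \<otimes>\<^bsub>A\<^esub> GL_det_inv l = \<one>\<^bsub>A\<^esub>"
  unfolding antipode_gens
  unfolding GL_det_inv_def A GL_ops
  by (rule GL_relation_eq[OF GL_relation.det_inv_left] GL_relation_eq[OF GL_relation.det_inv_right])+

lemma mu_hom:
  "mu_l A (f + g) = mu_l A f \<oplus>\<^bsub>A\<^esub> mu_l A g" "mu_l A (f * g) = mu_l A f \<otimes>\<^bsub>A\<^esub> mu_l A g" "mu_l A 1 = \<one>\<^bsub>A\<^esub>"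
  "mu_l A (mero_const c * f) = c \<odot>\<^bsub>A\<^esub> mu_l A f" "mu_l A 0 = \<zero>\<^bsub>A\<^esub>"
  "mu_r A (f + g) = mu_r A f \<oplus>\<^bsub>A\<^esub> mu_r A g" "mu_r A (f * g) = mu_r A f \<otimes>\<^bsub>A\<^esub> mu_r A g" "mu_r A 1 = \<one>\<^bsub>A\<^esub>"
  "mu_r A (mero_const c * f) = c \<odot>\<^bsub>A\<^esub> mu_r A f" "mu_r A 0 = \<zero>\<^bsub>A\<^esub>"
proof -
  note m = moment_map_GL[of l, where 'n = 'n, folded A, unfolded moment_map_def]
  have r: "mu_l A \<in> ring_hom ring_of_type_algebra A" "mu_r A \<in> ring_hom ring_of_type_algebra A"
    and c: "\<And>c f. mu_l A (mero_const c * f) = c \<odot>\<^bsub>A\<^esub> mu_l A f" "\<And>c f. mu_r A (mero_const c * f) = c \<odot>\<^bsub>A\<^esub> mu_r A f"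
    using m by blast+
  show "mu_l A (f + g) = mu_l A f \<oplus>\<^bsub>A\<^esub> mu_l A g" "mu_l A (f * g) = mu_l A f \<otimes>\<^bsub>A\<^esub> mu_l A g" "mu_l A 1 = \<one>\<^bsub>A\<^esub>"
    "mu_r A (f + g) = mu_r A f \<oplus>\<^bsub>A\<^esub> mu_r A g" "mu_r A (f * g) = mu_r A f \<otimes>\<^bsub>A\<^esub> mu_r A g" "mu_r A 1 = \<one>\<^bsub>A\<^esub>"
    using ring_hom_add[OF r(1)] ring_hom_add[OF r(2)] ring_hom_mult[OF r(1)] ring_hom_mult[OF r(2)] ring_hom_one[OF r(1)] ring_hom_one[OF r(2)]
    by simp_all
  show "mu_l A (mero_const c * f) = c \<odot>\<^bsub>A\<^esub> mu_l A f" "mu_r A (mero_const c * f) = c \<odot>\<^bsub>A\<^esub> mu_r A f" by (rule c)+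
  show "mu_l A 0 = \<zero>\<^bsub>A\<^esub>" "mu_r A 0 = \<zero>\<^bsub>A\<^esub>"
    using c(1)[of 0 0] c(2)[of 0 0] gc[OF mu_grade(1)[of 0]] gc[OF mu_grade(2)[of 0]] by simp_all
qed

lemma mu_swap:
  assumes "a \<in> grade A \<alpha> \<beta>"
  shows "a \<otimes>\<^bsub>A\<^esub> mu_l A f = mu_l A (mero_shift (- \<alpha>) f) \<otimes>\<^bsub>A\<^esub> a" "a \<otimes>\<^bsub>A\<^esub> mu_r A f = mu_r A (mero_shift (- \<beta>) f) \<otimes>\<^bsub>A\<^esub> a"
  using mu_l_commute[OF assms, of "mero_shift (- \<alpha>) f"] mu_r_commute[OF assms, of "mero_shift (- \<beta>) f"] by simp_all

lemma comult_gen_T: "GL_comult_gen l (GenT i j) = (\<Oplus>\<^bsub>T\<^esub>k\<in>UNIV. tens A A (GL_t l i k) (GL_t l k j))"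
  by (simp add: A)

lemma tens_t: "tens A A (GL_t l i k) (GL_t l k j) \<in> carrier T"
  by (rule AA.tens_closed[OF t_grade t_grade])

lemma mu_carrier: "mu_l A f \<in> carrier A" "mu_r A f \<in> carrier A"
  by (rule gc[OF mu_grade(1)] gc[OF mu_grade(2)])+

text \<open>The value for the rest of the word is a function of \<lambda>, and it passes the left
  leg of the leading letter with just the shift that the counit of this letter prescribes. What is
  left over is an entry of the product of \<open>t\<close> with its inverse, or the product of
  det^-1 with det.\<close>

lemma conv1_word: "conv1 (\<Delta> (GL_class l (word w))) = mu_l A (free_counit (word w) 1)"
proof (induction w)
  case Nil
  have "conv1 (tens A A \<one>\<^bsub>A\<^esub> \<one>\<^bsub>A\<^esub>) = \<one>\<^bsub>A\<^esub>" unfolding conv_tens(1)[OF one_grade one_grade] by (simp add: antipode)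
  then show ?case unfolding GL_comult_Nil[OF l] A[symmetric] AA.tens_one free_counit_Nil mu_hom by simp
next
  case (Cons g w)
  let ?F = "free_counit (word w) 1" and ?y = "\<Delta> (GL_class l (word w))"
  have y: "?y \<in> carrier T" using linear_mapD(1)[OF GL_comult_linear_map[OF l], of "GL_class l (word w)"] by (simp add: A)
  note m = conv1_mult[OF _ _ y, unfolded Cons]
  have "conv1 (GL_comult_gen l g \<otimes>\<^bsub>T\<^esub> ?y) = mu_l A (GL_counit_gen g ?F)"
  proof (cases g)
    case (GenL f)
    show ?thesis using m[OF mu_grade(1) one_grade] mu_carrier by (simp add: GenL A[symmetric] antipode mu_hom)
  next
    case (GenR f)
    show ?thesis using m[OF one_grade mu_grade(2)] mu_carrier
      by (simp add: GenR A[symmetric] antipode antipode_gens mu_hom mult.commute[of f] flip: mu_hom(2))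
  next
    case GenDetInv
    have "conv1 (GL_comult_gen l g \<otimes>\<^bsub>T\<^esub> ?y) = GL_det_inv l \<otimes>\<^bsub>A\<^esub> mu_l A ?F \<otimes>\<^bsub>A\<^esub> S (GL_det_inv l)"
      using m[OF det_inv_grade det_inv_grade] by (simp add: GenDetInv A[symmetric])
    also have "\<dots> = mu_l A (mero_shift 1 ?F) \<otimes>\<^bsub>A\<^esub> (GL_det_inv l \<otimes>\<^bsub>A\<^esub> S (GL_det_inv l))"
      unfolding mu_swap(1)[OF det_inv_grade] using mu_carrier gc[OF det_inv_grade] by (simp add: m_assoc antipode)
    finally show ?thesis unfolding antipode_det using mu_carrier by (simp add: GenDetInv)
  next
    case (GenT i j)
    have "conv1 (GL_comult_gen l g \<otimes>\<^bsub>T\<^esub> ?y) = conv1 (\<Oplus>\<^bsub>T\<^esub>k\<in>UNIV. tens A A (GL_t l i k) (GL_t l k j) \<otimes>\<^bsub>T\<^esub> ?y)"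
      unfolding GenT comult_gen_T by (subst AA.T.Q.finsum_ldistr) (use y tens_t in auto)
    also have "\<dots> = (\<Oplus>\<^bsub>A\<^esub>k\<in>UNIV. conv1 (tens A A (GL_t l i k) (GL_t l k j) \<otimes>\<^bsub>T\<^esub> ?y))"
      by (rule linear_map_finsum[OF AA.T.Q.calgebra_axioms calgebra_axioms conv_linear(1)])
         (use y tens_t AA.T.Q.m_closed in auto)
    also have "\<dots> = (\<Oplus>\<^bsub>A\<^esub>k\<in>UNIV. mu_l A (mero_shift (- unit_weight i) ?F) \<otimes>\<^bsub>A\<^esub> (GL_t l i k \<otimes>\<^bsub>A\<^esub> S (GL_t l k j)))"
      unfolding m[OF t_grade t_grade] mu_swap(1)[OF t_grade]
      using mu_carrier gc[OF t_grade] by (simp add: m_assoc antipode)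
    also have "\<dots> = mu_l A (mero_shift (- unit_weight i) ?F) \<otimes>\<^bsub>A\<^esub> (if i = j then \<one>\<^bsub>A\<^esub> else \<zero>\<^bsub>A\<^esub>)"
      unfolding antipode_t(1)[symmetric] by (rule finsum_rdistr[symmetric]) (use mu_carrier gc[OF t_grade] antipode in auto)
    finally show ?thesis using mu_carrier by (simp add: GenT mu_hom)
  qed
  then show ?case unfolding GL_comult_Cons[OF l] A[symmetric] free_counit_word_Cons .
qed

text \<open>Words grow at their right end here, as \<open>conv2_mult\<close> requires. The shift by
  the left degree builds up letter by letter, when the function of \<mu> obtained so far is moved
  past the value of S on the new letter.\<close>

lemma conv2_word: "conv2 (\<Delta> (GL_class l (word w))) = mu_r A (mero_shift (deg_l w) (free_counit (word w) 1))"
proof (induction w rule: rev_induct)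
  case Nil
  have "conv2 (tens A A \<one>\<^bsub>A\<^esub> \<one>\<^bsub>A\<^esub>) = \<one>\<^bsub>A\<^esub>" unfolding conv_tens(2)[OF one_grade one_grade] by (simp add: antipode)
  then show ?case unfolding GL_comult_Nil[OF l] A[symmetric] AA.tens_one free_counit_Nil by (simp add: mu_hom)
next
  case (snoc g w)
  \<comment> \<open>The word acts as G times the shift by minus its right degree. Unless G = 0, the
    shift by the left degree in the claim cancels that shift on the image of the last
    letter.\<close>
  obtain G where G: "free_counit (word w) = (\<lambda>h. G * mero_shift (- deg_r w) h)" "G = 0 \<or> deg_l w = deg_r w"
    using free_counit_word_deg by blast
  let ?F = "mero_shift (deg_l w) G" and ?y = "\<Delta> (GL_class l (word w))"
  have y: "?y \<in> carrier T" using linear_mapD(1)[OF GL_comult_linear_map[OF l], of "GL_class l (word w)"] by (simp add: A)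
  have F: "conv2 ?y = mu_r A ?F" unfolding snoc G(1) by simp
  note m = conv2_mult[OF _ _ y, unfolded F]
  have e: "mero_shift (deg_l (w @ [g])) (free_counit (word (w @ [g])) 1) = mero_shift (gen_deg_l g) (?F * GL_counit_gen g 1)"
  proof -
    have "free_counit (word (w @ [g])) 1 = free_counit (word w) (free_counit (word [g]) 1)"
      using free_counit_mult[of "word w" "word [g]"] unfolding word_mult by (simp add: fun_eq_iff)
    also have "free_counit (word [g]) 1 = GL_counit_gen g 1" by (simp add: free_counit_word_Cons free_counit_Nil)
    finally show ?thesis using G(2) unfolding G(1) by (auto simp: mero_shift_mult add.commute)
  qed
  have "conv2 (?y \<otimes>\<^bsub>T\<^esub> GL_comult_gen l g) = mu_r A (mero_shift (gen_deg_l g) (?F * GL_counit_gen g 1))"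
  proof (cases g)
    case (GenL f)
    show ?thesis using m[OF mu_grade(1) one_grade] mu_carrier
      by (simp add: GenL A[symmetric] antipode antipode_gens mult.commute[of _ f] mu_hom)
  next
    case (GenR f)
    show ?thesis using m[OF one_grade mu_grade(2)] mu_carrier by (simp add: GenR A[symmetric] antipode mu_hom)
  next
    case GenDetInv
    have S: "S (GL_det_inv l) \<in> grade A 1 1" using antipode_grade[OF det_inv_grade] by simp
    have "conv2 (?y \<otimes>\<^bsub>T\<^esub> GL_comult_gen l g) = S (GL_det_inv l) \<otimes>\<^bsub>A\<^esub> mu_r A ?F \<otimes>\<^bsub>A\<^esub> GL_det_inv l"
      using m[OF det_inv_grade det_inv_grade] by (simp add: GenDetInv A[symmetric])
    also have "\<dots> = mu_r A (mero_shift (- 1) ?F) \<otimes>\<^bsub>A\<^esub> (S (GL_det_inv l) \<otimes>\<^bsub>A\<^esub> GL_det_inv l)"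
      unfolding mu_swap(2)[OF S] using mu_carrier gc[OF det_inv_grade] by (simp add: m_assoc antipode)
    finally show ?thesis unfolding antipode_det using mu_carrier by (simp add: GenDetInv)
  next
    case (GenT i j)
    have S: "S (GL_t l i k) \<in> grade A (- unit_weight k) (- unit_weight i)" for k by (rule antipode_grade[OF t_grade])
    have "conv2 (?y \<otimes>\<^bsub>T\<^esub> GL_comult_gen l g) = conv2 (\<Oplus>\<^bsub>T\<^esub>k\<in>UNIV. ?y \<otimes>\<^bsub>T\<^esub> tens A A (GL_t l i k) (GL_t l k j))"
      unfolding GenT comult_gen_T by (subst AA.T.Q.finsum_rdistr) (use y tens_t in auto)
    also have "\<dots> = (\<Oplus>\<^bsub>A\<^esub>k\<in>UNIV. conv2 (?y \<otimes>\<^bsub>T\<^esub> tens A A (GL_t l i k) (GL_t l k j)))"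
      by (rule linear_map_finsum[OF AA.T.Q.calgebra_axioms calgebra_axioms conv_linear(2)])
         (use y tens_t AA.T.Q.m_closed in auto)
    also have "\<dots> = (\<Oplus>\<^bsub>A\<^esub>k\<in>UNIV. mu_r A (mero_shift (unit_weight i) ?F) \<otimes>\<^bsub>A\<^esub> (S (GL_t l i k) \<otimes>\<^bsub>A\<^esub> GL_t l k j))"
      unfolding m[OF t_grade t_grade] mu_swap(2)[OF S]
      using mu_carrier gc[OF t_grade] by (simp add: m_assoc antipode)
    also have "\<dots> = mu_r A (mero_shift (unit_weight i) ?F) \<otimes>\<^bsub>A\<^esub> (if i = j then \<one>\<^bsub>A\<^esub> else \<zero>\<^bsub>A\<^esub>)"
      unfolding antipode_t(2)[symmetric] by (rule finsum_rdistr[symmetric]) (use mu_carrier gc[OF t_grade] antipode in auto)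
    finally show ?thesis using mu_carrier by (simp add: GenT mu_hom)
  qed
  moreover have "\<Delta> (GL_class l (word (w @ [g]))) = ?y \<otimes>\<^bsub>T\<^esub> GL_comult_gen l g"
    unfolding GL_word_append[of l w "[g]"] GL_comult_word[OF l, symmetric] A by (rule ring_hom_mult[OF GL_comult_ring_hom[OF l]]) simp_all
  ultimately show ?case unfolding e by simp
qed

lemmas comult_linear = linear_mapD[OF GL_comult_linear_map[OF l, where 'a = 'n], folded A]
lemmas counit_linear = linear_mapD[OF GL_counit_linear_map[of l, where 'a = 'n], folded A]

lemma antipode_left:
  assumes "a \<in> carrier A"
  shows "conv1 (\<Delta> a) = mu_l A (\<epsilon> a 1)"
  using assms unfolding A
proof (induction a rule: GL_induct)
  case zero
  have "\<Delta> \<zero>\<^bsub>A\<^esub> = \<zero>\<^bsub>T\<^esub>" "\<epsilon> \<zero>\<^bsub>A\<^esub> = \<zero>\<^bsub>diff_ops\<^esub>"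
    using linear_map_zero[OF GL.Q.calgebra_axioms GG.T.Q.calgebra_axioms GL_comult_linear_map[OF l]]
      linear_map_zero[OF GL.Q.calgebra_axioms diff_ops.calgebra_axioms GL_counit_linear_map] by (simp_all add: A)
  then show ?case by (simp add: conv_zero mu_hom flip: A)
next
  case (word w c)
  have car: "GL_class l (word w) \<in> carrier A" by (simp add: A)
  show ?case unfolding A[symmetric] comult_linear(3)[OF car] counit_linear(3)[OF car] conv(3)[OF comult_linear(1)[OF car]]
      conv1_word GL_counit_class
    by (simp add: mu_hom(4))
next
  case (add y z)
  then have car: "y \<in> carrier A" "z \<in> carrier A" by (simp_all add: A)
  show ?case using add(3,4)
    unfolding A[symmetric] comult_linear(2)[OF car] counit_linear(2)[OF car] conv(2)[OF comult_linear(1)[OF car(1)] comult_linear(1)[OF car(2)]]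
    by (simp add: mu_hom)
qed

lemma antipode_right:
  assumes "a \<in> grade A \<alpha> \<beta>"
  shows "conv2 (\<Delta> a) = mu_r A (mero_shift \<alpha> (\<epsilon> a 1))"
  using assms unfolding A
proof (induction a rule: GL_grade_induct)
  case zero
  have "\<Delta> \<zero>\<^bsub>A\<^esub> = \<zero>\<^bsub>T\<^esub>" "\<epsilon> \<zero>\<^bsub>A\<^esub> = \<zero>\<^bsub>diff_ops\<^esub>"
    using linear_map_zero[OF GL.Q.calgebra_axioms GG.T.Q.calgebra_axioms GL_comult_linear_map[OF l]]
      linear_map_zero[OF GL.Q.calgebra_axioms diff_ops.calgebra_axioms GL_counit_linear_map] by (simp_all add: A)
  then show ?case by (simp add: conv_zero mu_hom flip: A)
next
  case (word w c)
  have car: "GL_class l (word w) \<in> carrier A" by (simp add: A)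
  show ?case unfolding A[symmetric] comult_linear(3)[OF car] counit_linear(3)[OF car] conv(6)[OF comult_linear(1)[OF car]]
      conv2_word GL_counit_class
    using word by (simp add: mu_hom(9) mero_shift_mult)
next
  case (add y z)
  then have car: "y \<in> carrier A" "z \<in> carrier A" by (simp_all add: A)
  show ?case using add(3,4)
    unfolding A[symmetric] comult_linear(2)[OF car] counit_linear(2)[OF car] conv(5)[OF comult_linear(1)[OF car(1)] comult_linear(1)[OF car(2)]]
    by (simp add: mu_hom mero_shift_add)
qed

lemma antipode_axioms:
  "a \<in> carrier A \<Longrightarrow> descend (linear_ext A (\<lambda>(b, c). b \<otimes>\<^bsub>A\<^esub> S c)) (\<Delta> a) = mu_l A (\<epsilon> a 1)"
  "a \<in> grade A \<alpha> \<beta> \<Longrightarrow> descend (linear_ext A (\<lambda>(b, c). S b \<otimes>\<^bsub>A\<^esub> c)) (\<Delta> a) = mu_r A (mero_shift \<alpha> (\<epsilon> a 1))"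
  using antipode_left antipode_right unfolding conv1_def conv2_def by blast+

lemma mu_r_inverse: "f \<noteq> 0 \<Longrightarrow> inv\<^bsub>A\<^esub> (mu_r A f) = mu_r A (inverse f)"
  using mu_hom(7)[of f "inverse f"] mu_hom(7)[of "inverse f" f] mu_hom(8)
  by (intro inv_unique'[symmetric] mu_carrier) simp_all

end

text \<open>\<open>F_R_GL\<close> extends the record \<open>GL_h_alg\<close> by two fields and so
  has another type; the results are carried over field by field.\<close>

definition same_h_alg :: "('n::finite, 'a, 'm) h_alg_scheme \<Rightarrow> ('n, 'a, 'k) h_alg_scheme \<Rightarrow> bool"
  where "same_h_alg A B \<longleftrightarrow> same_algebra A B \<and> grade A = grade B \<and> mu_l A = mu_l B \<and> mu_r A = mu_r B"

lemma same_h_algD: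
  assumes "same_h_alg A B"
  shows "carrier A = carrier B" "mult A = mult B" "one A = one B" "zero A = zero B" "add A = add B" "smult A = smult B"
    "grade A = grade B" "mu_l A = mu_l B" "mu_r A = mu_r B" "finsum A = finsum B"
proof -
  show *: "carrier A = carrier B" "mult A = mult B" "one A = one B" "zero A = zero B" "add A = add B" "smult A = smult B"
    "grade A = grade B" "mu_l A = mu_l B" "mu_r A = mu_r B"
    using assms by (simp_all add: same_h_alg_def same_algebra_def)
  show "finsum A = finsum B" by (rule finsum_fields_cong) (simp_all add: *)
qed

lemma same_h_alg_refl: "same_h_alg A A"
  by (simp add: same_h_alg_def same_algebra_def)

lemma same_h_alg_sym: "same_h_alg A B \<Longrightarrow> same_h_alg B A"
  by (simp add: same_h_alg_def same_algebra_def)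

lemma tensor_relation_cong:
  assumes "same_h_alg A A'" "same_h_alg B B'" "tensor_relation A B u v"
  shows "tensor_relation A' B' u v"
  using assms(3)
  by (induction rule: tensor_relation.induct; unfold same_h_algD[OF assms(1)] same_h_algD[OF assms(2)];
      blast intro: tensor_relation.intros)

text \<open>The tensor construction reads only the h-algebra fields of its factors, so exchanging a
  factor gives an equal tensor product and not merely an isomorphic one.\<close>

lemma tensor_cong:
  assumes "same_h_alg A A'" "same_h_alg B B'"
  shows "composable A B = composable A' B'" "tens A B = tens A' B'" "h_tensor A B = h_tensor A' B'"
proof -
  note eqs = same_h_algD[OF assms(1)] same_h_algD[OF assms(2)]
  have "tensor_relation A B u v \<longleftrightarrow> tensor_relation A' B' u v" for u v
    using tensor_relation_cong[OF assms] tensor_relation_cong[OF assms[THEN same_h_alg_sym]] by blast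
  then have null: "tensor_null A B = tensor_null A' B'" by (simp add: tensor_null_def)
  show comp: "composable A B = composable A' B'" by (simp only: composable_def eqs)
  have cover: "tensor_cover A B = tensor_cover A' B'" by (simp only: tensor_cover_def comp eqs)
  have cl: "tensor_class A B = tensor_class A' B'" by (rule ext) (simp only: tensor_class_def null cover)
  show tens: "tens A B = tens A' B'" by (intro ext) (simp only: tens_def cl)
  show "h_tensor A B = h_tensor A' B'" by (simp only: h_tensor_def null cover cl tens eqs)
qed

lemma h_algebra_cong:
  assumes "same_h_alg A' A" "h_algebra A"
  shows "h_algebra A'"
proof -
  note eqs = same_h_algD[OF assms(1)]
  have "complex_algebra A'"
    by (rule complex_algebra_cong[of A]) (use assms in \<open>simp_all add: h_algebra_def same_h_alg_def\<close>)
  moreover have "submodule H complex_ring A' = submodule H complex_ring A" for H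
    by (simp add: submodule_def submodule_axioms_def subgroup_def m_inv_def eqs)
  then have "bigraded A'"
    using assms(2) unfolding h_algebra_def bigraded_def eqs by simp
  moreover have "moment_map A' \<mu> = moment_map A \<mu>" for \<mu>
    unfolding moment_map_def ring_hom_def eqs ..
  ultimately show ?thesis using assms(2) unfolding h_algebra_def eqs by blast
qed

lemma F_R_GL_bialg: "comult (F_R_GL l) = GL_comult l" "counit (F_R_GL l) = GL_counit l"
  by (simp_all add: F_R_GL_def h_alg.defs h_bialg.defs GL_comult_def GL_counit_def)

lemma same_F_R_GL: "same_h_alg (F_R_GL l) (GL_h_alg l)"
  by (simp add: same_h_alg_def same_algebra_def F_R_GL_def h_alg.defs h_bialg.defs)

lemmas F_R_GL_simps = same_h_algD[OF same_F_R_GL] F_R_GL_bialg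
  tensor_cong[OF same_F_R_GL same_h_alg_refl] tensor_cong[OF same_h_alg_refl same_F_R_GL]

lemma linear_ext_F_R_GL: "linear_ext (F_R_GL l) = linear_ext (GL_h_alg l)"
  by (intro ext) (simp only: linear_ext_def F_R_GL_simps)

lemma h_bialgebroid_F_R_GL:
  assumes "generic_log l"
  shows "h_bialgebroid (F_R_GL l)"
  unfolding h_bialgebroid_def
proof (intro conjI)
  show "h_algebra (F_R_GL l)" by (rule h_algebra_cong[OF same_F_R_GL h_algebra_GL])
  show "h_algebra_hom (F_R_GL l) (h_tensor (F_R_GL l) (F_R_GL l)) (comult (F_R_GL l))"
    using GL_comult_hom[OF assms] unfolding h_algebra_hom_def ring_hom_def F_R_GL_simps .
  show "h_algebra_hom (F_R_GL l) diff_ops (counit (F_R_GL l))"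
    using GL_counit_hom unfolding h_algebra_hom_def ring_hom_def F_R_GL_simps .
  show "coassociative (F_R_GL l)"
    using GL_coassociative[OF assms]
    unfolding coassociative_def tensor_assoc_def tensor_map_def F_R_GL_simps by blast
  show "counital (F_R_GL l)"
    using GL_counital[OF assms] unfolding counital_def tensor_map_def F_R_GL_simps by blast
qed

lemma dyn_sign_nonzero: "generic_log l \<Longrightarrow> dyn_sign l I J \<noteq> 0"
  unfolding dyn_sign_def by (auto simp: at_diff_h_fun_nonzero)

theorem proposition5p2:
  fixes q logq :: complex
    and A :: "('n::{finite,linorder}, 'n GL_elt) h_bialg"
  assumes "q \<noteq> 0"
    and "\<And>k::nat. k > 0 \<Longrightarrow> q ^ k \<noteq> 1"
    and "exp logq = q"
    and "A = F_R_GL logq"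
  shows "\<exists>S. algebra_antihom A S \<and>
    S (GL_det_inv logq) = GL_det logq \<and>
    (\<forall>f. S (mu_r A f) = mu_l A f) \<and>
    (\<forall>f. S (mu_l A f) = mu_r A f) \<and>
    (\<forall>i j. S (GL_t logq i j) =
       GL_det_inv logq \<otimes>\<^bsub>A\<^esub>
       (mu_l A (dyn_sign logq (- {j}) {j}) \<otimes>\<^bsub>A\<^esub> inv\<^bsub>A\<^esub> (mu_r A (dyn_sign logq (- {i}) {i}))) \<otimes>\<^bsub>A\<^esub>
       GL_minor logq (- {j}) (- {i})) \<and>
    h_Hopf_algebroid A S"
proof -
  have l: "generic_log logq" using assms(2,3) by (simp add: generic_log_def)
  let ?S = "GL_antipode logq :: 'n GL_elt \<Rightarrow> 'n GL_elt" and ?G = "GL_h_alg logq :: ('n, 'n GL_elt) h_alg"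
  note S = antipode[OF l refl, where 'n = 'n] antipode_gens[OF l refl, where 'n = 'n]
  note carrier = GL.grade_carrier[OF GL.mu_grade(1)[of logq]] GL.grade_carrier[OF GL.mu_grade(2)[of logq]]
  have inv: "inv\<^bsub>A\<^esub> x = inv\<^bsub>?G\<^esub> x" for x
    unfolding m_inv_def assms(4) F_R_GL_simps ..
  have antihom: "algebra_antihom A ?S"
    unfolding algebra_antihom_def assms(4) F_R_GL_simps
    by (intro conjI ballI allI funcsetI S(1-5))
  have w: "GL_class logq (word [GenDetInv, GenL f, GenR g]) = GL_det_inv logq \<otimes>\<^bsub>?G\<^esub> (mu_l ?G f \<otimes>\<^bsub>?G\<^esub> mu_r ?G g)" for f g
    unfolding GL_det_inv_def GL_mu GL_word_Cons[of logq GenDetInv "[GenL f, GenR g]"] GL_word_Cons[of logq "GenL f" "[GenR g]"] ..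
  have tinv: "?S (GL_t logq i j) = GL_det_inv logq \<otimes>\<^bsub>A\<^esub>
      (mu_l A (dyn_sign logq (- {j}) {j}) \<otimes>\<^bsub>A\<^esub> inv\<^bsub>A\<^esub> (mu_r A (dyn_sign logq (- {i}) {i}))) \<otimes>\<^bsub>A\<^esub>
      GL_minor logq (- {j}) (- {i})" for i j
    unfolding inv unfolding assms(4) F_R_GL_simps mu_r_inverse[OF l refl dyn_sign_nonzero[OF l]] S(8)
      free_tinv_def GL_ops(1)[symmetric] w GL_minor_def ..
  have hopf: "h_Hopf_algebroid A ?S"
    unfolding h_Hopf_algebroid_def
  proof (intro conjI ballI allI)
    show "h_bialgebroid A" unfolding assms(4) by (rule h_bialgebroid_F_R_GL[OF l])
    show "?S \<in> carrier A \<rightarrow> carrier A" unfolding assms(4) F_R_GL_simps by (intro funcsetI S(1))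
    show "descend (linear_ext A (\<lambda>(b, c). b \<otimes>\<^bsub>A\<^esub> ?S c)) (comult A a) = mu_l A (counit A a 1)" if "a \<in> carrier A" for a
      using antipode_axioms(1)[OF l refl, of a] that unfolding assms(4) F_R_GL_simps linear_ext_F_R_GL by blast
    show "descend (linear_ext A (\<lambda>(b, c). ?S b \<otimes>\<^bsub>A\<^esub> c)) (comult A a) = mu_r A (mero_shift \<alpha> (counit A a 1))"
      if "a \<in> grade A \<alpha> \<beta>" for a \<alpha> \<beta>
      using antipode_axioms(2)[OF l refl, of a \<alpha> \<beta>] that unfolding assms(4) F_R_GL_simps linear_ext_F_R_GL by blast
  qed (simp_all add: assms(4) F_R_GL_simps S carrier)
  show ?thesis
  proof (intro exI[of _ ?S] conjI allI)
    show "?S (GL_det_inv logq) = GL_det logq" by (simp add: S GL_det_def GL_minor_def)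
    show "?S (mu_r A f) = mu_l A f" "?S (mu_l A f) = mu_r A f" for f
      unfolding assms(4) F_R_GL_simps by (rule S(7) S(6))+
  qed (fact antihom tinv hopf)+
qed

end
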